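(* Let $(X,\rho,\mu)$ be a space of homogeneous type and let $T$ be a Calderón–Zygmund operator on $X$. There is a constant $C$, depending only on $(X,\rho,\mu)$ and on $T$, such that for all $f$: 1. If $w\in A_\infty$ and $r=1+\frac{1}{2\varepsilon^{-1}[w]_{A_\infty}-1}$, where $\varepsilon$ is the dyadic child/parent constant of $X$, then $$\|Tf\|_{L^{1,\infty}(w)}\le C\,\log(e+[w]_{A_\infty})\,\|f\|_{L^1(M_rw)}.$$ 2. If $w\in A_1$, then $$\|Tf\|_{L^{1,\infty}(w)}\le C\,[w]_{A_1}\,\log(e+[w]_{A_\infty})\,\|f\|_{L^1(w)}.$$
   Context: Space of homogeneous type: a triple $(X,\rho,\mu)$ where $\rho$ is a quasimetric ($\rho(x,y)=0$ iff $x=y$; symmetric; $\rho(x,z)\le\kappa(\rho(x,y)+\rho(y,z))$) and $\mu$ is a positive doubling measure: $0<\mu(B(x_0,2r))\le D_\mu\,\mu(B(x_0,r))<\infty$. Dyadic cubes: a dyadic decomposition of $X$ is a family $\mathcal D=\bigcup_{k\in\mathbb Z}\mathcal D_k$ of sets with points $x_c(Q)$, $Q\in\mathcal D$, and constants $\delta>1$, $0<C_0<\infty$, $0<\varepsilon<1$ such that: $X=\bigcup_{Q\in\mathcal D_k}Q$ for each $k$; two cubes that intersect are nested; every $Q\in\mathcal D_k$ has at least one child in $\mathcal D_{k-1}$ contained in $Q$ and exactly one parent in $\mathcal D_{k+1}$ containing $Q$; $\mu(Q_2)\ge\varepsilon\mu(Q_1)$ if $Q_2$ is a child of $Q_1$;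 $B(x_c(Q),\delta^k)\subset Q\subset B(x_c(Q),C_0\delta^k)$ for $Q\in\mathcal D_k$. Fix finitely many dyadic decompositions (Hytönen–Kairema adjacent systems), with common constants depending only on $X$, such that every ball is contained in a cube, of one of them, of comparable measure. "Cube" means a member of one of these decompositions. $Mf(x)=\sup_{Q\ni x}\frac1{\mu(Q)}\int_Q|f|\,d\mu$, sup over cubes (comparable to the maximal operator over balls); $M_rw=(M(w^r))^{1/r}$. A weight is a locally integrable function with values in $(0,\infty)$ a.e.; $w(E)=\int_E w\,d\mu$; $\|f\|_{L^1(v)}=\int_X|f|v\,d\mu$; $\|g\|_{L^{1,\infty}(w)}=\sup_{\lambda>0}\lambda\,w(\{|g|>\lambda\})$. $[w]_{A_1}=\sup_Q\left(\frac1{\mu(Q)}\int_Q w\,d\mu\right)\operatorname{ess\,sup}_Q w^{-1}$ and $[w]_{A_\infty}=\sup_Q\frac1{w(Q)}\int_Q M(w\chi_Q)\,d\mu$ (sup over cubes); $w\in A_1$, $w\in A_\infty$ mean that the respective constant is finite. Calderón–Zygmund kernel: $K:X\times X\setminus\{x=y\}\to\mathbb R$ such that for some $\eta>0$, $C_K<\infty$ and all $x_0\ne y$, $|K(x_0,y)|\le \frac{C_K}{\mu(B(x_0,\rho(x_0,y)))}$, and whenever $\rho(x_0,x)\le\eta\rho(x_0,y)$, both $|K(x,y)-K(x_0,y)|$ and $|K(y,x)-K(y,x_0)|$ are at most $\left(\frac{\rho(x,x_0)}{\rho(x_0,y)}\right)^{\eta}\frac1{\mu(B(x_0,\rho(x_0,y)))}$.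 A Calderón–Zygmund operator is a linear operator $T$ bounded on $L^2(X,\mu)$ with $Tf(x)=\int_X K(x,y)f(y)\,d\mu(y)$ for $x$ outside the support of $f$. Inequalities are understood for $f\in L^2(X,\mu)$, where $Tf$ is defined.
   Formalization: The measure μ is assumed Borel regular (open sets, balls and cubes are measurable, and every measurable set lies in a Borel set of equal measure); for a measure on an arbitrary larger σ-algebra, such as a proper extension of Lebesgue measure, the claim is false. *)

theory Defs
  imports "HOL-Analysis.Analysis" "HOL-Probability.Essential_Supremum"
begin

text \<open>Throughout, the underlying set $X$ is \<open>space M\<close>, where \<open>M\<close> is the measure $\mu$.\<close>

section \<open>Spaces of homogeneous type\<close>

definition quasimetric_on :: "'a set \<Rightarrow> ('a \<Rightarrow> 'a \<Rightarrow> real) \<Rightarrow> bool" where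
  "quasimetric_on X \<rho> \<longleftrightarrow>
     (\<forall>x\<in>X. \<forall>y\<in>X. 0 \<le> \<rho> x y \<and> (\<rho> x y = 0 \<longleftrightarrow> x = y) \<and> \<rho> x y = \<rho> y x) \<and>
     (\<exists>\<kappa>. \<forall>x\<in>X. \<forall>y\<in>X. \<forall>z\<in>X. \<rho> x z \<le> \<kappa> * (\<rho> x y + \<rho> y z))"

definition qball :: "'a set \<Rightarrow> ('a \<Rightarrow> 'a \<Rightarrow> real) \<Rightarrow> 'a \<Rightarrow> real \<Rightarrow> 'a set" where
  "qball X \<rho> x r = {y \<in> X. \<rho> x y < r}"

definition qopen :: "'a set \<Rightarrow> ('a \<Rightarrow> 'a \<Rightarrow> real) \<Rightarrow> 'a set \<Rightarrow> bool" where
  "qopen X \<rho> U \<longleftrightarrow> U \<subseteq> X \<and> (\<forall>x\<in>U. \<exists>r>0. qball X \<rho> x r \<subseteq> U)"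

definition qborel :: "'a set \<Rightarrow> ('a \<Rightarrow> 'a \<Rightarrow> real) \<Rightarrow> 'a set set" where
  "qborel X \<rho> = sigma_sets X {U. qopen X \<rho> U}"

text \<open>
  Balls of a quasimetric need be neither open nor Borel, so their measurability is required
  separately.  The measure is Borel regular: measurable sets have Borel hulls of the same measure.
  Without this, the measure may live on a sigma-algebra the geometry of $X$ does not see (a proper
  extension of Lebesgue measure, say), and Lebesgue differentiation and the weak type theory of
  Calderon-Zygmund operators break down.
\<close>
definition homogeneous_type :: "('a \<Rightarrow> 'a \<Rightarrow> real) \<Rightarrow> 'a measure \<Rightarrow> bool" where
  "homogeneous_type \<rho> M \<longleftrightarrow>
     quasimetric_on (space M) \<rho> \<and>
     qborel (space M) \<rho> \<subseteq> sets M \<and>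
     (\<forall>x\<in>space M. \<forall>r. qball (space M) \<rho> x r \<in> sets M) \<and>
     (\<forall>A\<in>sets M. \<exists>B\<in>qborel (space M) \<rho>. A \<subseteq> B \<and> emeasure M B = emeasure M A) \<and>
     (\<exists>D::real. \<forall>x\<in>space M. \<forall>r>0.
        0 < emeasure M (qball (space M) \<rho> x (2 * r)) \<and>
        emeasure M (qball (space M) \<rho> x (2 * r)) \<le> ennreal D * emeasure M (qball (space M) \<rho> x r) \<and>
        ennreal D * emeasure M (qball (space M) \<rho> x r) < \<infinity>)"

section \<open>Dyadic cubes\<close>

text \<open>
  \<open>D k\<close> is the set of cubes of generation \<open>k\<close>.  The same set may be a cube of several generations
  (for instance, when $X$ is bounded or has isolated points), so the centre \<open>xc k Q\<close> may depend on
  the generation.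
\<close>
definition dyadic_decomposition ::
    "('a \<Rightarrow> 'a \<Rightarrow> real) \<Rightarrow> 'a measure \<Rightarrow> real \<Rightarrow> real \<Rightarrow> real \<Rightarrow> (int \<Rightarrow> 'a set set) \<Rightarrow> bool" where
  "dyadic_decomposition \<rho> M \<delta> C0 \<epsilon> D \<longleftrightarrow>
     (\<forall>k. \<forall>Q\<in>D k. Q \<in> sets M) \<and>
     (\<forall>k. \<Union>(D k) = space M) \<and>
     (\<forall>j k. \<forall>P\<in>D j. \<forall>Q\<in>D k. P \<inter> Q \<noteq> {} \<longrightarrow> P \<subseteq> Q \<or> Q \<subseteq> P) \<and>
     (\<forall>k. \<forall>Q\<in>D k. (\<exists>P\<in>D (k - 1). P \<subseteq> Q) \<and> (\<exists>!P. P \<in> D (k + 1) \<and> Q \<subseteq> P)) \<and>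
     (\<forall>k. \<forall>Q\<in>D k. \<forall>P\<in>D (k - 1). P \<subseteq> Q \<longrightarrow> ennreal \<epsilon> * emeasure M Q \<le> emeasure M P) \<and>
     (\<exists>xc. \<forall>k. \<forall>Q\<in>D k. xc k Q \<in> space M \<and>
        qball (space M) \<rho> (xc k Q) (\<delta> powi k) \<subseteq> Q \<and>
        Q \<subseteq> qball (space M) \<rho> (xc k Q) (C0 * \<delta> powi k))"

definition cubes :: "(int \<Rightarrow> 'a set set) set \<Rightarrow> 'a set set" where
  "cubes \<D> = (\<Union>D\<in>\<D>. \<Union>k. D k)"

definition adjacent_dyadic_systems ::
    "('a \<Rightarrow> 'a \<Rightarrow> real) \<Rightarrow> 'a measure \<Rightarrow> real \<Rightarrow> (int \<Rightarrow> 'a set set) set \<Rightarrow> bool" where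
  "adjacent_dyadic_systems \<rho> M \<epsilon> \<D> \<longleftrightarrow>
     finite \<D> \<and> 0 < \<epsilon> \<and> \<epsilon> < 1 \<and>
     (\<exists>\<delta> C0. 1 < \<delta> \<and> 0 < C0 \<and> (\<forall>D\<in>\<D>. dyadic_decomposition \<rho> M \<delta> C0 \<epsilon> D)) \<and>
     (\<exists>c::real. \<forall>x\<in>space M. \<forall>r>0. \<exists>Q\<in>cubes \<D>.
        qball (space M) \<rho> x r \<subseteq> Q \<and> emeasure M Q \<le> ennreal c * emeasure M (qball (space M) \<rho> x r))"

section \<open>Maximal operators and weights\<close>

definition maximal :: "'a measure \<Rightarrow> (int \<Rightarrow> 'a set set) set \<Rightarrow> ('a \<Rightarrow> real) \<Rightarrow> 'a \<Rightarrow> ennreal" where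
  "maximal M \<D> f x =
     (SUP Q\<in>{Q\<in>cubes \<D>. x \<in> Q}. (\<integral>\<^sup>+y\<in>Q. ennreal \<bar>f y\<bar> \<partial>M) / emeasure M Q)"

definition ennreal_powr :: "ennreal \<Rightarrow> real \<Rightarrow> ennreal" where
  \<comment> \<open>used for positive exponents only\<close>
  "ennreal_powr a p = (if a = \<infinity> then \<infinity> else ennreal (enn2real a powr p))"

definition maximal_r ::
    "'a measure \<Rightarrow> (int \<Rightarrow> 'a set set) set \<Rightarrow> real \<Rightarrow> ('a \<Rightarrow> real) \<Rightarrow> 'a \<Rightarrow> ennreal" where
  "maximal_r M \<D> r w x = ennreal_powr (maximal M \<D> (\<lambda>y. w y powr r) x) (1 / r)"

text \<open>Local integrability is integrability on balls.\<close>
definition weight :: "('a \<Rightarrow> 'a \<Rightarrow> real) \<Rightarrow> 'a measure \<Rightarrow> ('a \<Rightarrow> real) \<Rightarrow> bool" where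
  "weight \<rho> M w \<longleftrightarrow>
     w \<in> borel_measurable M \<and> (AE x in M. 0 < w x) \<and>
     (\<forall>x\<in>space M. \<forall>r. (\<integral>\<^sup>+y\<in>qball (space M) \<rho> x r. ennreal (w y) \<partial>M) < \<infinity>)"

definition wmeas :: "'a measure \<Rightarrow> ('a \<Rightarrow> real) \<Rightarrow> 'a set \<Rightarrow> ennreal" where
  "wmeas M w E = (\<integral>\<^sup>+x\<in>E. ennreal (w x) \<partial>M)"

definition A1_const :: "'a measure \<Rightarrow> (int \<Rightarrow> 'a set set) set \<Rightarrow> ('a \<Rightarrow> real) \<Rightarrow> ennreal" where
  "A1_const M \<D> w =
     (SUP Q\<in>cubes \<D>. (wmeas M w Q / emeasure M Q) *
        esssup (restrict_space M Q) (\<lambda>x. inverse (ennreal (w x))))"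

definition Ainf_const :: "'a measure \<Rightarrow> (int \<Rightarrow> 'a set set) set \<Rightarrow> ('a \<Rightarrow> real) \<Rightarrow> ennreal" where
  "Ainf_const M \<D> w =
     (SUP Q\<in>cubes \<D>. (\<integral>\<^sup>+x\<in>Q. maximal M \<D> (\<lambda>y. w y * indicator Q y) x \<partial>M) / wmeas M w Q)"

definition A1 ::
    "('a \<Rightarrow> 'a \<Rightarrow> real) \<Rightarrow> 'a measure \<Rightarrow> (int \<Rightarrow> 'a set set) set \<Rightarrow> ('a \<Rightarrow> real) set" where
  "A1 \<rho> M \<D> = {w. weight \<rho> M w \<and> A1_const M \<D> w < \<infinity>}"

definition Ainf ::
    "('a \<Rightarrow> 'a \<Rightarrow> real) \<Rightarrow> 'a measure \<Rightarrow> (int \<Rightarrow> 'a set set) set \<Rightarrow> ('a \<Rightarrow> real) set" where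
  "Ainf \<rho> M \<D> = {w. weight \<rho> M w \<and> Ainf_const M \<D> w < \<infinity>}"

text \<open>The $L^1(v)$ norm; the density $v$ may be infinite, as $M_r w$ a priori is.\<close>
definition L1_norm :: "'a measure \<Rightarrow> ('a \<Rightarrow> ennreal) \<Rightarrow> ('a \<Rightarrow> real) \<Rightarrow> ennreal" where
  "L1_norm M v f = (\<integral>\<^sup>+x. ennreal \<bar>f x\<bar> * v x \<partial>M)"

definition weak_L1_norm :: "'a measure \<Rightarrow> ('a \<Rightarrow> real) \<Rightarrow> ('a \<Rightarrow> real) \<Rightarrow> ennreal" where
  "weak_L1_norm M w g = (SUP t\<in>{0<..}. ennreal t * wmeas M w {x \<in> space M. t < \<bar>g x\<bar>})"

section \<open>Calderon-Zygmund operators\<close>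

text \<open>Values on the diagonal are irrelevant, whence the condition \<open>x \<noteq> y\<close>.\<close>
definition cz_kernel :: "('a \<Rightarrow> 'a \<Rightarrow> real) \<Rightarrow> 'a measure \<Rightarrow> ('a \<Rightarrow> 'a \<Rightarrow> real) \<Rightarrow> bool" where
  "cz_kernel \<rho> M K \<longleftrightarrow> (\<exists>\<eta>>0. \<exists>C_K. \<forall>x0\<in>space M. \<forall>y\<in>space M. x0 \<noteq> y \<longrightarrow>
     \<bar>K x0 y\<bar> \<le> C_K / measure M (qball (space M) \<rho> x0 (\<rho> x0 y)) \<and>
     (\<forall>x\<in>space M. x \<noteq> y \<and> \<rho> x0 x \<le> \<eta> * \<rho> x0 y \<longrightarrow>
        \<bar>K x y - K x0 y\<bar>
          \<le> (\<rho> x x0 / \<rho> x0 y) powr \<eta> * (1 / measure M (qball (space M) \<rho> x0 (\<rho> x0 y))) \<and>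
        \<bar>K y x - K y x0\<bar>
          \<le> (\<rho> x x0 / \<rho> x0 y) powr \<eta> * (1 / measure M (qball (space M) \<rho> x0 (\<rho> x0 y)))))"

definition L2 :: "'a measure \<Rightarrow> ('a \<Rightarrow> real) set" where
  "L2 M = {f \<in> borel_measurable M. integrable M (\<lambda>x. (f x)\<^sup>2)}"

definition L2_norm :: "'a measure \<Rightarrow> ('a \<Rightarrow> real) \<Rightarrow> real" where
  "L2_norm M f = sqrt (\<integral>x. (f x)\<^sup>2 \<partial>M)"

text \<open>The support of a function defined almost everywhere.\<close>
definition ess_support :: "('a \<Rightarrow> 'a \<Rightarrow> real) \<Rightarrow> 'a measure \<Rightarrow> ('a \<Rightarrow> real) \<Rightarrow> 'a set" where
  "ess_support \<rho> M f =
     space M - \<Union>{U. qopen (space M) \<rho> U \<and> (AE x in M. x \<in> U \<longrightarrow> f x = 0)}"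

text \<open>
  \<open>T\<close> acts on representatives of elements of $L^2$.  That it respects equality almost everywhere
  follows from linearity and boundedness.
\<close>
definition cz_operator ::
    "('a \<Rightarrow> 'a \<Rightarrow> real) \<Rightarrow> 'a measure \<Rightarrow> (('a \<Rightarrow> real) \<Rightarrow> 'a \<Rightarrow> real) \<Rightarrow> bool" where
  "cz_operator \<rho> M T \<longleftrightarrow>
     (\<forall>f\<in>L2 M. T f \<in> L2 M) \<and>
     (\<forall>f\<in>L2 M. \<forall>g\<in>L2 M. \<forall>a b. AE x in M. T (\<lambda>y. a * f y + b * g y) x = a * T f x + b * T g x) \<and>
     (\<exists>B. \<forall>f\<in>L2 M. L2_norm M (T f) \<le> B * L2_norm M f) \<and>
     (\<exists>K. cz_kernel \<rho> M K \<and>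
        (\<forall>f\<in>L2 M. AE x in M. x \<notin> ess_support \<rho> M f \<longrightarrow> T f x = (\<integral>y. K x y * f y \<partial>M)))"

end

theory Submission
  imports Defs
begin

text \<open>
  The heart of the matter is the bound $C \log(e+[w]_{A_\infty})\,\|f\|_{L^1(Mw)}$ for
  $w\in A_\infty$. It implies both claims, since $Mw\le M_rw$ by Young's inequality and
  $Mw\le[w]_{A_1}w$ almost everywhere; no reverse Hoelder inequality is needed.

  The operator is dominated pointwise by finitely many sparse operators, following Lerner and
  Ombrosi: on a cube $P$ one stopping_cubes at the maximal subcubes in which the set where $T(f\chi_{P^*})$
  or $M(f\chi_{P^*})$ is large has density above a threshold, and the oscillation of
  $T(f\chi_{P^*\setminus R^*})$ on a stopping cube $R$ is controlled by the maximal function. This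
  requires only the weak type $(1,1)$ of $T$, and no maximal truncations.

  For a sparse operator, following Domingo-Salazar, Lacey and Rey, the cubes are sorted by the size
  $4^{-k}$ of their averages. Each of the first $k_1\sim\log(e+[w]_{A_\infty})$ levels contributes at
  most a constant times $\|f\|_{L^1(Mw)}$. On the later levels, many cubes have to overlap for the
  sum to be large; the measure of such sets decays exponentially, first for $\mu$ and then for $w$,
  because a subset of $Q$ of relative measure $2^{-C[w]_{A_\infty}}$ has at most half of the
  $w$-measure of $Q$.
\<close>

section \<open>Laminar families and stopping cubes\<close>

text \<open>Two obstacles shape the development. The geometry is only quasimetric, and one set may
  be a cube of several generations; so the arguments about a single dyadic system run in
  \<open>cube_family\<close>, which forgets generations and obtains differentiation of integrals
  from outer approximation by cubes. Moreover, a sparse cube controls \<open>f\<close> only on a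
  dilate, which need not be a cube of its system; it is placed in a cube of an adjacent system. As
  different sparse cubes may receive the same adjacent cube, sparse collections are indexed
  families, governed by a packing condition on sums of measures. The logarithm comes from comparing
  two rates. With \<open>L\<close> of the order of [w], level k is harmful only where more than
  about 2^k/4 of its cubes overlap, and every \<open>L\<close> further overlaps halve the w-measure:
  a gain of 2 to the power -2^k/(4L). Averages of size 4^(-k) cost a factor 4^k. The gain wins once
  2^k \<ge> (4L)^2, that is, from k1 = 2 log_2(4L) on.\<close>

definition laminar :: "'a set set \<Rightarrow> bool" where
  "laminar F \<longleftrightarrow> (\<forall>P\<in>F. \<forall>Q\<in>F. P \<inter> Q \<noteq> {} \<longrightarrow> P \<subseteq> Q \<or> Q \<subseteq> P)"

definition maximal_sets :: "'a set set \<Rightarrow> 'a set set" where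
  "maximal_sets F = {P\<in>F. \<forall>Q\<in>F. P \<subseteq> Q \<longrightarrow> Q = P}"

lemma laminar_subset: "laminar F \<Longrightarrow> G \<subseteq> F \<Longrightarrow> laminar G"
  unfolding laminar_def by blast

lemma laminarD: "laminar F \<Longrightarrow> P \<in> F \<Longrightarrow> Q \<in> F \<Longrightarrow> x \<in> P \<Longrightarrow> x \<in> Q \<Longrightarrow> P \<subseteq> Q \<or> Q \<subseteq> P"
  unfolding laminar_def by blast

lemma maximal_sets_subset: "maximal_sets F \<subseteq> F"
  unfolding maximal_sets_def by blast

lemma disjoint_maximal_sets:
  assumes "laminar F"
  shows "disjoint (maximal_sets F)"
proof (rule pairwiseI)
  fix P Q assume PQ: "P \<in> maximal_sets F" "Q \<in> maximal_sets F" "P \<noteq> Q"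
  show "disjnt P Q"
  proof (rule ccontr)
    assume "\<not> disjnt P Q"
    then have "P \<subseteq> Q \<or> Q \<subseteq> P"
      using PQ assms unfolding maximal_sets_def laminar_def disjnt_def by blast
    then show False using PQ unfolding maximal_sets_def by blast
  qed
qed

lemma Union_maximal_sets:
  assumes "\<And>P. P \<in> F \<Longrightarrow> finite {Q\<in>F. P \<subseteq> Q}"
  shows "\<Union>(maximal_sets F) = \<Union>F"
proof
  show "\<Union>(maximal_sets F) \<subseteq> \<Union>F" using maximal_sets_subset by blast
  show "\<Union>F \<subseteq> \<Union>(maximal_sets F)"
  proof
    fix x assume "x \<in> \<Union>F"
    then obtain P where P: "P \<in> F" "x \<in> P" by blast
    then obtain Q where Q: "Q \<in> {Q\<in>F. P \<subseteq> Q}" "P \<subseteq> Q" "\<forall>b\<in>{Q\<in>F. P \<subseteq> Q}. Q \<subseteq> b \<longrightarrow> Q = b"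
      using finite_has_maximal2[OF assms[OF P(1)], of P] by blast
    then have "Q \<in> maximal_sets F" unfolding maximal_sets_def by blast
    then show "x \<in> \<Union>(maximal_sets F)" using P Q by blast
  qed
qed

text \<open>An infinite laminar family may consist of an increasing chain and have no maximal
  members. A finite subfamily can be replaced by its maximal members, which are disjoint and have
  the same union; the finite unions then increase to the whole union.\<close>

lemma laminar_emeasure_le:
  assumes lam: "laminar F" and cF: "countable F"
    and sF: "\<And>P. P \<in> F \<Longrightarrow> P \<in> sets N1" and s12: "sets N1 = sets N2"
    and le: "\<And>P. P \<in> F \<Longrightarrow> emeasure N1 P \<le> emeasure N2 P"
  shows "emeasure N1 (\<Union>F) \<le> emeasure N2 (\<Union>F)"
proof -
  have fin: "emeasure N1 (\<Union>G) \<le> emeasure N2 (\<Union>G)" if G: "finite G" "G \<subseteq> F" for G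
  proof -
    let ?m = "maximal_sets G"
    have m: "?m \<subseteq> F" "finite ?m" using G maximal_sets_subset[of G] by (auto intro: finite_subset)
    have d: "disjoint_family_on (\<lambda>P. P) ?m"
      using disjoint_maximal_sets[OF laminar_subset[OF lam G(2)]]
      by (auto simp: disjoint_family_on_def pairwise_def disjnt_def)
    have U: "\<Union>G = (\<Union>P\<in>?m. P)" using Union_maximal_sets[of G] G(1) by auto
    have e1: "emeasure N1 (\<Union>G) = (\<Sum>P\<in>?m. emeasure N1 P)"
      unfolding U by (rule sum_emeasure[symmetric]) (use m sF d in auto)
    have e2: "emeasure N2 (\<Union>G) = (\<Sum>P\<in>?m. emeasure N2 P)"
      unfolding U by (rule sum_emeasure[symmetric]) (use m sF s12 d in auto)
    show ?thesis unfolding e1 e2 by (rule sum_mono) (use m le in auto)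
  qed
  show ?thesis
  proof (cases "F = {}")
    case False
    let ?A = "\<lambda>n::nat. \<Union>(from_nat_into F ` {..n})"
    have r: "range (from_nat_into F) = F" using False cF by (rule range_from_nat_into)
    have U: "\<Union>F = (\<Union>n. ?A n)" by (subst r[symmetric]) auto
    have inc: "incseq ?A" by (intro monoI Union_mono image_mono) auto
    have sub: "from_nat_into F ` {..n} \<subseteq> F" for n using r by blast
    have s1: "?A n \<in> sets N1" for n
      using sub[of n] sF by (intro sets.finite_Union) auto
    have s1': "range ?A \<subseteq> sets N1" "range ?A \<subseteq> sets N2" using s1 s12 by auto
    have "emeasure N1 (\<Union>F) = (SUP n. emeasure N1 (?A n))"
      unfolding U by (rule SUP_emeasure_incseq[OF s1'(1) inc, symmetric])
    also have "\<dots> \<le> (SUP n. emeasure N2 (?A n))"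
      by (intro SUP_mono') (use fin sub in auto)
    also have "\<dots> = emeasure N2 (\<Union>F)"
      unfolding U by (rule SUP_emeasure_incseq[OF s1'(2) inc])
    finally show ?thesis .
  qed simp
qed

text \<open>The measure inequality for the densities \<open>f\<close> and \<open>g\<close>. It is
  the device by which estimates on single cubes are added up over a union throughout the
  proof.\<close>

lemma laminar_nn_integral_le:
  assumes "laminar F" "countable F" "\<And>P. P \<in> F \<Longrightarrow> P \<in> sets M"
    and fg: "f \<in> borel_measurable M" "g \<in> borel_measurable M"
    and le: "\<And>P. P \<in> F \<Longrightarrow> (\<integral>\<^sup>+x\<in>P. f x \<partial>M) \<le> (\<integral>\<^sup>+x\<in>P. g x \<partial>M)"
  shows "(\<integral>\<^sup>+x\<in>\<Union>F. f x \<partial>M) \<le> (\<integral>\<^sup>+x\<in>\<Union>F. g x \<partial>M)"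
proof -
  have U: "\<Union>F \<in> sets M" using assms(2,3) by (intro sets.countable_Union) auto
  have "emeasure (density M f) (\<Union>F) \<le> emeasure (density M g) (\<Union>F)"
    by (rule laminar_emeasure_le) (use assms in \<open>auto simp: emeasure_density\<close>)
  then show ?thesis using U fg by (simp add: emeasure_density)
qed

lemma set_nn_integral_mono:
  assumes "\<And>x. x \<in> P \<Longrightarrow> f x \<le> g x"
  shows "(\<integral>\<^sup>+x\<in>P. f x \<partial>M) \<le> (\<integral>\<^sup>+x\<in>P. g x \<partial>M)"
  by (rule nn_integral_mono) (use assms in \<open>auto simp: indicator_def\<close>)

lemma set_nn_integral_subset:
  assumes "P \<subseteq> Q"
  shows "(\<integral>\<^sup>+x\<in>P. f x \<partial>M) \<le> (\<integral>\<^sup>+x\<in>Q. f x \<partial>M)"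
  by (rule nn_integral_mono) (use assms in \<open>auto simp: indicator_def\<close>)

lemma set_nn_integral_const:
  "P \<in> sets M \<Longrightarrow> (\<integral>\<^sup>+x\<in>P. c \<partial>M) = c * emeasure M P"
  by (rule nn_integral_cmult_indicator)

lemma set_nn_integral_indicator:
  "P \<in> sets M \<Longrightarrow> F \<in> sets M \<Longrightarrow> (\<integral>\<^sup>+x\<in>P. indicator F x \<partial>M) = emeasure M (F \<inter> P)"
  by (simp add: indicator_inter_arith[symmetric] del: nn_integral_indicator flip: nn_integral_indicator)

lemma set_nn_integral_le_space:
  "(\<integral>\<^sup>+x\<in>P. f x \<partial>M) \<le> (\<integral>\<^sup>+x. f x \<partial>M)"
  by (rule nn_integral_mono) (auto simp: indicator_def)

text \<open>One dyadic system, seen as a family of sets. Since a cube may coincide with its parent,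
  \<open>parent\<close> asks for a strictly larger cube of comparable measure. The condition
  \<open>outer_regular\<close> plays the part of the Lebesgue differentiation theorem.\<close>

locale cube_family =
  fixes M :: "'a measure" and \<epsilon> :: real and \<Q> :: "'a set set"
  assumes eps: "0 < \<epsilon>" "\<epsilon> < 1"
    and countable_cubes: "countable \<Q>"
    and cube_sets: "\<And>P. P \<in> \<Q> \<Longrightarrow> P \<in> sets M"
    and laminar_cubes: "laminar \<Q>"
    and cube_pos: "\<And>P. P \<in> \<Q> \<Longrightarrow> 0 < emeasure M P"
    and cube_finite: "\<And>P. P \<in> \<Q> \<Longrightarrow> emeasure M P < \<infinity>"
    and parent: "\<And>P Q. P \<in> \<Q> \<Longrightarrow> Q \<in> \<Q> \<Longrightarrow> P \<subset> Q \<Longrightarrow>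
      \<exists>R\<in>\<Q>. P \<subset> R \<and> R \<subseteq> Q \<and> ennreal \<epsilon> * emeasure M R \<le> emeasure M P"
    and finite_between: "\<And>P Q. P \<in> \<Q> \<Longrightarrow> Q \<in> \<Q> \<Longrightarrow> finite {R\<in>\<Q>. P \<subseteq> R \<and> R \<subseteq> Q}"
    and outer_regular: "\<And>F Q \<eta>::real. F \<in> sets M \<Longrightarrow> F \<subseteq> Q \<Longrightarrow> Q \<in> \<Q> \<Longrightarrow> 0 < \<eta> \<Longrightarrow>
      \<exists>U\<subseteq>\<Q>. (\<forall>P\<in>U. P \<subseteq> Q) \<and> F \<subseteq> \<Union>U \<and> emeasure M (\<Union>U) \<le> emeasure M F + ennreal \<eta>"
begin

lemma countable_subcubes: "F \<subseteq> \<Q> \<Longrightarrow> countable F"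
  using countable_cubes countable_subset by blast

lemma Union_subcubes_sets: "F \<subseteq> \<Q> \<Longrightarrow> \<Union>F \<in> sets M"
  using countable_subcubes cube_sets by (intro sets.countable_Union) auto

text \<open>A substitute for the density theorem: cubes covering \<open>F\<close> with total measure
  at most \<mu>(F) + \<eta> give \<mu>(F) \<le> \<theta> (\<mu>(F) + \<eta>), and \<eta> tends to
  0.\<close>

lemma null_of_small_density:
  assumes F: "F \<in> sets M" "F \<subseteq> Q" "Q \<in> \<Q>" and \<theta>: "0 \<le> \<theta>" "\<theta> < 1"
    and le: "\<And>P. P \<in> \<Q> \<Longrightarrow> P \<subseteq> Q \<Longrightarrow> emeasure M (F \<inter> P) \<le> ennreal \<theta> * emeasure M P"
  shows "emeasure M F = 0"
proof -
  have fin: "emeasure M F < \<infinity>"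
    using emeasure_mono[OF F(2) cube_sets[OF F(3)]] cube_finite[OF F(3)] by (rule le_less_trans)
  have "emeasure M F \<le> ennreal \<theta> * (emeasure M F + ennreal \<eta>)" if \<eta>: "\<eta> > 0" for \<eta>
  proof -
    obtain U where U: "U \<subseteq> \<Q>" "\<forall>P\<in>U. P \<subseteq> Q" "F \<subseteq> \<Union>U"
      and UF: "emeasure M (\<Union>U) \<le> emeasure M F + ennreal \<eta>"
      using outer_regular[OF F \<eta>] by (elim exE conjE) (rule that)
    have "(\<integral>\<^sup>+x\<in>\<Union>U. indicator F x \<partial>M) \<le> (\<integral>\<^sup>+x\<in>\<Union>U. ennreal \<theta> \<partial>M)"
    proof (rule laminar_nn_integral_le)
      fix P assume P: "P \<in> U"
      have "(\<integral>\<^sup>+x\<in>P. indicator F x \<partial>M) = emeasure M (F \<inter> P)"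
        using F(1) cube_sets P U(1) by (intro set_nn_integral_indicator) auto
      also have "\<dots> \<le> ennreal \<theta> * emeasure M P" using le P U by auto
      finally show "(\<integral>\<^sup>+x\<in>P. indicator F x \<partial>M) \<le> (\<integral>\<^sup>+x\<in>P. ennreal \<theta> \<partial>M)"
        using cube_sets P U(1) by (simp add: set_nn_integral_const subset_eq)
    qed (use U(1) F(1) in \<open>auto intro: countable_subcubes cube_sets laminar_subset[OF laminar_cubes]\<close>)
    also have "(\<integral>\<^sup>+x\<in>\<Union>U. indicator F x \<partial>M) = emeasure M (F \<inter> \<Union>U)"
      using F(1) Union_subcubes_sets[OF U(1)] by (intro set_nn_integral_indicator)
    also have "F \<inter> \<Union>U = F" using U by blast
    also have "(\<integral>\<^sup>+x\<in>\<Union>U. ennreal \<theta> \<partial>M) = ennreal \<theta> * emeasure M (\<Union>U)"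
      using Union_subcubes_sets[OF U(1)] by (simp add: set_nn_integral_const)
    finally show ?thesis using UF by (meson mult_left_mono order_trans zero_le)
  qed
  then have le': "measure M F \<le> \<theta> * (measure M F + \<eta>)" if "\<eta> > 0" for \<eta>
  proof -
    have e: "emeasure M F = ennreal (measure M F)"
      using fin by (intro emeasure_eq_ennreal_measure) auto
    have "ennreal (measure M F) \<le> ennreal (\<theta> * (measure M F + \<eta>))"
      using \<open>\<And>\<eta>. \<eta> > 0 \<Longrightarrow> _\<close> [OF that] that \<theta> unfolding e
      by (simp add: ennreal_mult ennreal_plus)
    then show ?thesis using that \<theta> by (subst (asm) ennreal_le_iff) auto
  qed
  have "measure M F \<le> \<theta> * measure M F"
  proof (rule field_le_epsilon)
    fix e :: real assume e: "0 < e"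
    have "measure M F \<le> \<theta> * (measure M F + e)" by (rule le'[OF e])
    also have "\<dots> \<le> \<theta> * measure M F + e" using e \<theta> by (simp add: algebra_simps mult_left_le)
    finally show "measure M F \<le> \<theta> * measure M F + e" .
  qed
  then have "measure M F * (1 - \<theta>) \<le> 0" by (simp add: algebra_simps)
  then have "measure M F = 0"
    using \<theta> measure_nonneg[of M F] by (smt (verit) mult_pos_pos)
  then show ?thesis using fin by (simp add: emeasure_eq_ennreal_measure)
qed

text \<open>The selection of a Calderon-Zygmund decomposition. If the average over a cube
  \<open>Q\<close> itself exceeds \<open>t\<close>, the only stopping cube is \<open>Q\<close>;
  upper bounds for the averages therefore assume that the average over \<open>Q\<close> is at most
  \<open>t\<close>.\<close>

definition stopping_cubes :: "('a \<Rightarrow> ennreal) \<Rightarrow> real \<Rightarrow> 'a set \<Rightarrow> 'a set set" where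
  "stopping_cubes \<phi> t Q = maximal_sets {P\<in>\<Q>. P \<subseteq> Q \<and> ennreal t * emeasure M P < (\<integral>\<^sup>+x\<in>P. \<phi> x \<partial>M)}"

lemma stopping_cubesD:
  assumes "P \<in> stopping_cubes \<phi> t Q"
  shows "P \<in> \<Q>" "P \<subseteq> Q" "ennreal t * emeasure M P < (\<integral>\<^sup>+x\<in>P. \<phi> x \<partial>M)"
  using assms unfolding stopping_cubes_def maximal_sets_def by auto

lemma Union_stopping_cubes:
  assumes "Q \<in> \<Q>"
  shows "\<Union>(stopping_cubes \<phi> t Q) = \<Union>{P\<in>\<Q>. P \<subseteq> Q \<and> ennreal t * emeasure M P < (\<integral>\<^sup>+x\<in>P. \<phi> x \<partial>M)}"
  unfolding stopping_cubes_def
proof (rule Union_maximal_sets)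
  fix P assume "P \<in> {P\<in>\<Q>. P \<subseteq> Q \<and> ennreal t * emeasure M P < (\<integral>\<^sup>+x\<in>P. \<phi> x \<partial>M)}"
  then show "finite {R \<in> {P\<in>\<Q>. P \<subseteq> Q \<and> ennreal t * emeasure M P < (\<integral>\<^sup>+x\<in>P. \<phi> x \<partial>M)}. P \<subseteq> R}"
    using finite_between[of P Q] assms by (auto elim: rev_finite_subset)
qed

lemma disjoint_stopping_cubes: "disjoint (stopping_cubes \<phi> t Q)"
  unfolding stopping_cubes_def
  by (rule disjoint_maximal_sets, rule laminar_subset[OF laminar_cubes]) auto

lemma stopping_cubes_strict:
  assumes "(\<integral>\<^sup>+x\<in>Q. \<phi> x \<partial>M) \<le> ennreal t * emeasure M Q" "P \<in> stopping_cubes \<phi> t Q"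
  shows "P \<subset> Q"
  using stopping_cubesD[OF assms(2)] assms(1) by (metis leD psubsetI)

text \<open>The larger cube provided by \<open>parent\<close> cannot have been selected, as
  \<open>P\<close> is maximal. So its average is at most \<open>t\<close>, and the average over
  \<open>P\<close> exceeds it by at most the factor 1/\<epsilon>.\<close>

lemma stopping_cubes_upper:
  assumes Q: "Q \<in> \<Q>" "(\<integral>\<^sup>+x\<in>Q. \<phi> x \<partial>M) \<le> ennreal t * emeasure M Q" and P: "P \<in> stopping_cubes \<phi> t Q"
  obtains R where "R \<in> \<Q>" "P \<subset> R" "R \<subseteq> Q" "ennreal \<epsilon> * emeasure M R \<le> emeasure M P"
    "(\<integral>\<^sup>+x\<in>R. \<phi> x \<partial>M) \<le> ennreal t * emeasure M R"
proof -
  obtain R where R: "R \<in> \<Q>" "P \<subset> R" "R \<subseteq> Q" "ennreal \<epsilon> * emeasure M R \<le> emeasure M P"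
    using parent[OF stopping_cubesD(1)[OF P] Q(1) stopping_cubes_strict[OF Q(2) P]] by blast
  have "(\<integral>\<^sup>+x\<in>R. \<phi> x \<partial>M) \<le> ennreal t * emeasure M R"
  proof (rule ccontr)
    assume "\<not> ?thesis"
    then have "R = P" using P R unfolding stopping_cubes_def maximal_sets_def by (auto simp: not_le)
    then show False using R by blast
  qed
  then show ?thesis using R that by blast
qed

lemma inverse_eps_mult:
  assumes "ennreal \<epsilon> * a \<le> b"
  shows "a \<le> ennreal (1 / \<epsilon>) * b"
proof -
  have "a = ennreal (1 / \<epsilon>) * (ennreal \<epsilon> * a)"
    using eps by (simp add: mult.assoc[symmetric] ennreal_mult[symmetric])
  also have "\<dots> \<le> ennreal (1 / \<epsilon>) * b" using assms by (rule mult_left_mono) simp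
  finally show ?thesis .
qed

lemma stopping_cubes_average_le:
  assumes Q: "Q \<in> \<Q>" "(\<integral>\<^sup>+x\<in>Q. \<phi> x \<partial>M) \<le> ennreal t * emeasure M Q" and P: "P \<in> stopping_cubes \<phi> t Q"
    and t: "0 \<le> t"
  shows "(\<integral>\<^sup>+x\<in>P. \<phi> x \<partial>M) \<le> ennreal (t / \<epsilon>) * emeasure M P"
proof -
  obtain R where R: "P \<subset> R" "ennreal \<epsilon> * emeasure M R \<le> emeasure M P"
    "(\<integral>\<^sup>+x\<in>R. \<phi> x \<partial>M) \<le> ennreal t * emeasure M R"
    using stopping_cubes_upper[OF Q P] by metis
  have "(\<integral>\<^sup>+x\<in>P. \<phi> x \<partial>M) \<le> (\<integral>\<^sup>+x\<in>R. \<phi> x \<partial>M)" by (rule set_nn_integral_subset) (use R in auto)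
  also have "\<dots> \<le> ennreal t * emeasure M R" by (rule R)
  also have "\<dots> \<le> ennreal t * (ennreal (1 / \<epsilon>) * emeasure M P)"
    by (intro mult_left_mono inverse_eps_mult R) auto
  also have "\<dots> = ennreal (t / \<epsilon>) * emeasure M P"
    using t eps by (simp add: mult.assoc[symmetric] ennreal_mult[symmetric])
  finally show ?thesis .
qed

lemma Union_stopping_cubes_sets: "\<Union>(stopping_cubes \<phi> t Q) \<in> sets M"
  by (rule Union_subcubes_sets) (use stopping_cubesD in auto)

lemma countable_stopping_cubes: "countable (stopping_cubes \<phi> t Q)"
  by (rule countable_subcubes) (use stopping_cubesD in auto)

lemma stopping_cubes_measure_le:
  assumes "\<phi> \<in> borel_measurable M"
  shows "ennreal t * emeasure M (\<Union>(stopping_cubes \<phi> t Q)) \<le> (\<integral>\<^sup>+x\<in>\<Union>(stopping_cubes \<phi> t Q). \<phi> x \<partial>M)"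
proof -
  have "(\<integral>\<^sup>+x\<in>\<Union>(stopping_cubes \<phi> t Q). ennreal t \<partial>M) \<le> (\<integral>\<^sup>+x\<in>\<Union>(stopping_cubes \<phi> t Q). \<phi> x \<partial>M)"
    by (rule laminar_nn_integral_le[OF laminar_subset[OF laminar_cubes]])
      (use stopping_cubesD countable_stopping_cubes cube_sets assms in \<open>fastforce simp: set_nn_integral_const\<close>)+
  then show ?thesis using Union_stopping_cubes_sets by (simp add: set_nn_integral_const)
qed

text \<open>For s > t, the part of {\<phi> > s} outside the stopping cubes has density at most t/s
  in every subcube: a subcube either lies in a stopping cube or has average at most
  \<open>t\<close>, and then Chebyshev's inequality applies. Hence this part is null.\<close>

lemma AE_le_outside_stopping_cubes:
  assumes \<phi>[measurable]: "\<phi> \<in> borel_measurable M" and Q: "Q \<in> \<Q>" and t: "0 \<le> t"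
  shows "AE x in M. x \<in> Q \<longrightarrow> x \<notin> \<Union>(stopping_cubes \<phi> t Q) \<longrightarrow> \<phi> x \<le> ennreal t"
proof -
  define F where "F s = {x \<in> space M. s < \<phi> x} \<inter> (Q - \<Union>(stopping_cubes \<phi> t Q))" for s
  have Fs[measurable]: "F s \<in> sets M" for s
    unfolding F_def using cube_sets[OF Q] Union_stopping_cubes_sets by auto
  have null: "emeasure M (F (ennreal s)) = 0" if s: "t < s" for s
  proof (rule null_of_small_density[OF Fs _ Q, of s "t / s"])
    fix P assume P: "P \<in> \<Q>" "P \<subseteq> Q"
    show "emeasure M (F (ennreal s) \<inter> P) \<le> ennreal (t / s) * emeasure M P"
    proof (cases "F (ennreal s) \<inter> P = {}")
      case False
      then have "\<not> P \<subseteq> \<Union>(stopping_cubes \<phi> t Q)" unfolding F_def by blast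
      then have "\<not> ennreal t * emeasure M P < (\<integral>\<^sup>+x\<in>P. \<phi> x \<partial>M)"
        unfolding Union_stopping_cubes[OF Q] using P by blast
      then have le: "(\<integral>\<^sup>+x\<in>P. \<phi> x \<partial>M) \<le> ennreal t * emeasure M P" by simp
      have Ps: "P \<in> sets M" using cube_sets P by auto
      have "ennreal s * emeasure M (F (ennreal s) \<inter> P) = (\<integral>\<^sup>+x\<in>F (ennreal s) \<inter> P. ennreal s \<partial>M)"
        using Ps by (subst set_nn_integral_const) auto
      also have "\<dots> \<le> (\<integral>\<^sup>+x\<in>F (ennreal s) \<inter> P. \<phi> x \<partial>M)"
        by (rule set_nn_integral_mono) (auto simp: F_def)
      also have "\<dots> \<le> (\<integral>\<^sup>+x\<in>P. \<phi> x \<partial>M)" by (rule set_nn_integral_subset) auto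
      also note le
      finally have "ennreal (1 / s) * (ennreal s * emeasure M (F (ennreal s) \<inter> P))
          \<le> ennreal (1 / s) * (ennreal t * emeasure M P)" by (rule mult_left_mono) simp
      then show ?thesis using s t by (simp add: mult.assoc[symmetric] ennreal_mult[symmetric])
    qed simp
  qed (use s t in \<open>auto simp: F_def\<close>)
  have "AE x in M. \<forall>n::nat. x \<notin> F (ennreal (t + 1 / Suc n))"
    unfolding AE_all_countable
    by (intro allI AE_not_in null_setsI null) auto
  then show ?thesis
  proof (rule AE_mp, intro AE_I2 impI)
    fix x assume x: "x \<in> space M" "\<forall>n::nat. x \<notin> F (ennreal (t + 1 / Suc n))" "x \<in> Q" "x \<notin> \<Union>(stopping_cubes \<phi> t Q)"
    show "\<phi> x \<le> ennreal t"
    proof (rule ennreal_le_epsilon)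
      fix e :: real assume "0 < e"
      then obtain n where n: "1 / Suc n < e" using nat_approx_posE by blast
      have "\<phi> x \<le> ennreal (t + 1 / Suc n)" using x unfolding F_def by (auto simp: not_less)
      also have "\<dots> \<le> ennreal t + ennreal e" using n t \<open>0 < e\<close>
        by (subst ennreal_plus[symmetric]) (auto intro!: ennreal_leI)
      finally show "\<phi> x \<le> ennreal t + ennreal e" .
    qed
  qed
qed

end

section \<open>Overlaps in laminar families\<close>

lemma finite_chain_least:
  assumes "finite F" "F \<noteq> {}" "laminar F" "\<And>P. P \<in> F \<Longrightarrow> x \<in> P"
  obtains L where "L \<in> F" "\<And>P. P \<in> F \<Longrightarrow> L \<subseteq> P"
proof -
  obtain L where L: "L \<in> F" "\<forall>P\<in>F. P \<subseteq> L \<longrightarrow> L = P"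
    using finite_has_minimal[OF assms(1,2)] by auto
  have "L \<subseteq> P" if "P \<in> F" for P
    using laminarD[OF assms(3) L(1) that] assms(4) L that by blast
  then show ?thesis using that L by blast
qed

lemma finite_chain_greatest:
  assumes "finite F" "F \<noteq> {}" "laminar F" "\<And>P. P \<in> F \<Longrightarrow> x \<in> P"
  obtains L where "L \<in> F" "\<And>P. P \<in> F \<Longrightarrow> P \<subseteq> L"
proof -
  obtain L where L: "L \<in> F" "\<forall>P\<in>F. L \<subseteq> P \<longrightarrow> L = P"
    using finite_has_maximal[OF assms(1,2)] by auto
  have "P \<subseteq> L" if "P \<in> F" for P
    using laminarD[OF assms(3) L(1) that] assms(4) L that by blast
  then show ?thesis using that L by blast
qed

text \<open>Indices are counted, not sets: a cube that occurs under several indices counts several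
  times.\<close>

definition overlap :: "'i set \<Rightarrow> ('i \<Rightarrow> 'a set) \<Rightarrow> 'a set \<Rightarrow> 'a \<Rightarrow> nat" where
  "overlap I P R x = card {i\<in>I. x \<in> P i \<and> P i \<subseteq> R}"

text \<open>The members at which the overlap passes \<open>m\<close>: since at most \<open>m\<close> members lie strictly above
  such a set \<open>L\<close>, the overlap in \<open>L\<close> counted from \<open>L\<close> downwards is at least the total minus \<open>m\<close>,
  which makes the level estimates iterable.\<close>

definition crossing :: "'i set \<Rightarrow> ('i \<Rightarrow> 'a set) \<Rightarrow> 'a set \<Rightarrow> nat \<Rightarrow> 'a set set" where
  "crossing I P R m = {L \<in> P ` I. L \<subseteq> R \<and> m < card {i\<in>I. L \<subseteq> P i \<and> P i \<subseteq> R} \<and>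
     card {i\<in>I. L \<subset> P i \<and> P i \<subseteq> R} \<le> m}"

lemma crossing_overlap:
  assumes "finite I" "laminar (P ` I)" "L \<in> crossing I P R m" "x \<in> L"
  shows "m < overlap I P R x" "overlap I P R x \<le> m + overlap I P L x"
proof -
  have L: "L \<in> P ` I" "L \<subseteq> R" "m < card {i\<in>I. L \<subseteq> P i \<and> P i \<subseteq> R}"
    "card {i\<in>I. L \<subset> P i \<and> P i \<subseteq> R} \<le> m"
    using assms(3) unfolding crossing_def by auto
  have "card {i\<in>I. L \<subseteq> P i \<and> P i \<subseteq> R} \<le> overlap I P R x"
    unfolding overlap_def by (rule card_mono) (use assms in auto)
  then show "m < overlap I P R x" using L by simp
  have "{i\<in>I. x \<in> P i \<and> P i \<subseteq> R} \<subseteq> {i\<in>I. L \<subset> P i \<and> P i \<subseteq> R} \<union> {i\<in>I. x \<in> P i \<and> P i \<subseteq> L}"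
    using laminarD[OF assms(2) L(1)] assms(4) by blast
  then have "overlap I P R x \<le> card ({i\<in>I. L \<subset> P i \<and> P i \<subseteq> R} \<union> {i\<in>I. x \<in> P i \<and> P i \<subseteq> L})"
    unfolding overlap_def using assms(1) by (intro card_mono) auto
  also have "\<dots> \<le> m + overlap I P L x"
    unfolding overlap_def using L by (intro order_trans[OF card_Un_le] add_mono) auto
  finally show "overlap I P R x \<le> m + overlap I P L x" .
qed

text \<open>The members of the family that contain \<open>x\<close> and lie in \<open>R\<close> form
  a finite chain. Its largest element with more than \<open>m\<close> members at or above it has at
  most \<open>m\<close> strictly above it, since otherwise the smallest of those would be a larger
  such element.\<close>

lemma crossing_covers:
  assumes fin: "finite I" and lam: "laminar (P ` I)" and m: "m < overlap I P R x"
  shows "\<exists>L\<in>crossing I P R m. x \<in> L"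
proof -
  define A where "A = {i\<in>I. x \<in> P i \<and> P i \<subseteq> R}"
  have A: "finite A" "A \<subseteq> I" "m < card A" using fin m unfolding A_def overlap_def by auto
  have lam': "laminar (P ` B)" if "B \<subseteq> I" for B
    using laminar_subset[OF lam image_mono[OF that]] .
  define G where "G = {L \<in> P ` A. m < card {i\<in>I. L \<subseteq> P i \<and> P i \<subseteq> R}}"
  have mem: "\<exists>L\<in>G. L \<in> P ` B" if B: "B \<subseteq> A" "m < card B" for B
  proof -
    have "finite (P ` B)" "P ` B \<noteq> {}" using B finite_subset[OF B(1) A(1)] by auto
    then obtain L where L: "L \<in> P ` B" "\<And>Q. Q \<in> P ` B \<Longrightarrow> L \<subseteq> Q"
      using finite_chain_least[of "P ` B" x] lam'[of B] B A unfolding A_def by blast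
    have "B \<subseteq> {i\<in>I. L \<subseteq> P i \<and> P i \<subseteq> R}" using L(2) B unfolding A_def by auto
    then have "m < card {i\<in>I. L \<subseteq> P i \<and> P i \<subseteq> R}"
      using B(2) fin card_mono[of "{i\<in>I. L \<subseteq> P i \<and> P i \<subseteq> R}" B] by simp
    then show ?thesis unfolding G_def using L B by blast
  qed
  have "finite G" "G \<noteq> {}" using A mem[of A] unfolding G_def by auto
  then obtain L where L: "L \<in> G" "\<forall>Q\<in>G. L \<subseteq> Q \<longrightarrow> L = Q"
    using finite_has_maximal[of G] by blast
  have xL: "x \<in> L" "L \<subseteq> R" "L \<in> P ` I" using L unfolding G_def A_def by auto
  have "card {i\<in>I. L \<subset> P i \<and> P i \<subseteq> R} \<le> m"
  proof (rule ccontr)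
    assume "\<not> ?thesis"
    moreover have "{i\<in>I. L \<subset> P i \<and> P i \<subseteq> R} \<subseteq> A" using xL unfolding A_def by auto
    ultimately have "\<exists>Q\<in>G. Q \<in> P ` {i\<in>I. L \<subset> P i \<and> P i \<subseteq> R}" by (intro mem) auto
    then show False using L by blast
  qed
  then have "L \<in> crossing I P R m" using L xL unfolding crossing_def G_def by blast
  then show ?thesis using xL by blast
qed

lemma Union_crossing:
  assumes "finite I" "laminar (P ` I)" "\<And>i. i \<in> I \<Longrightarrow> P i \<subseteq> X"
  shows "\<Union>(crossing I P R m) = {x\<in>X. m < overlap I P R x}"
proof -
  have sub: "L \<subseteq> X" if "L \<in> crossing I P R m" for L
    using that assms(3) unfolding crossing_def by auto
  show ?thesis
  proof (intro set_eqI iffI)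
    fix x assume "x \<in> \<Union>(crossing I P R m)"
    then obtain L where L: "L \<in> crossing I P R m" "x \<in> L" by blast
    then show "x \<in> {x\<in>X. m < overlap I P R x}"
      using crossing_overlap(1)[OF assms(1,2) L] sub[OF L(1)] by blast
  next
    fix x assume "x \<in> {x\<in>X. m < overlap I P R x}"
    then show "x \<in> \<Union>(crossing I P R m)"
      using crossing_covers[OF assms(1,2), of m R x] by blast
  qed
qed

lemma overlap_sum:
  assumes "finite I"
  shows "of_nat (overlap I P R x) = (\<Sum>i\<in>{i\<in>I. P i \<subseteq> R}. indicator (P i) x :: 'b :: semiring_1)"
proof -
  have "{i\<in>I. x \<in> P i \<and> P i \<subseteq> R} = {i\<in>I. P i \<subseteq> R} \<inter> {i. x \<in> P i}" by auto
  then show ?thesis using assms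
    by (simp add: overlap_def indicator_def sum.If_cases)
qed

lemma overlap_level_sets:
  assumes "finite I" "\<And>i. i \<in> I \<Longrightarrow> P i \<in> sets N"
  shows "{x\<in>space N. m < overlap I P R x} \<in> sets N"
proof -
  have "{x\<in>space N. m < overlap I P R x} =
      {x\<in>space N. real m < (\<Sum>i\<in>{i\<in>I. P i \<subseteq> R}. indicator (P i) x)}"
    by (simp add: overlap_sum[OF assms(1), symmetric])
  also have "\<dots> \<in> sets N"
  proof -
    have [measurable]: "P i \<in> sets N" if "i \<in> {i\<in>I. P i \<subseteq> R}" for i using that assms by auto
    show ?thesis by measurable
  qed
  finally show ?thesis .
qed

text \<open>On a crossing cube \<open>L\<close>, more than \<open>m + n\<close> overlaps counted
  within \<open>R\<close> leave more than \<open>n\<close> counted within \<open>L\<close>. Thus the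
  hypothesis applies to each crossing cube, and these make up the set of overlap greater than
  \<open>m\<close>.\<close>

lemma overlap_level_step:
  assumes fin: "finite I" and lam: "laminar (P ` I)" and s: "\<And>i. i \<in> I \<Longrightarrow> P i \<in> sets N"
    and H: "\<And>i. i \<in> I \<Longrightarrow> c * emeasure N {x\<in>space N. n < overlap I P (P i) x} \<le> emeasure N (P i)"
  shows "c * emeasure N {x\<in>space N. m + n < overlap I P R x} \<le> emeasure N {x\<in>space N. m < overlap I P R x}"
proof -
  define S where "S = {x\<in>space N. m + n < overlap I P R x}"
  have S: "S \<in> sets N" unfolding S_def by (rule overlap_level_sets[OF fin s])
  have U: "\<Union>(crossing I P R m) = {x\<in>space N. m < overlap I P R x}"
    by (rule Union_crossing[OF fin lam]) (use s sets.sets_into_space in blast)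
  have cs: "crossing I P R m \<subseteq> P ` I" unfolding crossing_def by auto
  have Us: "\<Union>(crossing I P R m) \<in> sets N" unfolding U by (rule overlap_level_sets[OF fin s])
  have "(\<integral>\<^sup>+x\<in>\<Union>(crossing I P R m). c * indicator S x \<partial>N) \<le> (\<integral>\<^sup>+x\<in>\<Union>(crossing I P R m). 1 \<partial>N)"
  proof (rule laminar_nn_integral_le)
    fix L assume L: "L \<in> crossing I P R m"
    then obtain i where i: "i \<in> I" "L = P i" using cs by auto
    have "(\<integral>\<^sup>+x\<in>L. c * indicator S x \<partial>N) = c * emeasure N (L \<inter> S)"
      using s[OF i(1)] S i(2) by (simp add: mult.assoc nn_integral_cmult set_nn_integral_indicator Int_commute)
    also have "emeasure N (L \<inter> S) \<le> emeasure N {x\<in>space N. n < overlap I P (P i) x}"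
    proof (rule emeasure_mono)
      show "L \<inter> S \<subseteq> {x\<in>space N. n < overlap I P (P i) x}"
        using crossing_overlap(2)[OF fin lam L] i(2) unfolding S_def by fastforce
    qed (rule overlap_level_sets[OF fin s])
    also have "c * \<dots> \<le> emeasure N (P i)" by (rule H[OF i(1)])
    finally show "(\<integral>\<^sup>+x\<in>L. c * indicator S x \<partial>N) \<le> (\<integral>\<^sup>+x\<in>L. 1 \<partial>N)"
      using s[OF i(1)] i(2) by (simp add: mult_left_mono)
  next
    show "countable (crossing I P R m)" using cs fin by (meson countable_finite countable_subset finite_imageI)
    show "laminar (crossing I P R m)" using cs lam laminar_subset by blast
    show "\<And>L. L \<in> crossing I P R m \<Longrightarrow> L \<in> sets N" using cs s by auto
  qed (use S in auto)
  also have "(\<integral>\<^sup>+x\<in>\<Union>(crossing I P R m). c * indicator S x \<partial>N) = c * emeasure N (\<Union>(crossing I P R m) \<inter> S)"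
    using Us S by (simp add: mult.assoc nn_integral_cmult set_nn_integral_indicator Int_commute)
  also have "\<Union>(crossing I P R m) \<inter> S = S" unfolding U S_def by auto
  finally show ?thesis unfolding S_def U using overlap_level_sets[OF fin s, where m = m and R = R] by (simp add: mult.commute)
qed

text \<open>Each further \<open>m\<close> overlaps halve the measure. \<open>N\<close> is arbitrary
  because the lemma serves twice: for \<mu>, where Markov's inequality provides the first halving,
  and for the weighted measure, where the decay for \<mu> does.\<close>

lemma overlap_exponential_decay:
  assumes fin: "finite I" and lam: "laminar (P ` I)" and s: "\<And>i. i \<in> I \<Longrightarrow> P i \<in> sets N"
    and H: "\<And>i. i \<in> I \<Longrightarrow> 2 * emeasure N {x\<in>space N. m < overlap I P (P i) x} \<le> emeasure N (P i)"
    and i: "i \<in> I"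
  shows "2 ^ j * emeasure N {x\<in>space N. j * m < overlap I P (P i) x} \<le> emeasure N (P i)"
  using i
proof (induction j arbitrary: i)
  case 0
  have "{x\<in>space N. 0 < overlap I P (P i) x} \<subseteq> P i"
    using fin by (auto simp: overlap_def card_gt_0_iff)
  then show ?case using s[OF 0] by (auto intro: emeasure_mono)
next
  case (Suc j)
  have "2 ^ j * emeasure N {x\<in>space N. m + j * m < overlap I P (P i) x} \<le> emeasure N {x\<in>space N. m < overlap I P (P i) x}"
    by (rule overlap_level_step[OF fin lam s Suc.IH])
  then have "2 * (2 ^ j * emeasure N {x\<in>space N. m + j * m < overlap I P (P i) x})
      \<le> 2 * emeasure N {x\<in>space N. m < overlap I P (P i) x}"
    by (rule mult_left_mono) simp
  also have "\<dots> \<le> emeasure N (P i)" by (rule H[OF Suc.prems])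
  finally show ?case by (simp add: mult.assoc)
qed

lemma overlap_exponential_decay_global:
  assumes fin: "finite I" and lam: "laminar (P ` I)" and s: "\<And>i. i \<in> I \<Longrightarrow> P i \<in> sets N"
    and H: "\<And>i. i \<in> I \<Longrightarrow> 2 * emeasure N {x\<in>space N. m < overlap I P (P i) x} \<le> emeasure N (P i)"
  shows "2 ^ j * emeasure N {x\<in>space N. j * m < overlap I P R x} \<le> emeasure N (\<Union>(P ` I))"
proof -
  have "2 ^ j * emeasure N {x\<in>space N. 0 + j * m < overlap I P R x} \<le> emeasure N {x\<in>space N. 0 < overlap I P R x}"
    by (rule overlap_level_step[OF fin lam s overlap_exponential_decay[OF fin lam s H]])
  also have "\<dots> \<le> emeasure N (\<Union>(P ` I))"
    by (rule emeasure_mono) (use fin s in \<open>auto simp: overlap_def card_gt_0_iff intro!: sets.finite_Union\<close>)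
  finally show ?thesis by simp
qed

text \<open>The integral of the overlap function is the packing sum, so this is Chebyshev's
  inequality at height q\<Lambda>.\<close>

lemma overlap_markov:
  assumes fin: "finite I" and s: "\<And>i. i \<in> I \<Longrightarrow> P i \<in> sets N"
    and car: "(\<Sum>i\<in>{i\<in>I. P i \<subseteq> R}. emeasure N (P i)) \<le> of_nat \<Lambda> * emeasure N R" and \<Lambda>: "0 < \<Lambda>"
  shows "of_nat q * emeasure N {x\<in>space N. q * \<Lambda> < overlap I P R x} \<le> emeasure N R"
proof -
  let ?S = "{x\<in>space N. q * \<Lambda> < overlap I P R x}"
  have S: "?S \<in> sets N" by (rule overlap_level_sets[OF fin s])
  have "of_nat (q * \<Lambda>) * emeasure N ?S = (\<integral>\<^sup>+x\<in>?S. of_nat (q * \<Lambda>) \<partial>N)"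
    using S by (simp add: set_nn_integral_const)
  also have "\<dots> \<le> (\<integral>\<^sup>+x\<in>?S. of_nat (overlap I P R x) \<partial>N)"
    by (rule set_nn_integral_mono) (auto simp del: of_nat_mult intro!: of_nat_mono)
  also have "\<dots> \<le> (\<integral>\<^sup>+x. of_nat (overlap I P R x) \<partial>N)" by (rule set_nn_integral_le_space)
  also have "\<dots> = (\<Sum>i\<in>{i\<in>I. P i \<subseteq> R}. emeasure N (P i))"
    unfolding overlap_sum[OF fin] using s by (subst nn_integral_sum) auto
  also note car
  finally have "of_nat \<Lambda> * (of_nat q * emeasure N ?S) \<le> of_nat \<Lambda> * emeasure N R"
    by (simp add: mult_ac)
  then show ?thesis
    using \<Lambda> by (simp add: ennreal_mult_le_mult_iff[of "of_nat \<Lambda>"])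
qed

lemma sum_powers_of_two: "(\<Sum>j=1..m. (2::real) ^ j) \<le> 2 * 2 ^ m"
  by (induction m) auto

text \<open>The inequality 1 + u \<le> exp u for u = n ln 2 / 6, raised to the sixth power. The
  exponent is 2 times 3: from 2^k \<le> (J+1)^2 it yields 8^k \<le> c 2^J, which pays for the loss
  4^k and leaves a summable factor 2^(-k).\<close>

lemma power6_le_exp: "\<exists>c>0::real. \<forall>n::nat. (real n + 1) ^ 6 \<le> c * 2 ^ n"
proof (intro exI[of _ "(6 / ln 2) ^ 6"] conjI allI)
  fix n :: nat
  have "(real n + 1) * (ln 2 / 6) \<le> 1 + real n * ln 2 / 6"
    using ln_2_less_1 by (simp add: field_simps)
  also have "\<dots> \<le> exp (real n * ln 2 / 6)" by (rule exp_ge_add_one_self)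
  finally have "((real n + 1) * (ln 2 / 6)) ^ 6 \<le> exp (real n * ln 2 / 6) ^ 6"
    by (rule power_mono) simp
  also have "\<dots> = 2 ^ n" by (simp add: exp_of_nat_mult[symmetric] exp_of_nat_mult mult.commute)
  finally have "((real n + 1) * (ln 2 / 6)) ^ 6 \<le> 2 ^ n" .
  then show "(real n + 1) ^ 6 \<le> (6 / ln 2) ^ 6 * 2 ^ n"
  proof -
    assume le: "((real n + 1) * (ln 2 / 6)) ^ 6 \<le> 2 ^ n"
    have "(real n + 1) ^ 6 = (6 / ln 2) ^ 6 * ((real n + 1) * (ln 2 / 6)) ^ 6"
    proof -
      have "real n + 1 = (6 / ln 2) * ((real n + 1) * (ln 2 / 6))" by (simp add: field_simps)
      then show ?thesis by (metis power_mult_distrib)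
    qed
    then show ?thesis using mult_left_mono[OF le, of "(6 / ln 2) ^ 6"] by simp
  qed
qed simp

lemma geometric_level:
  assumes "0 < (a::real)" "a \<le> 1"
  obtains n where "(1/4) ^ Suc n < a" "a \<le> (1/4) ^ n"
proof -
  obtain m where m: "(1/4) ^ m < a" using real_arch_pow_inv[of a "1/4"] assms by auto
  define n where "n = (LEAST n. (1/4) ^ Suc n < a)"
  have "(1/4) ^ Suc m < a" using m assms by (simp add: power_Suc) 
  then have n: "(1/4) ^ Suc n < a" unfolding n_def by (rule LeastI)
  have "a \<le> (1/4) ^ n"
  proof (cases n)
    case (Suc k)
    then have "k < n" by simp
    then have "\<not> (1/4) ^ Suc k < a" unfolding n_def by (rule not_less_Least)
    then show ?thesis using Suc by simp
  qed (use assms in simp)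
  then show ?thesis by (rule that[OF n])
qed

lemma sum_half_powers: "(\<Sum>k\<in>{k1..<k2}. (1/2) ^ k) \<le> (2::real)"
proof -
  have "(\<Sum>k\<in>{k1..<k2}. (1/2) ^ k) \<le> (\<Sum>k. (1/2::real) ^ k)"
    by (rule sum_le_suminf) auto
  then show ?thesis by (simp add: suminf_geometric)
qed

lemma overlap_less_imp_mem:
  assumes "n < overlap I P R x"
  shows "x \<in> R"
proof -
  have "{i\<in>I. x \<in> P i \<and> P i \<subseteq> R} \<noteq> {}"
    using assms unfolding overlap_def by (metis card.empty not_less0)
  then show ?thesis by blast
qed

lemma one_le_ennrealI: "1 \<le> x \<Longrightarrow> (1::ennreal) \<le> ennreal x"
  by (metis ennreal_1 ennreal_leI)

section \<open>Weighted estimates for sparse families\<close>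

context cube_family
begin

text \<open>At the levels \<open>2 ^ j\<close> times the mean of \<open>\<phi>\<close>, \<open>j \<le> J\<close>, the integral of the maximal function
  collects at least \<open>\<epsilon> / 2\<close> times the mass of the topmost level set each time; that mass is
  therefore small, and off this set \<open>\<phi>\<close> is bounded.\<close>

lemma maximal_bound_small_sets:
  fixes W :: real and J :: nat
  assumes \<phi>[measurable]: "\<phi> \<in> borel_measurable M" and R: "R \<in> \<Q>"
    and N: "\<And>P x. P \<in> \<Q> \<Longrightarrow> P \<subseteq> R \<Longrightarrow> x \<in> P \<Longrightarrow> (\<integral>\<^sup>+y\<in>P. \<phi> y \<partial>M) \<le> N x * emeasure M P"
    and W: "0 \<le> W" "(\<integral>\<^sup>+x\<in>R. N x \<partial>M) \<le> ennreal W * (\<integral>\<^sup>+x\<in>R. \<phi> x \<partial>M)"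
    and fin: "(\<integral>\<^sup>+x\<in>R. \<phi> x \<partial>M) < \<infinity>" and J: "8 * W / \<epsilon> \<le> real J" "0 < J"
    and E: "E \<in> sets M" "E \<subseteq> R" "2 ^ (J + 2) * emeasure M E \<le> emeasure M R"
  shows "2 * (\<integral>\<^sup>+x\<in>E. \<phi> x \<partial>M) \<le> (\<integral>\<^sup>+x\<in>R. \<phi> x \<partial>M)"
proof -
  define r where "r = measure M R"
  define v where "v = enn2real (\<integral>\<^sup>+x\<in>R. \<phi> x \<partial>M)"
  define t where "t j = 2 ^ j * (v / r)" for j :: nat
  have er: "emeasure M R = ennreal r" unfolding r_def
    using cube_finite[OF R] by (intro emeasure_eq_ennreal_measure) auto
  have ev: "(\<integral>\<^sup>+x\<in>R. \<phi> x \<partial>M) = ennreal v" unfolding v_def using fin by simp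
  have r0: "0 < r" using cube_pos[OF R] er by simp
  have v0: "0 \<le> v" unfolding v_def by simp
  have t0: "0 \<le> t j" for j unfolding t_def using r0 v0 by simp
  have Rt: "(\<integral>\<^sup>+x\<in>R. \<phi> x \<partial>M) \<le> ennreal (t j) * emeasure M R" for j
  proof -
    have "(1::real) \<le> 2 ^ j" by simp
    then have "v \<le> t j * r" unfolding t_def using r0 v0 mult_right_mono[of 1 "2^j" v] by simp
    then show ?thesis unfolding er ev using t0 r0 by (simp add: ennreal_mult[symmetric] ennreal_leI)
  qed
  define \<Omega> where "\<Omega> j = \<Union>(stopping_cubes \<phi> (t j) R)" for j
  have \<Omega>s[measurable]: "\<Omega> j \<in> sets M" for j unfolding \<Omega>_def by (rule Union_stopping_cubes_sets)
  have \<Omega>R: "\<Omega> j \<subseteq> R" for j unfolding \<Omega>_def using stopping_cubesD(2) by blast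
  have tN: "ennreal (t j) \<le> N x" if x: "x \<in> \<Omega> j" for j x
  proof -
    obtain P where P: "P \<in> stopping_cubes \<phi> (t j) R" "x \<in> P" using x unfolding \<Omega>_def by blast
    note sP = stopping_cubesD[OF P(1)]
    have "ennreal (t j) * emeasure M P < N x * emeasure M P"
      using sP(3) N[OF sP(1,2) P(2)] by (rule less_le_trans)
    then show ?thesis by (meson leI mult_right_mono not_le order_less_imp_le zero_le)
  qed
  \<comment> \<open>Every t j with x in \<Omega> j is at most N x. As the t j double, half their sum
    is at most the largest of them.\<close>
  have sumN: "(\<Sum>j=1..J. ennreal (t j / 2) * indicator (\<Omega> j) x) \<le> N x" for x
  proof -
    define A where "A = {j\<in>{1..J}. x \<in> \<Omega> j}"
    have "(\<Sum>j=1..J. ennreal (t j / 2) * indicator (\<Omega> j) x) = (\<Sum>j\<in>A. ennreal (t j / 2))"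
      unfolding A_def by (rule sum.mono_neutral_cong_right) auto
    also have "\<dots> = ennreal (\<Sum>j\<in>A. t j / 2)" using t0 by (intro sum_ennreal) auto
    also have "\<dots> \<le> N x"
    proof (cases "A = {}")
      case False
      have fA: "finite A" unfolding A_def by simp
      have mA: "Max A \<in> A" using fA False by (rule Max_in)
      have "(\<Sum>j\<in>A. t j / 2) \<le> (\<Sum>j=1..Max A. t j / 2)"
        by (rule sum_mono2) (use fA t0 in \<open>auto simp: A_def\<close>)
      also have "\<dots> = (\<Sum>j=1..Max A. 2 ^ j) * (v / r / 2)"
        unfolding t_def sum_distrib_right by (intro sum.cong) auto
      also have "\<dots> \<le> (2 * 2 ^ Max A) * (v / r / 2)"
        by (intro mult_right_mono sum_powers_of_two) (use v0 r0 in auto)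
      also have "\<dots> = t (Max A)" unfolding t_def by simp
      finally have "ennreal (\<Sum>j\<in>A. t j / 2) \<le> ennreal (t (Max A))" by (rule ennreal_leI)
      also have "\<dots> \<le> N x" using mA unfolding A_def by (intro tN) simp
      finally show ?thesis .
    qed simp
    finally show ?thesis .
  qed
  have \<Omega>J: "\<Omega> J \<subseteq> \<Omega> j" if "j \<le> J" for j
  proof -
    have tt: "t j \<le> t J" unfolding t_def using that v0 r0
      by (intro mult_right_mono power_increasing) auto
    have "ennreal (t j) * emeasure M P < (\<integral>\<^sup>+y\<in>P. \<phi> y \<partial>M)"
      if "ennreal (t J) * emeasure M P < (\<integral>\<^sup>+y\<in>P. \<phi> y \<partial>M)" for P
      using that tt by (meson ennreal_leI le_less_trans mult_right_mono zero_le)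
    then show ?thesis unfolding \<Omega>_def Union_stopping_cubes[OF R] by blast
  qed
  \<comment> \<open>\<Omega> j contains \<Omega> J and has stopping cubes with averages at most t j
    / \<epsilon>. So each of the \<open>J\<close> levels contributes at least \<epsilon>/2 times the
    mass of \<Omega> J.\<close>
  have avg: "ennreal (\<epsilon> / 2) * (\<integral>\<^sup>+x\<in>\<Omega> J. \<phi> x \<partial>M) \<le> ennreal (t j / 2) * emeasure M (\<Omega> j)"
    if "j \<le> J" for j
  proof -
    have "(\<integral>\<^sup>+x\<in>\<Omega> J. \<phi> x \<partial>M) \<le> (\<integral>\<^sup>+x\<in>\<Omega> j. \<phi> x \<partial>M)"
      by (rule set_nn_integral_subset[OF \<Omega>J[OF that]])
    also have "\<dots> \<le> (\<integral>\<^sup>+x\<in>\<Omega> j. ennreal (t j / \<epsilon>) \<partial>M)" unfolding \<Omega>_def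
    proof (rule laminar_nn_integral_le)
      fix P assume P: "P \<in> stopping_cubes \<phi> (t j) R"
      show "(\<integral>\<^sup>+x\<in>P. \<phi> x \<partial>M) \<le> (\<integral>\<^sup>+x\<in>P. ennreal (t j / \<epsilon>) \<partial>M)"
        using stopping_cubes_average_le[OF R Rt P t0] cube_sets[OF stopping_cubesD(1)[OF P]]
        by (simp add: set_nn_integral_const)
    next
      show "laminar (stopping_cubes \<phi> (t j) R)" using stopping_cubesD(1) by (intro laminar_subset[OF laminar_cubes]) auto
    qed (use stopping_cubesD(1) cube_sets countable_stopping_cubes in auto)
    also have "\<dots> = ennreal (t j / \<epsilon>) * emeasure M (\<Omega> j)" by (simp add: set_nn_integral_const)
    finally have "ennreal (\<epsilon> / 2) * (\<integral>\<^sup>+x\<in>\<Omega> J. \<phi> x \<partial>M) \<le> ennreal (\<epsilon> / 2) * (ennreal (t j / \<epsilon>) * emeasure M (\<Omega> j))"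
      by (rule mult_left_mono) simp
    also have "\<dots> = ennreal (t j / 2) * emeasure M (\<Omega> j)"
      using eps t0 by (simp add: mult.assoc[symmetric] ennreal_mult[symmetric])
    finally show ?thesis .
  qed
  define u where "u = enn2real (\<integral>\<^sup>+x\<in>\<Omega> J. \<phi> x \<partial>M)"
  have "(\<integral>\<^sup>+x\<in>\<Omega> J. \<phi> x \<partial>M) \<le> ennreal v"
    using set_nn_integral_subset[OF \<Omega>R] ev by metis
  then have eu: "(\<integral>\<^sup>+x\<in>\<Omega> J. \<phi> x \<partial>M) = ennreal u" unfolding u_def
    by (simp add: le_less_trans[of _ "ennreal v"])
  have u0: "0 \<le> u" unfolding u_def by simp
  have "ennreal (real J * (\<epsilon> / 2) * u) = (\<Sum>j=1..J. ennreal (\<epsilon> / 2) * (\<integral>\<^sup>+x\<in>\<Omega> J. \<phi> x \<partial>M))"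
    unfolding eu using eps u0
    by (simp add: ennreal_mult[symmetric] ennreal_of_nat_eq_real_of_nat mult.assoc)
  also have "\<dots> \<le> (\<Sum>j=1..J. ennreal (t j / 2) * emeasure M (\<Omega> j))"
    by (intro sum_mono avg) auto
  also have "\<dots> = (\<Sum>j=1..J. (\<integral>\<^sup>+x. ennreal (t j / 2) * indicator (\<Omega> j) x \<partial>M))"
    by (intro sum.cong refl) (simp add: nn_integral_cmult_indicator)
  also have "\<dots> = (\<integral>\<^sup>+x. (\<Sum>j=1..J. ennreal (t j / 2) * indicator (\<Omega> j) x) \<partial>M)"
    by (rule nn_integral_sum[symmetric]) auto
  also have "\<dots> \<le> (\<integral>\<^sup>+x\<in>R. N x \<partial>M)"
  proof (rule nn_integral_mono)
    fix x
    show "(\<Sum>j=1..J. ennreal (t j / 2) * indicator (\<Omega> j) x) \<le> N x * indicator R x"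
      using sumN[of x] \<Omega>R by (cases "x \<in> R") (auto simp: subset_eq intro!: sum_nonpos)
  qed
  also have "\<dots> \<le> ennreal (W * v)" using W ev v0 by (simp add: ennreal_mult)
  finally have "real J * (\<epsilon> / 2) * u \<le> W * v"
    using W v0 by (subst (asm) ennreal_le_iff) auto
  \<comment> \<open>Here the choice J \<ge> 8W/\<epsilon> enters: \<Omega> J carries at most a
    quarter of the mass.\<close>
  also have "W * v \<le> (real J * \<epsilon> / 8) * v"
    using J eps v0 by (intro mult_right_mono) (auto simp: field_simps)
  finally have "(real J * \<epsilon>) * (u / 2) \<le> (real J * \<epsilon>) * (v / 8)" by (simp add: field_simps)
  then have uv: "u \<le> v / 4" using J(2) eps by (subst (asm) mult_le_cancel_left_pos) auto
  \<comment> \<open>Outside \<Omega> J the function \<phi> is at most t J almost everywhere; the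
    factor 2^(J+2) is such that this part of \<open>E\<close> also carries at most a quarter of the
    mass.\<close>
  define e where "e = measure M E"
  have "emeasure M E \<le> emeasure M R" using E cube_sets[OF R] by (intro emeasure_mono) auto
  then have ee: "emeasure M E = ennreal e" unfolding e_def
    using cube_finite[OF R] by (intro emeasure_eq_ennreal_measure) (auto simp: top_unique)
  have e0: "0 \<le> e" unfolding e_def by simp
  have "ennreal (2 ^ (J + 2) * e) \<le> ennreal r"
    using E(3) unfolding ee er using e0 by (simp add: ennreal_mult ennreal_power[symmetric])
  then have er4: "2 ^ (J + 2) * e \<le> r" using r0 by (subst (asm) ennreal_le_iff) auto
  have "(\<integral>\<^sup>+x\<in>E. \<phi> x \<partial>M) \<le> (\<integral>\<^sup>+x. \<phi> x * indicator (\<Omega> J) x + ennreal (t J) * indicator E x \<partial>M)"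
  proof (rule nn_integral_mono_AE)
    show "AE x in M. \<phi> x * indicator E x \<le> \<phi> x * indicator (\<Omega> J) x + ennreal (t J) * indicator E x"
      using AE_le_outside_stopping_cubes[OF \<phi> R t0[of J]]
    proof (rule AE_mp, intro AE_I2 impI)
      fix x assume "x \<in> R \<longrightarrow> x \<notin> \<Union> (stopping_cubes \<phi> (t J) R) \<longrightarrow> \<phi> x \<le> ennreal (t J)"
      then show "\<phi> x * indicator E x \<le> \<phi> x * indicator (\<Omega> J) x + ennreal (t J) * indicator E x"
        using E(2) unfolding \<Omega>_def[symmetric] by (auto simp: indicator_def)
    qed
  qed
  also have "\<dots> = ennreal u + ennreal (t J) * ennreal e"
    using E(1) by (subst nn_integral_add) (auto simp: eu nn_integral_cmult_indicator ee)
  also have "\<dots> = ennreal (u + t J * e)" using u0 t0 e0 by (simp add: ennreal_mult ennreal_plus)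
  finally have le: "(\<integral>\<^sup>+x\<in>E. \<phi> x \<partial>M) \<le> ennreal (u + t J * e)" .
  have "t J * e * 4 * r = (2 ^ (J + 2) * e) * v" unfolding t_def using r0 by (simp add: field_simps)
  also have "\<dots> \<le> r * v" using er4 v0 by (intro mult_right_mono)
  finally have "t J * e * 4 \<le> v" using r0 by (simp add: mult.commute)
  then have "2 * (u + t J * e) \<le> v" using uv by simp
  then have "ennreal (2 * (u + t J * e)) \<le> ennreal v" by (rule ennreal_leI)
  then have "2 * ennreal (u + t J * e) \<le> ennreal v"
    using u0 t0 e0 by (subst (asm) ennreal_mult) auto
  then show ?thesis unfolding ev using le by (meson mult_left_mono order_trans zero_le)
qed

text \<open>The average of \<phi> over \<open>P\<close> is a constant that lies below
  \<open>N\<close> on \<open>P\<close>, so it may be moved under the integral of \<open>g\<close>.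
  With N = Mw this is the place where w is replaced by Mw.\<close>

lemma average_times_weight_le:
  assumes g[measurable]: "g \<in> borel_measurable M" and \<phi>: "\<phi> \<in> borel_measurable M"
    and N[measurable]: "N \<in> borel_measurable M" and P: "P \<in> \<Q>" and S: "S \<in> sets M" "S \<subseteq> P"
    and le: "\<And>x. x \<in> P \<Longrightarrow> (\<integral>\<^sup>+y\<in>P. \<phi> y \<partial>M) \<le> N x * emeasure M P"
  shows "(\<integral>\<^sup>+x\<in>S. g x \<partial>M) * ((\<integral>\<^sup>+y\<in>P. \<phi> y \<partial>M) / emeasure M P) \<le> (\<integral>\<^sup>+x\<in>S. g x * N x \<partial>M)"
proof -
  let ?c = "(\<integral>\<^sup>+y\<in>P. \<phi> y \<partial>M) / emeasure M P"
  have "(\<integral>\<^sup>+x\<in>S. g x \<partial>M) * ?c = (\<integral>\<^sup>+x\<in>S. g x * ?c \<partial>M)"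
    using S by (subst nn_integral_multc[symmetric]) (auto intro!: nn_integral_cong simp: mult_ac)
  also have "\<dots> \<le> (\<integral>\<^sup>+x\<in>S. g x * N x \<partial>M)"
  proof (rule set_nn_integral_mono)
    fix x assume "x \<in> S"
    then have "?c \<le> N x" using le S cube_pos[OF P] by (intro divide_le_posI_ennreal) (auto simp: mult.commute)
    then show "g x * ?c \<le> g x * N x" by (rule mult_left_mono) simp
  qed
  finally show ?thesis .
qed

lemma weight_eq_average:
  assumes "P \<in> \<Q>"
  shows "c * emeasure M P * ((\<integral>\<^sup>+y\<in>P. \<phi> y \<partial>M) / emeasure M P) = c * (\<integral>\<^sup>+y\<in>P. \<phi> y \<partial>M)"
proof -
  have "emeasure M P * ((\<integral>\<^sup>+y\<in>P. \<phi> y \<partial>M) / emeasure M P) = (\<integral>\<^sup>+y\<in>P. \<phi> y \<partial>M)"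
    using cube_pos[OF assms] cube_finite[OF assms]
    by (simp add: ennreal_times_divide mult.commute[of "emeasure M P"] mult_divide_eq_ennreal)
  then show ?thesis by (simp add: mult.assoc)
qed

text \<open>The averages being comparable, the sets \<open>B i\<close> of large overlap carry at most half of the integral
  of \<open>g\<close> over \<open>P i\<close>, while the sets \<open>P i - B i\<close> overlap at most \<open>8 * \<Lambda>\<close> times.\<close>

lemma sparse_level_sum:
  fixes a :: "'i \<Rightarrow> real"
  assumes g[measurable]: "g \<in> borel_measurable M" and \<phi>: "\<phi> \<in> borel_measurable M"
    and N[measurable]: "N \<in> borel_measurable M"
    and le: "\<And>P x. P \<in> \<Q> \<Longrightarrow> x \<in> P \<Longrightarrow> (\<integral>\<^sup>+y\<in>P. \<phi> y \<partial>M) \<le> N x * emeasure M P"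
    and fin: "finite I" and P: "\<And>i. i \<in> I \<Longrightarrow> P i \<in> \<Q>"
    and car: "\<And>i. i \<in> I \<Longrightarrow> (\<Sum>k\<in>{k\<in>I. P k \<subseteq> P i}. emeasure M (P k)) \<le> of_nat \<Lambda> * emeasure M (P i)"
    and \<Lambda>: "0 < \<Lambda>" and avg: "\<And>i. i \<in> I \<Longrightarrow> (\<integral>\<^sup>+x\<in>P i. g x \<partial>M) = ennreal (a i) * emeasure M (P i)"
    and t: "0 \<le> t" "\<And>i. i \<in> I \<Longrightarrow> a i \<le> t" "\<And>i. i \<in> I \<Longrightarrow> t \<le> 4 * a i"
  shows "(\<Sum>i\<in>I. ennreal (a i) * (\<integral>\<^sup>+x\<in>P i. \<phi> x \<partial>M)) \<le> of_nat (16 * \<Lambda>) * (\<integral>\<^sup>+x. g x * N x \<partial>M)"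
proof -
  have lam: "laminar (P ` I)" by (rule laminar_subset[OF laminar_cubes]) (use P in auto)
  have Ps: "P i \<in> sets M" if "i \<in> I" for i using cube_sets P that by blast
  define B where "B i = {x\<in>space M. 8 * \<Lambda> < overlap I P (P i) x}" for i
  have Bs[measurable]: "B i \<in> sets M" for i
    unfolding B_def by (rule overlap_level_sets[OF fin Ps])
  have BP: "B i \<subseteq> P i" for i
    unfolding B_def by (auto dest: overlap_less_imp_mem)
  \<comment> \<open>The 8 is 4 times 2: a factor 4 is lost because t is only bounded by 4 a i, and a
    half has to remain.\<close>
  have Bm: "8 * emeasure M (B i) \<le> emeasure M (P i)" if "i \<in> I" for i
    using overlap_markov[OF fin Ps car[OF that] \<Lambda>, of 8] by (simp add: B_def)
  have UB: "\<Union>(crossing I P (P i) (8 * \<Lambda>)) = B i" for i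
    unfolding B_def by (rule Union_crossing[OF fin lam]) (use Ps sets.sets_into_space in blast)
  \<comment> \<open>The crossing cubes, whose union is B i, are members of the family, so the
    average of \<open>g\<close> over each is at most \<open>t\<close>.\<close>
  have Bg: "(\<integral>\<^sup>+x\<in>B i. g x \<partial>M) \<le> ennreal t * emeasure M (B i)" for i
  proof -
    have cs: "crossing I P (P i) (8 * \<Lambda>) \<subseteq> P ` I" unfolding crossing_def by auto
    have "(\<integral>\<^sup>+x\<in>\<Union>(crossing I P (P i) (8 * \<Lambda>)). g x \<partial>M) \<le> (\<integral>\<^sup>+x\<in>\<Union>(crossing I P (P i) (8 * \<Lambda>)). ennreal t \<partial>M)"
    proof (rule laminar_nn_integral_le)
      fix L assume "L \<in> crossing I P (P i) (8 * \<Lambda>)"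
      then obtain k where k: "k \<in> I" "L = P k" using cs by auto
      have "ennreal (a k) * emeasure M (P k) \<le> ennreal t * emeasure M (P k)"
        by (intro mult_right_mono ennreal_leI t k) auto
      then show "(\<integral>\<^sup>+x\<in>L. g x \<partial>M) \<le> (\<integral>\<^sup>+x\<in>L. ennreal t \<partial>M)"
        using avg[OF k(1)] Ps[OF k(1)] k(2) by (simp add: set_nn_integral_const)
    next
      show "countable (crossing I P (P i) (8 * \<Lambda>))"
        using cs fin by (meson countable_finite countable_subset finite_imageI)
      show "laminar (crossing I P (P i) (8 * \<Lambda>))" using cs lam laminar_subset by blast
      show "\<And>L. L \<in> crossing I P (P i) (8 * \<Lambda>) \<Longrightarrow> L \<in> sets M" using cs Ps by auto
    qed auto
    then show ?thesis unfolding UB by (simp add: set_nn_integral_const)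
  qed
  have half: "(\<integral>\<^sup>+x\<in>P i. g x \<partial>M) \<le> 2 * (\<integral>\<^sup>+x\<in>P i - B i. g x \<partial>M)" if i: "i \<in> I" for i
  proof -
    let ?b = "\<integral>\<^sup>+x\<in>B i. g x \<partial>M" and ?c = "\<integral>\<^sup>+x\<in>P i - B i. g x \<partial>M" and ?p = "\<integral>\<^sup>+x\<in>P i. g x \<partial>M"
    have split: "?p = ?b + ?c"
    proof -
      have "?p = (\<integral>\<^sup>+x. g x * indicator (B i) x + g x * indicator (P i - B i) x \<partial>M)"
        using BP[of i] by (intro nn_integral_cong) (auto simp: indicator_def)
      also have "\<dots> = ?b + ?c" using Ps[OF i] by (intro nn_integral_add) auto
      finally show ?thesis .
    qed
    have pf: "?p < \<infinity>" unfolding avg[OF i] using cube_finite[OF P[OF i]]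
      by (auto simp: ennreal_mult_less_top)
    have "8 * ?b \<le> ennreal t * (8 * emeasure M (B i))"
      using mult_left_mono[OF Bg[of i], of 8] by (simp add: mult_ac)
    also have "\<dots> \<le> ennreal t * emeasure M (P i)" by (intro mult_left_mono Bm i) auto
    also have "\<dots> \<le> ennreal (4 * a i) * emeasure M (P i)"
      by (intro mult_right_mono ennreal_leI t i) auto
    also have "\<dots> = 4 * ?p" unfolding avg[OF i] using t(1) t(3)[OF i]
      by (subst ennreal_mult) (auto simp: mult_ac)
    finally have "4 * (2 * ?b) \<le> 4 * ?p" by (simp add: mult.assoc[symmetric])
    then have "2 * ?b \<le> ?p" by (subst (asm) ennreal_mult_le_mult_iff) auto
    then have "2 * ?b \<le> ?b + ?c" unfolding split .
    then have "?b \<le> ?c"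
    proof -
      have bf: "?b < \<infinity>" using pf split by (simp add: less_top)
      have "?b + ?b \<le> ?b + ?c" using \<open>2 * ?b \<le> ?b + ?c\<close> by (simp add: mult_2)
      then show ?thesis using bf by (auto simp: ennreal_add_left_cancel_le)
    qed
    then show ?thesis unfolding split mult_2 by (rule add_right_mono)
  qed
  \<comment> \<open>Among the P i with x in P i - B i there is a largest one, P k. It contains the
    others, so they all enter the overlap at x within P k, which is at most 8\<Lambda> because x
    lies outside B k.\<close>
  have count: "(\<Sum>i\<in>I. indicator (P i - B i) x) \<le> (of_nat (8 * \<Lambda>) :: ennreal)" if x: "x \<in> space M" for x
  proof -
    define J where "J = {i\<in>I. x \<in> P i - B i}"
    have J: "finite J" "J \<subseteq> I" using fin unfolding J_def by auto
    have "(\<Sum>i\<in>I. indicator (P i - B i) x :: ennreal) = of_nat (card J)"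
    proof -
      have "(\<Sum>i\<in>I. indicator (P i - B i) x :: ennreal) = (\<Sum>i\<in>J. 1)"
        unfolding J_def using fin by (intro sum.mono_neutral_cong_right) auto
      then show ?thesis by simp
    qed
    also have "card J \<le> 8 * \<Lambda>"
    proof (cases "J = {}")
      case False
      obtain L where L: "L \<in> P ` J" "\<And>Q. Q \<in> P ` J \<Longrightarrow> Q \<subseteq> L"
        using finite_chain_greatest[of "P ` J" x] J False laminar_subset[OF lam image_mono[OF J(2)]]
        unfolding J_def by blast
      then obtain k where k: "k \<in> J" "L = P k" by blast
      have "card J \<le> overlap I P (P k) x"
        unfolding overlap_def using L k fin by (intro card_mono) (auto simp: J_def)
      also have "\<dots> \<le> 8 * \<Lambda>" using k x unfolding J_def B_def by (auto simp: not_less)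
      finally show ?thesis .
    qed simp
    finally show ?thesis by (simp del: of_nat_mult)
  qed
  have "(\<Sum>i\<in>I. ennreal (a i) * (\<integral>\<^sup>+x\<in>P i. \<phi> x \<partial>M))
      \<le> (\<Sum>i\<in>I. 2 * (\<integral>\<^sup>+x\<in>P i - B i. g x * N x \<partial>M))"
  proof (rule sum_mono)
    fix i assume i: "i \<in> I"
    let ?c = "(\<integral>\<^sup>+y\<in>P i. \<phi> y \<partial>M) / emeasure M (P i)"
    have "ennreal (a i) * (\<integral>\<^sup>+x\<in>P i. \<phi> x \<partial>M) = (\<integral>\<^sup>+x\<in>P i. g x \<partial>M) * ?c"
      unfolding avg[OF i] by (rule weight_eq_average[OF P[OF i], symmetric])
    also have "\<dots> \<le> (2 * (\<integral>\<^sup>+x\<in>P i - B i. g x \<partial>M)) * ?c"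
      by (rule mult_right_mono[OF half[OF i]]) simp
    also have "\<dots> \<le> 2 * (\<integral>\<^sup>+x\<in>P i - B i. g x * N x \<partial>M)"
      unfolding mult.assoc[of 2] using Ps[OF i]
      by (intro mult_left_mono average_times_weight_le[OF g \<phi> N P[OF i]] le P i) auto
    finally show "ennreal (a i) * (\<integral>\<^sup>+x\<in>P i. \<phi> x \<partial>M) \<le> 2 * (\<integral>\<^sup>+x\<in>P i - B i. g x * N x \<partial>M)" .
  qed
  also have "\<dots> = 2 * (\<integral>\<^sup>+x. (\<Sum>i\<in>I. g x * N x * indicator (P i - B i) x) \<partial>M)"
    using Ps by (subst nn_integral_sum) (auto simp: sum_distrib_left)
  also have "\<dots> \<le> 2 * (\<integral>\<^sup>+x. of_nat (8 * \<Lambda>) * (g x * N x) \<partial>M)"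
  proof (intro mult_left_mono nn_integral_mono)
    fix x assume x: "x \<in> space M"
    have "(\<Sum>i\<in>I. g x * N x * indicator (P i - B i) x) = g x * N x * (\<Sum>i\<in>I. indicator (P i - B i) x)"
      by (simp add: sum_distrib_left)
    also have "\<dots> \<le> g x * N x * of_nat (8 * \<Lambda>)" by (intro mult_left_mono count x) simp
    finally show "(\<Sum>i\<in>I. g x * N x * indicator (P i - B i) x) \<le> of_nat (8 * \<Lambda>) * (g x * N x)"
      by (simp add: mult_ac)
  qed simp
  also have "\<dots> = of_nat (16 * \<Lambda>) * (\<integral>\<^sup>+x. g x * N x \<partial>M)"
    by (subst nn_integral_cmult) (auto simp: mult.assoc[symmetric])
  finally show ?thesis .
qed

lemma average_weight_le:
  assumes g: "g \<in> borel_measurable M" and \<phi>: "\<phi> \<in> borel_measurable M"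
    and N: "N \<in> borel_measurable M" and P: "P \<in> \<Q>"
    and le: "\<And>x. x \<in> P \<Longrightarrow> (\<integral>\<^sup>+y\<in>P. \<phi> y \<partial>M) \<le> N x * emeasure M P"
    and avg: "(\<integral>\<^sup>+x\<in>P. g x \<partial>M) = c * emeasure M P"
  shows "c * (\<integral>\<^sup>+x\<in>P. \<phi> x \<partial>M) \<le> (\<integral>\<^sup>+x\<in>P. g x * N x \<partial>M)"
  using average_times_weight_le[OF g \<phi> N P cube_sets[OF P] order_refl le]
  unfolding avg weight_eq_average[OF P] by simp

text \<open>The height 1 is shared out: off the cubes with a i > 1, either the levels below
  \<open>k1\<close> contribute more than 1/2, or some level k \<ge> k1 contributes more than
  2^(-k)/4, since these quantities add up to at most 1/2. The three cases give the terms 1, 32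
  \<Lambda> k1 and 8c.\<close>

lemma sparse_weak_type:
  fixes a :: "'i \<Rightarrow> real"
  assumes g[measurable]: "g \<in> borel_measurable M" and \<phi>[measurable]: "\<phi> \<in> borel_measurable M"
    and N[measurable]: "N \<in> borel_measurable M"
    and le: "\<And>P x. P \<in> \<Q> \<Longrightarrow> x \<in> P \<Longrightarrow> (\<integral>\<^sup>+y\<in>P. \<phi> y \<partial>M) \<le> N x * emeasure M P"
    and fin: "finite I" and P: "\<And>i. i \<in> I \<Longrightarrow> P i \<in> \<Q>"
    and car: "\<And>i. i \<in> I \<Longrightarrow> (\<Sum>k\<in>{k\<in>I. P k \<subseteq> P i}. emeasure M (P k)) \<le> of_nat \<Lambda> * emeasure M (P i)"
    and \<Lambda>: "0 < \<Lambda>" and avg: "\<And>i. i \<in> I \<Longrightarrow> (\<integral>\<^sup>+x\<in>P i. g x \<partial>M) = ennreal (a i) * emeasure M (P i)"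
    and a0: "\<And>i. i \<in> I \<Longrightarrow> 0 \<le> a i"
    and small: "\<And>i E. i \<in> I \<Longrightarrow> E \<in> sets M \<Longrightarrow> E \<subseteq> P i \<Longrightarrow> 2 ^ j0 * emeasure M E \<le> emeasure M (P i) \<Longrightarrow>
      2 * (\<integral>\<^sup>+x\<in>E. \<phi> x \<partial>M) \<le> (\<integral>\<^sup>+x\<in>P i. \<phi> x \<partial>M)"
    and j0: "0 < j0" and k1: "(4 * (j0 * (2 * \<Lambda>)))\<^sup>2 \<le> (2::nat) ^ k1"
    and c: "0 < c" "\<And>n::nat. (real n + 1) ^ 6 \<le> c * 2 ^ n"
  shows "(\<integral>\<^sup>+x\<in>{x\<in>space M. 1 < (\<Sum>i\<in>I. a i * indicator (P i) x)}. \<phi> x \<partial>M)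
    \<le> ennreal (1 + 32 * real \<Lambda> * real k1 + 8 * c) * (\<integral>\<^sup>+x. g x * N x \<partial>M)"
proof -
  \<comment> \<open>By Markov, 2\<Lambda> overlaps halve the \<mu>-measure; after \<open>j0\<close>
    such halvings the relative measure is 2^(-j0), where \<open>small\<close> halves the integral of
    \<phi>.\<close>
  define L where "L = j0 * (2 * \<Lambda>)"
  define \<nu> where "\<nu> = density M \<phi>"
  define G where "G = (\<integral>\<^sup>+x. g x * N x \<partial>M)"
  \<comment> \<open>Rounded down, so that at most J k * L overlaps of cubes with averages at most
    4^(-k) contribute at most 2^(-k)/4.\<close>
  define J where "J k = 2 ^ k div (4 * L)" for k :: nat
  define lev where "lev i = (SOME n. (1/4) ^ Suc n < a i \<and> a i \<le> (1/4) ^ n)" for i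
  define II where "II k = {i\<in>I. 0 < a i \<and> a i \<le> 1 \<and> lev i = k}" for k
  define T3 where "T3 k = {x\<in>space M. J k * L < overlap (II k) P (space M) x}" for k
  define Tlow where "Tlow = {x\<in>space M. 1/2 < (\<Sum>k<k1. \<Sum>i\<in>II k. a i * indicator (P i) x)}"
  define T1 where "T1 = \<Union>(P ` {i\<in>I. 1 < a i})"
  define S where "S = {x\<in>space M. 1 < (\<Sum>i\<in>I. a i * indicator (P i) x)}"
  have L0: "0 < L" using j0 \<Lambda> unfolding L_def by simp
  have lev: "(1/4) ^ Suc (lev i) < a i \<and> a i \<le> (1/4) ^ lev i" if "0 < a i" "a i \<le> 1" for i
    unfolding lev_def by (rule someI_ex) (use geometric_level[OF that] in metis)
  have lev4: "(1/4) ^ lev i \<le> 4 * a i" if "0 < a i" "a i \<le> 1" for i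
    using lev[OF that] by simp
  have lam: "laminar (P ` B)" if "B \<subseteq> I" for B by (rule laminar_subset[OF laminar_cubes]) (use P that in auto)
  have Ps[measurable]: "P i \<in> sets M" if "i \<in> I" for i using cube_sets P that by blast
  have s\<nu>: "sets \<nu> = sets M" "space \<nu> = space M" unfolding \<nu>_def by auto
  have e\<nu>: "emeasure \<nu> A = (\<integral>\<^sup>+x\<in>A. \<phi> x \<partial>M)" if "A \<in> sets M" for A
    unfolding \<nu>_def using that by (simp add: emeasure_density)
  have II: "II k \<subseteq> I" "finite (II k)" for k using fin unfolding II_def by auto
  have PI[measurable]: "P i \<in> sets M" if "i \<in> II k" for i k using that II Ps by blast
  have car': "(\<Sum>l\<in>{l\<in>II k. P l \<subseteq> P i}. emeasure M (P l)) \<le> of_nat \<Lambda> * emeasure M (P i)" if "i \<in> II k" for i k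
  proof -
    have "(\<Sum>l\<in>{l\<in>II k. P l \<subseteq> P i}. emeasure M (P l)) \<le> (\<Sum>l\<in>{l\<in>I. P l \<subseteq> P i}. emeasure M (P l))"
      by (rule sum_mono2) (use fin II in auto)
    also have "\<dots> \<le> of_nat \<Lambda> * emeasure M (P i)" using that II by (intro car) auto
    finally show ?thesis .
  qed
  have T3s[measurable]: "T3 k \<in> sets M" for k
    unfolding T3_def by (rule overlap_level_sets) (use II PI in auto)
  have Tlow_s[measurable]: "Tlow \<in> sets M"
  proof -
    have [measurable]: "P i \<in> sets M" if "i \<in> II k" for i k using that II Ps by blast
    show ?thesis unfolding Tlow_def by measurable
  qed
  have T1s[measurable]: "T1 \<in> sets M" unfolding T1_def using fin Ps by (intro sets.finite_Union) auto
  have Ss[measurable]: "S \<in> sets M" unfolding S_def by measurable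
  have one: "ennreal (a i) * (\<integral>\<^sup>+x\<in>P i. \<phi> x \<partial>M) \<le> (\<integral>\<^sup>+x\<in>P i. g x * N x \<partial>M)" if "i \<in> I" for i
    by (rule average_weight_le[OF g \<phi> N P[OF that] le[OF P[OF that]] avg[OF that]])
  have level: "(\<Sum>i\<in>II k. ennreal (a i) * (\<integral>\<^sup>+x\<in>P i. \<phi> x \<partial>M)) \<le> of_nat (16 * \<Lambda>) * G" for k
    unfolding G_def
    by (rule sparse_level_sum[OF g \<phi> N le II(2) _ car' \<Lambda>, where t = "(1/4) ^ k"])
      (use II P avg lev lev4 in \<open>auto simp: II_def\<close>)
  \<comment> \<open>Two stages: exponential decay for \<mu> reaches relative measure 2^(-j0) after
    \<open>L\<close> overlaps, \<open>small\<close> turns this into one halving for \<nu>, and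
    iterating gives exponential decay for \<nu>.\<close>
  have decay: "2 ^ j * emeasure \<nu> {x\<in>space \<nu>. j * L < overlap (II k) P (space M) x} \<le> emeasure \<nu> (\<Union>(P ` II k))" for j k
  proof (rule overlap_exponential_decay_global[OF II(2) lam[OF II(1)]])
    fix i assume i: "i \<in> II k"
    then have iI: "i \<in> I" using II by blast
    let ?E = "{x\<in>space M. L < overlap (II k) P (P i) x}"
    have Es: "?E \<in> sets M" by (rule overlap_level_sets) (use II PI in auto)
    have "2 ^ j0 * emeasure M {x\<in>space M. j0 * (2 * \<Lambda>) < overlap (II k) P (P i) x} \<le> emeasure M (P i)"
    proof (rule overlap_exponential_decay[OF II(2) lam[OF II(1)] _ _ i])
      show "2 * emeasure M {x\<in>space M. 2 * \<Lambda> < overlap (II k) P (P l) x} \<le> emeasure M (P l)" if "l \<in> II k" for l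
        using overlap_markov[OF II(2) _ car'[OF that] \<Lambda>, of 2] PI by auto
    qed (use II PI in auto)
    then have "2 * (\<integral>\<^sup>+x\<in>?E. \<phi> x \<partial>M) \<le> (\<integral>\<^sup>+x\<in>P i. \<phi> x \<partial>M)"
      unfolding L_def[symmetric] by (intro small[OF iI Es]) (auto dest: overlap_less_imp_mem)
    then show "2 * emeasure \<nu> {x\<in>space \<nu>. L < overlap (II k) P (P i) x} \<le> emeasure \<nu> (P i)"
      using e\<nu>[OF Es] e\<nu>[OF Ps[OF iI]] s\<nu> by simp
  qed (use PI s\<nu> in auto)
  \<comment> \<open>On level k one has 1 < 4^(k+1) a i, so inserting the averages of
    \<open>g\<close> costs this factor.\<close>
  have U: "emeasure \<nu> (\<Union>(P ` II k)) \<le> ennreal (4 ^ Suc k) * G" for k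
  proof -
    have Us: "\<Union>(P ` II k) \<in> sets M" using II PI by (intro sets.finite_Union) auto
    have "(\<integral>\<^sup>+x\<in>\<Union>(P ` II k). \<phi> x \<partial>M) \<le> (\<integral>\<^sup>+x\<in>\<Union>(P ` II k). ennreal (4 ^ Suc k) * (g x * N x) \<partial>M)"
    proof (rule laminar_nn_integral_le)
      fix Q assume "Q \<in> P ` II k"
      then obtain i where i: "i \<in> II k" "Q = P i" by auto
      then have iI: "i \<in> I" using II by blast
      have "(1/4) ^ Suc k < a i" using i lev[of i] unfolding II_def by auto
      then have "1 \<le> 4 ^ Suc k * a i" by (simp add: power_divide field_simps)
      then have "1 * (\<integral>\<^sup>+x\<in>P i. \<phi> x \<partial>M) \<le> ennreal (4 ^ Suc k * a i) * (\<integral>\<^sup>+x\<in>P i. \<phi> x \<partial>M)"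
        by (intro mult_right_mono) (auto intro!: one_le_ennrealI)
      also have "\<dots> = ennreal (4 ^ Suc k) * (ennreal (a i) * (\<integral>\<^sup>+x\<in>P i. \<phi> x \<partial>M))"
        using a0[OF iI] by (simp add: ennreal_mult mult.assoc)
      also have "\<dots> \<le> ennreal (4 ^ Suc k) * (\<integral>\<^sup>+x\<in>P i. g x * N x \<partial>M)"
        by (intro mult_left_mono one iI) simp
      also have "\<dots> = (\<integral>\<^sup>+x\<in>P i. ennreal (4 ^ Suc k) * (g x * N x) \<partial>M)"
        using Ps[OF iI] by (subst nn_integral_cmult[symmetric]) (auto simp: mult.assoc)
      finally show "(\<integral>\<^sup>+x\<in>Q. \<phi> x \<partial>M) \<le> (\<integral>\<^sup>+x\<in>Q. ennreal (4 ^ Suc k) * (g x * N x) \<partial>M)"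
        unfolding i(2) by simp
    qed (use II PI lam in \<open>auto intro: countable_finite\<close>)
    also have "\<dots> \<le> (\<integral>\<^sup>+x. ennreal (4 ^ Suc k) * (g x * N x) \<partial>M)" by (rule set_nn_integral_le_space)
    also have "\<dots> = ennreal (4 ^ Suc k) * G" unfolding G_def by (rule nn_integral_cmult) measurable
    finally show ?thesis using e\<nu>[OF Us] by simp
  qed
  \<comment> \<open>From k1 on, (4L)^2 \<le> 2^k, hence (J k + 1)^2 \<ge> 2^k. So 2^(J k) dominates
    a multiple of 8^k, and the factor 4^(k+1) from \<open>U\<close> is absorbed.\<close>
  have T3: "emeasure \<nu> (T3 k) \<le> ennreal (4 * c * (1/2) ^ k) * G" if k: "k1 \<le> k" for k
  proof -
    have "2 ^ k < (J k + 1) * (4 * L)"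
      unfolding J_def using L0 by (metis Suc_eq_plus1 dividend_less_div_times mult.commute mult_Suc_right mult_is_0 not_gr_zero add.commute zero_neq_numeral)
    then have "((2::nat) ^ k)\<^sup>2 \<le> ((J k + 1) * (4 * L))\<^sup>2" by (intro power_mono) auto
    also have "\<dots> = (J k + 1)\<^sup>2 * (4 * L)\<^sup>2" by (rule power_mult_distrib)
    also have "\<dots> \<le> (J k + 1)\<^sup>2 * 2 ^ k"
      by (intro mult_left_mono order_trans[OF k1[folded L_def] power_increasing[OF k]]) auto
    finally have "2 ^ k * 2 ^ k \<le> (J k + 1)\<^sup>2 * 2 ^ k" unfolding power2_eq_square[of "2 ^ k"] .
    then have "2 ^ k \<le> (J k + 1)\<^sup>2" by (rule mult_right_le_imp_le) simp
    then have "real (2 ^ k) \<le> real ((J k + 1)\<^sup>2)" by (rule of_nat_mono)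
    then have "(2 ^ k) ^ 3 \<le> ((real (J k) + 1)\<^sup>2) ^ 3" by (intro power_mono) (auto simp: add.commute)
    also have "\<dots> = (real (J k) + 1) ^ 6" by (simp add: power_mult[symmetric])
    also have "\<dots> \<le> c * 2 ^ J k" by (rule c)
    finally have e8: "(2 ^ k) ^ 3 \<le> c * 2 ^ J k" .
    have "4 ^ Suc k / 2 ^ J k \<le> 4 * c * (1/2::real) ^ k"
    proof -
      have "(4::real) ^ Suc k * 2 ^ k = 4 * (2 ^ k) ^ 3"
        by (simp add: power3_eq_cube mult.assoc flip: power_mult_distrib)
      also have "\<dots> \<le> 4 * (c * 2 ^ J k)" using e8 by simp
      finally show ?thesis by (simp add: field_simps power_divide)
    qed
    then have le4: "ennreal (4 ^ Suc k / 2 ^ J k) \<le> ennreal (4 * c * (1/2) ^ k)" by (rule ennreal_leI)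
    have "ennreal (1 / 2 ^ J k) * 2 ^ J k = 1"
      using ennreal_power[of 2 "J k"] ennreal_mult[of "1 / 2 ^ J k" "2 ^ J k"] by simp
    then have "emeasure \<nu> (T3 k) = ennreal (1 / 2 ^ J k) * (2 ^ J k * emeasure \<nu> (T3 k))"
      by (simp add: mult.assoc[symmetric])
    also have "\<dots> \<le> ennreal (1 / 2 ^ J k) * (ennreal (4 ^ Suc k) * G)"
      using order_trans[OF decay[of "J k" k] U] unfolding T3_def s\<nu> by (intro mult_left_mono) auto
    also have "\<dots> = ennreal (4 ^ Suc k / 2 ^ J k) * G"
      by (simp add: mult.assoc[symmetric] ennreal_mult[symmetric])
    also have "\<dots> \<le> ennreal (4 * c * (1/2) ^ k) * G" by (intro mult_right_mono le4) simp
    finally show ?thesis .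
  qed
  have T1: "emeasure \<nu> T1 \<le> G"
  proof -
    have "(\<integral>\<^sup>+x\<in>\<Union>(P ` {i\<in>I. 1 < a i}). \<phi> x \<partial>M) \<le> (\<integral>\<^sup>+x\<in>\<Union>(P ` {i\<in>I. 1 < a i}). g x * N x \<partial>M)"
    proof (rule laminar_nn_integral_le)
      fix Q assume "Q \<in> P ` {i\<in>I. 1 < a i}"
      then obtain i where i: "i \<in> I" "1 < a i" "Q = P i" by auto
      have "1 * (\<integral>\<^sup>+x\<in>P i. \<phi> x \<partial>M) \<le> ennreal (a i) * (\<integral>\<^sup>+x\<in>P i. \<phi> x \<partial>M)"
        using i by (intro mult_right_mono) (auto intro!: one_le_ennrealI)
      also have "\<dots> \<le> (\<integral>\<^sup>+x\<in>P i. g x * N x \<partial>M)" by (rule one[OF i(1)])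
      finally show "(\<integral>\<^sup>+x\<in>Q. \<phi> x \<partial>M) \<le> (\<integral>\<^sup>+x\<in>Q. g x * N x \<partial>M)" using i by simp
    qed (use fin Ps lam in \<open>auto intro: countable_finite\<close>)
    also have "\<dots> \<le> G" unfolding G_def by (rule set_nn_integral_le_space)
    finally show ?thesis unfolding e\<nu>[OF T1s] unfolding T1_def .
  qed
  have Tlow: "emeasure \<nu> Tlow \<le> ennreal (32 * real \<Lambda> * real k1) * G"
  proof -
    have "emeasure \<nu> Tlow = (\<integral>\<^sup>+x\<in>Tlow. \<phi> x \<partial>M)" by (rule e\<nu>) simp
    also have "\<dots> \<le> (\<integral>\<^sup>+x. 2 * (\<Sum>k<k1. \<Sum>i\<in>II k. ennreal (a i) * (\<phi> x * indicator (P i) x)) \<partial>M)"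
    proof (rule nn_integral_mono)
      fix x assume "x \<in> space M"
      show "\<phi> x * indicator Tlow x \<le> 2 * (\<Sum>k<k1. \<Sum>i\<in>II k. ennreal (a i) * (\<phi> x * indicator (P i) x))"
      proof (cases "x \<in> Tlow")
        case True
        have e: "ennreal (\<Sum>k<k1. \<Sum>i\<in>II k. a i * indicator (P i) x) = (\<Sum>k<k1. \<Sum>i\<in>II k. ennreal (a i) * indicator (P i) x)"
        proof -
          have nn: "0 \<le> a i * indicator (P i) x" if "i \<in> II k" for i k
            using that unfolding II_def by (simp add: indicator_def)
          have "(\<Sum>k<k1. \<Sum>i\<in>II k. ennreal (a i) * indicator (P i) x)
              = (\<Sum>k<k1. \<Sum>i\<in>II k. ennreal (a i * indicator (P i) x))"
            by (intro sum.cong refl) (auto simp: indicator_def)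
          also have "\<dots> = (\<Sum>k<k1. ennreal (\<Sum>i\<in>II k. a i * indicator (P i) x))"
            by (intro sum.cong refl sum_ennreal nn)
          also have "\<dots> = ennreal (\<Sum>k<k1. \<Sum>i\<in>II k. a i * indicator (P i) x)"
            by (intro sum_ennreal sum_nonneg nn)
          finally show ?thesis by simp
        qed
        have "1 \<le> ennreal (2 * (\<Sum>k<k1. \<Sum>i\<in>II k. a i * indicator (P i) x))"
          using True unfolding Tlow_def by (auto intro!: one_le_ennrealI)
        also have "\<dots> = 2 * (\<Sum>k<k1. \<Sum>i\<in>II k. ennreal (a i) * indicator (P i) x)"
          unfolding e[symmetric] using a0 II by (subst ennreal_mult) (auto intro!: sum_nonneg)
        finally have "\<phi> x * 1 \<le> \<phi> x * (2 * (\<Sum>k<k1. \<Sum>i\<in>II k. ennreal (a i) * indicator (P i) x))"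
          by (rule mult_left_mono) simp
        then show ?thesis using True by (simp add: sum_distrib_left mult_ac)
      qed simp
    qed
    also have "\<dots> = 2 * (\<Sum>k<k1. \<Sum>i\<in>II k. ennreal (a i) * (\<integral>\<^sup>+x\<in>P i. \<phi> x \<partial>M))"
    proof -
      have [measurable]: "P i \<in> sets M" if "i \<in> II k" for i k using that II Ps by blast
      show ?thesis
        by (subst nn_integral_cmult, measurable)
          (simp add: nn_integral_sum nn_integral_cmult cong: sum.cong)
    qed
    also have "\<dots> \<le> 2 * (\<Sum>k<k1. of_nat (16 * \<Lambda>) * G)" by (intro mult_left_mono sum_mono level) simp
    also have "\<dots> = ennreal (32 * real \<Lambda> * real k1) * G"
      by (simp add: ennreal_mult ennreal_of_nat_eq_real_of_nat[symmetric] mult_ac)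
    finally show ?thesis .
  qed
  define K where "K = Suc (\<Sum>i\<in>I. lev i)"
  have levK: "lev i < K" if "i \<in> I" for i
    unfolding K_def using member_le_sum[of i I lev] that fin by simp
  have cover: "S \<subseteq> T1 \<union> Tlow \<union> (\<Union>k\<in>{k1..<K}. T3 k)"
  proof (rule subsetI, rule ccontr)
    fix x assume x: "x \<in> S" and nx: "x \<notin> T1 \<union> Tlow \<union> (\<Union>k\<in>{k1..<K}. T3 k)"
    have xs: "x \<in> space M" using x unfolding S_def by simp
    let ?f = "\<lambda>i. a i * indicator (P i) x"
    have high: "(\<Sum>i\<in>II k. ?f i) \<le> (1/2) ^ k / 4" if "k \<in> {k1..<K}" for k
    proof -
      have "x \<notin> T3 k" using nx that by blast
      then have n: "overlap (II k) P (space M) x \<le> J k * L" using xs unfolding T3_def by (simp add: not_less)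
      have "J k * (4 * L) \<le> 2 ^ k" unfolding J_def by (rule div_times_less_eq_dividend)
      then have "real (J k * (4 * L)) \<le> real (2 ^ k)" by (rule of_nat_mono)
      then have "real (J k * L) \<le> 2 ^ k / 4" by simp
      then have n': "real (overlap (II k) P (space M) x) \<le> 2 ^ k / 4" using n by linarith
      have "(\<Sum>i\<in>II k. ?f i) \<le> (\<Sum>i\<in>II k. (1/4) ^ k * indicator (P i) x)"
        using lev by (intro sum_mono mult_right_mono) (auto simp: II_def)
      also have "\<dots> = (1/4) ^ k * real (overlap (II k) P (space M) x)"
      proof -
        have "{i\<in>II k. P i \<subseteq> space M} = II k" using II Ps sets.sets_into_space by blast
        then show ?thesis unfolding overlap_sum[OF II(2)] by (simp add: sum_distrib_left)
      qed
      also have "\<dots> \<le> (1/4) ^ k * (2 ^ k / 4)" by (intro mult_left_mono n') simp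
      also have "\<dots> = (1/2) ^ k / 4" by (simp add: power_mult_distrib[symmetric])
      finally show ?thesis .
    qed
    have "(\<Sum>i\<in>I. ?f i) = (\<Sum>i\<in>(\<Union>k\<in>{..<K}. II k). ?f i)"
    proof (rule sum.mono_neutral_right[OF fin])
      show "(\<Union>k\<in>{..<K}. II k) \<subseteq> I" using II by blast
      show "\<forall>i\<in>I - (\<Union>k\<in>{..<K}. II k). ?f i = 0"
      proof
        fix i assume i: "i \<in> I - (\<Union>k\<in>{..<K}. II k)"
        then have "\<not> (0 < a i \<and> a i \<le> 1)" using levK unfolding II_def by auto
        then have "a i = 0 \<or> 1 < a i" using a0 i by force
        moreover have "x \<notin> P i" if "1 < a i" using that nx i unfolding T1_def by blast
        ultimately show "?f i = 0" by auto
      qed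
    qed
    also have "\<dots> = (\<Sum>k<K. \<Sum>i\<in>II k. ?f i)"
      by (rule sum.UNION_disjoint) (use II in \<open>auto simp: II_def\<close>)
    \<comment> \<open>All indices of the finite family have levels below \<open>K\<close>, which may
      be smaller than \<open>k1\<close>; the maximum makes the splitting at \<open>k1\<close>
      legitimate.\<close>
    also have "\<dots> \<le> (\<Sum>k<max k1 K. \<Sum>i\<in>II k. ?f i)"
      by (rule sum_mono2) (use a0 II in \<open>auto intro!: sum_nonneg simp: subset_eq\<close>)
    also have "\<dots> = (\<Sum>k<k1. \<Sum>i\<in>II k. ?f i) + (\<Sum>k\<in>{k1..<max k1 K}. \<Sum>i\<in>II k. ?f i)"
      by (subst sum.atLeastLessThan_concat[of 0 k1, symmetric, unfolded atLeast0LessThan])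
        (auto simp: atLeast0LessThan)
    also have "{k1..<max k1 K} = {k1..<K}" by auto
    also have "(\<Sum>k\<in>{k1..<K}. \<Sum>i\<in>II k. ?f i) \<le> (\<Sum>k\<in>{k1..<K}. (1/2) ^ k / 4)" by (intro sum_mono high)
    also have "\<dots> \<le> 2 / 4" unfolding sum_divide_distrib[symmetric] by (intro divide_right_mono sum_half_powers) simp
    finally have "(\<Sum>i\<in>I. ?f i) \<le> (\<Sum>k<k1. \<Sum>i\<in>II k. ?f i) + 1 / 2" by simp
    moreover have "(\<Sum>k<k1. \<Sum>i\<in>II k. ?f i) \<le> 1/2" using nx xs unfolding Tlow_def by auto
    ultimately show False using x unfolding S_def by simp
  qed
  have "emeasure \<nu> S \<le> emeasure \<nu> (T1 \<union> Tlow \<union> (\<Union>k\<in>{k1..<K}. T3 k))"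
    by (rule emeasure_mono[OF cover]) (auto simp: s\<nu>)
  also have "\<dots> \<le> emeasure \<nu> T1 + emeasure \<nu> Tlow + (\<Sum>k\<in>{k1..<K}. emeasure \<nu> (T3 k))"
    by (intro order_trans[OF emeasure_subadditive] add_mono emeasure_subadditive_finite order_refl) (auto simp: s\<nu>)
  also have "\<dots> \<le> G + ennreal (32 * real \<Lambda> * real k1) * G + (\<Sum>k\<in>{k1..<K}. ennreal (4 * c * (1/2) ^ k) * G)"
    by (intro add_mono sum_mono T1 Tlow T3) auto
  also have "(\<Sum>k\<in>{k1..<K}. ennreal (4 * c * (1/2) ^ k) * G) = ennreal (4 * c * (\<Sum>k\<in>{k1..<K}. (1/2) ^ k)) * G"
    using c(1) by (simp add: sum_distrib_right[symmetric] sum_distrib_left)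
  also have "\<dots> \<le> ennreal (8 * c) * G"
    using c(1) sum_half_powers[of k1 K] by (intro mult_right_mono ennreal_leI) auto
  finally have "emeasure \<nu> S \<le> G + ennreal (32 * real \<Lambda> * real k1) * G + ennreal (8 * c) * G"
    by (simp add: add_left_mono)
  also have "\<dots> = ennreal (1 + 32 * real \<Lambda> * real k1 + 8 * c) * G"
    using c(1) by (simp add: ennreal_plus distrib_right)
  finally show ?thesis using e\<nu>[OF Ss] unfolding S_def G_def by simp
qed

end

section \<open>Spaces of homogeneous type\<close>

lemma qballI: "y \<in> X \<Longrightarrow> \<rho> x y < r \<Longrightarrow> y \<in> qball X \<rho> x r"
  and qball_mono: "r \<le> s \<Longrightarrow> qball X \<rho> x r \<subseteq> qball X \<rho> x s"
  unfolding qball_def by auto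

locale homogeneous_space =
  fixes \<rho> :: "'a \<Rightarrow> 'a \<Rightarrow> real" and M :: "'a measure" and \<kappa> A :: real
  assumes rho_nonneg: "\<And>x y. x \<in> space M \<Longrightarrow> y \<in> space M \<Longrightarrow> 0 \<le> \<rho> x y"
    and rho_eq_0: "\<And>x y. x \<in> space M \<Longrightarrow> y \<in> space M \<Longrightarrow> \<rho> x y = 0 \<longleftrightarrow> x = y"
    and rho_sym: "\<And>x y. x \<in> space M \<Longrightarrow> y \<in> space M \<Longrightarrow> \<rho> x y = \<rho> y x"
    and kappa: "1 \<le> \<kappa>"
    and rho_triangle: "\<And>x y z. x \<in> space M \<Longrightarrow> y \<in> space M \<Longrightarrow> z \<in> space M \<Longrightarrow> \<rho> x z \<le> \<kappa> * (\<rho> x y + \<rho> y z)"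
    and qborel_sets: "qborel (space M) \<rho> \<subseteq> sets M"
    and ball_sets: "\<And>x r. x \<in> space M \<Longrightarrow> qball (space M) \<rho> x r \<in> sets M"
    and borel_hull: "\<And>F. F \<in> sets M \<Longrightarrow> \<exists>B\<in>qborel (space M) \<rho>. F \<subseteq> B \<and> emeasure M B = emeasure M F"
    and ball_pos: "\<And>x r. x \<in> space M \<Longrightarrow> 0 < r \<Longrightarrow> 0 < emeasure M (qball (space M) \<rho> x r)"
    and ball_finite: "\<And>x r. x \<in> space M \<Longrightarrow> 0 < r \<Longrightarrow> emeasure M (qball (space M) \<rho> x r) < \<infinity>"
    and A1: "1 \<le> A"
    and doubling: "\<And>x r. x \<in> space M \<Longrightarrow> 0 < r \<Longrightarrow>
      emeasure M (qball (space M) \<rho> x (2 * r)) \<le> ennreal A * emeasure M (qball (space M) \<rho> x r)"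
begin

abbreviation B :: "'a \<Rightarrow> real \<Rightarrow> 'a set" where "B \<equiv> qball (space M) \<rho>"

lemma centre_in_ball: "x \<in> space M \<Longrightarrow> 0 < r \<Longrightarrow> x \<in> B x r"
  using rho_eq_0[of x x] by (auto simp: qball_def)

lemma ball_subset_ball:
  assumes "x \<in> space M" "y \<in> B x r"
  shows "B y s \<subseteq> B x (\<kappa> * (r + s))"
proof
  fix z assume z: "z \<in> B y s"
  have "\<rho> x z \<le> \<kappa> * (\<rho> x y + \<rho> y z)" using assms z by (intro rho_triangle) (auto simp: qball_def)
  also have "\<dots> < \<kappa> * (r + s)" using assms z kappa by (intro mult_strict_left_mono) (auto simp: qball_def)
  finally show "z \<in> B x (\<kappa> * (r + s))" using z by (auto simp: qball_def)
qed

lemma ball_pow2: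
  assumes "x \<in> space M" "0 < r"
  shows "emeasure M (B x (2 ^ n * r)) \<le> ennreal (A ^ n) * emeasure M (B x r)"
proof (induction n)
  case (Suc n)
  have "emeasure M (B x (2 * (2 ^ n * r))) \<le> ennreal A * emeasure M (B x (2 ^ n * r))"
    using assms by (intro doubling) auto
  also have "\<dots> \<le> ennreal A * (ennreal (A ^ n) * emeasure M (B x r))" by (intro mult_left_mono Suc) simp
  also have "\<dots> = ennreal (A ^ Suc n) * emeasure M (B x r)"
    using A1 by (simp add: ennreal_mult mult.assoc)
  finally show ?case by (simp add: mult.assoc)
qed simp

lemma ball_scale: "\<exists>C\<ge>1. \<forall>x\<in>space M. \<forall>r>0. emeasure M (B x (c * r)) \<le> ennreal C * emeasure M (B x r)"
proof -
  obtain n where n: "c < 2 ^ n" using real_arch_pow[of 2 c] by auto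
  show ?thesis
  proof (intro exI[of _ "A ^ n"] conjI ballI allI impI)
    show "1 \<le> A ^ n" using A1 by (rule one_le_power)
    fix x and r :: real assume x: "x \<in> space M" "0 < r"
    have "emeasure M (B x (c * r)) \<le> emeasure M (B x (2 ^ n * r))"
      using x n by (intro emeasure_mono qball_mono ball_sets) auto
    also have "\<dots> \<le> ennreal (A ^ n) * emeasure M (B x r)" by (rule ball_pow2[OF x])
    finally show "emeasure M (B x (c * r)) \<le> ennreal (A ^ n) * emeasure M (B x r)" .
  qed
qed

text \<open>Balls need not be open; chains with geometrically decreasing steps sweep out an open set
  inside a given ball.\<close>

primrec chain :: "nat \<Rightarrow> real \<Rightarrow> 'a \<Rightarrow> 'a \<Rightarrow> bool" where
  "chain 0 s y z \<longleftrightarrow> y = z"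
| "chain (Suc n) s y z \<longleftrightarrow> (\<exists>u\<in>space M. \<rho> y u < s / (2 * \<kappa>) \<and> chain n (s / (2 * \<kappa>)) u z)"

lemma chain_bound:
  "chain n s y z \<Longrightarrow> y \<in> space M \<Longrightarrow> 0 \<le> s \<Longrightarrow> z \<in> space M \<and> \<rho> y z \<le> s"
proof (induction n arbitrary: s y)
  case 0
  then show ?case using rho_eq_0[of y y] by auto
next
  case (Suc n)
  then obtain u where u: "u \<in> space M" "\<rho> y u < s / (2 * \<kappa>)" "chain n (s / (2 * \<kappa>)) u z" by auto
  have z: "z \<in> space M" "\<rho> u z \<le> s / (2 * \<kappa>)" using Suc.IH[OF u(3,1)] Suc.prems kappa by auto
  have "\<rho> y z \<le> \<kappa> * (\<rho> y u + \<rho> u z)" by (rule rho_triangle) (use Suc u z in auto)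
  also have "\<dots> \<le> \<kappa> * (s / (2 * \<kappa>) + s / (2 * \<kappa>))" using u z kappa by (intro mult_left_mono) auto
  also have "\<dots> = s" using kappa by (simp add: field_simps)
  finally show ?case using z by simp
qed

lemma chain_extend:
  "chain n s y z \<Longrightarrow> v \<in> space M \<Longrightarrow> \<rho> z v < s / (2 * \<kappa>) ^ Suc n \<Longrightarrow> chain (Suc n) s y v"
proof (induction n arbitrary: s y)
  case (Suc n)
  then obtain u where u: "u \<in> space M" "\<rho> y u < s / (2 * \<kappa>)" "chain n (s / (2 * \<kappa>)) u z" by auto
  have "chain (Suc n) (s / (2 * \<kappa>)) u v"
    by (rule Suc.IH[OF u(3)]) (use Suc.prems in auto)
  then show ?case using u by auto
qed auto

text \<open>Needed because \<open>ess_support\<close> removes open sets only, while the geometry of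
  cubes provides balls on which a function vanishes. The radius is halved since the chain bound is
  not strict.\<close>

lemma open_nbhd:
  assumes x: "x \<in> space M" and s: "0 < s"
  obtains U where "qopen (space M) \<rho> U" "x \<in> U" "U \<subseteq> B x s"
proof -
  let ?U = "{z. \<exists>n. chain n (s / 2) x z}"
  have U: "?U \<subseteq> B x s"
    using chain_bound[OF _ x, of _ "s / 2"] s by (force simp: qball_def)
  have "\<exists>r>0. B z r \<subseteq> ?U" if z: "z \<in> ?U" for z
  proof -
    obtain n where n: "chain n (s / 2) x z" using z by auto
    have "B z (s / 2 / (2 * \<kappa>) ^ Suc n) \<subseteq> ?U"
      using chain_extend[OF n] unfolding qball_def by blast
    moreover have "0 < s / 2 / (2 * \<kappa>) ^ Suc n" using s kappa by auto
    ultimately show ?thesis by blast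
  qed
  then have "qopen (space M) \<rho> ?U" using U unfolding qopen_def by (auto simp: qball_def)
  moreover have "chain 0 (s / 2) x x" by simp
  then have "x \<in> ?U" by blast
  ultimately show ?thesis using U by (rule that)
qed

lemma qopen_sets: "qopen (space M) \<rho> U \<Longrightarrow> U \<in> sets M"
  using qborel_sets unfolding qborel_def by (auto intro: sigma_sets.Basic)

end

lemma homogeneous_type_obtains:
  assumes "homogeneous_type \<rho> M"
  obtains \<kappa> A where "homogeneous_space \<rho> M \<kappa> A"
proof -
  from assms have q: "quasimetric_on (space M) \<rho>" and b: "qborel (space M) \<rho> \<subseteq> sets M"
    and bs: "\<forall>x\<in>space M. \<forall>r. qball (space M) \<rho> x r \<in> sets M"
    and h: "\<forall>A\<in>sets M. \<exists>B\<in>qborel (space M) \<rho>. A \<subseteq> B \<and> emeasure M B = emeasure M A"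
    and "\<exists>D::real. \<forall>x\<in>space M. \<forall>r>0. 0 < emeasure M (qball (space M) \<rho> x (2 * r)) \<and>
        emeasure M (qball (space M) \<rho> x (2 * r)) \<le> ennreal D * emeasure M (qball (space M) \<rho> x r) \<and>
        ennreal D * emeasure M (qball (space M) \<rho> x r) < \<infinity>"
    unfolding homogeneous_type_def by auto
  then obtain D where D: "\<And>x r. x \<in> space M \<Longrightarrow> 0 < r \<Longrightarrow> 0 < emeasure M (qball (space M) \<rho> x (2 * r)) \<and>
        emeasure M (qball (space M) \<rho> x (2 * r)) \<le> ennreal D * emeasure M (qball (space M) \<rho> x r) \<and>
        ennreal D * emeasure M (qball (space M) \<rho> x r) < \<infinity>" by blast
  obtain \<kappa> where \<kappa>: "\<forall>x\<in>space M. \<forall>y\<in>space M. \<forall>z\<in>space M. \<rho> x z \<le> \<kappa> * (\<rho> x y + \<rho> y z)"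
    and m: "\<forall>x\<in>space M. \<forall>y\<in>space M. 0 \<le> \<rho> x y \<and> (\<rho> x y = 0 \<longleftrightarrow> x = y) \<and> \<rho> x y = \<rho> y x"
    using q unfolding quasimetric_on_def by auto
  have "homogeneous_space \<rho> M (max 1 \<kappa>) (max 1 D)"
  proof
    fix x y z assume xyz: "x \<in> space M" "y \<in> space M" "z \<in> space M"
    have "\<rho> x z \<le> \<kappa> * (\<rho> x y + \<rho> y z)" using \<kappa> xyz by blast
    also have "\<dots> \<le> max 1 \<kappa> * (\<rho> x y + \<rho> y z)" using m xyz by (intro mult_right_mono) auto
    finally show "\<rho> x z \<le> max 1 \<kappa> * (\<rho> x y + \<rho> y z)" .
  next
    fix x and r :: real assume x: "x \<in> space M" "0 < r"
    \<comment> \<open>Positivity and finiteness are assumed in terms of doubled balls; the ball of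
      radius \<open>r\<close> is the double of the one of radius r/2.\<close>
    have r2: "0 < r / 2" using x by simp
    show "0 < emeasure M (qball (space M) \<rho> x r)" using D[OF x(1) r2] by simp
    have "emeasure M (qball (space M) \<rho> x r) \<le> ennreal D * emeasure M (qball (space M) \<rho> x (r/2))"
      using D[OF x(1) r2] by simp
    also have "\<dots> < \<infinity>" using D[OF x(1) r2] by blast
    finally show "emeasure M (qball (space M) \<rho> x r) < \<infinity>" .
    have "ennreal D * emeasure M (qball (space M) \<rho> x r) \<le> ennreal (max 1 D) * emeasure M (qball (space M) \<rho> x r)"
      by (intro mult_right_mono ennreal_leI) auto
    then show "emeasure M (qball (space M) \<rho> x (2 * r)) \<le> ennreal (max 1 D) * emeasure M (qball (space M) \<rho> x r)"
      using D[OF x] by (meson order_trans)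
  qed (use m b bs h in auto)
  then show ?thesis by (rule that)
qed

section \<open>Dyadic cubes\<close>

lemma decreasing_small:
  assumes S: "\<And>n::nat. S n \<in> sets N" "decseq S" "(\<Inter>n. S n) = {}" and fin: "emeasure N (S 0) < \<infinity>"
    and \<eta>: "0 < (\<eta>::real)"
  shows "\<exists>n. emeasure N (S n) \<le> ennreal \<eta>"
proof -
  have f: "emeasure N (S n) \<noteq> \<infinity>" for n
    using emeasure_mono[OF decseqD[OF S(2), of 0 n] S(1)] fin by (auto simp: top_unique)
  have "(\<lambda>n. emeasure N (S n)) \<longlonglongrightarrow> emeasure N (\<Inter>n. S n)"
    by (rule Lim_emeasure_decseq) (use S f in auto)
  then have "(\<lambda>n. emeasure N (S n)) \<longlonglongrightarrow> 0" using S(3) by simp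
  then have "eventually (\<lambda>n. emeasure N (S n) < ennreal \<eta>) sequentially"
    using \<eta> by (intro order_tendstoD(2)) auto
  then obtain n where "\<forall>m\<ge>n. emeasure N (S m) < ennreal \<eta>"
    unfolding eventually_sequentially by (elim exE)
  then have "emeasure N (S n) < ennreal \<eta>" by blast
  then show ?thesis by (intro exI[of _ n]) (rule less_imp_le)
qed

locale dyadic_space = homogeneous_space +
  fixes \<epsilon> :: real and \<D> :: "(int \<Rightarrow> 'a set set) set" and \<delta> C0 c_cov :: real
  assumes finite_systems: "finite \<D>" and eps_pos: "0 < \<epsilon>" and eps_less: "\<epsilon> < 1"
    and delta: "1 < \<delta>" and C0: "0 < C0"
    and dyadic: "\<And>D. D \<in> \<D> \<Longrightarrow> dyadic_decomposition \<rho> M \<delta> C0 \<epsilon> D"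
    and covering: "\<And>x r. x \<in> space M \<Longrightarrow> 0 < r \<Longrightarrow> \<exists>Q\<in>cubes \<D>. B x r \<subseteq> Q \<and>
      emeasure M Q \<le> ennreal c_cov * emeasure M (B x r)"
begin

definition cubes_of :: "(int \<Rightarrow> 'a set set) \<Rightarrow> 'a set set" where
  "cubes_of D = (\<Union>k. D k)"

lemma cubes_eq: "cubes \<D> = (\<Union>D\<in>\<D>. cubes_of D)"
  unfolding cubes_def cubes_of_def by simp

section \<open>Combinatorics and measure of the cubes of one system\<close>

context
  fixes D assumes D: "D \<in> \<D>"
begin

lemmas dyadicD = dyadic[OF D, unfolded dyadic_decomposition_def]

lemma cell_sets: "P \<in> D k \<Longrightarrow> P \<in> sets M"
  using dyadicD[THEN conjunct1] by simp

lemma cells_cover: "\<Union>(D k) = space M"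
  using dyadicD[THEN conjunct2, THEN conjunct1] by simp

lemma nested: "P \<in> D j \<Longrightarrow> Q \<in> D k \<Longrightarrow> P \<inter> Q \<noteq> {} \<Longrightarrow> P \<subseteq> Q \<or> Q \<subseteq> P"
  using dyadicD[THEN conjunct2, THEN conjunct2, THEN conjunct1] by simp

lemma child_ex: "Q \<in> D k \<Longrightarrow> \<exists>P\<in>D (k - 1). P \<subseteq> Q"
  and parent_ex1: "Q \<in> D k \<Longrightarrow> \<exists>!P. P \<in> D (k + 1) \<and> Q \<subseteq> P"
  using dyadicD[THEN conjunct2, THEN conjunct2, THEN conjunct2, THEN conjunct1] by simp_all

lemma child_measure:
  "Q \<in> D k \<Longrightarrow> P \<in> D (k - 1) \<Longrightarrow> P \<subseteq> Q \<Longrightarrow> ennreal \<epsilon> * emeasure M Q \<le> emeasure M P"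
  using dyadicD[THEN conjunct2, THEN conjunct2, THEN conjunct2, THEN conjunct2, THEN conjunct1] by simp

lemma cell_centre:
  assumes "P \<in> D k"
  shows "\<exists>x. x \<in> space M \<and> B x (\<delta> powi k) \<subseteq> P \<and> P \<subseteq> B x (C0 * \<delta> powi k)"
proof -
  obtain xc where "\<forall>k. \<forall>Q\<in>D k. xc k Q \<in> space M \<and> B (xc k Q) (\<delta> powi k) \<subseteq> Q \<and>
      Q \<subseteq> B (xc k Q) (C0 * \<delta> powi k)"
    using dyadicD[THEN conjunct2, THEN conjunct2, THEN conjunct2, THEN conjunct2, THEN conjunct2] by (elim exE)
  then show ?thesis using assms by (intro exI[of _ "xc k P"]) simp
qed

lemma powi_delta_pos: "0 < \<delta> powi k"
  using delta by (simp add: zero_less_power_int)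

lemma cell_nonempty: "P \<in> D k \<Longrightarrow> P \<noteq> {}"
  using cell_centre[of P k] centre_in_ball[OF _ powi_delta_pos[of k]] by blast

text \<open>Disjointness within a generation comes from the uniqueness of parents: two nested cells
  of generation k would both be parents of a child of the smaller one.\<close>

lemma cell_unique: 
  assumes "P \<in> D k" "Q \<in> D k" "P \<inter> Q \<noteq> {}"
  shows "P = Q"
proof -
  have *: "P = Q" if PQ: "P \<in> D k" "Q \<in> D k" "P \<subseteq> Q" for P Q
  proof -
    obtain R where R: "R \<in> D (k - 1)" "R \<subseteq> P" using child_ex[OF PQ(1)] by blast
    have "\<exists>!S. S \<in> D k \<and> R \<subseteq> S" using parent_ex1[OF R(1)] by simp
    then show ?thesis using PQ R by (metis subset_trans)
  qed
  show ?thesis using nested[OF assms] *[OF assms(1,2)] *[OF assms(2,1)] by blast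
qed

lemma ancestor:
  assumes "j \<le> k" "P \<in> D j"
  shows "\<exists>Q\<in>D k. P \<subseteq> Q"
  using assms
proof (induction k rule: int_ge_induct)
  case (step k)
  then obtain Q where Q: "Q \<in> D k" "P \<subseteq> Q" by blast
  then show ?case using parent_ex1[OF Q(1)] by blast
qed auto

lemma subset_of_gen_le:
  assumes "j \<le> k" "P \<in> D j" "Q \<in> D k" "P \<inter> Q \<noteq> {}"
  shows "P \<subseteq> Q"
proof -
  obtain S where S: "S \<in> D k" "P \<subseteq> S" using ancestor[OF assms(1,2)] by blast
  then have "S = Q" using cell_unique[OF S(1) assms(3)] assms(4) by blast
  then show ?thesis using S by simp
qed

lemma gen_less_of_psubset:
  assumes "P \<in> D j" "Q \<in> D k" "P \<subset> Q"
  shows "j < k"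
proof (rule ccontr)
  assume "\<not> j < k"
  then have "Q \<subseteq> P" using subset_of_gen_le[of k j Q P] assms cell_nonempty[OF assms(1)] by auto
  then show False using assms by blast
qed

lemma cubes_ofE: assumes "P \<in> cubes_of D" obtains k where "P \<in> D k"
  using assms unfolding cubes_of_def by blast

lemma cubes_of_I: "P \<in> D k \<Longrightarrow> P \<in> cubes_of D"
  unfolding cubes_of_def by blast

lemma cubes_of_sets: "P \<in> cubes_of D \<Longrightarrow> P \<in> sets M"
  using cell_sets by (elim cubes_ofE)

lemma cubes_of_laminar: "laminar (cubes_of D)"
  unfolding laminar_def cubes_of_def using nested by blast

lemma cubes_of_pos: "P \<in> cubes_of D \<Longrightarrow> 0 < emeasure M P"
proof (elim cubes_ofE)
  fix k assume P: "P \<in> D k"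
  obtain x where x: "x \<in> space M" "B x (\<delta> powi k) \<subseteq> P" using cell_centre[OF P] by blast
  then show ?thesis
    using ball_pos[OF x(1) powi_delta_pos[of k]] emeasure_mono[OF x(2) cell_sets[OF P]] by simp
qed

lemma cubes_of_finite: "P \<in> cubes_of D \<Longrightarrow> emeasure M P < \<infinity>"
proof (elim cubes_ofE)
  fix k assume P: "P \<in> D k"
  obtain x where x: "x \<in> space M" "P \<subseteq> B x (C0 * \<delta> powi k)" using cell_centre[OF P] by blast
  have "0 < C0 * \<delta> powi k" using C0 powi_delta_pos[of k] by simp
  then show ?thesis
    using ball_finite[OF x(1)] emeasure_mono[OF x(2) ball_sets[OF x(1)]] by (meson le_less_trans)
qed

text \<open>Successive parents may be equal as sets. One climbs from \<open>P\<close> until the set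
  changes for the first time, which happens below the generation of \<open>Q\<close> or when
  reaching it; only this last step costs the factor \<epsilon>.\<close>

lemma cubes_of_parent:
  assumes "P \<in> cubes_of D" "Q \<in> cubes_of D" "P \<subset> Q"
  shows "\<exists>R\<in>cubes_of D. P \<subset> R \<and> R \<subseteq> Q \<and> ennreal \<epsilon> * emeasure M R \<le> emeasure M P"
proof -
  obtain j k where jk: "P \<in> D j" "Q \<in> D k" using assms(1,2) by (elim cubes_ofE)
  have main: "\<And>j. P \<in> D j \<Longrightarrow> n = nat (k - j) \<Longrightarrow> ?thesis" for n
  proof (induction n)
    case (0 j)
    then show ?case using gen_less_of_psubset[OF 0(1) jk(2) assms(3)] by simp
  next
    case (Suc n j)
    have j: "j < k" by (rule gen_less_of_psubset[OF Suc(2) jk(2) assms(3)])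
    obtain R where R: "R \<in> D (j + 1)" "P \<subseteq> R" using parent_ex1[OF Suc(2)] by blast
    show ?case
    proof (cases "R = P")
      case True
      then show ?thesis using R Suc.IH[of "j + 1"] Suc(3) by auto
    next
      case False
      have "R \<inter> Q \<noteq> {}" using R assms(3) cell_nonempty[OF Suc(2)] by blast
      then have "R \<subseteq> Q" using subset_of_gen_le[OF _ R(1) jk(2)] j by simp
      moreover have "ennreal \<epsilon> * emeasure M R \<le> emeasure M P"
        using child_measure[OF R(1), of P] Suc(2) R by simp
      ultimately show ?thesis using False R cubes_of_I[OF R(1)] by blast
    qed
  qed
  show ?thesis using main[OF jk(1) refl] .
qed

text \<open>A cube strictly between belongs to a generation strictly between, and each generation
  has only one cell containing the nonempty set \<open>P\<close>.\<close>

lemma cubes_of_finite_between: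
  assumes "P \<in> cubes_of D" "Q \<in> cubes_of D"
  shows "finite {R\<in>cubes_of D. P \<subseteq> R \<and> R \<subseteq> Q}"
proof -
  obtain j k where jk: "P \<in> D j" "Q \<in> D k" using assms by (elim cubes_ofE)
  define cell where "cell i = (SOME R. R \<in> D i \<and> P \<subseteq> R)" for i
  have "{R\<in>cubes_of D. P \<subseteq> R \<and> R \<subseteq> Q} \<subseteq> {P, Q} \<union> cell ` {j..k}"
  proof
    fix R assume R: "R \<in> {R\<in>cubes_of D. P \<subseteq> R \<and> R \<subseteq> Q}"
    then obtain i where i: "R \<in> D i" using cubes_ofE by blast
    show "R \<in> {P, Q} \<union> cell ` {j..k}"
    proof (cases "R = P \<or> R = Q")
      case False
      then have "j < i" "i < k"
        using gen_less_of_psubset[OF jk(1) i] gen_less_of_psubset[OF i jk(2)] R by auto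
      have "cell i \<in> D i \<and> P \<subseteq> cell i"
        unfolding cell_def by (rule someI[of _ R]) (use i R in auto)
      then have "cell i = R"
        using cell_unique[of "cell i" i R] i R cell_nonempty[OF jk(1)] by blast
      then show ?thesis using \<open>j < i\<close> \<open>i < k\<close> by force
    qed auto
  qed
  then show ?thesis by (rule finite_subset) auto
qed

text \<open>The cells of one generation are disjoint and of positive measure, so only finitely many
  of them take more than 1/(m+1) of a given ball, which has finite measure. Every cell does so for
  some m and some ball about a fixed point.\<close>

lemma cells_countable: "countable (D k)"
proof (cases "space M = {}")
  case True
  then have "D k = {}" using cell_nonempty cells_cover by blast
  then show ?thesis by simp
next
  case False
  then obtain x0 where x0: "x0 \<in> space M" by blast
  define F where "F n m = {P\<in>D k. 1 / real (Suc m) < measure M (P \<inter> B x0 (real (Suc n)))}" for n m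
  have finb: "emeasure M (B x0 (real (Suc n))) < \<infinity>" for n using ball_finite[OF x0] by simp
  have fin: "finite (F n m)" for n m
  proof (rule conjunct1[OF finite_if_finite_subsets_card_bdd[of _ "nat \<lceil>real (Suc m) * measure M (B x0 (real (Suc n)))\<rceil>"]])
    fix G assume G: "G \<subseteq> F n m" "finite G"
    let ?b = "B x0 (real (Suc n))"
    have meas: "P \<inter> ?b \<in> sets M" if "P \<in> G" for P
      using that G cell_sets ball_sets[OF x0] unfolding F_def by auto
    have "real (card G) * (1 / real (Suc m)) = (\<Sum>P\<in>G. 1 / real (Suc m))" by simp
    also have "\<dots> \<le> (\<Sum>P\<in>G. measure M (P \<inter> ?b))"
      using G unfolding F_def by (intro sum_mono) auto
    also have "\<dots> = measure M (\<Union>P\<in>G. P \<inter> ?b)"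
    proof (rule measure_finite_Union[symmetric, OF G(2)])
      show "disjoint_family_on (\<lambda>P. P \<inter> ?b) G"
        unfolding disjoint_family_on_def using cell_unique G unfolding F_def by blast
      fix P assume "P \<in> G"
      have "emeasure M (P \<inter> ?b) \<le> emeasure M ?b" by (intro emeasure_mono ball_sets x0) auto
      then show "emeasure M (P \<inter> ?b) \<noteq> \<infinity>" using finb[of n] by (auto simp: top_unique)
    qed (use meas in auto)
    also have "\<dots> \<le> measure M ?b"
    proof (rule measure_mono_fmeasurable)
      show "(\<Union>P\<in>G. P \<inter> ?b) \<in> sets M" using meas G(2) by (intro sets.finite_UN) auto
      show "?b \<in> fmeasurable M" using finb[of n] ball_sets[OF x0] by (intro fmeasurableI)
    qed auto
    finally show "card G \<le> nat \<lceil>real (Suc m) * measure M ?b\<rceil>"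
      by (simp add: field_simps) linarith
  qed
  have "D k \<subseteq> (\<Union>n. \<Union>m. F n m)"
  proof
    fix P assume P: "P \<in> D k"
    have "P = (\<Union>n. P \<inter> B x0 (real (Suc n)))"
    proof -
      have "\<exists>n. \<rho> x0 y < real (Suc n)" for y
        using reals_Archimedean2 by (metis less_SucI of_nat_less_iff order_less_trans lessI)
      then show ?thesis using sets.sets_into_space[OF cell_sets[OF P]] by (auto simp: qball_def)
    qed
    have "\<exists>n. emeasure M (P \<inter> B x0 (real (Suc n))) \<noteq> 0"
    proof (rule ccontr)
      assume "\<not> ?thesis"
      then have "emeasure M (\<Union>n. P \<inter> B x0 (real (Suc n))) = 0"
        using cell_sets[OF P] ball_sets[OF x0] by (intro emeasure_UN_eq_0) auto
      then show False using cubes_of_pos[OF cubes_of_I[OF P]] \<open>P = _\<close> by simp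
    qed
    then obtain n where n: "emeasure M (P \<inter> B x0 (real (Suc n))) \<noteq> 0" by blast
    have "emeasure M (P \<inter> B x0 (real (Suc n))) < \<infinity>"
      using finb[of n] emeasure_mono[of "P \<inter> B x0 (real (Suc n))" "B x0 (real (Suc n))" M] ball_sets[OF x0]
      by (auto intro: le_less_trans)
    then have "0 < measure M (P \<inter> B x0 (real (Suc n)))"
      using n by (simp add: measure_def enn2real_positive_iff zero_less_iff_neq_zero)
    then obtain m where "1 / real (Suc m) < measure M (P \<inter> B x0 (real (Suc n)))"
      using nat_approx_posE by blast
    then show "P \<in> (\<Union>n. \<Union>m. F n m)" using P unfolding F_def by blast
  qed
  moreover have "countable (\<Union>n. \<Union>m. F n m)" by (intro countable_UN countableI_type countable_finite[OF fin])
  ultimately show ?thesis by (rule countable_subset)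
qed

lemma cubes_of_countable: "countable (cubes_of D)"
  unfolding cubes_of_def by (intro countable_UN cells_countable) auto

text \<open>Two points of a cell of generation k lie within C0 \<delta>^k of its centre, hence at
  distance at most 2 \<kappa> C0 \<delta>^k from each other.\<close>

lemma small_cell:
  assumes x: "x \<in> space M" and s: "0 < s"
  shows "\<exists>k0. \<forall>k\<le>k0. \<forall>P\<in>D k. x \<in> P \<longrightarrow> P \<subseteq> B x s"
proof -
  obtain n where n: "(1 / \<delta>) ^ n < s / (2 * \<kappa> * C0)"
    using real_arch_pow_inv[of "s / (2 * \<kappa> * C0)" "1 / \<delta>"] s kappa C0 delta by auto
  show ?thesis
  proof (intro exI[of _ "- int n"] allI impI ballI)
    fix k P assume k: "k \<le> - int n" and P: "P \<in> D k" "x \<in> P"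
    obtain c where c: "c \<in> space M" "P \<subseteq> B c (C0 * \<delta> powi k)" using cell_centre[OF P(1)] by blast
    have "\<delta> powi k \<le> \<delta> powi (- int n)" using k delta by (intro power_int_increasing) auto
    also have "\<dots> = (1 / \<delta>) ^ n" by (simp add: power_int_minus power_divide field_simps)
    also note n
    finally have d: "2 * \<kappa> * C0 * \<delta> powi k < s" using kappa C0 by (simp add: field_simps)
    show "P \<subseteq> B x s"
    proof
      fix y assume y: "y \<in> P"
      have *: "y \<in> space M" "\<rho> c y < C0 * \<delta> powi k" "\<rho> c x < C0 * \<delta> powi k"
        using c y P by (auto simp: qball_def)
      have "\<rho> x y \<le> \<kappa> * (\<rho> x c + \<rho> c y)" by (rule rho_triangle) (use x c * in auto)
      also have "\<dots> \<le> \<kappa> * (C0 * \<delta> powi k + C0 * \<delta> powi k)"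
        using * rho_sym[OF x c(1)] kappa by (intro mult_left_mono) auto
      also have "\<dots> < s" using d by (simp add: algebra_simps)
      finally show "y \<in> B x s" using * by (auto simp: qball_def)
    qed
  qed
qed

text \<open>Unions of cubes form a topology in which all cubes are clopen.\<close>

definition cube_open :: "'a set \<Rightarrow> bool" where
  "cube_open S \<longleftrightarrow> (\<forall>x\<in>S. \<exists>P\<in>cubes_of D. x \<in> P \<and> P \<subseteq> S)"

lemma cube_open_eq: "cube_open S \<Longrightarrow> S = \<Union>{P\<in>cubes_of D. P \<subseteq> S}"
  unfolding cube_open_def by blast

lemma cube_open_sets: "cube_open S \<Longrightarrow> S \<in> sets M"
  by (subst cube_open_eq, assumption, rule sets.countable_Union)
    (use cubes_of_sets cubes_of_countable in \<open>auto intro: countable_subset\<close>)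

lemma cube_open_Union:
  assumes "\<And>i. i \<in> I \<Longrightarrow> cube_open (S i)"
  shows "cube_open (\<Union>i\<in>I. S i)"
  unfolding cube_open_def
proof
  fix x assume "x \<in> (\<Union>i\<in>I. S i)"
  then obtain i where i: "i \<in> I" "x \<in> S i" by blast
  obtain P where "P \<in> cubes_of D" "x \<in> P" "P \<subseteq> S i"
    using assms[OF i(1)] i(2) unfolding cube_open_def by blast
  then show "\<exists>P\<in>cubes_of D. x \<in> P \<and> P \<subseteq> (\<Union>i\<in>I. S i)" using i(1) by blast
qed

lemma cube_open_Int:
  assumes S: "cube_open S" "cube_open T"
  shows "cube_open (S \<inter> T)"
  unfolding cube_open_def
proof
  fix x assume x: "x \<in> S \<inter> T"
  then obtain P Q where PQ: "P \<in> cubes_of D" "x \<in> P" "P \<subseteq> S" "Q \<in> cubes_of D" "x \<in> Q" "Q \<subseteq> T"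
    using S unfolding cube_open_def by blast
  have "P \<subseteq> Q \<or> Q \<subseteq> P" by (rule laminarD[OF cubes_of_laminar PQ(1,4,2,5)])
  then show "\<exists>P\<in>cubes_of D. x \<in> P \<and> P \<subseteq> S \<inter> T" using PQ by blast
qed

lemma cube_open_INT:
  "finite I \<Longrightarrow> (\<And>i. i \<in> I \<Longrightarrow> cube_open (S i)) \<Longrightarrow> cube_open (space M \<inter> (\<Inter>i\<in>I. S i))"
proof (induction I rule: finite_induct)
  case empty
  have "cube_open (space M)"
    unfolding cube_open_def
  proof
    fix x assume "x \<in> space M"
    then obtain P where "P \<in> D 0" "x \<in> P" using cells_cover[of 0] by blast
    then show "\<exists>P\<in>cubes_of D. x \<in> P \<and> P \<subseteq> space M" using cubes_of_I sets.sets_into_space[OF cell_sets] by blast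
  qed
  then show ?case by simp
next
  case (insert i I)
  have "space M \<inter> (\<Inter>j\<in>insert i I. S j) = S i \<inter> (space M \<inter> (\<Inter>j\<in>I. S j))" by auto
  then show ?case using cube_open_Int[OF insert.prems[of i] insert.IH] insert.prems by simp
qed

lemma cube_open_complement:
  assumes "P \<in> cubes_of D"
  shows "cube_open (space M - P)"
  unfolding cube_open_def
proof
  fix x assume x: "x \<in> space M - P"
  obtain k where k: "P \<in> D k" using assms by (elim cubes_ofE)
  obtain R where R: "R \<in> D k" "x \<in> R" using cells_cover[of k] x by blast
  have "R \<inter> P = {}" using cell_unique[OF R(1) k] R x by blast
  then show "\<exists>P'\<in>cubes_of D. x \<in> P' \<and> P' \<subseteq> space M - P"
    using R cubes_of_I[OF R(1)] sets.sets_into_space[OF cell_sets[OF R(1)]] by blast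
qed

lemma cube_open_cube: "P \<in> cubes_of D \<Longrightarrow> cube_open P"
  unfolding cube_open_def by blast

section \<open>Approximation of Borel sets by unions of cubes\<close>

lemma qopen_cube_open:
  assumes "qopen (space M) \<rho> U"
  shows "cube_open U"
  unfolding cube_open_def
proof
  fix x assume x: "x \<in> U"
  then obtain r where r: "0 < r" "B x r \<subseteq> U" "x \<in> space M" using assms unfolding qopen_def by blast
  obtain k where "\<forall>j\<le>k. \<forall>P\<in>D j. x \<in> P \<longrightarrow> P \<subseteq> B x r" using small_cell[OF r(3,1)] by (elim exE)
  then have k: "\<forall>P\<in>D k. x \<in> P \<longrightarrow> P \<subseteq> B x r" by blast
  obtain P where P: "P \<in> D k" "x \<in> P" using cells_cover[of k] r(3) by blast
  have "P \<subseteq> U" using k P r(2) by blast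
  then show "\<exists>P\<in>cubes_of D. x \<in> P \<and> P \<subseteq> U" using cubes_of_I[OF P(1)] P(2) by blast
qed

text \<open>Stated symmetrically in the set and its complement: both are covered by unions of cubes
  that overlap little within \<open>Q\<close>. This makes the complement step a mere exchange of
  \<open>S\<close> and \<open>T\<close>.\<close>

lemma borel_cube_approx:
  assumes Q: "Q \<in> cubes_of D" and F: "F \<in> qborel (space M) \<rho>"
  shows "\<forall>\<eta>>0::real. \<exists>S T. cube_open S \<and> cube_open T \<and> F \<inter> Q \<subseteq> S \<and> Q - F \<subseteq> T \<and>
    emeasure M (S \<inter> T \<inter> Q) \<le> ennreal \<eta>"
  using F unfolding qborel_def
proof (induction rule: sigma_sets.induct)
  case (Basic U)
  then have U: "cube_open U" using qopen_cube_open by blast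
  show ?case
  proof (intro allI impI)
    fix \<eta> :: real assume \<eta>: "0 < \<eta>"
    let ?C = "{P\<in>cubes_of D. P \<subseteq> U}"
    show "\<exists>S T. cube_open S \<and> cube_open T \<and> U \<inter> Q \<subseteq> S \<and> Q - U \<subseteq> T \<and> emeasure M (S \<inter> T \<inter> Q) \<le> ennreal \<eta>"
    proof (cases "?C = {}")
      case True
      then have "U = {}" using cube_open_eq[OF U] unfolding True by simp
      then show ?thesis using cube_open_cube[OF Q] by (intro exI[of _ "{}"] exI[of _ Q]) (auto simp: cube_open_def)
    next
      case False
      have "countable ?C" using cubes_of_countable by (auto intro: countable_subset)
      then have r: "range (from_nat_into ?C) = ?C" using False by (intro range_from_nat_into)
      define p where "p = from_nat_into ?C"
      have p: "p n \<in> cubes_of D" "p n \<subseteq> U" for n using r unfolding p_def by blast+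
      have pU: "U = (\<Union>n. p n)" using cube_open_eq[OF U] r unfolding p_def by auto
      \<comment> \<open>Finitely many cubes exhausting \<open>U\<close> are removed. Their
        complements are unions of cubes, and the part of \<open>U\<close> left over shrinks to the
        empty set.\<close>
      define T where "T n = space M \<inter> (\<Inter>i\<in>{..n}. space M - p i)" for n :: nat
      have T: "cube_open (T n)" for n
        unfolding T_def by (intro cube_open_INT cube_open_complement p) auto
      have "\<exists>n. emeasure M (U \<inter> T n \<inter> Q) \<le> ennreal \<eta>"
      proof (rule decreasing_small[OF _ _ _ _ \<eta>])
        show "U \<inter> T n \<inter> Q \<in> sets M" for n
          using cube_open_sets[OF U] cube_open_sets[OF T[of n]] cubes_of_sets[OF Q] by auto
        show "decseq (\<lambda>n. U \<inter> T n \<inter> Q)" unfolding decseq_def T_def by force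
        show "(\<Inter>n. U \<inter> T n \<inter> Q) = {}" unfolding pU T_def by auto
        have "emeasure M (U \<inter> T 0 \<inter> Q) \<le> emeasure M Q" by (intro emeasure_mono cubes_of_sets Q) auto
        then show "emeasure M (U \<inter> T 0 \<inter> Q) < \<infinity>" using cubes_of_finite[OF Q] by (rule le_less_trans)
      qed
      then obtain n where n: "emeasure M (U \<inter> T n \<inter> Q) \<le> ennreal \<eta>" by blast
      have "Q - U \<subseteq> T n" using p sets.sets_into_space[OF cubes_of_sets[OF Q]] unfolding T_def by blast
      then show ?thesis using U T[of n] n by (intro exI[of _ U] exI[of _ "T n"]) auto
    qed
  qed
next
  case Empty
  show ?case using cube_open_cube[OF Q] by (intro allI impI exI[of _ "{}"] exI[of _ Q]) (auto simp: cube_open_def)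
next
  case (Compl F)
  show ?case
  proof (intro allI impI)
    fix \<eta> :: real assume "0 < \<eta>"
    then obtain S T where "cube_open S" "cube_open T" "F \<inter> Q \<subseteq> S" "Q - F \<subseteq> T" "emeasure M (S \<inter> T \<inter> Q) \<le> ennreal \<eta>"
      using Compl.IH by blast
    then show "\<exists>S T. cube_open S \<and> cube_open T \<and> (space M - F) \<inter> Q \<subseteq> S \<and> Q - (space M - F) \<subseteq> T \<and> emeasure M (S \<inter> T \<inter> Q) \<le> ennreal \<eta>"
      using sets.sets_into_space[OF cubes_of_sets[OF Q]]
      by (intro exI[of _ T] exI[of _ S]) (auto simp: Int_commute)
  qed
next
  case (Union F)
  show ?case
  proof (intro allI impI)
    fix \<eta> :: real assume \<eta>: "0 < \<eta>"
    \<comment> \<open>The errors of the single sets add up to at most \<eta>/2; the other half pays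
      for truncating the union.\<close>
    define e where "e n = \<eta> / 4 * (1/2) ^ n" for n :: nat
    have "\<forall>n. \<exists>S T. cube_open S \<and> cube_open T \<and> F n \<inter> Q \<subseteq> S \<and> Q - F n \<subseteq> T \<and> emeasure M (S \<inter> T \<inter> Q) \<le> ennreal (e n)"
      using Union.IH \<eta> unfolding e_def by simp
    then obtain S T where ST: "\<And>n. cube_open (S n)" "\<And>n. cube_open (T n)" "\<And>n. F n \<inter> Q \<subseteq> S n"
      "\<And>n. Q - F n \<subseteq> T n" "\<And>n. emeasure M (S n \<inter> T n \<inter> Q) \<le> ennreal (e n)" by metis
    note Qm = cubes_of_sets[OF Q] and Sm = cube_open_sets[OF ST(1)] and Tm = cube_open_sets[OF ST(2)]
    define S' where "S' = (\<Union>n. S n)"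
    have S': "cube_open S'" unfolding S'_def by (rule cube_open_Union) (rule ST)
    have "\<exists>N. emeasure M (S' \<inter> Q - (\<Union>n\<in>{..N}. S n)) \<le> ennreal (\<eta> / 2)"
    proof (rule decreasing_small)
      show "S' \<inter> Q - (\<Union>n\<in>{..N}. S n) \<in> sets M" for N
        using cube_open_sets[OF S'] Qm Sm by auto
      show "decseq (\<lambda>N. S' \<inter> Q - (\<Union>n\<in>{..N}. S n))" unfolding decseq_def by force
      show "(\<Inter>N. S' \<inter> Q - (\<Union>n\<in>{..N}. S n)) = {}" unfolding S'_def by auto
      have "emeasure M (S' \<inter> Q - (\<Union>n\<in>{..0}. S n)) \<le> emeasure M Q" by (intro emeasure_mono Qm) auto
      then show "emeasure M (S' \<inter> Q - (\<Union>n\<in>{..0}. S n)) < \<infinity>" using cubes_of_finite[OF Q] by (rule le_less_trans)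
    qed (use \<eta> in simp)
    then obtain N where N: "emeasure M (S' \<inter> Q - (\<Union>n\<in>{..N}. S n)) \<le> ennreal (\<eta> / 2)" by blast
    \<comment> \<open>An infinite intersection of unions of cubes need not be such a union, so only
      \<open>T 0\<close> to \<open>T N\<close> are intersected. What the remaining
      \<open>S n\<close> add is the small set estimated by \<open>N\<close>.\<close>
    define T' where "T' = space M \<inter> (\<Inter>n\<in>{..N}. T n)"
    have T': "cube_open T'" unfolding T'_def by (rule cube_open_INT) (use ST in auto)
    have "S' \<inter> T' \<inter> Q \<subseteq> (\<Union>n\<in>{..N}. S n \<inter> T n \<inter> Q) \<union> (S' \<inter> Q - (\<Union>n\<in>{..N}. S n))"
      unfolding T'_def by blast
    then have "emeasure M (S' \<inter> T' \<inter> Q) \<le> emeasure M ((\<Union>n\<in>{..N}. S n \<inter> T n \<inter> Q) \<union> (S' \<inter> Q - (\<Union>n\<in>{..N}. S n)))"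
      by (rule emeasure_mono) (use cube_open_sets[OF S'] Qm Sm Tm in auto)
    also have "\<dots> \<le> emeasure M (\<Union>n\<in>{..N}. S n \<inter> T n \<inter> Q) + emeasure M (S' \<inter> Q - (\<Union>n\<in>{..N}. S n))"
      by (rule emeasure_subadditive) (use cube_open_sets[OF S'] Qm Sm Tm in auto)
    also have "\<dots> \<le> (\<Sum>n\<le>N. emeasure M (S n \<inter> T n \<inter> Q)) + ennreal (\<eta> / 2)"
      by (intro add_mono N emeasure_subadditive_finite) (use Qm Sm Tm in auto)
    also have "\<dots> \<le> (\<Sum>n\<le>N. ennreal (e n)) + ennreal (\<eta> / 2)" by (intro add_mono sum_mono ST) auto
    also have "\<dots> = ennreal ((\<Sum>n\<le>N. e n) + \<eta> / 2)"
      using \<eta> by (subst sum_ennreal) (auto simp: e_def sum_nonneg ennreal_plus)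
    also have "\<dots> \<le> ennreal \<eta>"
    proof (rule ennreal_leI)
      have "(\<Sum>n\<le>N. e n) = \<eta> / 4 * (\<Sum>n\<in>{0..<Suc N}. (1/2) ^ n)"
        unfolding e_def by (simp add: sum_distrib_left atLeast0LessThan lessThan_Suc_atMost)
      also have "\<dots> \<le> \<eta> / 4 * 2" using \<eta> by (intro mult_left_mono sum_half_powers) auto
      finally show "(\<Sum>n\<le>N. e n) + \<eta> / 2 \<le> \<eta>" by simp
    qed
    finally have "emeasure M (S' \<inter> T' \<inter> Q) \<le> ennreal \<eta>" .
    moreover have "(\<Union>n. F n) \<inter> Q \<subseteq> S'" using ST(3) unfolding S'_def by blast
    moreover have "Q - (\<Union>n. F n) \<subseteq> T'"
      using ST(4) sets.sets_into_space[OF Qm] unfolding T'_def by blast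
    ultimately show "\<exists>S T. cube_open S \<and> cube_open T \<and> (\<Union>n. F n) \<inter> Q \<subseteq> S \<and> Q - (\<Union>n. F n) \<subseteq> T \<and>
        emeasure M (S \<inter> T \<inter> Q) \<le> ennreal \<eta>" using S' T' by blast
  qed
qed

text \<open>Borel regularity reduces the claim to a hull \<open>H\<close> of \<open>F\<close>.
  Points of S \<inter> Q outside \<open>H\<close> lie in \<open>T\<close>, so they belong to the
  small overlap.\<close>

lemma cubes_of_outer_regular:
  assumes F: "F \<in> sets M" "F \<subseteq> Q" and Q: "Q \<in> cubes_of D" and \<eta>: "0 < (\<eta>::real)"
  shows "\<exists>U\<subseteq>cubes_of D. (\<forall>P\<in>U. P \<subseteq> Q) \<and> F \<subseteq> \<Union>U \<and> emeasure M (\<Union>U) \<le> emeasure M F + ennreal \<eta>"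
proof -
  obtain H where H: "H \<in> qborel (space M) \<rho>" "F \<subseteq> H" "emeasure M H = emeasure M F"
    using borel_hull[OF F(1)] by blast
  obtain S T where ST: "cube_open S" "cube_open T" "H \<inter> Q \<subseteq> S" "Q - H \<subseteq> T"
    "emeasure M (S \<inter> T \<inter> Q) \<le> ennreal \<eta>"
    using borel_cube_approx[OF Q H(1)] \<eta> by blast
  have SQ: "cube_open (S \<inter> Q)" by (intro cube_open_Int ST cube_open_cube Q)
  let ?U = "{P\<in>cubes_of D. P \<subseteq> S \<inter> Q}"
  have U: "\<Union>?U = S \<inter> Q" by (rule cube_open_eq[OF SQ, symmetric])
  have Hs: "H \<in> sets M" using H qborel_sets by blast
  have "emeasure M (S \<inter> Q) \<le> emeasure M (H \<union> S \<inter> T \<inter> Q)"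
    by (rule emeasure_mono) (use ST Hs cube_open_sets cubes_of_sets[OF Q] in auto)
  also have "\<dots> \<le> emeasure M H + emeasure M (S \<inter> T \<inter> Q)"
    by (rule emeasure_subadditive) (use ST Hs cube_open_sets cubes_of_sets[OF Q] in auto)
  also have "\<dots> \<le> emeasure M F + ennreal \<eta>" using H ST by (intro add_mono) auto
  finally show ?thesis
    by (intro exI[of _ ?U]) (use U H F ST in auto)
qed

lemma cube_family_cubes_of: "cube_family M \<epsilon> (cubes_of D)"
  by unfold_locales
    (fact eps_pos eps_less cubes_of_countable cubes_of_sets cubes_of_laminar cubes_of_pos cubes_of_finite cubes_of_parent
      cubes_of_finite_between cubes_of_outer_regular)+

end

end

lemma adjacent_dyadic_systems_obtains:
  assumes "homogeneous_space \<rho> M \<kappa> A" "adjacent_dyadic_systems \<rho> M \<epsilon> \<D>"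
  obtains \<delta> C0 c where "dyadic_space \<rho> M \<kappa> A \<epsilon> \<D> \<delta> C0 c"
proof -
  from assms(2) obtain \<delta> C0 c where "1 < \<delta>" "0 < C0" "\<forall>D\<in>\<D>. dyadic_decomposition \<rho> M \<delta> C0 \<epsilon> D"
    "finite \<D>" "0 < \<epsilon>" "\<epsilon> < 1"
    "\<forall>x\<in>space M. \<forall>r>0. \<exists>Q\<in>cubes \<D>.
        qball (space M) \<rho> x r \<subseteq> Q \<and> emeasure M Q \<le> ennreal c * emeasure M (qball (space M) \<rho> x r)"
    unfolding adjacent_dyadic_systems_def by blast
  then have "dyadic_space \<rho> M \<kappa> A \<epsilon> \<D> \<delta> C0 c"
    using assms(1) by (intro dyadic_space.intro dyadic_space_axioms.intro) auto
  then show ?thesis by (rule that)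
qed

section \<open>Maximal functions and weights\<close>

text \<open>Fixes the parameters of \<open>sparse_weak_type\<close> with j0 = J + 2:
  \<open>J\<close> grows linearly in W = [w], and \<open>k\<close> only has to be of the order log(e
  + W), because the quantity to be dominated by 2^k is quadratic in \<open>J\<close>.\<close>

lemma log_constant:
  fixes \<epsilon> c :: real and \<Lambda> :: nat
  assumes \<epsilon>: "0 < \<epsilon>" and \<Lambda>: "0 < \<Lambda>" and c: "0 < c"
  obtains C where "0 < C" "\<And>W. 0 \<le> W \<Longrightarrow> \<exists>J k::nat. 0 < J \<and> 8 * W / \<epsilon> \<le> real J \<and>
    (4 * ((J + 2) * (2 * \<Lambda>)))\<^sup>2 \<le> (2::nat) ^ k \<and>
    1 + 32 * real \<Lambda> * real k + 8 * c \<le> C * ln (exp 1 + W)"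
proof -
  define H where "H = 64 * real \<Lambda> / \<epsilon> + 32 * real \<Lambda>"
  define C where "C = 1 + 8 * c + 32 * real \<Lambda> * (2 / ln 2 * (ln H + 1) + 1)"
  have H: "1 \<le> H" unfolding H_def using \<epsilon> \<Lambda> by (simp add: add_increasing)
  have l2: "0 < ln (2::real)" by simp
  have lH: "0 \<le> ln H" using H by simp
  have C: "0 < C" unfolding C_def using c lH by (auto intro!: add_pos_nonneg)
  have main: "\<exists>J k::nat. 0 < J \<and> 8 * W / \<epsilon> \<le> real J \<and>
    (4 * ((J + 2) * (2 * \<Lambda>)))\<^sup>2 \<le> (2::nat) ^ k \<and>
    1 + 32 * real \<Lambda> * real k + 8 * c \<le> C * ln (exp 1 + W)" if W: "0 \<le> W" for W
  proof -
    define J where "J = nat \<lceil>8 * W / \<epsilon>\<rceil> + 1"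
    have W8: "0 \<le> 8 * W / \<epsilon>" using W \<epsilon> by simp
    have J: "0 < J" "8 * W / \<epsilon> \<le> real J" "real J \<le> 8 * W / \<epsilon> + 2"
      unfolding J_def using W8 by linarith+
    define y where "y = real (4 * ((J + 2) * (2 * \<Lambda>)))"
    have y: "1 \<le> y" unfolding y_def using J(1) \<Lambda> by (simp add: Suc_leI del: of_nat_mult of_nat_add)
    \<comment> \<open>The least integer at least 2 log_2 y, so that y^2 \<le> 2^k; here y is the
      number 4L of \<open>sparse_weak_type\<close>.\<close>
    define k where "k = nat \<lceil>2 * (ln y / ln 2)\<rceil>"
    have ly: "0 \<le> 2 * (ln y / ln 2)" using y l2 by simp
    have k: "2 * (ln y / ln 2) \<le> real k" "real k \<le> 2 * (ln y / ln 2) + 1"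
      unfolding k_def using ly by linarith+
    have "ln (y\<^sup>2) \<le> ln (2 ^ k)"
      using k(1) y l2 by (simp add: ln_realpow pos_divide_le_eq field_simps)
    then have "y\<^sup>2 \<le> 2 ^ k" using y by (subst (asm) ln_le_cancel_iff) auto
    then have "real ((4 * ((J + 2) * (2 * \<Lambda>)))\<^sup>2) \<le> real (2 ^ k)" unfolding y_def by simp
    then have k2: "(4 * ((J + 2) * (2 * \<Lambda>)))\<^sup>2 \<le> (2::nat) ^ k" by (subst (asm) of_nat_le_iff)
    let ?L = "ln (exp 1 + W)"
    have L: "1 \<le> ?L" using W ln_le_cancel_iff[of "exp 1" "exp 1 + W"] by (simp add: add_pos_nonneg)
    have e1: "1 \<le> exp (1::real)" by simp
    have "y = 8 * real \<Lambda> * (real J + 2)" unfolding y_def by (simp add: algebra_simps)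
    also have "\<dots> \<le> 8 * real \<Lambda> * (8 * W / \<epsilon> + 4)" using J(3) by (intro mult_left_mono) auto
    also have "\<dots> = 64 * real \<Lambda> / \<epsilon> * W + 32 * real \<Lambda> * 1" by (simp add: algebra_simps)
    also have "\<dots> \<le> H * W + H * exp 1"
      unfolding H_def using W \<epsilon> e1 by (intro add_mono mult_right_mono mult_mono) auto
    finally have "y \<le> H * (exp 1 + W)" by (simp add: algebra_simps)
    then have "ln y \<le> ln (H * (exp 1 + W))" using y by simp
    also have "\<dots> = ln H + ?L" using H W by (intro ln_mult_pos) (auto simp: add_pos_nonneg)
    also have "\<dots> \<le> (ln H + 1) * ?L" using mult_left_mono[OF L lH] by (simp add: algebra_simps)
    finally have lny: "ln y \<le> (ln H + 1) * ?L" .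
    have "real k \<le> 2 / ln 2 * ln y + 1" using k(2) by simp
    also have "\<dots> \<le> 2 / ln 2 * ((ln H + 1) * ?L) + ?L" using lny L l2 by (intro add_mono mult_left_mono) auto
    also have "\<dots> = (2 / ln 2 * (ln H + 1) + 1) * ?L"
      by (simp only: distrib_right mult.assoc mult_1_left)
    finally have "32 * real \<Lambda> * real k \<le> 32 * real \<Lambda> * ((2 / ln 2 * (ln H + 1) + 1) * ?L)"
      by (intro mult_left_mono) auto
    moreover have "(1 + 8 * c) * 1 \<le> (1 + 8 * c) * ?L" using L c by (intro mult_left_mono) auto
    ultimately have "1 + 32 * real \<Lambda> * real k + 8 * c \<le> C * ?L"
      unfolding C_def distrib_right[of _ _ ?L] by (simp add: mult.assoc distrib_right)
    then show ?thesis using J k2 by blast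
  qed
  show ?thesis by (rule that[OF C main])
qed

context dyadic_space
begin

text \<open>A set may be a cube of several generations; one of them is chosen, together with a centre.\<close>

definition gen_centre :: "(int \<Rightarrow> 'a set set) \<Rightarrow> 'a set \<Rightarrow> int \<times> 'a" where
  "gen_centre D P = (SOME (k, x). P \<in> D k \<and> x \<in> space M \<and> B x (\<delta> powi k) \<subseteq> P \<and> P \<subseteq> B x (C0 * \<delta> powi k))"

definition centre :: "(int \<Rightarrow> 'a set set) \<Rightarrow> 'a set \<Rightarrow> 'a" where
  "centre D P = snd (gen_centre D P)"

definition radius :: "(int \<Rightarrow> 'a set set) \<Rightarrow> 'a set \<Rightarrow> real" where
  "radius D P = \<delta> powi fst (gen_centre D P)"

lemma gen_centre:
  assumes D: "D \<in> \<D>" and P: "P \<in> cubes_of D"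
  shows "P \<in> D (fst (gen_centre D P))" "centre D P \<in> space M" "B (centre D P) (radius D P) \<subseteq> P"
    "P \<subseteq> B (centre D P) (C0 * radius D P)"
proof -
  obtain k where k: "P \<in> D k" by (rule cubes_ofE[OF D P])
  obtain x where x: "x \<in> space M \<and> B x (\<delta> powi k) \<subseteq> P \<and> P \<subseteq> B x (C0 * \<delta> powi k)"
    using cell_centre[OF D k] by (elim exE)
  have "\<exists>p. case p of (k, x) \<Rightarrow> P \<in> D k \<and> x \<in> space M \<and> B x (\<delta> powi k) \<subseteq> P \<and> P \<subseteq> B x (C0 * \<delta> powi k)"
    using k x by (intro exI[of _ "(k, x)"]) simp
  from someI_ex[OF this] show "P \<in> D (fst (gen_centre D P))" "centre D P \<in> space M" "B (centre D P) (radius D P) \<subseteq> P"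
    "P \<subseteq> B (centre D P) (C0 * radius D P)"
    unfolding gen_centre_def[symmetric] centre_def radius_def by (auto simp: case_prod_beta)
qed

lemma radius_pos: "0 < radius D P"
  unfolding radius_def using delta by (simp add: zero_less_power_int)

lemma centre_in: "D \<in> \<D> \<Longrightarrow> P \<in> cubes_of D \<Longrightarrow> centre D P \<in> P"
  using gen_centre(2,3) centre_in_ball[OF _ radius_pos] by blast

text \<open>A cube strictly contained in another has a strictly smaller generation, whichever
  generations have been chosen for the two sets.\<close>

lemma radius_mono:
  assumes D: "D \<in> \<D>" and P: "P \<in> cubes_of D" "Q \<in> cubes_of D" "P \<subseteq> Q"
  shows "radius D P \<le> radius D Q"
proof (cases "P = Q")
  case False
  then have "fst (gen_centre D P) < fst (gen_centre D Q)"
    using gen_less_of_psubset[OF D gen_centre(1)[OF D P(1)] gen_centre(1)[OF D P(2)]] P(3) by blast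
  then show ?thesis unfolding radius_def using delta by (intro power_int_increasing) auto
qed simp

lemma ball_le_cube: "\<exists>C\<ge>1. \<forall>D\<in>\<D>. \<forall>P\<in>cubes_of D. emeasure M (B (centre D P) (\<beta> * radius D P)) \<le> ennreal C * emeasure M P"
proof -
  obtain C where C: "1 \<le> C" "\<forall>x\<in>space M. \<forall>r>0. emeasure M (B x (\<beta> * r)) \<le> ennreal C * emeasure M (B x r)"
    using ball_scale[of \<beta>] by blast
  show ?thesis
  proof (intro exI[of _ C] conjI C(1) ballI)
    fix D P assume DP: "D \<in> \<D>" "P \<in> cubes_of D"
    have "emeasure M (B (centre D P) (\<beta> * radius D P)) \<le> ennreal C * emeasure M (B (centre D P) (radius D P))"
      using C(2) gen_centre(2)[OF DP] radius_pos by blast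
    also have "\<dots> \<le> ennreal C * emeasure M P"
      by (intro mult_left_mono emeasure_mono gen_centre(3)[OF DP] cubes_of_sets[OF DP]) simp
    finally show "emeasure M (B (centre D P) (\<beta> * radius D P)) \<le> ennreal C * emeasure M P" .
  qed
qed

section \<open>The maximal operator over all cubes\<close>

lemma cubes_countable: "countable (cubes \<D>)"
  unfolding cubes_eq by (rule countable_UN[OF countable_finite[OF finite_systems] cubes_of_countable])

lemma cube_measurable: "Q \<in> cubes \<D> \<Longrightarrow> Q \<in> sets M"
  unfolding cubes_eq using cubes_of_sets by blast

lemma cube_measure_pos: "Q \<in> cubes \<D> \<Longrightarrow> 0 < emeasure M Q"
  unfolding cubes_eq using cubes_of_pos by blast

lemma cube_measure_finite: "Q \<in> cubes \<D> \<Longrightarrow> emeasure M Q < \<infinity>"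
  unfolding cubes_eq using cubes_of_finite by blast

lemma maximal_upper:
  assumes "Q \<in> cubes \<D>" "x \<in> Q"
  shows "(\<integral>\<^sup>+y\<in>Q. ennreal \<bar>f y\<bar> \<partial>M) \<le> maximal M \<D> f x * emeasure M Q"
proof -
  have "(\<integral>\<^sup>+y\<in>Q. ennreal \<bar>f y\<bar> \<partial>M) / emeasure M Q \<le> maximal M \<D> f x"
    unfolding maximal_def by (rule SUP_upper) (use assms in auto)
  then have "(\<integral>\<^sup>+y\<in>Q. ennreal \<bar>f y\<bar> \<partial>M) / emeasure M Q * emeasure M Q \<le> maximal M \<D> f x * emeasure M Q"
    by (rule mult_right_mono) simp
  then show ?thesis using cube_measure_pos[OF assms(1)] cube_measure_finite[OF assms(1)]
    by (simp add: ennreal_divide_times mult_divide_eq_ennreal)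
qed

text \<open>Moving the condition x \<in> Q into an indicator gives a supremum over a fixed countable
  family, which makes measurability evident.\<close>

lemma maximal_eq: "maximal M \<D> f x =
    (SUP Q\<in>cubes \<D>. (\<integral>\<^sup>+y\<in>Q. ennreal \<bar>f y\<bar> \<partial>M) / emeasure M Q * indicator Q x)"
proof (rule antisym)
  show "maximal M \<D> f x \<le> (SUP Q\<in>cubes \<D>. (\<integral>\<^sup>+y\<in>Q. ennreal \<bar>f y\<bar> \<partial>M) / emeasure M Q * indicator Q x)"
    unfolding maximal_def
    by (rule SUP_least, rule SUP_upper2) auto
  show "(SUP Q\<in>cubes \<D>. (\<integral>\<^sup>+y\<in>Q. ennreal \<bar>f y\<bar> \<partial>M) / emeasure M Q * indicator Q x) \<le> maximal M \<D> f x"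
  proof (rule SUP_least)
    fix Q assume "Q \<in> cubes \<D>"
    then show "(\<integral>\<^sup>+y\<in>Q. ennreal \<bar>f y\<bar> \<partial>M) / emeasure M Q * indicator Q x \<le> maximal M \<D> f x"
      unfolding maximal_def by (cases "x \<in> Q") (auto intro: SUP_upper)
  qed
qed

lemma maximal_measurable[measurable]: "maximal M \<D> f \<in> borel_measurable M"
proof -
  have "(\<lambda>x. SUP Q\<in>cubes \<D>. (\<integral>\<^sup>+y\<in>Q. ennreal \<bar>f y\<bar> \<partial>M) / emeasure M Q * indicator Q x) \<in> borel_measurable M"
  proof (rule borel_measurable_SUP[OF cubes_countable])
    fix Q assume "Q \<in> cubes \<D>"
    then have [measurable]: "Q \<in> sets M" by (rule cube_measurable)
    show "(\<lambda>x. (\<integral>\<^sup>+y\<in>Q. ennreal \<bar>f y\<bar> \<partial>M) / emeasure M Q * indicator Q x) \<in> borel_measurable M"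
      by measurable
  qed
  then show ?thesis unfolding maximal_eq[symmetric] .
qed

lemma maximal_mono:
  assumes "\<And>x. \<bar>f x\<bar> \<le> \<bar>g x\<bar>"
  shows "maximal M \<D> f x \<le> maximal M \<D> g x"
  unfolding maximal_def
  by (intro SUP_mono' divide_right_mono_ennreal set_nn_integral_mono ennreal_leI assms)

lemma maximal_zero:
  assumes "f \<in> borel_measurable M" "AE x in M. f x = 0"
  shows "maximal M \<D> f x = 0"
proof -
  have "(\<integral>\<^sup>+y\<in>Q. ennreal \<bar>f y\<bar> \<partial>M) = 0" for Q
    using assms(2) nn_integral_cong_AE[of "\<lambda>y. ennreal \<bar>f y\<bar> * indicator Q y" "\<lambda>_. 0" M] by (auto simp: eventually_mono)
  then show ?thesis unfolding maximal_def by (auto simp: SUP_constant bot_ennreal)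
qed

text \<open>Within one system the cubes of large average are laminar, so no covering lemma is
  involved and the constant is 1. Adding up the systems gives the factor
  \<open>card \<D>\<close>.\<close>

lemma maximal_weak_type:
  assumes f[measurable]: "f \<in> borel_measurable M" and t: "0 \<le> t"
  shows "ennreal t * emeasure M {x\<in>space M. ennreal t < maximal M \<D> f x} \<le> of_nat (card \<D>) * (\<integral>\<^sup>+x. ennreal \<bar>f x\<bar> \<partial>M)"
proof -
  let ?F = "\<lambda>D. {P\<in>cubes_of D. ennreal t * emeasure M P \<le> (\<integral>\<^sup>+y\<in>P. ennreal \<bar>f y\<bar> \<partial>M)}"
  have Fs: "\<Union>(?F D) \<in> sets M" if "D \<in> \<D>" for D
    using cubes_of_sets[OF that] cubes_of_countable[OF that] by (intro sets.countable_Union) (auto intro: countable_subset)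
  have one: "ennreal t * emeasure M (\<Union>(?F D)) \<le> (\<integral>\<^sup>+x. ennreal \<bar>f x\<bar> \<partial>M)" if D: "D \<in> \<D>" for D
  proof -
    have "(\<integral>\<^sup>+x\<in>\<Union>(?F D). ennreal t \<partial>M) \<le> (\<integral>\<^sup>+x\<in>\<Union>(?F D). ennreal \<bar>f x\<bar> \<partial>M)"
      by (rule laminar_nn_integral_le)
        (use cubes_of_sets[OF D] cubes_of_countable[OF D] laminar_subset[OF cubes_of_laminar[OF D]]
          in \<open>auto simp: set_nn_integral_const intro: countable_subset\<close>)
    also have "\<dots> \<le> (\<integral>\<^sup>+x. ennreal \<bar>f x\<bar> \<partial>M)" by (rule set_nn_integral_le_space)
    finally show ?thesis using Fs[OF D] by (simp add: set_nn_integral_const)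
  qed
  have sub: "{x\<in>space M. ennreal t < maximal M \<D> f x} \<subseteq> (\<Union>D\<in>\<D>. \<Union>(?F D))"
  proof
    fix x assume "x \<in> {x\<in>space M. ennreal t < maximal M \<D> f x}"
    then obtain Q where Q: "Q \<in> cubes \<D>" "x \<in> Q" "ennreal t < (\<integral>\<^sup>+y\<in>Q. ennreal \<bar>f y\<bar> \<partial>M) / emeasure M Q"
      unfolding maximal_def by (auto simp: less_SUP_iff)
    have "ennreal t * emeasure M Q \<le> (\<integral>\<^sup>+y\<in>Q. ennreal \<bar>f y\<bar> \<partial>M) / emeasure M Q * emeasure M Q"
      using Q(3) by (intro mult_right_mono) auto
    also have "\<dots> = (\<integral>\<^sup>+y\<in>Q. ennreal \<bar>f y\<bar> \<partial>M)"
      using cube_measure_pos[OF Q(1)] cube_measure_finite[OF Q(1)]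
      by (simp add: ennreal_divide_times mult_divide_eq_ennreal)
    finally show "x \<in> (\<Union>D\<in>\<D>. \<Union>(?F D))" using Q(1,2) unfolding cubes_eq by blast
  qed
  have "emeasure M {x\<in>space M. ennreal t < maximal M \<D> f x} \<le> emeasure M (\<Union>D\<in>\<D>. \<Union>(?F D))"
    by (rule emeasure_mono[OF sub]) (use Fs finite_systems in auto)
  also have "\<dots> \<le> (\<Sum>D\<in>\<D>. emeasure M (\<Union>(?F D)))"
    by (rule emeasure_subadditive_finite) (use Fs finite_systems in auto)
  finally have "ennreal t * emeasure M {x\<in>space M. ennreal t < maximal M \<D> f x}
      \<le> (\<Sum>D\<in>\<D>. ennreal t * emeasure M (\<Union>(?F D)))"
    unfolding sum_distrib_left[symmetric] by (rule mult_left_mono) simp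
  also have "\<dots> \<le> (\<Sum>D\<in>\<D>. (\<integral>\<^sup>+x. ennreal \<bar>f x\<bar> \<partial>M))" by (rule sum_mono[OF one])
  finally show ?thesis by simp
qed

lemma ball_average_le_maximal:
  assumes "x \<in> space M" "0 < r" "z \<in> B x r"
  shows "(\<integral>\<^sup>+y\<in>B x r. ennreal \<bar>f y\<bar> \<partial>M) \<le> (ennreal c_cov * maximal M \<D> f z) * emeasure M (B x r)"
proof -
  obtain Q where Q: "Q \<in> cubes \<D>" "B x r \<subseteq> Q" "emeasure M Q \<le> ennreal c_cov * emeasure M (B x r)"
    using covering[OF assms(1,2)] by blast
  have "(\<integral>\<^sup>+y\<in>B x r. ennreal \<bar>f y\<bar> \<partial>M) \<le> (\<integral>\<^sup>+y\<in>Q. ennreal \<bar>f y\<bar> \<partial>M)"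
    by (rule set_nn_integral_subset[OF Q(2)])
  also have "\<dots> \<le> maximal M \<D> f z * emeasure M Q" by (rule maximal_upper) (use Q assms in auto)
  also have "\<dots> \<le> maximal M \<D> f z * (ennreal c_cov * emeasure M (B x r))" by (rule mult_left_mono[OF Q(3)]) simp
  finally show ?thesis by (simp add: mult_ac)
qed

section \<open>Weights and their constants\<close>

lemma cube_in_ball:
  assumes "Q \<in> cubes \<D>"
  obtains x r where "x \<in> space M" "Q \<subseteq> B x r"
  using assms gen_centre(2,4) unfolding cubes_eq by blast

lemma weight_measurable:
  assumes "weight \<rho> M w"
  shows "(\<lambda>x. ennreal (w x)) \<in> borel_measurable M"
proof -
  have [measurable]: "w \<in> borel_measurable M" using assms unfolding weight_def by simp
  show ?thesis by measurable
qed

lemma weight_cube_finite: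
  assumes w: "weight \<rho> M w" and Q: "Q \<in> cubes \<D>"
  shows "wmeas M w Q < \<infinity>"
proof -
  obtain x r where x: "x \<in> space M" "Q \<subseteq> B x r" by (rule cube_in_ball[OF Q])
  have "wmeas M w Q \<le> (\<integral>\<^sup>+y\<in>B x r. ennreal (w y) \<partial>M)"
    unfolding wmeas_def by (rule set_nn_integral_subset[OF x(2)])
  then show ?thesis using w x(1) unfolding weight_def by (auto intro: le_less_trans)
qed

lemma weight_cube_pos:
  assumes w: "weight \<rho> M w" and Q: "Q \<in> cubes \<D>"
  shows "wmeas M w Q \<noteq> 0"
proof
  have [measurable]: "w \<in> borel_measurable M" "Q \<in> sets M"
    using w cube_measurable[OF Q] unfolding weight_def by auto
  assume "wmeas M w Q = 0"
  then have "AE x in M. ennreal (w x) * indicator Q x = 0"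
    unfolding wmeas_def by (subst (asm) nn_integral_0_iff_AE) auto
  moreover have "AE x in M. 0 < w x" using w unfolding weight_def by simp
  ultimately have "AE x in M. x \<notin> Q" by eventually_elim (auto simp: indicator_def split: if_splits)
  then have "emeasure M Q = 0"
    using sets.sets_into_space[OF cube_measurable[OF Q]] by (subst (asm) AE_iff_measurable[of Q]) auto
  then show False using cube_measure_pos[OF Q] by simp
qed

lemma Ainf_maximal_bound:
  assumes w: "w \<in> Ainf \<rho> M \<D>" and Q: "Q \<in> cubes \<D>"
  shows "(\<integral>\<^sup>+x\<in>Q. maximal M \<D> (\<lambda>y. w y * indicator Q y) x \<partial>M)
    \<le> ennreal (enn2real (Ainf_const M \<D> w)) * wmeas M w Q"
proof -
  have wt: "weight \<rho> M w" and fin: "Ainf_const M \<D> w < \<infinity>" using w unfolding Ainf_def by auto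
  have "(\<integral>\<^sup>+x\<in>Q. maximal M \<D> (\<lambda>y. w y * indicator Q y) x \<partial>M) / wmeas M w Q \<le> Ainf_const M \<D> w"
    unfolding Ainf_const_def by (rule SUP_upper[OF Q])
  then have "(\<integral>\<^sup>+x\<in>Q. maximal M \<D> (\<lambda>y. w y * indicator Q y) x \<partial>M) / wmeas M w Q * wmeas M w Q
      \<le> Ainf_const M \<D> w * wmeas M w Q" by (rule mult_right_mono) simp
  then show ?thesis
    using weight_cube_pos[OF wt Q] weight_cube_finite[OF wt Q] fin
    by (simp add: ennreal_divide_times mult_divide_eq_ennreal)
qed

lemma wmeas_le_maximal:
  assumes "Q \<in> cubes \<D>" "x \<in> Q"
  shows "wmeas M w Q \<le> maximal M \<D> w x * emeasure M Q"
proof -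
  have "wmeas M w Q \<le> (\<integral>\<^sup>+y\<in>Q. ennreal \<bar>w y\<bar> \<partial>M)"
    unfolding wmeas_def by (intro set_nn_integral_mono ennreal_leI) simp
  also have "\<dots> \<le> maximal M \<D> w x * emeasure M Q" by (rule maximal_upper[OF assms])
  finally show ?thesis .
qed

text \<open>\<open>maximal_bound_small_sets\<close> for N = M(w \<chi>_Q) and W = [w]. Only subcubes
  of \<open>Q\<close> are tested there, so the localization of the weight to \<open>Q\<close> does
  no harm.\<close>

lemma Ainf_small_sets:
  assumes w: "w \<in> Ainf \<rho> M \<D>" and D: "D \<in> \<D>" and Q: "Q \<in> cubes_of D"
    and J: "8 * enn2real (Ainf_const M \<D> w) / \<epsilon> \<le> real J" "0 < J"
    and E: "E \<in> sets M" "E \<subseteq> Q" "2 ^ (J + 2) * emeasure M E \<le> emeasure M Q"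
  shows "2 * (\<integral>\<^sup>+x\<in>E. ennreal (w x) \<partial>M) \<le> (\<integral>\<^sup>+x\<in>Q. ennreal (w x) \<partial>M)"
proof -
  have wt: "weight \<rho> M w" using w unfolding Ainf_def by simp
  have Qc: "Q \<in> cubes \<D>" using D Q unfolding cubes_eq by blast
  show ?thesis
  proof (rule cube_family.maximal_bound_small_sets[OF cube_family_cubes_of[OF D] _ Q _ _ _ _ J E])
    show "(\<lambda>x. ennreal (w x)) \<in> borel_measurable M" by (rule weight_measurable[OF wt])
    show "0 \<le> enn2real (Ainf_const M \<D> w)" by simp
    show "(\<integral>\<^sup>+x\<in>Q. maximal M \<D> (\<lambda>y. w y * indicator Q y) x \<partial>M)
        \<le> ennreal (enn2real (Ainf_const M \<D> w)) * (\<integral>\<^sup>+x\<in>Q. ennreal (w x) \<partial>M)"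
      using Ainf_maximal_bound[OF w Qc] unfolding wmeas_def .
    show "(\<integral>\<^sup>+x\<in>Q. ennreal (w x) \<partial>M) < \<infinity>"
      using weight_cube_finite[OF wt Qc] unfolding wmeas_def .
    fix P x assume P: "P \<in> cubes_of D" "P \<subseteq> Q" "x \<in> P"
    then have Pc: "P \<in> cubes \<D>" using D unfolding cubes_eq by blast
    have "(\<integral>\<^sup>+y\<in>P. ennreal (w y) \<partial>M) \<le> wmeas M (\<lambda>y. w y * indicator Q y) P"
      unfolding wmeas_def using P(2) by (intro set_nn_integral_mono) auto
    also have "\<dots> \<le> maximal M \<D> (\<lambda>y. w y * indicator Q y) x * emeasure M P"
      by (rule wmeas_le_maximal[OF Pc P(3)])
    finally show "(\<integral>\<^sup>+y\<in>P. ennreal (w y) \<partial>M) \<le> maximal M \<D> (\<lambda>y. w y * indicator Q y) x * emeasure M P" .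
  qed
qed

text \<open>\<open>sparse_weak_type\<close> for the function s|f| and the weight Mw. The scale
  \<open>s\<close> allows every level of the weak type inequality to be reduced to the height
  1.\<close>

lemma sparse_weighted_bound:
  fixes \<Lambda> :: nat
  assumes \<Lambda>: "0 < \<Lambda>"
  obtains C where "0 < C" "\<And>w f D I (S :: 'i \<Rightarrow> 'a set) a s. w \<in> Ainf \<rho> M \<D> \<Longrightarrow> D \<in> \<D> \<Longrightarrow> f \<in> borel_measurable M \<Longrightarrow>
    finite I \<Longrightarrow> (\<And>i. i \<in> I \<Longrightarrow> S i \<in> cubes_of D) \<Longrightarrow>
    (\<And>i. i \<in> I \<Longrightarrow> (\<Sum>k\<in>{k\<in>I. S k \<subseteq> S i}. emeasure M (S k)) \<le> of_nat \<Lambda> * emeasure M (S i)) \<Longrightarrow>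
    (\<And>i. i \<in> I \<Longrightarrow> (\<integral>\<^sup>+x\<in>S i. ennreal \<bar>f x\<bar> \<partial>M) = ennreal (a i) * emeasure M (S i)) \<Longrightarrow>
    (\<And>i. i \<in> I \<Longrightarrow> 0 \<le> a i) \<Longrightarrow> 0 \<le> s \<Longrightarrow>
    wmeas M w {x\<in>space M. 1 < (\<Sum>i\<in>I. s * a i * indicator (S i) x)}
      \<le> ennreal (C * ln (exp 1 + enn2real (Ainf_const M \<D> w)) * s) * (\<integral>\<^sup>+x. ennreal \<bar>f x\<bar> * maximal M \<D> w x \<partial>M)"
proof -
  obtain c where c: "0 < c" "\<And>n::nat. (real n + 1) ^ 6 \<le> c * 2 ^ n" using power6_le_exp by blast
  obtain C where C: "0 < C" "\<And>W. 0 \<le> W \<Longrightarrow> \<exists>J k::nat. 0 < J \<and> 8 * W / \<epsilon> \<le> real J \<and>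
    (4 * ((J + 2) * (2 * \<Lambda>)))\<^sup>2 \<le> (2::nat) ^ k \<and> 1 + 32 * real \<Lambda> * real k + 8 * c \<le> C * ln (exp 1 + W)"
    by (rule log_constant[OF eps_pos \<Lambda> c(1)]) blast
  have "wmeas M w {x\<in>space M. 1 < (\<Sum>i\<in>I. s * a i * indicator (S i) x)}
      \<le> ennreal (C * ln (exp 1 + enn2real (Ainf_const M \<D> w)) * s) * (\<integral>\<^sup>+x. ennreal \<bar>f x\<bar> * maximal M \<D> w x \<partial>M)"
    if w: "w \<in> Ainf \<rho> M \<D>" and D: "D \<in> \<D>" and f[measurable]: "f \<in> borel_measurable M" and fin: "finite I"
      and S: "\<And>i. i \<in> I \<Longrightarrow> S i \<in> cubes_of D"
      and car: "\<And>i. i \<in> I \<Longrightarrow> (\<Sum>k\<in>{k\<in>I. S k \<subseteq> S i}. emeasure M (S k)) \<le> of_nat \<Lambda> * emeasure M (S i)"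
      and avg: "\<And>i. i \<in> I \<Longrightarrow> (\<integral>\<^sup>+x\<in>S i. ennreal \<bar>f x\<bar> \<partial>M) = ennreal (a i) * emeasure M (S i)"
      and a0: "\<And>i. i \<in> I \<Longrightarrow> 0 \<le> a i" and s: "0 \<le> s"
    for w f D I and S :: "'i \<Rightarrow> 'a set" and a s
  proof -
    let ?W = "enn2real (Ainf_const M \<D> w)"
    let ?G = "\<integral>\<^sup>+x. ennreal \<bar>f x\<bar> * maximal M \<D> w x \<partial>M"
    obtain J k where Jk: "0 < J" "8 * ?W / \<epsilon> \<le> real J" "(4 * ((J + 2) * (2 * \<Lambda>)))\<^sup>2 \<le> (2::nat) ^ k"
      "1 + 32 * real \<Lambda> * real k + 8 * c \<le> C * ln (exp 1 + ?W)" using C(2)[of ?W] by auto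
    have wm: "(\<lambda>x. ennreal (w x)) \<in> borel_measurable M"
      using w unfolding Ainf_def by (intro weight_measurable) auto
    have "(\<integral>\<^sup>+x\<in>{x\<in>space M. 1 < (\<Sum>i\<in>I. s * a i * indicator (S i) x)}. ennreal (w x) \<partial>M)
        \<le> ennreal (1 + 32 * real \<Lambda> * real k + 8 * c) * (\<integral>\<^sup>+x. (ennreal s * ennreal \<bar>f x\<bar>) * maximal M \<D> w x \<partial>M)"
    proof (rule cube_family.sparse_weak_type[OF cube_family_cubes_of[OF D] _ wm maximal_measurable _ fin S car \<Lambda>
          _ _ _ _ Jk(3) c])
      show "(\<lambda>x. ennreal s * ennreal \<bar>f x\<bar>) \<in> borel_measurable M" by measurable
      show "0 \<le> s * a i" if "i \<in> I" for i using a0[OF that] s by simp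
      show "0 < J + 2" by simp
      show "(\<integral>\<^sup>+y\<in>P. ennreal (w y) \<partial>M) \<le> maximal M \<D> w x * emeasure M P" if "P \<in> cubes_of D" "x \<in> P" for P x
        using wmeas_le_maximal[of P x w] that D unfolding wmeas_def cubes_eq by blast
      show "(\<integral>\<^sup>+x\<in>S i. ennreal s * ennreal \<bar>f x\<bar> \<partial>M) = ennreal (s * a i) * emeasure M (S i)" if i: "i \<in> I" for i
      proof -
        have [measurable]: "S i \<in> sets M" by (rule cubes_of_sets[OF D S[OF i]])
        have "(\<integral>\<^sup>+x\<in>S i. ennreal s * ennreal \<bar>f x\<bar> \<partial>M) = ennreal s * (\<integral>\<^sup>+x\<in>S i. ennreal \<bar>f x\<bar> \<partial>M)"
          by (simp add: mult.assoc nn_integral_cmult)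
        then show ?thesis unfolding avg[OF i] using s a0[OF i] by (simp add: ennreal_mult mult.assoc)
      qed
      show "2 * (\<integral>\<^sup>+x\<in>E. ennreal (w x) \<partial>M) \<le> (\<integral>\<^sup>+x\<in>S i. ennreal (w x) \<partial>M)"
        if "i \<in> I" "E \<in> sets M" "E \<subseteq> S i" "2 ^ (J + 2) * emeasure M E \<le> emeasure M (S i)" for i E
        by (rule Ainf_small_sets[OF w D S[OF that(1)] Jk(2,1) that(2-4)])
    qed
    also have "(\<integral>\<^sup>+x. (ennreal s * ennreal \<bar>f x\<bar>) * maximal M \<D> w x \<partial>M) = ennreal s * ?G"
      by (simp add: mult.assoc nn_integral_cmult)
    also have "ennreal (1 + 32 * real \<Lambda> * real k + 8 * c) * (ennreal s * ?G)
        \<le> ennreal (C * ln (exp 1 + ?W)) * (ennreal s * ?G)"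
      by (intro mult_right_mono ennreal_leI Jk(4)) simp
    also have "\<dots> = ennreal (C * ln (exp 1 + ?W) * s) * ?G"
    proof -
      have "1 \<le> exp (1::real) + ?W" by (simp add: add_increasing2)
      then have "0 \<le> C * ln (exp 1 + ?W)" using C(1) by simp
      then show ?thesis unfolding mult.assoc[symmetric] using s by (simp only: ennreal_mult)
    qed
    finally show ?thesis unfolding wmeas_def .
  qed
  then show ?thesis by (rule that[OF C(1)])
qed

lemma maximal_le_maximal_r:
  assumes w: "weight \<rho> M w" and r: "1 \<le> r"
  shows "maximal M \<D> w x \<le> maximal_r M \<D> r w x"
proof (cases "maximal M \<D> (\<lambda>y. w y powr r) x = \<infinity>")
  case True
  then show ?thesis unfolding maximal_r_def ennreal_powr_def by simp
next
  case False
  define m where "m = enn2real (maximal M \<D> (\<lambda>y. w y powr r) x)"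
  have m0: "0 \<le> m" unfolding m_def by simp
  have me: "maximal M \<D> (\<lambda>y. w y powr r) x = ennreal m"
    unfolding m_def using False by (simp add: less_top)
  have wm[measurable]: "w \<in> borel_measurable M" and wpos: "AE y in M. 0 < w y"
    using w unfolding weight_def by auto
  define s where "s = m powr (1 / r)"
  have "(\<integral>\<^sup>+y\<in>Q. ennreal \<bar>w y\<bar> \<partial>M) / emeasure M Q \<le> ennreal s" if Q: "Q \<in> cubes \<D>" "x \<in> Q" for Q
  proof -
    have [measurable]: "Q \<in> sets M" by (rule cube_measurable[OF Q(1)])
    have le: "(\<integral>\<^sup>+y\<in>Q. ennreal \<bar>w y powr r\<bar> \<partial>M) \<le> ennreal m * emeasure M Q"
      using maximal_upper[OF Q, of "\<lambda>y. w y powr r"] unfolding me .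
    have "(\<integral>\<^sup>+y\<in>Q. ennreal \<bar>w y\<bar> \<partial>M) \<le> ennreal s * emeasure M Q"
    proof (cases "m = 0")
      \<comment> \<open>Separated because the general case divides by a power of s = 0. Here w
        vanishes almost everywhere on \<open>Q\<close>.\<close>
      case True
      then have "(\<integral>\<^sup>+y\<in>Q. ennreal \<bar>w y powr r\<bar> \<partial>M) = 0" using le by simp
      then have "AE y in M. ennreal \<bar>w y powr r\<bar> * indicator Q y = 0" by (subst (asm) nn_integral_0_iff_AE) auto
      then have "AE y in M. ennreal \<bar>w y\<bar> * indicator Q y = 0"
        by eventually_elim (auto simp: indicator_def split: if_splits)
      then have "(\<integral>\<^sup>+y\<in>Q. ennreal \<bar>w y\<bar> \<partial>M) = 0" by (subst nn_integral_0_iff_AE) auto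
      then show ?thesis by simp
    next
      case False
      then have m: "0 < m" using m0 by simp
      have s: "0 < s" "s powr r = m" unfolding s_def using m r by (auto simp: powr_powr)
      \<comment> \<open>Young's inequality for u^r and m with exponents 1/r and 1 - 1/r, sharp at u
        = s. Averaged over \<open>Q\<close>, the right side becomes at most m = s^(r-1) s, so that
        dividing by s^(r-1) bounds the average of w by s.\<close>
      have young: "u * s powr (r - 1) \<le> 1 / r * u powr r + (1 - 1 / r) * m" if "0 < u" for u
      proof -
        have "(u powr r) powr (1 / r) * m powr (1 - 1 / r) \<le> 1 / r * u powr r + (1 - 1 / r) * m"
          by (rule Youngs_inequality_0) (use r that m in auto)
        moreover have "(u powr r) powr (1 / r) = u" using r that by (simp add: powr_powr)
        moreover have "m powr (1 - 1 / r) = s powr (r - 1)"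
          unfolding s_def using r by (simp add: powr_powr diff_divide_distrib)
        ultimately show ?thesis by simp
      qed
      let ?k = "s powr (r - 1)"
      have k: "0 < ?k" using s(1) by simp
      have "ennreal ?k * (\<integral>\<^sup>+y\<in>Q. ennreal \<bar>w y\<bar> \<partial>M) = (\<integral>\<^sup>+y. ennreal ?k * (ennreal \<bar>w y\<bar> * indicator Q y) \<partial>M)"
        by (rule nn_integral_cmult[symmetric]) measurable
      also have "\<dots> \<le> (\<integral>\<^sup>+y. ennreal (1 / r) * (ennreal \<bar>w y powr r\<bar> * indicator Q y)
          + ennreal ((1 - 1 / r) * m) * indicator Q y \<partial>M)"
      proof (rule nn_integral_mono_AE)
        show "AE y in M. ennreal ?k * (ennreal \<bar>w y\<bar> * indicator Q y)
          \<le> ennreal (1 / r) * (ennreal \<bar>w y powr r\<bar> * indicator Q y) + ennreal ((1 - 1 / r) * m) * indicator Q y"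
          using wpos
        proof eventually_elim
          case (elim y)
          have "ennreal (w y * ?k) \<le> ennreal (1 / r * w y powr r + (1 - 1 / r) * m)"
            by (rule ennreal_leI[OF young[OF elim]])
          then show ?case using elim k r m
            by (auto simp: indicator_def ennreal_plus ennreal_mult[symmetric] mult.commute simp del: times_divide_eq_right)
        qed
      qed
      also have "\<dots> = ennreal (1 / r) * (\<integral>\<^sup>+y\<in>Q. ennreal \<bar>w y powr r\<bar> \<partial>M) + ennreal ((1 - 1 / r) * m) * emeasure M Q"
        by (subst nn_integral_add, measurable) (simp add: nn_integral_cmult nn_integral_cmult_indicator)
      also have "\<dots> \<le> ennreal (1 / r) * (ennreal m * emeasure M Q) + ennreal ((1 - 1 / r) * m) * emeasure M Q"
        by (intro add_mono mult_left_mono le) auto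
      also have "\<dots> = ennreal (1 / r * m + (1 - 1 / r) * m) * emeasure M Q"
        using r m by (simp add: ennreal_plus ennreal_mult distrib_right mult.assoc del: times_divide_eq_left times_divide_eq_right)
      also have "1 / r * m + (1 - 1 / r) * m = m" by (simp add: algebra_simps)
      also have "m = ?k * s"
        using s powr_add[of s "r - 1" 1] by simp
      also have "ennreal (?k * s) * emeasure M Q = ennreal ?k * (ennreal s * emeasure M Q)"
        using s k by (simp add: ennreal_mult mult.assoc)
      finally show ?thesis using k by (subst (asm) ennreal_mult_le_mult_iff) auto
    qed
    then show ?thesis using cube_measure_pos[OF Q(1)]
      by (intro divide_le_posI_ennreal) (auto simp: mult.commute)
  qed
  then have "maximal M \<D> w x \<le> ennreal s" unfolding maximal_def by (intro SUP_least) auto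
  also have "ennreal s = maximal_r M \<D> r w x"
    unfolding maximal_r_def ennreal_powr_def me s_def using m0 by simp
  finally show ?thesis .
qed

text \<open>On a cube, M(w \<chi>_Q) is at least the average of w. The bound keeps the denominator
  in the definition of r positive, whence r \<ge> 1; a nonempty space is required for a cube to
  exist.\<close>

lemma Ainf_const_ge_1:
  assumes w: "w \<in> Ainf \<rho> M \<D>" and ne: "space M \<noteq> {}"
  shows "1 \<le> enn2real (Ainf_const M \<D> w)"
proof -
  have wt: "weight \<rho> M w" and fin: "Ainf_const M \<D> w < \<infinity>" using w unfolding Ainf_def by auto
  obtain x where x: "x \<in> space M" using ne by blast
  obtain Q where Q: "Q \<in> cubes \<D>" using covering[OF x, of 1] by auto
  have [measurable]: "Q \<in> sets M" by (rule cube_measurable[OF Q])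
  have "wmeas M w Q = wmeas M w Q / emeasure M Q * emeasure M Q"
    using cube_measure_pos[OF Q] cube_measure_finite[OF Q]
    by (simp add: ennreal_divide_times mult_divide_eq_ennreal)
  also have "\<dots> = (\<integral>\<^sup>+x\<in>Q. wmeas M w Q / emeasure M Q \<partial>M)" by (simp add: set_nn_integral_const)
  also have "\<dots> \<le> (\<integral>\<^sup>+x\<in>Q. maximal M \<D> (\<lambda>y. w y * indicator Q y) x \<partial>M)"
  proof (rule set_nn_integral_mono)
    fix x assume x: "x \<in> Q"
    have "wmeas M w Q = wmeas M (\<lambda>y. w y * indicator Q y) Q"
      unfolding wmeas_def by (intro nn_integral_cong) (auto simp: indicator_def)
    also have "\<dots> \<le> maximal M \<D> (\<lambda>y. w y * indicator Q y) x * emeasure M Q"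
      by (rule wmeas_le_maximal[OF Q x])
    finally show "wmeas M w Q / emeasure M Q \<le> maximal M \<D> (\<lambda>y. w y * indicator Q y) x"
      using cube_measure_pos[OF Q] by (intro divide_le_posI_ennreal) (auto simp: mult.commute)
  qed
  also have "\<dots> \<le> ennreal (enn2real (Ainf_const M \<D> w)) * wmeas M w Q" by (rule Ainf_maximal_bound[OF w Q])
  finally have le: "wmeas M w Q \<le> ennreal (enn2real (Ainf_const M \<D> w)) * wmeas M w Q" .
  define v where "v = enn2real (wmeas M w Q)"
  have v: "wmeas M w Q = ennreal v" "0 < v"
    using weight_cube_pos[OF wt Q] weight_cube_finite[OF wt Q] unfolding v_def
    by (auto simp: enn2real_positive_iff zero_less_iff_neq_zero)
  have "v \<le> enn2real (Ainf_const M \<D> w) * v" using le v(2) unfolding v(1) by (simp add: ennreal_mult[symmetric])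
  then show ?thesis using v(2) by simp
qed

text \<open>For each cube the essential supremum bounds 1/w off a null set. There are countably many
  cubes, so one null set serves for all of them.\<close>

lemma A1_maximal_le:
  assumes w: "w \<in> A1 \<rho> M \<D>"
  shows "AE x in M. maximal M \<D> w x \<le> ennreal (enn2real (A1_const M \<D> w)) * ennreal (w x)"
proof -
  let ?c = "enn2real (A1_const M \<D> w)"
  have wt: "weight \<rho> M w" and fin: "A1_const M \<D> w < \<infinity>" using w unfolding A1_def by auto
  have wm[measurable]: "w \<in> borel_measurable M" and wpos: "AE x in M. 0 < w x"
    using wt unfolding weight_def by auto
  have upper: "AE x in M. \<forall>Q\<in>cubes \<D>. x \<in> Q \<longrightarrow> wmeas M w Q / emeasure M Q * inverse (ennreal (w x)) \<le> ennreal ?c"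
  proof (subst AE_ball_countable[OF cubes_countable], rule ballI)
    fix Q assume Q: "Q \<in> cubes \<D>"
    let ?e = "esssup (restrict_space M Q) (\<lambda>x. inverse (ennreal (w x)))"
    have "wmeas M w Q / emeasure M Q * ?e \<le> A1_const M \<D> w"
      unfolding A1_const_def by (rule SUP_upper[OF Q])
    also have "\<dots> = ennreal ?c" using fin by simp
    finally have c: "wmeas M w Q / emeasure M Q * ?e \<le> ennreal ?c" .
    have cubes_of: "Q \<inter> space M \<in> sets M" using cube_measurable[OF Q] by auto
    have "AE x in M. x \<in> Q \<longrightarrow> inverse (ennreal (w x)) \<le> ?e"
      using esssup_AE[where M = "restrict_space M Q" and f = "\<lambda>x. inverse (ennreal (w x))"] unfolding AE_restrict_space_iff[OF cubes_of] .
    then show "AE x in M. x \<in> Q \<longrightarrow> wmeas M w Q / emeasure M Q * inverse (ennreal (w x)) \<le> ennreal ?c"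
      by eventually_elim (use c in \<open>meson mult_left_mono order_trans zero_le\<close>)
  qed
  \<comment> \<open>The maximal operator averages |w|, while w is positive only almost
    everywhere.\<close>
  have abs_w: "(\<integral>\<^sup>+y\<in>Q. ennreal \<bar>w y\<bar> \<partial>M) = wmeas M w Q" for Q
    unfolding wmeas_def by (rule nn_integral_cong_AE) (use wpos in eventually_elim, simp)
  show ?thesis using upper wpos
  proof eventually_elim
    case (elim x)
    show ?case unfolding maximal_def
    proof (rule SUP_least)
      fix Q assume Q: "Q \<in> {Q\<in>cubes \<D>. x \<in> Q}"
      let ?q = "wmeas M w Q / emeasure M Q"
      have "?q * inverse (ennreal (w x)) * ennreal (w x) \<le> ennreal ?c * ennreal (w x)"
        using elim(1) Q by (intro mult_right_mono) auto
      moreover have "inverse (ennreal (w x)) * ennreal (w x) = 1"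
        using elim(2) by (simp add: inverse_ennreal ennreal_mult[symmetric])
      ultimately show "(\<integral>\<^sup>+y\<in>Q. ennreal \<bar>w y\<bar> \<partial>M) / emeasure M Q \<le> ennreal ?c * ennreal (w x)"
        unfolding abs_w by (simp add: mult.assoc)
    qed
  qed
qed

text \<open>The localized maximal function is at most Mw, hence at most the A_1 constant times w;
  integration over \<open>Q\<close> bounds [w] by the A_1 constant. This brings the second claim
  under the estimate for A_infinity weights.\<close>

lemma A1_subset_Ainf:
  assumes w: "w \<in> A1 \<rho> M \<D>"
  shows "w \<in> Ainf \<rho> M \<D>"
proof -
  let ?c = "enn2real (A1_const M \<D> w)"
  have wt: "weight \<rho> M w" using w unfolding A1_def by auto
  have "Ainf_const M \<D> w \<le> ennreal ?c"
    unfolding Ainf_const_def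
  proof (rule SUP_least)
    fix Q assume Q: "Q \<in> cubes \<D>"
    have [measurable]: "Q \<in> sets M" "(\<lambda>x. ennreal (w x)) \<in> borel_measurable M"
      using cube_measurable[OF Q] weight_measurable[OF wt] by auto
    have "(\<integral>\<^sup>+x\<in>Q. maximal M \<D> (\<lambda>y. w y * indicator Q y) x \<partial>M) \<le> (\<integral>\<^sup>+x\<in>Q. ennreal ?c * ennreal (w x) \<partial>M)"
    proof (rule nn_integral_mono_AE)
      show "AE x in M. maximal M \<D> (\<lambda>y. w y * indicator Q y) x * indicator Q x \<le> ennreal ?c * ennreal (w x) * indicator Q x"
        using A1_maximal_le[OF w]
      proof eventually_elim
        case (elim x)
        have "maximal M \<D> (\<lambda>y. w y * indicator Q y) x \<le> maximal M \<D> w x"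
          by (rule maximal_mono) (auto simp: indicator_def)
        then show ?case using elim by (intro mult_right_mono) auto
      qed
    qed
    also have "\<dots> = ennreal ?c * wmeas M w Q"
      unfolding wmeas_def by (simp add: mult.assoc nn_integral_cmult)
    finally show "(\<integral>\<^sup>+x\<in>Q. maximal M \<D> (\<lambda>y. w y * indicator Q y) x \<partial>M) / wmeas M w Q \<le> ennreal ?c"
      using weight_cube_pos[OF wt Q] by (intro divide_le_posI_ennreal) (auto simp: mult.commute zero_less_iff_neq_zero)
  qed
  then show ?thesis using wt unfolding Ainf_def by (auto intro: le_less_trans)
qed

end

section \<open>Calderon-Zygmund operators\<close>

text \<open>Continuity from above along an enumeration. It permits the Calderon-Zygmund
  decomposition to use finitely many cubes.\<close>

lemma finite_subfamily_small_rest: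
  assumes F: "countable F" "\<And>P. P \<in> F \<Longrightarrow> P \<in> sets N" and fin: "emeasure N (\<Union>F) < \<infinity>" and \<eta>: "0 < (\<eta>::real)"
  shows "\<exists>E\<subseteq>F. finite E \<and> emeasure N (\<Union>F - \<Union>E) \<le> ennreal \<eta>"
proof (cases "F = {}")
  case False
  let ?p = "from_nat_into F"
  have r: "range ?p = F" using False F(1) by (rule range_from_nat_into)
  have sub: "?p ` {..n} \<subseteq> F" for n using r by blast
  have U: "\<Union>F \<in> sets N" using F by (intro sets.countable_Union) auto
  have s: "\<Union>F - \<Union>(?p ` {..n}) \<in> sets N" for n
    by (rule sets.Diff[OF U sets.finite_Union]) (use sub[of n] F(2) in auto)
  have "\<exists>n. emeasure N (\<Union>F - \<Union>(?p ` {..n})) \<le> ennreal \<eta>"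
  proof (rule decreasing_small[OF s _ _ _ \<eta>])
    show "decseq (\<lambda>n. \<Union>F - \<Union>(?p ` {..n}))" unfolding decseq_def by force
    have "\<Union>F = (\<Union>n. \<Union>(?p ` {..n}))" by (subst r[symmetric]) auto
    then show "(\<Inter>n. \<Union>F - \<Union>(?p ` {..n})) = {}" by blast
    show "emeasure N (\<Union>F - \<Union>(?p ` {..0})) < \<infinity>"
      by (rule le_less_trans[OF emeasure_mono[OF Diff_subset U] fin])
  qed
  then obtain n where "emeasure N (\<Union>F - \<Union>(?p ` {..n})) \<le> ennreal \<eta>" by blast
  then show ?thesis using sub[of n] by (intro exI[of _ "?p ` {..n}"]) auto
qed (auto intro!: exI[of _ "{}"])

lemma sum_disjoint_nn_integral_le:
  assumes g[measurable]: "g \<in> borel_measurable M" and F: "finite F" "disjoint F" "\<And>P. P \<in> F \<Longrightarrow> P \<in> sets M"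
  shows "(\<Sum>P\<in>F. \<integral>\<^sup>+x\<in>P. g x \<partial>M) \<le> (\<integral>\<^sup>+x. g x \<partial>M)"
proof -
  have "(\<Sum>P\<in>F. \<integral>\<^sup>+x\<in>P. g x \<partial>M) = (\<Sum>P\<in>F. emeasure (density M g) P)"
    using F by (intro sum.cong) (auto simp: emeasure_density)
  also have "\<dots> = emeasure (density M g) (\<Union>P\<in>F. P)"
    using F by (intro sum_emeasure) (auto simp: disjoint_family_on_def pairwise_def disjnt_def)
  also have "\<dots> \<le> emeasure (density M g) (space M)"
    using F(3) sets.sets_into_space[of _ M] by (intro emeasure_mono) auto
  also have "\<dots> = (\<integral>\<^sup>+x. g x \<partial>M)" by (simp add: emeasure_density cong: nn_integral_cong)
  finally show ?thesis .
qed

section \<open>Square integrable functions\<close>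

lemma L2_I: "f \<in> borel_measurable M \<Longrightarrow> integrable M (\<lambda>x. (f x)\<^sup>2) \<Longrightarrow> f \<in> L2 M"
  by (simp add: L2_def)

lemma L2_measurable: "f \<in> L2 M \<Longrightarrow> f \<in> borel_measurable M"
  by (simp add: L2_def)

lemma L2_dominated:
  assumes "g \<in> L2 M" "f \<in> borel_measurable M" "\<And>x. x \<in> space M \<Longrightarrow> \<bar>f x\<bar> \<le> \<bar>g x\<bar>"
  shows "f \<in> L2 M"
proof (rule L2_I[OF assms(2)])
  show "integrable M (\<lambda>x. (f x)\<^sup>2)"
  proof (rule Bochner_Integration.integrable_bound)
    show "integrable M (\<lambda>x. (g x)\<^sup>2)" using assms(1) by (simp add: L2_def)
    show "AE x in M. norm ((f x)\<^sup>2) \<le> norm ((g x)\<^sup>2)"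
      using assms(3) by (intro AE_I2) (simp add: power2_le_iff_abs_le abs_le_square_iff[symmetric])
  qed (use assms in auto)
qed

lemma L2_finite_nn_integral:
  assumes "f \<in> borel_measurable M" "(\<integral>\<^sup>+x. ennreal ((f x)\<^sup>2) \<partial>M) < \<infinity>"
  shows "f \<in> L2 M"
  using assms by (intro L2_I integrableI_bounded) auto

lemma L2_nn_integral: "f \<in> L2 M \<Longrightarrow> (\<integral>\<^sup>+x. ennreal ((f x)\<^sup>2) \<partial>M) < \<infinity>"
  unfolding L2_def by (auto simp: integrable_iff_bounded)

lemma L2_linear:
  assumes f: "f \<in> L2 M" "g \<in> L2 M"
  shows "(\<lambda>x. a * f x + b * g x) \<in> L2 M"
proof (rule L2_I)
  have m: "f \<in> borel_measurable M" "g \<in> borel_measurable M" using f by (auto simp: L2_def)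
  then show "(\<lambda>x. a * f x + b * g x) \<in> borel_measurable M" by auto
  show "integrable M (\<lambda>x. (a * f x + b * g x)\<^sup>2)"
  proof (rule Bochner_Integration.integrable_bound)
    show "integrable M (\<lambda>x. 2 * (a\<^sup>2 * (f x)\<^sup>2) + 2 * (b\<^sup>2 * (g x)\<^sup>2))"
      using f by (auto simp: L2_def)
    have *: "(s + t)\<^sup>2 \<le> 2 * s\<^sup>2 + 2 * t\<^sup>2" for s t :: real
      using sum_squares_bound[of s t] by (simp add: power2_sum)
    show "AE x in M. norm ((a * f x + b * g x)\<^sup>2) \<le> norm (2 * (a\<^sup>2 * (f x)\<^sup>2) + 2 * (b\<^sup>2 * (g x)\<^sup>2))"
      using *[of "a * f _" "b * g _"] by (intro AE_I2) (simp add: power_mult_distrib)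
  qed (use m in auto)
qed

lemma L2_cut:
  assumes "f \<in> L2 M" "S \<in> sets M"
  shows "(\<lambda>x. f x * indicator S x) \<in> L2 M"
proof (rule L2_dominated[OF assms(1)])
  show "(\<lambda>x. f x * indicator S x) \<in> borel_measurable M"
    using L2_measurable[OF assms(1)] assms(2) by measurable
qed (auto simp: indicator_def)

lemma L2_sum:
  "finite F \<Longrightarrow> (\<And>i. i \<in> F \<Longrightarrow> h i \<in> L2 M) \<Longrightarrow> (\<lambda>x. \<Sum>i\<in>F. h i x :: real) \<in> L2 M"
proof (induction F rule: finite_induct)
  case empty
  then show ?case by (auto simp: L2_def)
next
  case (insert i F)
  then show ?case using L2_linear[of "h i" M "\<lambda>x. \<Sum>i\<in>F. h i x" 1 1] by simp
qed

lemma term_le_suminf: "f m \<le> (\<Sum>m. f m :: ennreal)"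
  using sum_le_suminf[of f "{m}"] by simp

section \<open>The operator and its kernel\<close>

locale cz_space = dyadic_space \<rho> M \<kappa> A \<epsilon> \<D> \<delta> C0 c_cov
  for \<rho> :: "'a \<Rightarrow> 'a \<Rightarrow> real" and M :: "'a measure" and \<kappa> A \<epsilon> \<D> \<delta> C0 c_cov +
  fixes T :: "('a \<Rightarrow> real) \<Rightarrow> 'a \<Rightarrow> real" and K :: "'a \<Rightarrow> 'a \<Rightarrow> real" and \<eta> CK b :: real
  assumes T_L2: "\<And>f. f \<in> L2 M \<Longrightarrow> T f \<in> L2 M"
    and T_linear: "\<And>f g a b. f \<in> L2 M \<Longrightarrow> g \<in> L2 M \<Longrightarrow>
      AE x in M. T (\<lambda>y. a * f y + b * g y) x = a * T f x + b * T g x"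
    and b0: "0 \<le> b"
    and T_bounded: "\<And>f. f \<in> L2 M \<Longrightarrow> (\<integral>\<^sup>+x. ennreal ((T f x)\<^sup>2) \<partial>M) \<le> ennreal b * (\<integral>\<^sup>+x. ennreal ((f x)\<^sup>2) \<partial>M)"
    and eta: "0 < \<eta>" and CK0: "0 \<le> CK"
    and kernel_size: "\<And>x y. x \<in> space M \<Longrightarrow> y \<in> space M \<Longrightarrow> x \<noteq> y \<Longrightarrow> \<bar>K x y\<bar> \<le> CK / measure M (B x (\<rho> x y))"
    and kernel_smooth1: "\<And>x y z. x \<in> space M \<Longrightarrow> y \<in> space M \<Longrightarrow> z \<in> space M \<Longrightarrow> x \<noteq> y \<Longrightarrow> z \<noteq> y \<Longrightarrow> \<rho> x z \<le> \<eta> * \<rho> x y \<Longrightarrow>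
      \<bar>K z y - K x y\<bar> \<le> (\<rho> z x / \<rho> x y) powr \<eta> * (1 / measure M (B x (\<rho> x y)))"
    and kernel_smooth2: "\<And>x y z. x \<in> space M \<Longrightarrow> y \<in> space M \<Longrightarrow> z \<in> space M \<Longrightarrow> x \<noteq> y \<Longrightarrow> z \<noteq> y \<Longrightarrow> \<rho> x z \<le> \<eta> * \<rho> x y \<Longrightarrow>
      \<bar>K y z - K y x\<bar> \<le> (\<rho> z x / \<rho> x y) powr \<eta> * (1 / measure M (B x (\<rho> x y)))"
    and T_kernel: "\<And>f. f \<in> L2 M \<Longrightarrow> AE x in M. x \<notin> ess_support \<rho> M f \<longrightarrow> T f x = (\<integral>y. K x y * f y \<partial>M)"
begin

lemma T_measurable[measurable]: "f \<in> L2 M \<Longrightarrow> T f \<in> borel_measurable M"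
  using T_L2 L2_measurable by blast

lemma T_add:
  assumes "f \<in> L2 M" "g \<in> L2 M" "\<And>x. h x = f x + g x"
  shows "AE x in M. T h x = T f x + T g x"
proof -
  have "h = (\<lambda>y. 1 * f y + 1 * g y)" using assms(3) by auto
  then show ?thesis using T_linear[OF assms(1,2), of 1 1] by simp
qed

text \<open>With linearity this shows that \<open>T\<close> respects equality almost
  everywhere.\<close>

lemma T_null:
  assumes "f \<in> L2 M" "AE x in M. f x = 0"
  shows "AE x in M. T f x = 0"
proof -
  have [measurable]: "f \<in> borel_measurable M" using assms(1) by (rule L2_measurable)
  have "(\<integral>\<^sup>+x. ennreal ((f x)\<^sup>2) \<partial>M) = 0" using assms(2) by (subst nn_integral_0_iff_AE) auto
  then have "(\<integral>\<^sup>+x. ennreal ((T f x)\<^sup>2) \<partial>M) = 0" using T_bounded[OF assms(1)] by simp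
  then show ?thesis using T_measurable[OF assms(1)] by (subst (asm) nn_integral_0_iff_AE) auto
qed

lemma T_sum:
  assumes "finite F" "\<And>i. i \<in> F \<Longrightarrow> h i \<in> L2 M"
  shows "AE x in M. T (\<lambda>y. \<Sum>i\<in>F. h i y) x = (\<Sum>i\<in>F. T (h i) x)"
  using assms
proof (induction F rule: finite_induct)
  case empty
  have "(\<lambda>_. 0) \<in> L2 M" by (auto simp: L2_def)
  then show ?case using T_null[of "\<lambda>_. 0"] by simp
next
  case (insert i F)
  have "AE x in M. T (\<lambda>y. \<Sum>i\<in>insert i F. h i y) x = T (h i) x + T (\<lambda>y. \<Sum>i\<in>F. h i y) x"
    by (rule T_add) (use insert in \<open>auto intro: L2_sum\<close>)
  moreover have "AE x in M. T (\<lambda>y. \<Sum>i\<in>F. h i y) x = (\<Sum>i\<in>F. T (h i) x)" using insert by auto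
  ultimately show ?case by eventually_elim (use insert in simp)
qed

lemma T_kernel_off_support:
  assumes f: "f \<in> L2 M" and S: "\<And>x. x \<in> S \<Longrightarrow> x \<in> space M \<and> (\<exists>s>0. \<forall>y\<in>B x s. f y = 0)"
  shows "AE x in M. x \<in> S \<longrightarrow> T f x = (\<integral>y. K x y * f y \<partial>M)"
  using T_kernel[OF f]
proof (rule AE_mp, intro AE_I2 impI)
  fix x assume *: "x \<notin> ess_support \<rho> M f \<longrightarrow> T f x = (\<integral>y. K x y * f y \<partial>M)" and x: "x \<in> S"
  obtain s where s: "0 < s" "\<forall>y\<in>B x s. f y = 0" using S[OF x] by blast
  obtain U where U: "qopen (space M) \<rho> U" "x \<in> U" "U \<subseteq> B x s"
    using open_nbhd[of x s] S[OF x] s(1) by blast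
  have "AE y in M. y \<in> U \<longrightarrow> f y = 0" using U s by (intro AE_I2) blast
  then have "x \<notin> ess_support \<rho> M f" using U unfolding ess_support_def by blast
  then show "T f x = (\<integral>y. K x y * f y \<partial>M)" using * by simp
qed

text \<open>Measurability of the kernel in one variable is not assumed but extracted from its
  smoothness: K x is continuous off x, so its superlevel sets are open.\<close>

lemma kernel_qopen:
  assumes x: "x \<in> space M"
  shows "qopen (space M) \<rho> {y\<in>space M. y \<noteq> x \<and> a < s * K x y}"
  unfolding qopen_def
proof (intro conjI ballI)
  fix y assume "y \<in> {y\<in>space M. y \<noteq> x \<and> a < s * K x y}"
  then have y: "y \<in> space M" "y \<noteq> x" "a < s * K x y" by auto
  have r: "0 < \<rho> y x" using y x rho_nonneg[of y x] rho_eq_0[of y x] by force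
  define m where "m = measure M (B y (\<rho> y x))"
  have m: "0 < m" unfolding m_def
    using ball_pos[OF y(1) r] ball_finite[OF y(1) r] by (simp add: measure_def enn2real_positive_iff)
  define e where "e = (s * K x y - a) / (\<bar>s\<bar> + 1)"
  have e: "0 < e" using y unfolding e_def by simp
  \<comment> \<open>At distance less than q \<rho>(y,x) from y, the smoothness bound is smaller than
    \<open>e\<close>. The other terms of the minimum defining \<open>t\<close> keep z away from x
    and within the range of the smoothness condition.\<close>
  define q where "q = (e * m) powr (1 / \<eta>)"
  have q: "0 < q" using e m unfolding q_def by simp
  define t where "t = \<rho> y x * min (min 1 \<eta>) q"
  have t: "0 < t" using r eta q unfolding t_def by simp
  have "B y t \<subseteq> {y\<in>space M. y \<noteq> x \<and> a < s * K x y}"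
  proof
    fix z assume "z \<in> B y t"
    then have z: "z \<in> space M" "\<rho> y z < t" by (auto simp: qball_def)
    have tl: "t \<le> \<rho> y x" "t \<le> \<eta> * \<rho> y x" "t \<le> \<rho> y x * q"
      using r unfolding t_def by (auto intro: mult_left_mono simp: mult.commute min_le_iff_disj)
    have zx: "z \<noteq> x" using z(2) tl by auto
    have "\<bar>K x z - K x y\<bar> \<le> (\<rho> z y / \<rho> y x) powr \<eta> * (1 / m)"
      unfolding m_def by (rule kernel_smooth2) (use x y z zx tl in auto)
    also have "\<dots> < q powr \<eta> * (1 / m)"
    proof (rule mult_strict_right_mono)
      have "\<rho> z y < \<rho> y x * q" using z tl rho_sym[OF z(1) y(1)] by simp
      then have "\<rho> z y / \<rho> y x < q" using r by (simp add: divide_less_eq mult.commute)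
      moreover have "0 \<le> \<rho> z y / \<rho> y x" using r rho_nonneg[OF z(1) y(1)] by simp
      ultimately show "(\<rho> z y / \<rho> y x) powr \<eta> < q powr \<eta>" using eta by (intro powr_less_mono2)
    qed (use m in simp)
    also have "q powr \<eta> * (1 / m) = e"
      unfolding q_def powr_powr using eta e m by simp
    finally have d: "\<bar>K x z - K x y\<bar> < e" .
    have "s * K x y - s * K x z \<le> \<bar>s\<bar> * \<bar>K x z - K x y\<bar>"
      by (metis abs_ge_self abs_minus_commute abs_mult right_diff_distrib)
    also have "\<dots> \<le> \<bar>s\<bar> * e" using d by (intro mult_left_mono) auto
    also have "\<dots> < (\<bar>s\<bar> + 1) * e" using e by simp
    also have "\<dots> = s * K x y - a" unfolding e_def by simp
    finally have "a < s * K x z" by simp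
    then show "z \<in> {y\<in>space M. y \<noteq> x \<and> a < s * K x y}" using z zx by simp
  qed
  then show "\<exists>r>0. B y r \<subseteq> {y\<in>space M. y \<noteq> x \<and> a < s * K x y}" using t by blast
qed auto

text \<open>The value at x, on which nothing is known, is replaced by 0; points are measurable
  because their complements are open.\<close>

lemma kernel_measurable:
  assumes x: "x \<in> space M"
  shows "(\<lambda>y. if y = x then 0 else K x y) \<in> borel_measurable M"
proof (subst borel_measurable_iff_greater, rule allI)
  fix a :: real
  have s: "{y\<in>space M. y \<noteq> x \<and> a < K x y} \<in> sets M"
    using qopen_sets[OF kernel_qopen[OF x, of a 1]] by simp
  have "qopen (space M) \<rho> (space M - {x})"
    unfolding qopen_def
  proof (intro conjI ballI)
    fix y assume y: "y \<in> space M - {x}"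
    then have "0 < \<rho> y x" using x rho_nonneg[of y x] rho_eq_0[of y x] by force
    then show "\<exists>r>0. B y r \<subseteq> space M - {x}" by (intro exI[of _ "\<rho> y x"]) (auto simp: qball_def)
  qed auto
  from sets.compl_sets[OF qopen_sets[OF this]] have "space M - (space M - {x}) \<in> sets M" .
  moreover have "space M - (space M - {x}) = {x}" using x by blast
  ultimately have xs: "{x} \<in> sets M" by simp
  have eq: "{y\<in>space M. a < (if y = x then 0 else K x y)} =
      {y\<in>space M. y \<noteq> x \<and> a < K x y} \<union> (if a < 0 then {x} else {})"
    using x by (auto split: if_splits)
  show "{y\<in>space M. a < (if y = x then 0 else K x y)} \<in> sets M"
    unfolding eq by (intro sets.Un s) (simp add: xs)
qed

text \<open>Outside B x s the kernel is bounded by CK / \<mu>(B x s), since the balls in the size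
  condition only grow with the distance.\<close>

lemma kernel_integrable:
  assumes x: "x \<in> space M" and s: "0 < s" and f: "integrable M f" and f0: "\<And>y. y \<in> B x s \<Longrightarrow> f y = 0"
  shows "integrable M (\<lambda>y. K x y * f y)"
proof (rule Bochner_Integration.integrable_bound)
  show "integrable M (\<lambda>y. CK / measure M (B x s) * f y)" using f by simp
  have "(\<lambda>y. K x y * f y) = (\<lambda>y. (if y = x then 0 else K x y) * f y)"
    using f0[OF centre_in_ball[OF x s]] by auto
  then show "(\<lambda>y. K x y * f y) \<in> borel_measurable M"
    using kernel_measurable[OF x] f by auto
  show "AE y in M. norm (K x y * f y) \<le> norm (CK / measure M (B x s) * f y)"
  proof (intro AE_I2)
    fix y assume y: "y \<in> space M"
    show "norm (K x y * f y) \<le> norm (CK / measure M (B x s) * f y)"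
    proof (cases "y \<in> B x s")
      case False
      then have d: "s \<le> \<rho> x y" using y by (auto simp: qball_def)
      have xy: "x \<noteq> y" using False centre_in_ball[OF x s] by auto
      have m: "0 < measure M (B x s)"
        using ball_pos[OF x s] ball_finite[OF x s] by (simp add: measure_def enn2real_positive_iff)
      have "measure M (B x s) \<le> measure M (B x (\<rho> x y))"
        using ball_finite[OF x, of "\<rho> x y"] s d ball_sets[OF x]
        by (intro measure_mono_fmeasurable qball_mono fmeasurableI) auto
      then have "CK / measure M (B x (\<rho> x y)) \<le> CK / measure M (B x s)"
        using CK0 m by (intro divide_left_mono) auto
      then have "\<bar>K x y\<bar> \<le> CK / measure M (B x s)" using kernel_size[OF x y xy] by simp
      then have "\<bar>K x y\<bar> * \<bar>f y\<bar> \<le> CK / measure M (B x s) * \<bar>f y\<bar>" by (rule mult_right_mono) simp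
      then show ?thesis using CK0 by (simp add: abs_mult)
    qed (simp add: f0)
  qed
qed

text \<open>The decay of the smoothness factor when the distance doubles.\<close>

definition \<theta> :: real where "\<theta> = 2 powr (- \<eta>)"

lemma theta: "0 < \<theta>" "\<theta> < 1"
  unfolding \<theta>_def using eta by (auto simp: powr_less_one)

text \<open>A sum over dyadic annuli majorizing the kernel differences at distance at least \<open>R\<close>.\<close>

definition annuli_sum :: "'a \<Rightarrow> real \<Rightarrow> 'a \<Rightarrow> ennreal" where
  "annuli_sum x R y = (\<Sum>m. ennreal (\<theta> ^ m / measure M (B x (2 ^ m * R))) * indicator (B x (2 ^ Suc m * R)) y)"

lemma annuli_sum_measurable: "x \<in> space M \<Longrightarrow> annuli_sum x R \<in> borel_measurable M"
  unfolding annuli_sum_def using ball_sets by measurable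

text \<open>If 2^m R \<le> \<rho>(x,y) < 2^(m+1) R, the smoothness factor is at most \<theta>^m and
  the ball of radius \<rho>(x,y) contains the one of radius 2^m R; a single term of the sum
  suffices.\<close>

lemma annuli_sum_lower:
  assumes x: "x \<in> space M" and R: "0 < R" and y: "y \<in> space M" "R \<le> \<rho> x y" and r: "0 \<le> r" "r \<le> R"
  shows "ennreal ((r / \<rho> x y) powr \<eta> * (1 / measure M (B x (\<rho> x y)))) \<le> annuli_sum x R y"
proof -
  define m where "m = (LEAST m::nat. \<rho> x y < 2 ^ Suc m * R)"
  obtain k :: nat where "\<rho> x y / R < 2 ^ k" using real_arch_pow[of 2] by auto
  also have "(2::real) ^ k \<le> 2 ^ Suc k" by simp
  finally have "\<rho> x y < 2 ^ Suc k * R" using R by (simp add: divide_less_eq)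
  then have m: "\<rho> x y < 2 ^ Suc m * R" unfolding m_def by (rule LeastI)
  have m': "2 ^ m * R \<le> \<rho> x y"
  proof (cases m)
    case (Suc n)
    then have "n < m" by simp
    then have "\<not> \<rho> x y < 2 ^ Suc n * R" unfolding m_def by (rule not_less_Least)
    then show ?thesis using Suc by simp
  qed (use y in simp)
  have p: "0 < 2 ^ m * R" "0 < \<rho> x y" using R y by auto
  have "(r / \<rho> x y) powr \<eta> \<le> (1 / 2 ^ m) powr \<eta>"
  proof (rule powr_mono2)
    have "r * 2 ^ m \<le> R * 2 ^ m" using r by (intro mult_right_mono) auto
    also have "\<dots> \<le> \<rho> x y" using m' by (simp add: mult.commute)
    finally have "r * 2 ^ m \<le> \<rho> x y" .
    then show "r / \<rho> x y \<le> 1 / 2 ^ m" using p by (simp add: field_simps)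
  qed (use eta r p in auto)
  also have "\<dots> = \<theta> ^ m"
    unfolding \<theta>_def by (simp add: powr_divide powr_realpow[symmetric] powr_powr powr_minus_divide mult.commute powr_power divide_simps)
  finally have t: "(r / \<rho> x y) powr \<eta> \<le> \<theta> ^ m" .
  have mp: "0 < measure M (B x (2 ^ m * R))"
    using ball_pos[OF x p(1)] ball_finite[OF x p(1)] by (simp add: measure_def enn2real_positive_iff)
  have "measure M (B x (2 ^ m * R)) \<le> measure M (B x (\<rho> x y))"
    using ball_finite[OF x p(2)] ball_sets[OF x] m'
    by (intro measure_mono_fmeasurable qball_mono fmeasurableI) auto
  then have "(r / \<rho> x y) powr \<eta> * (1 / measure M (B x (\<rho> x y))) \<le> \<theta> ^ m * (1 / measure M (B x (2 ^ m * R)))"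
    using t mp theta by (intro mult_mono divide_left_mono) (auto intro: mult_pos_pos)
  then have "ennreal ((r / \<rho> x y) powr \<eta> * (1 / measure M (B x (\<rho> x y))))
      \<le> ennreal (\<theta> ^ m / measure M (B x (2 ^ m * R))) * indicator (B x (2 ^ Suc m * R)) y"
    using m y by (auto simp: qball_def intro: ennreal_leI)
  also have "\<dots> \<le> annuli_sum x R y"
    unfolding annuli_sum_def by (rule term_le_suminf)
  finally show ?thesis .
qed

text \<open>Each term is normalized by the ball of half the radius, which doubling repairs at the
  price of \<open>A\<close>; the rest is a geometric series in \<theta>.\<close>

lemma annuli_sum_integral:
  assumes x: "x \<in> space M" and R: "0 < R" and g[measurable]: "g \<in> borel_measurable M"
    and le: "\<And>r. R \<le> r \<Longrightarrow> (\<integral>\<^sup>+y\<in>B x r. g y \<partial>M) \<le> N * emeasure M (B x r)"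
  shows "(\<integral>\<^sup>+y. annuli_sum x R y * g y \<partial>M) \<le> ennreal (A / (1 - \<theta>)) * N"
proof -
  have [measurable]: "B x r \<in> sets M" for r by (rule ball_sets[OF x])
  have "(\<integral>\<^sup>+y. annuli_sum x R y * g y \<partial>M) =
      (\<integral>\<^sup>+y. (\<Sum>m. ennreal (\<theta> ^ m / measure M (B x (2 ^ m * R))) * (g y * indicator (B x (2 ^ Suc m * R)) y)) \<partial>M)"
    unfolding annuli_sum_def by (simp add: ennreal_suminf_multc[symmetric] mult_ac)
  also have "\<dots> = (\<Sum>m. ennreal (\<theta> ^ m / measure M (B x (2 ^ m * R))) * (\<integral>\<^sup>+y\<in>B x (2 ^ Suc m * R). g y \<partial>M))"
    by (subst nn_integral_suminf) (auto simp: nn_integral_cmult)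
  also have "\<dots> \<le> (\<Sum>m. ennreal (A * \<theta> ^ m) * N)"
  proof (rule suminf_le)
    fix m
    have p: "0 < 2 ^ m * R" using R by simp
    have R': "R \<le> 2 ^ Suc m * R" using R by (simp add: mult_le_cancel_right1)
      (metis one_le_power one_le_numeral mult_2 add_increasing2 le_numeral_extra(4) order_trans zero_le_one)
    have mp: "0 < measure M (B x (2 ^ m * R))"
      using ball_pos[OF x p] ball_finite[OF x p] by (simp add: measure_def enn2real_positive_iff)
    have em: "emeasure M (B x (2 ^ m * R)) = ennreal (measure M (B x (2 ^ m * R)))"
      using ball_finite[OF x p] by (intro emeasure_eq_ennreal_measure) auto
    have "(\<integral>\<^sup>+y\<in>B x (2 ^ Suc m * R). g y \<partial>M) \<le> N * emeasure M (B x (2 ^ Suc m * R))"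
      by (rule le[OF R'])
    also have "\<dots> \<le> N * (ennreal A * emeasure M (B x (2 ^ m * R)))"
      using doubling[OF x p] by (intro mult_left_mono) (auto simp: mult.assoc)
    finally have "ennreal (\<theta> ^ m / measure M (B x (2 ^ m * R))) * (\<integral>\<^sup>+y\<in>B x (2 ^ Suc m * R). g y \<partial>M)
        \<le> ennreal (\<theta> ^ m / measure M (B x (2 ^ m * R))) * (N * (ennreal A * emeasure M (B x (2 ^ m * R))))"
      by (rule mult_left_mono) simp
    also have "\<dots> = ennreal (A * \<theta> ^ m) * N"
    proof -
      have "ennreal (\<theta> ^ m / measure M (B x (2 ^ m * R))) * (ennreal A * emeasure M (B x (2 ^ m * R))) = ennreal (A * \<theta> ^ m)"
        unfolding em using mp theta A1 by (simp add: ennreal_mult[symmetric])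
      then show ?thesis by (metis mult.assoc mult.commute)
    qed
    finally show "ennreal (\<theta> ^ m / measure M (B x (2 ^ m * R))) * (\<integral>\<^sup>+y\<in>B x (2 ^ Suc m * R). g y \<partial>M)
        \<le> ennreal (A * \<theta> ^ m) * N" .
  qed auto
  also have "\<dots> = (\<Sum>m. ennreal (A * \<theta> ^ m)) * N" by simp
  also have "(\<Sum>m. ennreal (A * \<theta> ^ m)) = ennreal (A / (1 - \<theta>))"
  proof -
    have "(\<lambda>m. A * \<theta> ^ m) sums (A * (1 / (1 - \<theta>)))"
      using theta by (intro sums_mult geometric_sums) auto
    then show ?thesis using theta A1 by (intro suminf_ennreal_eq) auto
  qed
  finally show ?thesis .
qed

end

context cz_space
begin

text \<open>Two demands on the enlargement: points of a cube are close to its centre in the sense of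
  the smoothness condition, as seen from outside, and a ball of the cube's radius about each of its
  points fits inside.\<close>

definition \<alpha> :: real where "\<alpha> = max (C0 / \<eta>) (\<kappa> * (C0 + 1))"

lemma alpha: "C0 \<le> \<alpha>" "C0 \<le> \<eta> * \<alpha>" "\<kappa> * (C0 + 1) \<le> \<alpha>" "0 < \<alpha>"
proof -
  show 3: "\<kappa> * (C0 + 1) \<le> \<alpha>" unfolding \<alpha>_def by simp
  have "C0 + 1 \<le> \<kappa> * (C0 + 1)" using kappa C0 mult_right_mono[of 1 \<kappa> "C0 + 1"] by simp
  then show "C0 \<le> \<alpha>" "0 < \<alpha>" using 3 C0 by linarith+
  have "C0 / \<eta> \<le> \<alpha>" unfolding \<alpha>_def by simp
  then show "C0 \<le> \<eta> * \<alpha>" using eta by (simp add: divide_le_eq mult.commute)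
qed

definition enlarged :: "(int \<Rightarrow> 'a set set) \<Rightarrow> 'a set \<Rightarrow> 'a set" where
  "enlarged D P = B (centre D P) (\<alpha> * radius D P)"

context
  fixes D P assumes D: "D \<in> \<D>" and P: "P \<in> cubes_of D"
begin

lemma enlarged_sets: "enlarged D P \<in> sets M"
  unfolding enlarged_def by (rule ball_sets[OF gen_centre(2)[OF D P]])

text \<open>Provides a positive distance between the cube and the complement of its enlargement,
  which both the kernel representation and the integrability of the kernel require.\<close>

lemma near_ball_subset_enlarged:
  assumes "x \<in> P"
  shows "B x (radius D P) \<subseteq> enlarged D P"
proof -
  have "B x (radius D P) \<subseteq> B (centre D P) (\<kappa> * (C0 * radius D P + radius D P))"
    by (rule ball_subset_ball) (use assms gen_centre[OF D P] in auto)
  also have "\<dots> \<subseteq> enlarged D P"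
    unfolding enlarged_def using mult_right_mono[OF alpha(3), of "radius D P"] radius_pos[of D P]
    by (intro qball_mono) (auto simp: algebra_simps)
  finally show ?thesis .
qed

lemma cube_subset_enlarged: "P \<subseteq> enlarged D P"
  using near_ball_subset_enlarged centre_in_ball[OF _ radius_pos] sets.sets_into_space[OF cubes_of_sets[OF D P]] by blast

lemma far_ball_disjoint:
  assumes x: "x \<in> space M" "x \<notin> enlarged D P" and y: "y \<in> B x (radius D P)"
  shows "y \<notin> P"
proof
  assume "y \<in> P"
  then have "x \<in> B y (radius D P)" "x \<notin> B y (radius D P)"
    using y x rho_sym[of x y] near_ball_subset_enlarged[of y] by (auto simp: qball_def)
  then show False by blast
qed

text \<open>The constant is the kernel integral at the centre, not a value of \<open>T h\<close>,
  which is meaningful only almost everywhere. All balls in the annuli sum contain \<open>P\<close>,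
  so their averages are bounded by the maximal function at any point of \<open>P\<close>.\<close>

lemma cz_oscillation:
  assumes h: "h \<in> L2 M" "integrable M h" and h0: "\<And>y. y \<in> enlarged D P \<Longrightarrow> h y = 0"
  shows "\<exists>c. AE x in M. x \<in> P \<longrightarrow> (\<forall>z\<in>P. ennreal \<bar>T h x - c\<bar> \<le> ennreal (A / (1 - \<theta>)) * (ennreal c_cov * maximal M \<D> h z))"
proof -
  let ?p = "centre D P" and ?R = "\<alpha> * radius D P"
  define c where "c = (\<integral>y. K ?p y * h y \<partial>M)"
  have hm[measurable]: "h \<in> borel_measurable M" using h(1) by (rule L2_measurable)
  note g = gen_centre[OF D P]
  have R: "0 < ?R" using alpha radius_pos by simp
  have Pin: "x \<in> P \<Longrightarrow> x \<in> space M" for x using sets.sets_into_space[OF cubes_of_sets[OF D P]] by blast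
  have int: "integrable M (\<lambda>y. K x y * h y)" if "x \<in> P" for x
    by (rule kernel_integrable[OF Pin[OF that] radius_pos h(2)]) (use h0 near_ball_subset_enlarged[OF that] in blast)
  have "AE x in M. x \<in> P \<longrightarrow> T h x = (\<integral>y. K x y * h y \<partial>M)"
  proof (rule T_kernel_off_support[OF h(1)])
    fix x assume x: "x \<in> P"
    then show "x \<in> space M \<and> (\<exists>s>0. \<forall>y\<in>B x s. h y = 0)"
      using Pin h0 near_ball_subset_enlarged[OF x] radius_pos[of D P] by blast
  qed
  then have "AE x in M. x \<in> P \<longrightarrow> (\<forall>z\<in>P. ennreal \<bar>T h x - c\<bar> \<le> ennreal (A / (1 - \<theta>)) * (ennreal c_cov * maximal M \<D> h z))"
  proof (rule AE_mp, intro AE_I2 impI ballI)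
    fix x z assume x: "x \<in> P" and z: "z \<in> P" and "x \<in> P \<longrightarrow> T h x = (\<integral>y. K x y * h y \<partial>M)"
    then have Th: "T h x = (\<integral>y. K x y * h y \<partial>M)" by simp
    have "T h x - c = (\<integral>y. (K x y - K ?p y) * h y \<partial>M)"
      unfolding Th c_def left_diff_distrib
      by (rule Bochner_Integration.integral_diff[OF int[OF x] int[OF centre_in[OF D P]], symmetric])
    moreover have "integrable M (\<lambda>y. (K x y - K ?p y) * h y)"
      unfolding left_diff_distrib
      by (rule Bochner_Integration.integrable_diff[OF int[OF x] int[OF centre_in[OF D P]]])
    ultimately have "ennreal \<bar>T h x - c\<bar> \<le> (\<integral>\<^sup>+y. ennreal \<bar>(K x y - K ?p y) * h y\<bar> \<partial>M)"
      using integral_norm_bound_ennreal[of M "\<lambda>y. (K x y - K ?p y) * h y"] by simp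
    also have "\<dots> \<le> (\<integral>\<^sup>+y. annuli_sum ?p ?R y * ennreal \<bar>h y\<bar> \<partial>M)"
    proof (rule nn_integral_mono)
      fix y assume y: "y \<in> space M"
      show "ennreal \<bar>(K x y - K ?p y) * h y\<bar> \<le> annuli_sum ?p ?R y * ennreal \<bar>h y\<bar>"
      proof (cases "y \<in> enlarged D P")
        case False
        then have d: "?R \<le> \<rho> ?p y" using y unfolding enlarged_def by (auto simp: qball_def)
        have xp: "\<rho> ?p x < C0 * radius D P" using g(4) x by (auto simp: qball_def)
        have xy: "x \<noteq> y" "?p \<noteq> y" using False cube_subset_enlarged x centre_in[OF D P] by auto
        have sm: "\<rho> ?p x \<le> \<eta> * \<rho> ?p y"
        proof -
          have "C0 * radius D P \<le> \<eta> * \<alpha> * radius D P" using alpha(2) radius_pos[of D P] by simp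
          also have "\<dots> \<le> \<eta> * \<rho> ?p y" using d eta by (simp add: mult.assoc)
          finally show ?thesis using xp by simp
        qed
        have le: "\<bar>K x y - K ?p y\<bar> \<le> (\<rho> x ?p / \<rho> ?p y) powr \<eta> * (1 / measure M (B ?p (\<rho> ?p y)))"
          by (rule kernel_smooth1) (use g y Pin x xy sm in auto)
        have "ennreal \<bar>K x y - K ?p y\<bar> \<le> ennreal ((\<rho> x ?p / \<rho> ?p y) powr \<eta> * (1 / measure M (B ?p (\<rho> ?p y))))"
          by (rule ennreal_leI[OF le])
        also have "\<dots> \<le> annuli_sum ?p ?R y"
        proof (rule annuli_sum_lower[OF g(2) R y d])
          show "0 \<le> \<rho> x ?p" using rho_nonneg Pin x g by auto
          have "\<rho> x ?p < C0 * radius D P" using xp rho_sym[OF Pin[OF x] g(2)] by simp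
          also have "\<dots> \<le> ?R" using alpha(1) radius_pos[of D P] by simp
          finally show "\<rho> x ?p \<le> ?R" by simp
        qed
        finally have "ennreal \<bar>K x y - K ?p y\<bar> * ennreal \<bar>h y\<bar> \<le> annuli_sum ?p ?R y * ennreal \<bar>h y\<bar>"
          by (rule mult_right_mono) simp
        then show ?thesis by (simp add: abs_mult ennreal_mult)
      qed (simp add: h0)
    qed
    also have "\<dots> \<le> ennreal (A / (1 - \<theta>)) * (ennreal c_cov * maximal M \<D> h z)"
    proof (rule annuli_sum_integral[OF g(2) R])
      fix r assume r: "?R \<le> r"
      have "z \<in> B ?p r" by (rule subsetD[OF qball_mono[OF r] subsetD[OF cube_subset_enlarged[unfolded enlarged_def] z]])
      then show "(\<integral>\<^sup>+y\<in>B ?p r. ennreal \<bar>h y\<bar> \<partial>M) \<le> ennreal c_cov * maximal M \<D> h z * emeasure M (B ?p r)"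
        using r R by (intro ball_average_le_maximal[OF g(2)]) auto
    qed measurable
    finally show "ennreal \<bar>T h x - c\<bar> \<le> ennreal (A / (1 - \<theta>)) * (ennreal c_cov * maximal M \<D> h z)" .
  qed
  then show ?thesis by blast
qed

text \<open>The vanishing mean allows K x ?p to be subtracted. Smoothness in the second variable
  then bounds the integrand by the annuli sum, whose own integral is estimated with g = 1 and N =
  1.\<close>

lemma cz_cancellation:
  assumes f: "f \<in> L2 M" "integrable M f" and f0: "\<And>y. y \<notin> P \<Longrightarrow> f y = 0" and mean: "(\<integral>y. f y \<partial>M) = 0"
  shows "(\<integral>\<^sup>+x\<in>space M - enlarged D P. ennreal \<bar>T f x\<bar> \<partial>M) \<le> ennreal (A / (1 - \<theta>)) * (\<integral>\<^sup>+x. ennreal \<bar>f x\<bar> \<partial>M)"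
proof -
  let ?p = "centre D P" and ?R = "\<alpha> * radius D P" and ?I = "\<integral>\<^sup>+x. ennreal \<bar>f x\<bar> \<partial>M"
  have fm[measurable]: "f \<in> borel_measurable M" using f(1) by (rule L2_measurable)
  note g = gen_centre[OF D P]
  have R: "0 < ?R" using alpha radius_pos by simp
  have Pin: "x \<in> P \<Longrightarrow> x \<in> space M" for x using sets.sets_into_space[OF cubes_of_sets[OF D P]] by blast
  have "AE x in M. x \<in> space M - enlarged D P \<longrightarrow> T f x = (\<integral>y. K x y * f y \<partial>M)"
  proof (rule T_kernel_off_support[OF f(1)])
    fix x assume x: "x \<in> space M - enlarged D P"
    then have "\<forall>y\<in>B x (radius D P). f y = 0" using far_ball_disjoint[of x] f0 by blast
    then show "x \<in> space M \<and> (\<exists>s>0. \<forall>y\<in>B x s. f y = 0)" using x radius_pos[of D P] by blast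
  qed
  then have "AE x in M. ennreal \<bar>T f x\<bar> * indicator (space M - enlarged D P) x \<le> annuli_sum ?p ?R x * ?I"
  proof (rule AE_mp, intro AE_I2 impI)
    fix x assume xs: "x \<in> space M" and Tx: "x \<in> space M - enlarged D P \<longrightarrow> T f x = (\<integral>y. K x y * f y \<partial>M)"
    show "ennreal \<bar>T f x\<bar> * indicator (space M - enlarged D P) x \<le> annuli_sum ?p ?R x * ?I"
    proof (cases "x \<in> enlarged D P")
      case False
      have int: "integrable M (\<lambda>y. K x y * f y)"
        by (rule kernel_integrable[OF xs radius_pos[of D P] f(2)]) (use far_ball_disjoint[OF xs False] f0 in blast)
      have "T f x = (\<integral>y. K x y * f y \<partial>M) - K x ?p * (\<integral>y. f y \<partial>M)" using Tx xs False mean by simp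
      also have "\<dots> = (\<integral>y. K x y * f y - K x ?p * f y \<partial>M)"
        using int f(2) by (subst Bochner_Integration.integral_diff) auto
      finally have "ennreal \<bar>T f x\<bar> \<le> (\<integral>\<^sup>+y. ennreal \<bar>K x y * f y - K x ?p * f y\<bar> \<partial>M)"
        using integral_norm_bound_ennreal[of M "\<lambda>y. K x y * f y - K x ?p * f y"] int f(2) by simp
      also have "\<dots> \<le> (\<integral>\<^sup>+y. annuli_sum ?p ?R x * ennreal \<bar>f y\<bar> \<partial>M)"
      proof (rule nn_integral_mono)
        fix y assume y: "y \<in> space M"
        show "ennreal \<bar>K x y * f y - K x ?p * f y\<bar> \<le> annuli_sum ?p ?R x * ennreal \<bar>f y\<bar>"
        proof (cases "y \<in> P")
          case True
          have d: "?R \<le> \<rho> ?p x" using xs False unfolding enlarged_def by (auto simp: qball_def)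
          have yp: "\<rho> ?p y < C0 * radius D P" using g(4) True by (auto simp: qball_def)
          have xy: "?p \<noteq> x" "y \<noteq> x" using False cube_subset_enlarged True centre_in[OF D P] by auto
          have sm: "\<rho> ?p y \<le> \<eta> * \<rho> ?p x"
          proof -
            have "C0 * radius D P \<le> \<eta> * \<alpha> * radius D P" using alpha(2) radius_pos[of D P] by simp
            also have "\<dots> \<le> \<eta> * \<rho> ?p x" using d eta by (simp add: mult.assoc)
            finally show ?thesis using yp by simp
          qed
          have le: "\<bar>K x y - K x ?p\<bar> \<le> (\<rho> y ?p / \<rho> ?p x) powr \<eta> * (1 / measure M (B ?p (\<rho> ?p x)))"
            by (rule kernel_smooth2) (use g y xs xy sm in auto)
          have "ennreal \<bar>K x y - K x ?p\<bar> \<le> ennreal ((\<rho> y ?p / \<rho> ?p x) powr \<eta> * (1 / measure M (B ?p (\<rho> ?p x))))"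
            by (rule ennreal_leI[OF le])
          also have "\<dots> \<le> annuli_sum ?p ?R x"
          proof (rule annuli_sum_lower[OF g(2) R xs d])
            show "0 \<le> \<rho> y ?p" using rho_nonneg y g by auto
            have "\<rho> y ?p < C0 * radius D P" using yp rho_sym[OF y g(2)] by simp
            also have "\<dots> \<le> ?R" using alpha(1) radius_pos[of D P] by simp
            finally show "\<rho> y ?p \<le> ?R" by simp
          qed
          finally have "ennreal \<bar>K x y - K x ?p\<bar> * ennreal \<bar>f y\<bar> \<le> annuli_sum ?p ?R x * ennreal \<bar>f y\<bar>"
            by (rule mult_right_mono) simp
          then show ?thesis by (simp add: abs_mult ennreal_mult left_diff_distrib[symmetric])
        qed (simp add: f0)
      qed
      also have "\<dots> = annuli_sum ?p ?R x * ?I" by (rule nn_integral_cmult) measurable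
      finally show ?thesis using xs False by simp
    qed simp
  qed
  then have "(\<integral>\<^sup>+x\<in>space M - enlarged D P. ennreal \<bar>T f x\<bar> \<partial>M) \<le> (\<integral>\<^sup>+x. annuli_sum ?p ?R x * ?I \<partial>M)"
    by (rule nn_integral_mono_AE)
  also have "\<dots> = (\<integral>\<^sup>+x. annuli_sum ?p ?R x * 1 \<partial>M) * ?I"
    using annuli_sum_measurable[OF g(2)] by (subst nn_integral_multc) auto
  also have "\<dots> \<le> (ennreal (A / (1 - \<theta>)) * 1) * ?I"
    by (intro mult_right_mono annuli_sum_integral[OF g(2) R]) (use ball_sets[OF g(2)] in auto)
  finally show ?thesis by simp
qed

end

end

section \<open>The unweighted local weak type estimate\<close>

context cz_space
begin

lemma T_chebyshev:
  assumes g: "g \<in> L2 M" and I: "0 \<le> I" "(\<integral>\<^sup>+x. ennreal ((g x)\<^sup>2) \<partial>M) \<le> ennreal (s * I)" and t: "0 < t"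
    and s: "0 \<le> s"
  shows "ennreal t * emeasure M {x\<in>space M. t / 2 < \<bar>T g x\<bar>} \<le> ennreal (4 * b * s / t * I)"
proof -
  let ?S = "{x\<in>space M. t / 2 < \<bar>T g x\<bar>}"
  have [measurable]: "T g \<in> borel_measurable M" using g by measurable
  have "ennreal (t\<^sup>2 / 4) * emeasure M ?S = (\<integral>\<^sup>+x\<in>?S. ennreal (t\<^sup>2 / 4) \<partial>M)"
    by (simp add: set_nn_integral_const)
  also have "\<dots> \<le> (\<integral>\<^sup>+x. ennreal ((T g x)\<^sup>2) \<partial>M)"
  proof (rule nn_integral_mono)
    fix x assume "x \<in> space M"
    show "ennreal (t\<^sup>2 / 4) * indicator ?S x \<le> ennreal ((T g x)\<^sup>2)"
    proof (cases "x \<in> ?S")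
      case True
      then have "(t / 2)\<^sup>2 \<le> \<bar>T g x\<bar>\<^sup>2" using t by (intro power_mono) auto
      then show ?thesis using True by (simp add: power_divide ennreal_leI)
    qed simp
  qed
  also have "\<dots> \<le> ennreal b * (\<integral>\<^sup>+x. ennreal ((g x)\<^sup>2) \<partial>M)" by (rule T_bounded[OF g])
  also have "\<dots> \<le> ennreal b * ennreal (s * I)" by (rule mult_left_mono[OF I(2)]) simp
  finally have "ennreal (4 / t) * (ennreal (t\<^sup>2 / 4) * emeasure M ?S) \<le> ennreal (4 / t) * (ennreal b * ennreal (s * I))"
    by (rule mult_left_mono) simp
  moreover have "ennreal (4 / t) * ennreal (t\<^sup>2 / 4) = ennreal t"
    using t by (subst ennreal_mult[symmetric]) (auto simp: power2_eq_square)
  moreover have "ennreal (4 / t) * (ennreal b * ennreal (s * I)) = ennreal (4 * b * s / t * I)"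
    using t b0 s I(1) by (simp add: ennreal_mult[symmetric] mult_ac)
  ultimately show ?thesis by (simp add: mult.assoc[symmetric])
qed

text \<open>Only finitely many bad pieces are split off: the remaining ones carry little \<open>L\<^sup>2\<close> mass of
  \<open>f\<close>, so that the infinite sum in the usual Calderon-Zygmund decomposition is avoided.\<close>

lemma local_weak_type_aux:
  assumes D: "D \<in> \<D>" and Q: "Q \<in> cubes_of D" and f: "f \<in> L2 M" and t: "0 < t"
    and f0: "\<And>y. y \<notin> Q \<Longrightarrow> f y = 0" and le: "(\<integral>\<^sup>+x. ennreal \<bar>f x\<bar> \<partial>M) \<le> ennreal t * emeasure M Q"
    and Cb: "1 \<le> Cb" "\<And>P. P \<in> cubes_of D \<Longrightarrow> emeasure M (enlarged D P) \<le> ennreal Cb * emeasure M P"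
  shows "ennreal t * emeasure M {x\<in>space M. t < \<bar>T f x\<bar>}
    \<le> ennreal (12 * b / \<epsilon> + Cb + 4 * (A / (1 - \<theta>))) * (\<integral>\<^sup>+x. ennreal \<bar>f x\<bar> \<partial>M)"
proof -
  interpret cube_family M \<epsilon> "cubes_of D" by (rule cube_family_cubes_of[OF D])
  define C2 where "C2 = A / (1 - \<theta>)"
  have C2: "0 \<le> C2" unfolding C2_def using A1 theta by simp
  have fm[measurable]: "f \<in> borel_measurable M" by (rule L2_measurable[OF f])
  have Qm[measurable]: "Q \<in> sets M" by (rule cube_sets[OF Q])
  define I where "I = enn2real (\<integral>\<^sup>+x. ennreal \<bar>f x\<bar> \<partial>M)"
  have "(\<integral>\<^sup>+x. ennreal \<bar>f x\<bar> \<partial>M) < \<infinity>"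
    using le cube_finite[OF Q] by (auto simp: ennreal_mult_less_top intro: le_less_trans)
  then have eI: "(\<integral>\<^sup>+x. ennreal \<bar>f x\<bar> \<partial>M) = ennreal I" and fint: "integrable M f"
    unfolding I_def by (auto intro!: integrableI_bounded)
  have I0: "0 \<le> I" unfolding I_def by simp
  show ?thesis
  proof (cases "I = 0")
    \<comment> \<open>Treated apart because the tolerance t * I for the remaining cubes must be
      positive.\<close>
    case True
    then have "AE x in M. f x = 0" using eI by (simp add: nn_integral_0_iff_AE)
    then have "AE x in M. T f x = 0" by (rule T_null[OF f])
    then have "AE x in M. x \<notin> {x\<in>space M. t < \<bar>T f x\<bar>}" by eventually_elim (use t in auto)
    then have "emeasure M {x\<in>space M. t < \<bar>T f x\<bar>} = 0"
      using T_measurable[OF f] by (intro emeasure_eq_0_AE) (auto simp: AE_conj_iff eventually_mono)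
    then show ?thesis by simp
  next
    case False
    then have I: "0 < I" using I0 by simp
    define \<phi> where "\<phi> x = ennreal \<bar>f x\<bar>" for x
    have \<phi>m[measurable]: "\<phi> \<in> borel_measurable M" unfolding \<phi>_def by measurable
    have H: "(\<integral>\<^sup>+x\<in>Q. \<phi> x \<partial>M) \<le> ennreal t * emeasure M Q"
      unfolding \<phi>_def by (rule order_trans[OF set_nn_integral_le_space le])
    let ?P = "stopping_cubes \<phi> t Q"
    have Pm: "P \<in> sets M" if "P \<in> ?P" for P using stopping_cubesD(1)[OF that] cube_sets by blast
    have f2: "(\<integral>\<^sup>+x. ennreal ((f x)\<^sup>2) \<partial>M) < \<infinity>" by (rule L2_nn_integral[OF f])
    have "\<exists>E\<subseteq>?P. finite E \<and> emeasure (density M (\<lambda>x. ennreal ((f x)\<^sup>2))) (\<Union>?P - \<Union>E) \<le> ennreal (t * I)"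
    proof (rule finite_subfamily_small_rest)
      show "emeasure (density M (\<lambda>x. ennreal ((f x)\<^sup>2))) (\<Union>?P) < \<infinity>"
        using Union_stopping_cubes_sets f2 set_nn_integral_le_space[of M "\<lambda>x. ennreal ((f x)\<^sup>2)"]
        by (simp add: emeasure_density) (meson le_less_trans)
    qed (use countable_stopping_cubes Pm t I in auto)
    then obtain E where E: "E \<subseteq> ?P" "finite E"
      "emeasure (density M (\<lambda>x. ennreal ((f x)\<^sup>2))) (\<Union>?P - \<Union>E) \<le> ennreal (t * I)" by blast
    have Em: "P \<in> sets M" if "P \<in> E" for P using that E Pm by blast
    have UEm[measurable]: "\<Union>E \<in> sets M" using E Em by (intro sets.finite_Union) auto
    have UPm[measurable]: "\<Union>?P \<in> sets M" by (rule Union_stopping_cubes_sets)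
    have rest: "(\<integral>\<^sup>+x\<in>\<Union>?P - \<Union>E. ennreal ((f x)\<^sup>2) \<partial>M) \<le> ennreal (t * I)"
      using E(3) by (simp add: emeasure_density)
    have Ed: "disjoint E" using disjoint_stopping_cubes E(1) by (rule pairwise_subset)
    have EQ: "P \<in> cubes_of D" if "P \<in> E" for P using that E(1) stopping_cubesD(1) by blast
    define av where "av P = (\<integral>x. f x * indicator P x \<partial>M) / measure M P" for P
    define bad where "bad P x = (f x - av P) * indicator P x" for P x
    define G where "G x = f x - (\<Sum>P\<in>E. bad P x)" for x
    have mp: "0 < measure M P" "emeasure M P = ennreal (measure M P)" if "P \<in> E" for P
      using cube_pos[OF EQ[OF that]] cube_finite[OF EQ[OF that]]
      by (auto simp: measure_def enn2real_positive_iff)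
    have av: "ennreal \<bar>av P\<bar> * emeasure M P \<le> (\<integral>\<^sup>+x\<in>P. \<phi> x \<partial>M)" if P: "P \<in> E" for P
    proof -
      have "\<bar>av P\<bar> * measure M P = \<bar>\<integral>x. f x * indicator P x \<partial>M\<bar>"
        unfolding av_def using mp(1)[OF P] by simp
      moreover have "ennreal \<bar>\<integral>x. f x * indicator P x \<partial>M\<bar> \<le> (\<integral>\<^sup>+x. ennreal \<bar>f x * indicator P x\<bar> \<partial>M)"
        using integral_norm_bound_ennreal[of M "\<lambda>x. f x * indicator P x"]
          integrable_mult_indicator[OF Em[OF P] fint] by (simp add: mult.commute)
      moreover have "(\<integral>\<^sup>+x. ennreal \<bar>f x * indicator P x\<bar> \<partial>M) = (\<integral>\<^sup>+x\<in>P. \<phi> x \<partial>M)"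
        unfolding \<phi>_def by (intro nn_integral_cong) (auto simp: indicator_def)
      ultimately show ?thesis unfolding mp(2)[OF P] by (simp add: ennreal_mult[symmetric])
    qed
    have av_le: "\<bar>av P\<bar> \<le> t / \<epsilon>" if P: "P \<in> E" for P
    proof -
      have "ennreal \<bar>av P\<bar> * emeasure M P \<le> ennreal (t / \<epsilon>) * emeasure M P"
        using av[OF P] stopping_cubes_average_le[OF Q H] P E(1) t by (meson less_imp_le order_trans subsetD)
      then have "\<bar>av P\<bar> * measure M P \<le> t / \<epsilon> * measure M P"
        unfolding mp(2)[OF P] using t eps by (simp add: ennreal_mult[symmetric])
      then show ?thesis using mp(1)[OF P] by (rule mult_right_le_imp_le)
    qed
    have indL2: "(\<lambda>x. indicator P x) \<in> L2 M" if P: "P \<in> E" for P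
    proof (rule L2_finite_nn_integral)
      have "(\<integral>\<^sup>+x. ennreal ((indicator P x)\<^sup>2) \<partial>M) = (\<integral>\<^sup>+x. indicator P x \<partial>M)"
        by (intro nn_integral_cong) (auto simp: indicator_def)
      then show "(\<integral>\<^sup>+x. ennreal ((indicator P x)\<^sup>2) \<partial>M) < \<infinity>"
        using Em[OF P] cube_finite[OF EQ[OF P]] by simp
    qed (use Em[OF P] in simp)
    have bad_eq: "bad P = (\<lambda>x. 1 * (f x * indicator P x) + (- av P) * indicator P x)" for P
      unfolding bad_def by (auto simp: left_diff_distrib)
    have badL2: "bad P \<in> L2 M" if P: "P \<in> E" for P
      unfolding bad_eq by (intro L2_linear L2_cut f Em P indL2)
    have int1: "integrable M (\<lambda>x. f x * indicator P x)" if P: "P \<in> E" for P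
      using integrable_mult_indicator[OF Em[OF P] fint] by (simp add: mult.commute)
    have int2: "integrable M (indicator P :: 'a \<Rightarrow> real)" if P: "P \<in> E" for P
      using Em[OF P] cube_finite[OF EQ[OF P]] by auto
    have bad_int: "integrable M (bad P)" if P: "P \<in> E" for P
      unfolding bad_eq using int1[OF P] int2[OF P] by auto
    have bad_mean: "(\<integral>x. bad P x \<partial>M) = 0" if P: "P \<in> E" for P
    proof -
      have "(\<integral>x. bad P x \<partial>M) = (\<integral>x. f x * indicator P x \<partial>M) - av P * measure M P"
        unfolding bad_eq using int1[OF P] int2[OF P] Em[OF P] sets.sets_into_space[OF Em[OF P]]
        by (simp add: Int_absorb2)
      then show ?thesis unfolding av_def using mp(1)[OF P] by simp
    qed
    have bad_off: "bad P y = 0" if "y \<notin> P" for P y using that unfolding bad_def by simp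
    have bad_norm: "(\<integral>\<^sup>+x. ennreal \<bar>bad P x\<bar> \<partial>M) \<le> 2 * (\<integral>\<^sup>+x\<in>P. \<phi> x \<partial>M)" if P: "P \<in> E" for P
    proof -
      have "(\<integral>\<^sup>+x. ennreal \<bar>bad P x\<bar> \<partial>M) \<le> (\<integral>\<^sup>+x. \<phi> x * indicator P x + ennreal \<bar>av P\<bar> * indicator P x \<partial>M)"
      proof (rule nn_integral_mono)
        fix x
        have "ennreal \<bar>f x - av P\<bar> \<le> ennreal (\<bar>f x\<bar> + \<bar>av P\<bar>)" by (rule ennreal_leI) simp
        then show "ennreal \<bar>bad P x\<bar> \<le> \<phi> x * indicator P x + ennreal \<bar>av P\<bar> * indicator P x"
          unfolding bad_def \<phi>_def by (cases "x \<in> P") (auto simp: ennreal_plus)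
      qed
      also have "\<dots> = (\<integral>\<^sup>+x\<in>P. \<phi> x \<partial>M) + ennreal \<bar>av P\<bar> * emeasure M P"
        using Em[OF P] by (subst nn_integral_add) (auto simp: nn_integral_cmult_indicator)
      also have "\<dots> \<le> (\<integral>\<^sup>+x\<in>P. \<phi> x \<partial>M) + (\<integral>\<^sup>+x\<in>P. \<phi> x \<partial>M)" by (rule add_left_mono[OF av[OF P]])
      finally show ?thesis by (simp add: mult_2)
    qed
    have sumP: "(\<Sum>P\<in>E. \<integral>\<^sup>+x\<in>P. \<phi> x \<partial>M) \<le> ennreal I"
      unfolding eI[symmetric] using sum_disjoint_nn_integral_le[OF \<phi>m E(2) Ed Em] by (simp add: \<phi>_def)
    have G_eq: "G = (\<lambda>x. 1 * f x + (-1) * (\<Sum>P\<in>E. bad P x))" unfolding G_def by auto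
    have GL2: "G \<in> L2 M" unfolding G_eq by (intro L2_linear f L2_sum E(2) badL2)
    have Gin: "G x = av P" if x: "x \<in> P" "P \<in> E" for x P
    proof -
      have "bad R x = 0" if "R \<in> E - {P}" for R
        using that x Ed by (intro bad_off) (auto simp: pairwise_def disjnt_def)
      then have "(\<Sum>R\<in>E. bad R x) = (\<Sum>R\<in>{P}. bad R x)"
        using x E(2) by (intro sum.mono_neutral_right) auto
      then show ?thesis unfolding G_def bad_def using x by simp
    qed
    have Gout: "G x = f x" if "x \<notin> \<Union>E" for x
      unfolding G_def using that by (simp add: bad_off sum.neutral)
    \<comment> \<open>Three regions: on the selected cubes G is the mean of f, at most t/\<epsilon>
      in size; on the stopping cubes not selected it is f, with small square integral; elsewhere |f|
      \<le> t, or f = 0. They contribute t I / \<epsilon>, t I and t I.\<close>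
    have "AE x in M. ennreal ((G x)\<^sup>2) \<le> ennreal t * \<phi> x + ennreal ((f x)\<^sup>2) * indicator (\<Union>?P - \<Union>E) x
        + (\<Sum>P\<in>E. ennreal (t / \<epsilon> * \<bar>av P\<bar>) * indicator P x)"
      using AE_le_outside_stopping_cubes[OF \<phi>m Q less_imp_le[OF t]]
    proof (rule AE_mp, intro AE_I2 impI)
      fix x assume x: "x \<in> Q \<longrightarrow> x \<notin> \<Union>?P \<longrightarrow> \<phi> x \<le> ennreal t"
      let ?a = "ennreal t * \<phi> x" and ?b = "ennreal ((f x)\<^sup>2) * indicator (\<Union>?P - \<Union>E) x"
        and ?c = "\<Sum>P\<in>E. ennreal (t / \<epsilon> * \<bar>av P\<bar>) * indicator P x"
      consider (inside) "x \<in> \<Union>E" | (remainder) "x \<in> \<Union>?P - \<Union>E" | (outside) "x \<notin> \<Union>E" "x \<notin> \<Union>?P" by blast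
      then show "ennreal ((G x)\<^sup>2) \<le> ?a + ?b + ?c"
      proof cases
        case inside
        then obtain P where P: "P \<in> E" "x \<in> P" by blast
        have "(G x)\<^sup>2 = \<bar>av P\<bar> * \<bar>av P\<bar>" using Gin[OF P(2,1)] by (simp add: power2_eq_square)
        also have "\<dots> \<le> t / \<epsilon> * \<bar>av P\<bar>" by (intro mult_right_mono av_le P) simp
        finally have "ennreal ((G x)\<^sup>2) \<le> ennreal (t / \<epsilon> * \<bar>av P\<bar>) * indicator P x" using P by (simp add: ennreal_leI)
        also have "\<dots> \<le> ?c" by (rule member_le_sum) (use P E(2) in auto)
        finally show ?thesis by (simp add: add_increasing)
      next
        case remainder
        then have "ennreal ((G x)\<^sup>2) = ?b" using Gout[of x] by simp
        then show ?thesis by (simp add: add_increasing add_increasing2)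
      next
        case outside
        have "(f x)\<^sup>2 \<le> t * \<bar>f x\<bar>"
        proof (cases "x \<in> Q")
          case True
          then have "\<bar>f x\<bar> \<le> t" using x outside t by (simp add: \<phi>_def)
          then have "\<bar>f x\<bar> * \<bar>f x\<bar> \<le> t * \<bar>f x\<bar>" by (rule mult_right_mono) simp
          then show ?thesis by (simp add: power2_eq_square)
        qed (simp add: f0)
        then have "ennreal ((G x)\<^sup>2) \<le> ennreal (t * \<bar>f x\<bar>)" using Gout[OF outside(1)] by (simp add: ennreal_leI)
        also have "\<dots> = ?a" unfolding \<phi>_def using t by (simp add: ennreal_mult)
        finally show ?thesis by (simp add: add_increasing2)
      qed
    qed
    then have "(\<integral>\<^sup>+x. ennreal ((G x)\<^sup>2) \<partial>M) \<le> (\<integral>\<^sup>+x. ennreal t * \<phi> x + ennreal ((f x)\<^sup>2) * indicator (\<Union>?P - \<Union>E) x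
        + (\<Sum>P\<in>E. ennreal (t / \<epsilon> * \<bar>av P\<bar>) * indicator P x) \<partial>M)"
      by (rule nn_integral_mono_AE)
    also have "\<dots> = ennreal t * ennreal I + (\<integral>\<^sup>+x\<in>\<Union>?P - \<Union>E. ennreal ((f x)\<^sup>2) \<partial>M)
        + (\<Sum>P\<in>E. ennreal (t / \<epsilon> * \<bar>av P\<bar>) * emeasure M P)"
    proof -
      have [measurable]: "\<And>P. P \<in> E \<Longrightarrow> P \<in> sets M" by (rule Em)
      have 1: "(\<integral>\<^sup>+x. ennreal t * \<phi> x \<partial>M) = ennreal t * ennreal I"
        unfolding eI[symmetric] \<phi>_def by (rule nn_integral_cmult) measurable
      have 2: "(\<integral>\<^sup>+x. (\<Sum>P\<in>E. ennreal (t / \<epsilon> * \<bar>av P\<bar>) * indicator P x) \<partial>M) = (\<Sum>P\<in>E. ennreal (t / \<epsilon> * \<bar>av P\<bar>) * emeasure M P)"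
        by (subst nn_integral_sum) (auto simp: nn_integral_cmult_indicator)
      show ?thesis unfolding 1[symmetric] 2[symmetric]
        by (subst nn_integral_add, measurable, subst nn_integral_add, measurable)
    qed
    also have "\<dots> \<le> ennreal (t * I) + ennreal (t * I) + ennreal (t / \<epsilon> * I)"
    proof (intro add_mono rest)
      show "ennreal t * ennreal I \<le> ennreal (t * I)" using t I by (simp add: ennreal_mult)
      have "(\<Sum>P\<in>E. ennreal (t / \<epsilon> * \<bar>av P\<bar>) * emeasure M P) = (\<Sum>P\<in>E. ennreal (t / \<epsilon>) * (ennreal \<bar>av P\<bar> * emeasure M P))"
        using t eps by (intro sum.cong refl) (simp add: ennreal_mult mult.assoc del: times_divide_eq_left)
      also have "\<dots> \<le> (\<Sum>P\<in>E. ennreal (t / \<epsilon>) * (\<integral>\<^sup>+x\<in>P. \<phi> x \<partial>M))"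
        by (intro sum_mono mult_left_mono av) auto
      also have "\<dots> \<le> ennreal (t / \<epsilon>) * ennreal I"
        unfolding sum_distrib_left[symmetric] by (rule mult_left_mono[OF sumP]) simp
      also have "\<dots> = ennreal (t / \<epsilon> * I)" using t eps I by (simp add: ennreal_mult[symmetric])
      finally show "(\<Sum>P\<in>E. ennreal (t / \<epsilon> * \<bar>av P\<bar>) * emeasure M P) \<le> ennreal (t / \<epsilon> * I)" .
    qed
    also have "\<dots> \<le> ennreal (3 * t / \<epsilon> * I)"
    proof -
      have three_times: "x + x + y \<le> 3 * y" if "x \<le> y" for x y :: real using that by linarith
      have "t \<le> t / \<epsilon>" using t eps by (simp add: field_simps)
      then have "t * I \<le> t / \<epsilon> * I" using I by (intro mult_right_mono) auto
      then have "t * I + t * I + t / \<epsilon> * I \<le> 3 * (t / \<epsilon> * I)" by (rule three_times)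
      also have "\<dots> = 3 * t / \<epsilon> * I" by simp
      finally have "t * I + t * I + t / \<epsilon> * I \<le> 3 * t / \<epsilon> * I" .
      then have "ennreal (t * I + t * I + t / \<epsilon> * I) \<le> ennreal (3 * t / \<epsilon> * I)" by (rule ennreal_leI)
      moreover have "0 \<le> t * I" "0 \<le> t / \<epsilon> * I" using t eps I by auto
      ultimately show ?thesis by (simp only: ennreal_plus add_nonneg_nonneg)
    qed
    finally have "ennreal t * emeasure M {x\<in>space M. t / 2 < \<bar>T G x\<bar>} \<le> ennreal (4 * b * (3 * t / \<epsilon>) / t * I)"
      by (intro T_chebyshev[OF GL2 I0 _ t]) (use t eps in auto)
    then have S1: "ennreal t * emeasure M {x\<in>space M. t / 2 < \<bar>T G x\<bar>} \<le> ennreal (12 * b / \<epsilon> * I)"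
      using t by (simp add: mult.assoc mult.left_commute)
    define S2 where "S2 = (\<Union>P\<in>E. enlarged D P)"
    have bigm: "enlarged D P \<in> sets M" if "P \<in> E" for P by (rule enlarged_sets[OF D EQ[OF that]])
    have S2m[measurable]: "S2 \<in> sets M" unfolding S2_def using E(2) bigm by (intro sets.finite_UN) auto
    \<comment> \<open>The enlarged cubes are simply discarded: their measure is comparable to that
      of the selected cubes, which the stopping condition bounds by I/t.\<close>
    have S2: "ennreal t * emeasure M S2 \<le> ennreal Cb * ennreal I"
    proof -
      have "emeasure M S2 \<le> (\<Sum>P\<in>E. emeasure M (enlarged D P))"
        unfolding S2_def by (rule emeasure_subadditive_finite) (use E(2) bigm in auto)
      also have "\<dots> \<le> (\<Sum>P\<in>E. ennreal Cb * emeasure M P)" by (intro sum_mono Cb EQ)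
      finally have "ennreal t * emeasure M S2 \<le> ennreal t * (\<Sum>P\<in>E. ennreal Cb * emeasure M P)"
        by (rule mult_left_mono) simp
      also have "\<dots> = ennreal Cb * (\<Sum>P\<in>E. ennreal t * emeasure M P)"
        by (simp add: sum_distrib_left mult_ac)
      also have "\<dots> \<le> ennreal Cb * (\<Sum>P\<in>E. \<integral>\<^sup>+x\<in>P. \<phi> x \<partial>M)"
        using E(1) by (intro mult_left_mono sum_mono less_imp_le[OF stopping_cubesD(3)]) auto
      also have "\<dots> \<le> ennreal Cb * ennreal I" by (rule mult_left_mono[OF sumP]) simp
      finally show ?thesis .
    qed
    define S3 where "S3 = {x\<in>space M - S2. t / 2 < (\<Sum>P\<in>E. \<bar>T (bad P) x\<bar>)}"
    have Tbm[measurable]: "T (bad P) \<in> borel_measurable M" if "P \<in> E" for P by (rule T_measurable[OF badL2[OF that]])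
    have S3m[measurable]: "S3 \<in> sets M"
    proof -
      have "S3 = {x\<in>space M. t / 2 < (\<Sum>P\<in>E. \<bar>T (bad P) x\<bar>)} - S2" unfolding S3_def by auto
      also have "\<dots> \<in> sets M" by (intro sets.Diff S2m) measurable
      finally show ?thesis .
    qed
    \<comment> \<open>The 4 collects a 2 from Chebyshev's inequality at height t/2 and a 2 from the
      norm of a bad piece.\<close>
    have S3: "ennreal t * emeasure M S3 \<le> ennreal (4 * C2) * ennreal I"
    proof -
      have "ennreal (t / 2) * emeasure M S3 = (\<integral>\<^sup>+x\<in>S3. ennreal (t / 2) \<partial>M)" by (simp add: set_nn_integral_const)
      also have "\<dots> \<le> (\<integral>\<^sup>+x\<in>S3. (\<Sum>P\<in>E. ennreal \<bar>T (bad P) x\<bar>) \<partial>M)"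
        by (rule set_nn_integral_mono) (auto simp: S3_def intro!: ennreal_leI)
      also have "\<dots> = (\<Sum>P\<in>E. (\<integral>\<^sup>+x\<in>S3. ennreal \<bar>T (bad P) x\<bar> \<partial>M))"
        unfolding sum_distrib_right by (rule nn_integral_sum) measurable
      also have "\<dots> \<le> (\<Sum>P\<in>E. ennreal C2 * (2 * (\<integral>\<^sup>+x\<in>P. \<phi> x \<partial>M)))"
      proof (rule sum_mono)
        fix P assume P: "P \<in> E"
        have "(\<integral>\<^sup>+x\<in>S3. ennreal \<bar>T (bad P) x\<bar> \<partial>M) \<le> (\<integral>\<^sup>+x\<in>space M - enlarged D P. ennreal \<bar>T (bad P) x\<bar> \<partial>M)"
          by (rule set_nn_integral_subset) (use P in \<open>auto simp: S3_def S2_def\<close>)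
        also have "\<dots> \<le> ennreal C2 * (\<integral>\<^sup>+x. ennreal \<bar>bad P x\<bar> \<partial>M)"
          unfolding C2_def by (rule cz_cancellation[OF D EQ[OF P] badL2[OF P] bad_int[OF P] bad_off bad_mean[OF P]])
        also have "\<dots> \<le> ennreal C2 * (2 * (\<integral>\<^sup>+x\<in>P. \<phi> x \<partial>M))" by (rule mult_left_mono[OF bad_norm[OF P]]) simp
        finally show "(\<integral>\<^sup>+x\<in>S3. ennreal \<bar>T (bad P) x\<bar> \<partial>M) \<le> ennreal C2 * (2 * (\<integral>\<^sup>+x\<in>P. \<phi> x \<partial>M))" .
      qed
      also have "\<dots> = ennreal C2 * (2 * (\<Sum>P\<in>E. \<integral>\<^sup>+x\<in>P. \<phi> x \<partial>M))" by (simp add: sum_distrib_left)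
      also have "\<dots> \<le> ennreal C2 * (2 * ennreal I)" by (intro mult_left_mono sumP) auto
      finally have "ennreal 2 * (ennreal (t / 2) * emeasure M S3) \<le> ennreal 2 * (ennreal C2 * (2 * ennreal I))"
        by (rule mult_left_mono) simp
      moreover have "ennreal 2 * ennreal (t / 2) = ennreal t"
        using t by (subst ennreal_mult[symmetric]) auto
      moreover have "ennreal 2 * (ennreal C2 * (2 * ennreal I)) = ennreal (4 * C2) * ennreal I"
        using C2 by (simp add: ennreal_mult mult_ac)
      ultimately show ?thesis by (simp add: mult.assoc[symmetric])
    qed
    have "AE x in M. T f x = T G x + T (\<lambda>x. \<Sum>P\<in>E. bad P x) x"
      by (rule T_add[OF GL2 L2_sum[OF E(2) badL2]]) (auto simp: G_def)
    moreover have "AE x in M. T (\<lambda>x. \<Sum>P\<in>E. bad P x) x = (\<Sum>P\<in>E. T (bad P) x)"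
      by (rule T_sum[OF E(2) badL2])
    ultimately have "AE x in M. x \<in> {x\<in>space M. t < \<bar>T f x\<bar>} \<longrightarrow> x \<in> {x\<in>space M. t / 2 < \<bar>T G x\<bar>} \<union> S2 \<union> S3"
    proof eventually_elim
      case (elim x)
      have "\<bar>T f x\<bar> \<le> \<bar>T G x\<bar> + (\<Sum>P\<in>E. \<bar>T (bad P) x\<bar>)"
        using elim sum_abs[of "\<lambda>P. T (bad P) x" E] by linarith
      then show ?case unfolding S3_def by auto
    qed
    then have "emeasure M {x\<in>space M. t < \<bar>T f x\<bar>} \<le> emeasure M ({x\<in>space M. t / 2 < \<bar>T G x\<bar>} \<union> S2 \<union> S3)"
      using T_measurable[OF GL2] by (intro emeasure_mono_AE) auto
    also have "\<dots> \<le> emeasure M {x\<in>space M. t / 2 < \<bar>T G x\<bar>} + emeasure M S2 + emeasure M S3"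
      using T_measurable[OF GL2]
      by (intro order_trans[OF emeasure_subadditive] add_mono order_refl emeasure_subadditive) auto
    finally have "ennreal t * emeasure M {x\<in>space M. t < \<bar>T f x\<bar>}
        \<le> ennreal t * (emeasure M {x\<in>space M. t / 2 < \<bar>T G x\<bar>} + emeasure M S2 + emeasure M S3)"
      by (rule mult_left_mono) simp
    also have "\<dots> \<le> ennreal (12 * b / \<epsilon> * I) + ennreal Cb * ennreal I + ennreal (4 * C2) * ennreal I"
      unfolding distrib_left by (intro add_mono S1 S2 S3)
    also have "\<dots> = ennreal (12 * b / \<epsilon> + Cb + 4 * C2) * ennreal I"
      using b0 eps Cb(1) C2 I0
      by (simp add: ennreal_mult[symmetric] ennreal_plus[symmetric] distrib_right del: ennreal_plus)
    finally show ?thesis unfolding eI C2_def .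
  qed
qed

text \<open>Support in a cube with average at most \<open>t\<close> lets the stopping procedure
  start; in \<open>exceptional_small\<close> such a cube is at hand. The constant is the same for
  all systems and cubes.\<close>

lemma local_weak_type:
  obtains C where "1 \<le> C" "\<And>D Q f t. D \<in> \<D> \<Longrightarrow> Q \<in> cubes_of D \<Longrightarrow> f \<in> L2 M \<Longrightarrow> 0 < t \<Longrightarrow> (\<And>y. y \<notin> Q \<Longrightarrow> f y = 0) \<Longrightarrow>
    (\<integral>\<^sup>+x. ennreal \<bar>f x\<bar> \<partial>M) \<le> ennreal t * emeasure M Q \<Longrightarrow>
    ennreal t * emeasure M {x\<in>space M. t < \<bar>T f x\<bar>} \<le> ennreal C * (\<integral>\<^sup>+x. ennreal \<bar>f x\<bar> \<partial>M)"
proof -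
  obtain Cb where Cb: "1 \<le> Cb" "\<forall>D\<in>\<D>. \<forall>P\<in>cubes_of D. emeasure M (B (centre D P) (\<alpha> * radius D P)) \<le> ennreal Cb * emeasure M P"
    using ball_le_cube[of \<alpha>] by blast
  let ?C = "12 * b / \<epsilon> + Cb + 4 * (A / (1 - \<theta>))"
  have "0 \<le> 12 * b / \<epsilon>" "0 \<le> 4 * (A / (1 - \<theta>))" using b0 eps_pos A1 theta by auto
  then have "1 \<le> ?C" using Cb(1) by linarith
  moreover have "ennreal t * emeasure M {x\<in>space M. t < \<bar>T f x\<bar>} \<le> ennreal ?C * (\<integral>\<^sup>+x. ennreal \<bar>f x\<bar> \<partial>M)"
    if "D \<in> \<D>" "Q \<in> cubes_of D" "f \<in> L2 M" "0 < t" "\<And>y. y \<notin> Q \<Longrightarrow> f y = 0"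
      "(\<integral>\<^sup>+x. ennreal \<bar>f x\<bar> \<partial>M) \<le> ennreal t * emeasure M Q" for D Q f t
    by (rule local_weak_type_aux[OF that Cb(1)]) (use Cb(2) that(1) in \<open>auto simp: enlarged_def\<close>)
  ultimately show ?thesis by (rule that)
qed

end

section \<open>Sparse domination\<close>

context cz_space
begin

text \<open>Unlike \<^term>\<open>enlarged D P\<close>, this dilate of a cube is monotone in the cube.\<close>

definition dilate :: "(int \<Rightarrow> 'a set set) \<Rightarrow> 'a set \<Rightarrow> 'a set" where
  "dilate D P = \<Union>(enlarged D ` {R\<in>cubes_of D. R \<subseteq> P})"

lemma dilate_mono: "P \<subseteq> Q \<Longrightarrow> dilate D P \<subseteq> dilate D Q"
  unfolding dilate_def by blast

lemma enlarged_subset_dilate: "P \<in> cubes_of D \<Longrightarrow> enlarged D P \<subseteq> dilate D P"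
  unfolding dilate_def by blast

lemma dilate_sets: "D \<in> \<D> \<Longrightarrow> dilate D P \<in> sets M"
  unfolding dilate_def using cubes_of_countable enlarged_sets
  by (intro sets.countable_UN') (auto intro: countable_subset)

lemma cube_subset_dilate: "D \<in> \<D> \<Longrightarrow> P \<in> cubes_of D \<Longrightarrow> P \<subseteq> dilate D P"
  using cube_subset_enlarged enlarged_subset_dilate by blast

text \<open>A subcube has its centre in \<open>P\<close> and no larger radius, so its enlargement
  reaches only a bounded multiple of the radius of \<open>P\<close>.\<close>

lemma dilate_subset_ball:
  assumes D: "D \<in> \<D>" and P: "P \<in> cubes_of D"
  shows "dilate D P \<subseteq> B (centre D P) (\<kappa> * (C0 + \<alpha>) * radius D P)"
proof -
  have "enlarged D R \<subseteq> B (centre D P) (\<kappa> * (C0 + \<alpha>) * radius D P)" if R: "R \<in> cubes_of D" "R \<subseteq> P" for R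
  proof -
    have "enlarged D R \<subseteq> B (centre D R) (\<alpha> * radius D P)"
      unfolding enlarged_def using radius_mono[OF D R(1) P R(2)] alpha(4) by (intro qball_mono) simp
    also have "\<dots> \<subseteq> B (centre D P) (\<kappa> * (C0 * radius D P + \<alpha> * radius D P))"
      by (rule ball_subset_ball) (use centre_in[OF D R(1)] R(2) gen_centre[OF D P] in auto)
    finally show ?thesis by (simp add: algebra_simps)
  qed
  then show ?thesis unfolding dilate_def by blast
qed

text \<open>The use of the adjacent systems: the ball around the dilate lies in a cube, possibly of
  another system, and doubling compares its measure with that of \<open>P\<close>.\<close>

lemma dilate_in_cube:
  obtains C where "1 \<le> C" "\<And>D P. D \<in> \<D> \<Longrightarrow> P \<in> cubes_of D \<Longrightarrow> \<exists>Q\<in>cubes \<D>. dilate D P \<subseteq> Q \<and> emeasure M Q \<le> ennreal C * emeasure M P"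
proof -
  let ?\<beta> = "\<kappa> * (C0 + \<alpha>)"
  obtain C where C: "1 \<le> C" "\<forall>D\<in>\<D>. \<forall>P\<in>cubes_of D. emeasure M (B (centre D P) (?\<beta> * radius D P)) \<le> ennreal C * emeasure M P"
    using ball_le_cube[of ?\<beta>] by blast
  have "0 < C0 + \<alpha>" using C0 alpha(4) by simp
  then have b: "0 < ?\<beta>" using kappa by simp
  have "\<exists>Q\<in>cubes \<D>. dilate D P \<subseteq> Q \<and> emeasure M Q \<le> ennreal (max 1 c_cov * C) * emeasure M P"
    if D: "D \<in> \<D>" and P: "P \<in> cubes_of D" for D P
  proof -
    have "0 < ?\<beta> * radius D P" using b radius_pos by simp
    then obtain Q where Q: "Q \<in> cubes \<D>" "B (centre D P) (?\<beta> * radius D P) \<subseteq> Q"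
      "emeasure M Q \<le> ennreal c_cov * emeasure M (B (centre D P) (?\<beta> * radius D P))"
      using covering[OF gen_centre(2)[OF D P]] by blast
    note Q(3)
    also have "\<dots> \<le> ennreal (max 1 c_cov) * (ennreal C * emeasure M P)"
      using C(2) D P by (intro mult_mono ennreal_leI) auto
    also have "\<dots> = ennreal (max 1 c_cov * C) * emeasure M P"
      using C(1) by (simp add: ennreal_mult mult.assoc)
    finally show ?thesis using Q dilate_subset_ball[OF D P] by blast
  qed
  moreover have "1 * 1 \<le> max 1 c_cov * C" using C(1) by (intro mult_mono) auto
  ultimately show ?thesis using that[of "max 1 c_cov * C"] by simp
qed

definition cutoff :: "(int \<Rightarrow> 'a set set) \<Rightarrow> ('a \<Rightarrow> real) \<Rightarrow> 'a set \<Rightarrow> 'a \<Rightarrow> real" where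
  "cutoff D f P y = f y * indicator (dilate D P) y"

text \<open>The integral is over the dilate of \<open>P\<close>, but the normalization is by the measure of \<open>P\<close> itself.\<close>

definition avg :: "(int \<Rightarrow> 'a set set) \<Rightarrow> ('a \<Rightarrow> real) \<Rightarrow> 'a set \<Rightarrow> real" where
  "avg D f P = enn2real (\<integral>\<^sup>+x\<in>dilate D P. ennreal \<bar>f x\<bar> \<partial>M) / measure M P"

text \<open>Outside this set, the value of \<open>T\<close> and the maximal function of the same
  cutoff are both bounded by \<Lambda> times the average of \<open>f\<close>.\<close>

definition exceptional :: "(int \<Rightarrow> 'a set set) \<Rightarrow> ('a \<Rightarrow> real) \<Rightarrow> real \<Rightarrow> 'a set \<Rightarrow> 'a set" where
  "exceptional D f \<Lambda> P = {x\<in>P. \<Lambda> * avg D f P < \<bar>T (cutoff D f P) x\<bar>} \<union>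
     {x\<in>P. ennreal (\<Lambda> * avg D f P) < maximal M \<D> (cutoff D f P) x}"

lemma avg_nonneg: "0 \<le> avg D f P"
  unfolding avg_def by simp

lemma avg_eq:
  assumes D: "D \<in> \<D>" and P: "P \<in> cubes_of D" and f: "integrable M f"
  shows "ennreal (avg D f P) * emeasure M P = (\<integral>\<^sup>+x\<in>dilate D P. ennreal \<bar>f x\<bar> \<partial>M)"
proof -
  have "(\<integral>\<^sup>+x\<in>dilate D P. ennreal \<bar>f x\<bar> \<partial>M) \<le> (\<integral>\<^sup>+x. ennreal \<bar>f x\<bar> \<partial>M)" by (rule set_nn_integral_le_space)
  also have "\<dots> < \<infinity>" using f by (simp add: integrable_iff_bounded)
  finally have fin: "(\<integral>\<^sup>+x\<in>dilate D P. ennreal \<bar>f x\<bar> \<partial>M) < \<infinity>" .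
  have m: "0 < measure M P" "emeasure M P = ennreal (measure M P)"
    using cubes_of_pos[OF D P] cubes_of_finite[OF D P] by (auto simp: measure_def enn2real_positive_iff)
  have "ennreal (avg D f P) * emeasure M P = ennreal (avg D f P * measure M P)"
    unfolding m(2) by (simp add: ennreal_mult avg_nonneg)
  also have "avg D f P * measure M P = enn2real (\<integral>\<^sup>+x\<in>dilate D P. ennreal \<bar>f x\<bar> \<partial>M)"
    unfolding avg_def using m(1) by simp
  finally show ?thesis using fin by simp
qed

lemma cutoff_L2: "D \<in> \<D> \<Longrightarrow> f \<in> L2 M \<Longrightarrow> cutoff D f P \<in> L2 M"
  unfolding cutoff_def[abs_def] by (rule L2_cut[OF _ dilate_sets])

lemma cutoff_nn_integral: "(\<integral>\<^sup>+x. ennreal \<bar>cutoff D f P x\<bar> \<partial>M) = (\<integral>\<^sup>+x\<in>dilate D P. ennreal \<bar>f x\<bar> \<partial>M)"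
  unfolding cutoff_def by (intro nn_integral_cong) (auto simp: indicator_def)

lemma exceptional_sets:
  assumes D: "D \<in> \<D>" and P: "P \<in> cubes_of D" and f: "f \<in> L2 M"
  shows "exceptional D f \<Lambda> P \<in> sets M"
proof -
  have [measurable]: "P \<in> sets M" "T (cutoff D f P) \<in> borel_measurable M"
    using cubes_of_sets[OF D P] T_measurable[OF cutoff_L2[OF D f]] by auto
  have "exceptional D f \<Lambda> P = ({x\<in>space M. \<Lambda> * avg D f P < \<bar>T (cutoff D f P) x\<bar>} \<union>
     {x\<in>space M. ennreal (\<Lambda> * avg D f P) < maximal M \<D> (cutoff D f P) x}) \<inter> P"
    using sets.sets_into_space[OF cubes_of_sets[OF D P]] unfolding exceptional_def by auto
  also have "\<dots> \<in> sets M" by measurable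
  finally show ?thesis .
qed

text \<open>The weak type inequalities for \<open>T\<close> and \<open>M\<close> at height \<Lambda>
  times the average bound the relative measure by (C + n)/\<Lambda>. The bound \<epsilon>/8 is what
  the densities in \<open>children\<close> require.\<close>

lemma exceptional_small:
  obtains \<Lambda> where "1 \<le> \<Lambda>" "\<And>D f P. D \<in> \<D> \<Longrightarrow> f \<in> L2 M \<Longrightarrow> integrable M f \<Longrightarrow> P \<in> cubes_of D \<Longrightarrow>
    emeasure M (exceptional D f \<Lambda> P) \<le> ennreal (\<epsilon> / 8) * emeasure M P"
proof -
  obtain C where C: "1 \<le> C" "\<And>D Q f t. D \<in> \<D> \<Longrightarrow> Q \<in> cubes_of D \<Longrightarrow> f \<in> L2 M \<Longrightarrow> 0 < t \<Longrightarrow> (\<And>y. y \<notin> Q \<Longrightarrow> f y = 0) \<Longrightarrow>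
    (\<integral>\<^sup>+x. ennreal \<bar>f x\<bar> \<partial>M) \<le> ennreal t * emeasure M Q \<Longrightarrow>
    ennreal t * emeasure M {x\<in>space M. t < \<bar>T f x\<bar>} \<le> ennreal C * (\<integral>\<^sup>+x. ennreal \<bar>f x\<bar> \<partial>M)"
    by (rule local_weak_type) blast
  define n where "n = real (card \<D>)"
  define \<Lambda> where "\<Lambda> = 16 * (C + n) / \<epsilon>"
  have n: "0 \<le> n" unfolding n_def by simp
  have \<Lambda>: "1 \<le> \<Lambda>" unfolding \<Lambda>_def using C(1) n eps_pos eps_less by (simp add: field_simps)
  have "emeasure M (exceptional D f \<Lambda> P) \<le> ennreal (\<epsilon> / 8) * emeasure M P"
    if D: "D \<in> \<D>" and f: "f \<in> L2 M" and fint: "integrable M f" and P: "P \<in> cubes_of D" for D f P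
  proof -
    let ?g = "cutoff D f P"
    let ?E1 = "{x\<in>space M. \<Lambda> * avg D f P < \<bar>T ?g x\<bar>}"
    let ?E2 = "{x\<in>space M. ennreal (\<Lambda> * avg D f P) < maximal M \<D> ?g x}"
    have g: "?g \<in> L2 M" by (rule cutoff_L2[OF D f])
    have gm[measurable]: "?g \<in> borel_measurable M" by (rule L2_measurable[OF g])
    have Tm[measurable]: "T ?g \<in> borel_measurable M" by (rule T_measurable[OF g])
    have gi: "(\<integral>\<^sup>+x. ennreal \<bar>?g x\<bar> \<partial>M) = ennreal (avg D f P) * emeasure M P"
      unfolding cutoff_nn_integral avg_eq[OF D P fint] ..
    have sub: "exceptional D f \<Lambda> P \<subseteq> ?E1 \<union> ?E2"
      using sets.sets_into_space[OF cubes_of_sets[OF D P]] unfolding exceptional_def by auto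
    have le: "emeasure M (exceptional D f \<Lambda> P) \<le> emeasure M ?E1 + emeasure M ?E2"
      by (rule order_trans[OF emeasure_mono[OF sub] emeasure_subadditive]) auto
    show ?thesis
    proof (cases "avg D f P = 0")
      case True
      then have "(\<integral>\<^sup>+x. ennreal \<bar>?g x\<bar> \<partial>M) = 0" using gi by simp
      then have g0: "AE x in M. ?g x = 0" by (subst (asm) nn_integral_0_iff_AE) auto
      have "emeasure M ?E1 = 0"
        using T_null[OF g g0] True by (intro emeasure_eq_0_AE) (auto elim: eventually_mono)
      moreover have "?E2 = {}" using maximal_zero[OF gm g0] by auto
      then have "emeasure M ?E2 = 0" by (simp only: emeasure_empty)
      ultimately have "emeasure M (exceptional D f \<Lambda> P) = 0" using le by simp
      then show ?thesis by simp
    next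
      case False
      then have a: "0 < avg D f P" using avg_nonneg[of D f P] by simp
      let ?t = "\<Lambda> * avg D f P"
      have t: "0 < ?t" using a \<Lambda> by simp
      \<comment> \<open>The cutoff lives on the dilate, not on \<open>P\<close>; it is supported in
        this larger cube, which may belong to another system and to which
        \<open>local_weak_type\<close> is applied.\<close>
      obtain Q where Q: "Q \<in> cubes \<D>" "dilate D P \<subseteq> Q" by (rule dilate_in_cube) (use D P in blast)
      then obtain D' where D': "D' \<in> \<D>" "Q \<in> cubes_of D'" unfolding cubes_eq by blast
      have PQ: "P \<subseteq> Q" using cube_subset_dilate[OF D P] Q(2) by blast
      have "ennreal ?t * emeasure M ?E1 \<le> ennreal C * (\<integral>\<^sup>+x. ennreal \<bar>?g x\<bar> \<partial>M)"
      proof (rule C(2)[OF D' g t])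
        show "?g y = 0" if "y \<notin> Q" for y using that Q(2) unfolding cutoff_def by (auto simp: indicator_def)
        have "avg D f P \<le> ?t" using mult_right_mono[OF \<Lambda>, of "avg D f P"] a by simp
        then show "(\<integral>\<^sup>+x. ennreal \<bar>?g x\<bar> \<partial>M) \<le> ennreal ?t * emeasure M Q"
          unfolding gi using PQ cubes_of_sets[OF D'] by (intro mult_mono ennreal_leI emeasure_mono) auto
      qed
      moreover have "ennreal ?t * emeasure M ?E2 \<le> ennreal n * (\<integral>\<^sup>+x. ennreal \<bar>?g x\<bar> \<partial>M)"
        using maximal_weak_type[OF gm less_imp_le[OF t]] unfolding n_def by (simp add: ennreal_of_nat_eq_real_of_nat)
      ultimately have "ennreal ?t * emeasure M ?E1 + ennreal ?t * emeasure M ?E2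
          \<le> ennreal C * (\<integral>\<^sup>+x. ennreal \<bar>?g x\<bar> \<partial>M) + ennreal n * (\<integral>\<^sup>+x. ennreal \<bar>?g x\<bar> \<partial>M)"
        by (rule add_mono)
      also have "\<dots> = ennreal ((C + n) * avg D f P) * emeasure M P"
        unfolding gi using C(1) n a by (simp add: ennreal_mult ennreal_plus distrib_right mult.assoc)
      finally have "ennreal ?t * (emeasure M ?E1 + emeasure M ?E2) \<le> ennreal ((C + n) * avg D f P) * emeasure M P"
        by (simp add: distrib_left)
      then have "ennreal (1 / ?t) * (ennreal ?t * (emeasure M ?E1 + emeasure M ?E2))
          \<le> ennreal (1 / ?t) * (ennreal ((C + n) * avg D f P) * emeasure M P)"
        by (rule mult_left_mono) simp
      moreover have "ennreal (1 / ?t) * ennreal ?t = 1"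
        using t by (subst ennreal_mult[symmetric]) auto
      moreover have "ennreal (1 / ?t) * ennreal ((C + n) * avg D f P) = ennreal (\<epsilon> / 16)"
      proof -
        have "0 < C + n" using C(1) n by simp
        then have "1 / ?t * ((C + n) * avg D f P) = \<epsilon> / 16"
          unfolding \<Lambda>_def using a eps_pos by (simp add: divide_simps)
        moreover have "ennreal (1 / ?t) * ennreal ((C + n) * avg D f P) = ennreal (1 / ?t * ((C + n) * avg D f P))"
          by (rule ennreal_mult[symmetric]) (use t C(1) n a in auto)
        ultimately show ?thesis by (simp only:)
      qed
      ultimately have "emeasure M ?E1 + emeasure M ?E2 \<le> ennreal (\<epsilon> / 16) * emeasure M P"
        by (simp add: mult.assoc[symmetric])
      also have "\<dots> \<le> ennreal (\<epsilon> / 8) * emeasure M P"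
        using eps_pos by (intro mult_right_mono ennreal_leI) auto
      finally show ?thesis using le by simp
    qed
  qed
  then show ?thesis using that[OF \<Lambda>] by blast
qed

text \<open>The threshold \<epsilon>/4 is twice the bound \<epsilon>/8 for the exceptional set, so
  the children cover at most half of the cube; and it is small enough that, after the loss
  1/\<epsilon>, the exceptional set has density at most 1/4 in each child.\<close>

definition children :: "(int \<Rightarrow> 'a set set) \<Rightarrow> ('a \<Rightarrow> real) \<Rightarrow> real \<Rightarrow> 'a set \<Rightarrow> 'a set set" where
  "children D f \<Lambda> P = cube_family.stopping_cubes M (cubes_of D) (indicator (exceptional D f \<Lambda> P)) (\<epsilon> / 4) P"

text \<open>The constant of \<open>cz_oscillation\<close> as a real number; the maximum with 0
  reproduces the truncation in \<open>ennreal c_cov\<close>.\<close>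

definition C1 :: real where "C1 = A / (1 - \<theta>) * max 0 c_cov"

lemma C1_nonneg: "0 \<le> C1"
  unfolding C1_def using A1 theta by simp

context
  fixes D f \<Lambda>
  assumes D: "D \<in> \<D>" and f: "f \<in> L2 M" and fint: "integrable M f" and \<Lambda>: "1 \<le> \<Lambda>"
    and small: "\<And>P. P \<in> cubes_of D \<Longrightarrow> emeasure M (exceptional D f \<Lambda> P) \<le> ennreal (\<epsilon> / 8) * emeasure M P"
begin

interpretation cube_family M \<epsilon> "cubes_of D" by (rule cube_family_cubes_of[OF D])

lemma exceptional_measurable: "P \<in> cubes_of D \<Longrightarrow> exceptional D f \<Lambda> P \<in> sets M"
  by (rule exceptional_sets[OF D _ f])

lemma children_cube: "R \<in> children D f \<Lambda> P \<Longrightarrow> R \<in> cubes_of D" "R \<in> children D f \<Lambda> P \<Longrightarrow> R \<subseteq> P"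
  unfolding children_def by (auto dest: stopping_cubesD)

lemma disjoint_children: "disjoint (children D f \<Lambda> P)"
  unfolding children_def by (rule disjoint_stopping_cubes)

lemma countable_children: "countable (children D f \<Lambda> P)"
  unfolding children_def by (rule countable_stopping_cubes)

lemma exceptional_integral: "P \<in> cubes_of D \<Longrightarrow> R \<in> cubes_of D \<Longrightarrow> (\<integral>\<^sup>+x\<in>R. indicator (exceptional D f \<Lambda> P) x \<partial>M) = emeasure M (exceptional D f \<Lambda> P \<inter> R)"
  using exceptional_measurable cube_sets by (intro set_nn_integral_indicator)

lemma exceptional_start:
  assumes P: "P \<in> cubes_of D"
  shows "(\<integral>\<^sup>+x\<in>P. indicator (exceptional D f \<Lambda> P) x \<partial>M) \<le> ennreal (\<epsilon> / 4) * emeasure M P"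
proof -
  have "emeasure M (exceptional D f \<Lambda> P \<inter> P) \<le> emeasure M (exceptional D f \<Lambda> P)"
    by (intro emeasure_mono exceptional_measurable P) auto
  also have "\<dots> \<le> ennreal (\<epsilon> / 8) * emeasure M P" by (rule small[OF P])
  also have "\<dots> \<le> ennreal (\<epsilon> / 4) * emeasure M P" using eps_pos by (intro mult_right_mono ennreal_leI) auto
  finally show ?thesis unfolding exceptional_integral[OF P P] .
qed

lemma children_measure:
  assumes P: "P \<in> cubes_of D"
  shows "2 * emeasure M (\<Union>(children D f \<Lambda> P)) \<le> emeasure M P"
proof -
  have m: "indicator (exceptional D f \<Lambda> P) \<in> borel_measurable M" using exceptional_measurable[OF P] by simp
  let ?U = "\<Union>(children D f \<Lambda> P)"
  have U: "?U \<in> sets M" unfolding children_def by (rule Union_stopping_cubes_sets)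
  have "ennreal (\<epsilon> / 4) * emeasure M ?U \<le> (\<integral>\<^sup>+x\<in>?U. indicator (exceptional D f \<Lambda> P) x \<partial>M)"
    unfolding children_def by (rule stopping_cubes_measure_le[OF m])
  also have "\<dots> \<le> emeasure M (exceptional D f \<Lambda> P)"
    using set_nn_integral_le_space[of M "indicator (exceptional D f \<Lambda> P)" ?U] exceptional_measurable[OF P] by simp
  also have "\<dots> \<le> ennreal (\<epsilon> / 8) * emeasure M P" by (rule small[OF P])
  finally have "ennreal (8 / \<epsilon>) * (ennreal (\<epsilon> / 4) * emeasure M ?U) \<le> ennreal (8 / \<epsilon>) * (ennreal (\<epsilon> / 8) * emeasure M P)"
    by (rule mult_left_mono) simp
  then show ?thesis using eps_pos by (simp add: mult.assoc[symmetric] ennreal_mult[symmetric])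
qed

text \<open>The exceptional sets of \<open>P\<close> and \<open>R\<close> take at most 1/4 and 1/8
  of \<open>R\<close>. Hence the good points have positive measure and can be made to satisfy any
  property that holds almost everywhere.\<close>

lemma good_point:
  assumes P: "P \<in> cubes_of D" and R: "R \<in> children D f \<Lambda> P" and ae: "AE x in M. \<Psi> x"
  obtains z where "z \<in> R" "z \<notin> exceptional D f \<Lambda> P" "z \<notin> exceptional D f \<Lambda> R" "\<Psi> z"
proof -
  have RD: "R \<in> cubes_of D" by (rule children_cube(1)[OF R])
  have "\<exists>z. z \<in> R \<and> z \<notin> exceptional D f \<Lambda> P \<and> z \<notin> exceptional D f \<Lambda> R \<and> \<Psi> z"
  proof (rule ccontr)
    assume n: "\<not> ?thesis"
    let ?S = "exceptional D f \<Lambda> P \<inter> R \<union> exceptional D f \<Lambda> R"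
    have S: "?S \<in> sets M" using exceptional_measurable[OF P] exceptional_measurable[OF RD] cube_sets[OF RD] by auto
    have "AE x in M. x \<in> R \<longrightarrow> x \<in> ?S" using ae by eventually_elim (use n in auto)
    then have "emeasure M R \<le> emeasure M ?S" using S by (intro emeasure_mono_AE)
    also have "\<dots> \<le> emeasure M (exceptional D f \<Lambda> P \<inter> R) + emeasure M (exceptional D f \<Lambda> R)"
      using exceptional_measurable[OF P] exceptional_measurable[OF RD] cube_sets[OF RD] by (intro emeasure_subadditive) auto
    also have "\<dots> \<le> ennreal (1 / 4) * emeasure M R + ennreal (1 / 8) * emeasure M R"
    proof (rule add_mono)
      have "(\<integral>\<^sup>+x\<in>R. indicator (exceptional D f \<Lambda> P) x \<partial>M) \<le> ennreal (\<epsilon> / 4 / \<epsilon>) * emeasure M R"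
        by (rule stopping_cubes_average_le[OF P exceptional_start[OF P] R[unfolded children_def]]) (use eps_pos in simp)
      then show "emeasure M (exceptional D f \<Lambda> P \<inter> R) \<le> ennreal (1 / 4) * emeasure M R"
        unfolding exceptional_integral[OF P RD] using eps_pos by simp
      have "ennreal (\<epsilon> / 8) * emeasure M R \<le> ennreal (1 / 8) * emeasure M R"
        using eps_less by (intro mult_right_mono ennreal_leI) auto
      then show "emeasure M (exceptional D f \<Lambda> R) \<le> ennreal (1 / 8) * emeasure M R"
        using small[OF RD] by (rule order_trans[rotated])
    qed
    also have "\<dots> = ennreal (3 / 8) * emeasure M R"
      unfolding distrib_right[symmetric] by (subst ennreal_plus[symmetric]) auto
    finally have le: "emeasure M R \<le> ennreal (3 / 8) * emeasure M R" .
    have e: "emeasure M R = ennreal (measure M R)" "0 < measure M R"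
      using cube_pos[OF RD] cube_finite[OF RD] by (auto simp: measure_def enn2real_positive_iff)
    have "measure M R \<le> 3 / 8 * measure M R" using le unfolding e(1) by (simp add: ennreal_mult[symmetric])
    then show False using e(2) by simp
  qed
  then show ?thesis using that by blast
qed

text \<open>Off the children the density \<epsilon>/4 < 1 of an indicator means that almost no point
  is exceptional. On a child \<open>R\<close>, a good point bounds \<open>T h\<close> for the
  difference \<open>h\<close> of the two cutoffs, and the oscillation estimate carries this bound to
  almost every point of \<open>R\<close>.\<close>

lemma domination_step:
  assumes P: "P \<in> cubes_of D"
  shows "AE x in M. x \<in> P \<longrightarrow>
    (x \<notin> \<Union>(children D f \<Lambda> P) \<longrightarrow> \<bar>T (cutoff D f P) x\<bar> \<le> \<Lambda> * (1 + 2 * C1) * avg D f P) \<and>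
    (\<forall>R\<in>children D f \<Lambda> P. x \<in> R \<longrightarrow> \<bar>T (cutoff D f P) x\<bar> \<le> \<bar>T (cutoff D f R) x\<bar> + \<Lambda> * (1 + 2 * C1) * (avg D f P + avg D f R))"
proof -
  have m: "indicator (exceptional D f \<Lambda> P) \<in> borel_measurable M" using exceptional_measurable[OF P] by simp
  have "AE x in M. x \<in> P \<longrightarrow> x \<notin> \<Union>(children D f \<Lambda> P) \<longrightarrow> indicator (exceptional D f \<Lambda> P) x \<le> ennreal (\<epsilon> / 4)"
    unfolding children_def by (rule AE_le_outside_stopping_cubes[OF m P]) (use eps_pos in simp)
  then have 1: "AE x in M. x \<in> P \<longrightarrow> x \<notin> \<Union>(children D f \<Lambda> P) \<longrightarrow> \<bar>T (cutoff D f P) x\<bar> \<le> \<Lambda> * (1 + 2 * C1) * avg D f P"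
  proof eventually_elim
    case (elim x)
    show ?case
    proof (intro impI)
      assume x: "x \<in> P" "x \<notin> \<Union>(children D f \<Lambda> P)"
      have "x \<notin> exceptional D f \<Lambda> P"
      proof
        assume "x \<in> exceptional D f \<Lambda> P"
        then have "ennreal 1 \<le> ennreal (\<epsilon> / 4)" using elim x by simp
        then show False using eps_less eps_pos by (subst (asm) ennreal_le_iff) auto
      qed
      then have "\<bar>T (cutoff D f P) x\<bar> \<le> \<Lambda> * avg D f P" using x unfolding exceptional_def by (auto simp: not_less)
      also have "\<dots> \<le> \<Lambda> * avg D f P * (1 + 2 * C1)"
        using mult_left_mono[of 1 "1 + 2 * C1" "\<Lambda> * avg D f P"] C1_nonneg \<Lambda> avg_nonneg[of D f P] by simp
      finally show "\<bar>T (cutoff D f P) x\<bar> \<le> \<Lambda> * (1 + 2 * C1) * avg D f P" by (simp add: mult_ac)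
    qed
  qed
  have 2: "AE x in M. x \<in> R \<longrightarrow> \<bar>T (cutoff D f P) x\<bar> \<le> \<bar>T (cutoff D f R) x\<bar> + \<Lambda> * (1 + 2 * C1) * (avg D f P + avg D f R)"
    if R: "R \<in> children D f \<Lambda> P" for R
  proof -
    have RD: "R \<in> cubes_of D" "R \<subseteq> P" using children_cube[OF R] by auto
    \<comment> \<open>Since dilates are monotone, \<open>h\<close> is exactly the difference of the
      cutoffs to \<open>P\<close> and to \<open>R\<close>; it vanishes on the enlargement of
      \<open>R\<close>.\<close>
    define h where "h y = f y * indicator (dilate D P - dilate D R) y" for y
    have S: "dilate D P - dilate D R \<in> sets M" using dilate_sets[OF D] by auto
    have h: "h \<in> L2 M" unfolding h_def[abs_def] by (rule L2_cut[OF f S])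
    have hi: "integrable M h"
      unfolding h_def[abs_def] using integrable_mult_indicator[OF S fint] by (simp add: mult.commute)
    have h0: "h y = 0" if "y \<in> enlarged D R" for y
      using that enlarged_subset_dilate[OF RD(1)] unfolding h_def by (auto simp: indicator_def)
    obtain c where c: "AE x in M. x \<in> R \<longrightarrow>
        (\<forall>z\<in>R. ennreal \<bar>T h x - c\<bar> \<le> ennreal (A / (1 - \<theta>)) * (ennreal c_cov * maximal M \<D> h z))"
      using cz_oscillation[OF D RD(1) h hi h0] by blast
    have add: "AE x in M. T (cutoff D f P) x = T (cutoff D f R) x + T h x"
      by (rule T_add[OF cutoff_L2[OF D f] h])
        (use dilate_mono[OF RD(2), of D] in \<open>auto simp: cutoff_def h_def indicator_def\<close>)
    obtain z where z: "z \<in> R" "z \<notin> exceptional D f \<Lambda> P" "z \<notin> exceptional D f \<Lambda> R"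
      "(z \<in> R \<longrightarrow> (\<forall>y\<in>R. ennreal \<bar>T h z - c\<bar> \<le> ennreal (A / (1 - \<theta>)) * (ennreal c_cov * maximal M \<D> h y))) \<and>
       T (cutoff D f P) z = T (cutoff D f R) z + T h z"
      by (rule good_point[OF P R AE_conjI[OF c add]])
    have mz: "maximal M \<D> h z \<le> ennreal (\<Lambda> * avg D f P)"
    proof -
      have "maximal M \<D> h z \<le> maximal M \<D> (cutoff D f P) z"
        by (rule maximal_mono) (auto simp: h_def cutoff_def indicator_def)
      also have "\<dots> \<le> ennreal (\<Lambda> * avg D f P)" using z RD unfolding exceptional_def by (auto simp: not_less)
      finally show ?thesis .
    qed
    have La: "0 \<le> \<Lambda> * avg D f P" using \<Lambda> avg_nonneg[of D f P] by simp
    have osc: "\<bar>T h x - c\<bar> \<le> C1 * (\<Lambda> * avg D f P)"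
      if "\<forall>z\<in>R. ennreal \<bar>T h x - c\<bar> \<le> ennreal (A / (1 - \<theta>)) * (ennreal c_cov * maximal M \<D> h z)" for x
    proof -
      have "ennreal \<bar>T h x - c\<bar> \<le> ennreal (A / (1 - \<theta>)) * (ennreal c_cov * maximal M \<D> h z)"
        using that z(1) by blast
      also have "\<dots> \<le> ennreal (A / (1 - \<theta>)) * (ennreal (max 0 c_cov) * ennreal (\<Lambda> * avg D f P))"
        by (intro mult_left_mono mult_mono mz ennreal_leI) auto
      also have "\<dots> = ennreal (C1 * (\<Lambda> * avg D f P))"
        unfolding C1_def using A1 theta La by (simp add: ennreal_mult[symmetric] mult.assoc)
      finally show ?thesis using C1_nonneg La by (subst (asm) ennreal_le_iff) auto
    qed
    \<comment> \<open>T h is bounded as a difference of two values of \<open>T\<close> at a point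
      that is exceptional for neither cube; no truncated operator enters.\<close>
    have Tz: "\<bar>T h z\<bar> \<le> \<Lambda> * avg D f P + \<Lambda> * avg D f R"
    proof -
      have "\<bar>T (cutoff D f P) z\<bar> \<le> \<Lambda> * avg D f P" "\<bar>T (cutoff D f R) z\<bar> \<le> \<Lambda> * avg D f R"
        using z RD unfolding exceptional_def by (auto simp: not_less)
      then show ?thesis using z(4) by linarith
    qed
    show ?thesis using c add
    proof eventually_elim
      case (elim x)
      show ?case
      proof
        assume x: "x \<in> R"
        have "\<bar>T h x - c\<bar> \<le> C1 * (\<Lambda> * avg D f P)" "\<bar>T h z - c\<bar> \<le> C1 * (\<Lambda> * avg D f P)"
          using osc elim(1) x z by blast+
        then have "\<bar>T h x\<bar> \<le> \<Lambda> * avg D f P + \<Lambda> * avg D f R + 2 * (C1 * (\<Lambda> * avg D f P))"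
          using Tz by linarith
        also have "\<dots> \<le> \<Lambda> * (1 + 2 * C1) * (avg D f P + avg D f R)"
        proof -
          have "0 \<le> 2 * C1 * (\<Lambda> * avg D f R)" using C1_nonneg \<Lambda> avg_nonneg[of D f R] by simp
          then show ?thesis by (simp add: algebra_simps)
        qed
        finally show "\<bar>T (cutoff D f P) x\<bar> \<le> \<bar>T (cutoff D f R) x\<bar> + \<Lambda> * (1 + 2 * C1) * (avg D f P + avg D f R)"
          using elim(2) by linarith
      qed
    qed
  qed
  have "AE x in M. \<forall>R\<in>children D f \<Lambda> P. x \<in> R \<longrightarrow> \<bar>T (cutoff D f P) x\<bar> \<le> \<bar>T (cutoff D f R) x\<bar> + \<Lambda> * (1 + 2 * C1) * (avg D f P + avg D f R)"
    using 2 by (subst AE_ball_countable[OF countable_children]) blast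
  with 1 show ?thesis by eventually_elim blast
qed

section \<open>The generations of the stopping construction\<close>

primrec generation :: "'a set \<Rightarrow> nat \<Rightarrow> 'a set set" where
  "generation Q 0 = {Q}"
| "generation Q (Suc n) = (\<Union>P\<in>generation Q n. children D f \<Lambda> P)"

lemma generation_cubes: "Q \<in> cubes_of D \<Longrightarrow> P \<in> generation Q n \<Longrightarrow> P \<in> cubes_of D"
  by (induction n arbitrary: P) (auto dest: children_cube)

lemma countable_generation: "countable (generation Q n)"
  by (induction n) (auto intro: countable_children)

lemma generation_Union_sets: "Q \<in> cubes_of D \<Longrightarrow> \<Union>(generation Q n) \<in> sets M"
  using generation_cubes cube_sets countable_generation by (intro sets.countable_Union) auto

lemma disjoint_generation: "disjoint (generation Q n)"
proof (induction n)
  case (Suc n)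
  show ?case
  proof (rule pairwiseI)
    fix R R' assume R: "R \<in> generation Q (Suc n)" "R' \<in> generation Q (Suc n)" "R \<noteq> R'"
    then obtain P P' where P: "P \<in> generation Q n" "R \<in> children D f \<Lambda> P" "P' \<in> generation Q n" "R' \<in> children D f \<Lambda> P'" by auto
    show "disjnt R R'"
    proof (cases "P = P'")
      case True
      then show ?thesis using disjoint_children R(3) P by (auto simp: pairwise_def)
    next
      case False
      then have "disjnt P P'" using Suc P by (auto simp: pairwise_def)
      then show ?thesis using children_cube(2)[OF P(2)] children_cube(2)[OF P(4)] by (auto simp: disjnt_def)
    qed
  qed
qed simp

lemma generation_next:
  assumes P: "P \<in> generation Q n"
  shows "P \<inter> \<Union>(generation Q (Suc n)) = \<Union>(children D f \<Lambda> P)"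
proof
  show "\<Union>(children D f \<Lambda> P) \<subseteq> P \<inter> \<Union>(generation Q (Suc n))" using P children_cube(2) by fastforce
  show "P \<inter> \<Union>(generation Q (Suc n)) \<subseteq> \<Union>(children D f \<Lambda> P)"
  proof
    fix x assume x: "x \<in> P \<inter> \<Union>(generation Q (Suc n))"
    then obtain P' R where R: "P' \<in> generation Q n" "R \<in> children D f \<Lambda> P'" "x \<in> R" by auto
    then have "x \<in> P'" using children_cube(2) by blast
    then have "P = P'" using disjoint_generation[of Q n] P R(1) x by (auto simp: pairwise_def disjnt_def)
    then show "x \<in> \<Union>(children D f \<Lambda> P)" using R by blast
  qed
qed

lemma generation_Suc_subset: "\<Union>(generation Q (Suc n)) \<subseteq> \<Union>(generation Q n)"
  using children_cube(2) by fastforce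

lemma generation_antimono: "m \<le> n \<Longrightarrow> \<Union>(generation Q n) \<subseteq> \<Union>(generation Q m)"
  by (rule lift_Suc_antimono_le[of "\<lambda>n. \<Union>(generation Q n)"]) (rule generation_Suc_subset)

lemma generation_decay:
  assumes Q: "Q \<in> cubes_of D"
  shows "2 * emeasure M (\<Union>(generation Q (Suc n))) \<le> emeasure M (\<Union>(generation Q n))"
proof -
  let ?S = "\<Union>(generation Q (Suc n))" and ?U = "\<Union>(generation Q n)"
  have S: "?S \<in> sets M" "?U \<in> sets M" by (rule generation_Union_sets[OF Q])+
  have c: "(\<integral>\<^sup>+x\<in>P. 2 * indicator ?S x \<partial>M) = 2 * emeasure M (P \<inter> ?S)" if "P \<in> sets M" for P
    using that S by (simp add: mult.assoc nn_integral_cmult set_nn_integral_indicator Int_commute)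
  have "(\<integral>\<^sup>+x\<in>?U. 2 * indicator ?S x \<partial>M) \<le> (\<integral>\<^sup>+x\<in>?U. 1 \<partial>M)"
  proof (rule laminar_nn_integral_le)
    fix P assume P: "P \<in> generation Q n"
    have PD: "P \<in> cubes_of D" by (rule generation_cubes[OF Q P])
    show "(\<integral>\<^sup>+x\<in>P. 2 * indicator ?S x \<partial>M) \<le> (\<integral>\<^sup>+x\<in>P. 1 \<partial>M)"
      using children_measure[OF PD] cube_sets[OF PD] unfolding c[OF cube_sets[OF PD]] generation_next[OF P] by simp
  next
    show "laminar (generation Q n)" by (rule laminar_subset[OF laminar_cubes]) (use generation_cubes[OF Q] in blast)
  qed (use countable_generation generation_cubes[OF Q] cube_sets S in auto)
  moreover have "?U \<inter> ?S = ?S" using generation_Suc_subset by blast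
  ultimately show ?thesis using S unfolding c[OF S(2)] by simp
qed

text \<open>Each generation covers at most half of the measure of the preceding one, so the points
  in all of them form a null set. Hence the iteration stops after finitely many steps at almost
  every point.\<close>

lemma generation_AE_leaves:
  assumes Q: "Q \<in> cubes_of D"
  shows "AE x in M. \<exists>n. x \<notin> \<Union>(generation Q n)"
proof -
  have le: "2 ^ n * emeasure M (\<Union>(generation Q n)) \<le> emeasure M Q" for n
  proof (induction n)
    case (Suc n)
    have "2 ^ n * (2 * emeasure M (\<Union>(generation Q (Suc n)))) \<le> 2 ^ n * emeasure M (\<Union>(generation Q n))"
      by (rule mult_left_mono[OF generation_decay[OF Q]]) simp
    then show ?case using Suc by (simp add: mult_ac)
  qed simp
  let ?N = "\<Inter>n. \<Union>(generation Q n)"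
  have N: "?N \<in> sets M" using generation_Union_sets[OF Q] by auto
  have "emeasure M ?N = 0"
  proof (rule ccontr)
    assume "emeasure M ?N \<noteq> 0"
    have "?N \<subseteq> \<Union>(generation Q 0)" by blast
    then have "emeasure M ?N \<le> emeasure M Q" by (intro emeasure_mono) (auto simp: cube_sets[OF Q])
    then have e: "emeasure M ?N = ennreal (measure M ?N)"
      using cube_finite[OF Q] by (intro emeasure_eq_ennreal_measure) (auto simp: top_unique)
    then have pos: "0 < measure M ?N" using \<open>emeasure M ?N \<noteq> 0\<close> by (metis ennreal_0 measure_nonneg order_le_less)
    obtain n where n: "measure M Q / measure M ?N < 2 ^ n" using real_arch_pow[of 2] by auto
    have "2 ^ n * emeasure M ?N \<le> emeasure M Q"
      by (rule order_trans[OF mult_left_mono[OF emeasure_mono] le[of n]]) (use generation_Union_sets[OF Q] in auto)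
    moreover have "emeasure M Q = ennreal (measure M Q)"
      using cube_finite[OF Q] by (intro emeasure_eq_ennreal_measure) auto
    moreover have "(2::ennreal) ^ n = ennreal (2 ^ n)" using ennreal_power[of 2 n] by simp
    ultimately have "2 ^ n * measure M ?N \<le> measure M Q"
      unfolding e by (simp add: ennreal_mult[symmetric])
    then show False using n pos by (simp add: divide_less_eq)
  qed
  then have "AE x in M. x \<notin> ?N" using N by (intro AE_not_in null_setsI)
  then show ?thesis by eventually_elim auto
qed

text \<open>\<open>domination_step\<close> is iterated along the finitely many cubes that contain x.
  Indices are pairs, so the fresh index in each step is new for trivial reasons.\<close>

lemma generation_domination:
  assumes Q: "Q \<in> cubes_of D" and f0: "\<And>y. y \<notin> Q \<Longrightarrow> f y = 0"
  shows "AE x in M. x \<in> Q \<longrightarrow> (\<exists>J \<subseteq> {(n, P). P \<in> generation Q n}. finite J \<and> (\<forall>i\<in>J. x \<in> snd i) \<and>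
    \<bar>T f x\<bar> \<le> 2 * (\<Lambda> * (1 + 2 * C1)) * (\<Sum>i\<in>J. avg D f (snd i)))"
proof -
  let ?c = "\<Lambda> * (1 + 2 * C1)"
  have c: "0 \<le> ?c" using \<Lambda> C1_nonneg by simp
  have "AE x in M. \<forall>P\<in>cubes_of D. x \<in> P \<longrightarrow>
    (x \<notin> \<Union>(children D f \<Lambda> P) \<longrightarrow> \<bar>T (cutoff D f P) x\<bar> \<le> ?c * avg D f P) \<and>
    (\<forall>R\<in>children D f \<Lambda> P. x \<in> R \<longrightarrow> \<bar>T (cutoff D f P) x\<bar> \<le> \<bar>T (cutoff D f R) x\<bar> + ?c * (avg D f P + avg D f R))"
    using domination_step by (subst AE_ball_countable[OF countable_cubes]) blast
  with generation_AE_leaves[OF Q] show ?thesis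
  proof eventually_elim
    case (elim x)
    \<comment> \<open>The extra summand with the average of \<open>P\<close> makes the induction
      work: a step from \<open>P\<close> to \<open>R\<close> costs the averages of both, and the
      share of \<open>R\<close> is absorbed by the extra summand for \<open>R\<close>. Together with
      the one demanded for \<open>P\<close>, this gives the factor 2.\<close>
    have main: "\<exists>J \<subseteq> {(k, P). k \<ge> m \<and> P \<in> generation Q k}. finite J \<and> (\<forall>i\<in>J. x \<in> snd i) \<and>
        \<bar>T (cutoff D f P) x\<bar> + ?c * avg D f P \<le> 2 * ?c * (\<Sum>i\<in>J. avg D f (snd i))"
      if "P \<in> generation Q m" "x \<in> P" "x \<notin> \<Union>(generation Q (m + Suc n))" for n m P
      using that
    proof (induction n arbitrary: m P)
      case 0
      have PD: "P \<in> cubes_of D" by (rule generation_cubes[OF Q 0(1)])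
      have "x \<notin> \<Union>(children D f \<Lambda> P)" using 0 by auto
      then have "\<bar>T (cutoff D f P) x\<bar> \<le> ?c * avg D f P" using elim(2) PD 0(2) by blast
      then show ?case using 0 by (intro exI[of _ "{(m, P)}"]) auto
    next
      case (Suc n)
      have PD: "P \<in> cubes_of D" by (rule generation_cubes[OF Q Suc.prems(1)])
      show ?case
      proof (cases "x \<in> \<Union>(children D f \<Lambda> P)")
        case False
        then have "\<bar>T (cutoff D f P) x\<bar> \<le> ?c * avg D f P" using elim(2) PD Suc.prems(2) by blast
        then show ?thesis using Suc.prems by (intro exI[of _ "{(m, P)}"]) auto
      next
        case True
        then obtain R where R: "R \<in> children D f \<Lambda> P" "x \<in> R" by blast
        have "R \<in> generation Q (Suc m)" using R Suc.prems(1) by auto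
        then obtain J where J: "J \<subseteq> {(k, P). k \<ge> Suc m \<and> P \<in> generation Q k}" "finite J" "\<forall>i\<in>J. x \<in> snd i"
          "\<bar>T (cutoff D f R) x\<bar> + ?c * avg D f R \<le> 2 * ?c * (\<Sum>i\<in>J. avg D f (snd i))"
          using Suc.IH[of R "Suc m"] R(2) Suc.prems(3) by auto
        have nJ: "(m, P) \<notin> J" using J(1) by auto
        have "\<bar>T (cutoff D f P) x\<bar> \<le> \<bar>T (cutoff D f R) x\<bar> + ?c * (avg D f P + avg D f R)"
          using elim(2) PD Suc.prems(2) R by blast
        then have "\<bar>T (cutoff D f P) x\<bar> + ?c * avg D f P \<le> 2 * ?c * avg D f P + 2 * ?c * (\<Sum>i\<in>J. avg D f (snd i))"
          using J(4) unfolding distrib_left[of ?c] by linarith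
        also have "\<dots> = 2 * ?c * (\<Sum>i\<in>insert (m, P) J. avg D f (snd i))"
          using J(2) nJ by (simp add: distrib_left)
        finally show ?thesis
          using J(1-3) Suc.prems(1,2) by (intro exI[of _ "insert (m, P) J"]) auto
      qed
    qed
    show ?case
    proof
      assume x: "x \<in> Q"
      obtain n where n: "x \<notin> \<Union>(generation Q n)" using elim(1) by blast
      then have "x \<notin> \<Union>(generation Q (0 + Suc n))" using generation_antimono[of n "Suc n" Q] by (auto simp del: generation.simps)
      then obtain J where J: "J \<subseteq> {(k, P). k \<ge> 0 \<and> P \<in> generation Q k}" "finite J" "\<forall>i\<in>J. x \<in> snd i"
          "\<bar>T (cutoff D f Q) x\<bar> + ?c * avg D f Q \<le> 2 * ?c * (\<Sum>i\<in>J. avg D f (snd i))"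
        using main[of Q 0 n] x by auto
      have "cutoff D f Q = f"
        using f0 cube_subset_dilate[OF D Q] by (auto simp: cutoff_def indicator_def fun_eq_iff)
      then have "\<bar>T f x\<bar> \<le> 2 * ?c * (\<Sum>i\<in>J. avg D f (snd i))"
        using J(4) mult_nonneg_nonneg[OF c avg_nonneg[of D f Q]] by simp
      then show "\<exists>J \<subseteq> {(n, P). P \<in> generation Q n}. finite J \<and> (\<forall>i\<in>J. x \<in> snd i) \<and>
          \<bar>T f x\<bar> \<le> 2 * ?c * (\<Sum>i\<in>J. avg D f (snd i))"
        using J by (intro exI[of _ J]) auto
    qed
  qed
qed

end

lemma sparse_domination:
  obtains C where "1 \<le> C" "\<And>D Q f. D \<in> \<D> \<Longrightarrow> Q \<in> cubes_of D \<Longrightarrow> f \<in> L2 M \<Longrightarrow> integrable M f \<Longrightarrow> (\<And>y. y \<notin> Q \<Longrightarrow> f y = 0) \<Longrightarrow>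
    \<exists>(I :: (nat \<times> 'a set) set) E. countable I \<and> disjoint_family_on E I \<and>
      (\<forall>i\<in>I. snd i \<in> cubes_of D \<and> E i \<in> sets M \<and> E i \<subseteq> snd i \<and> emeasure M (snd i) \<le> 2 * emeasure M (E i)) \<and>
      (AE x in M. x \<in> Q \<longrightarrow> (\<exists>J\<subseteq>I. finite J \<and> (\<forall>i\<in>J. x \<in> snd i) \<and> \<bar>T f x\<bar> \<le> C * (\<Sum>i\<in>J. avg D f (snd i))))"
proof -
  obtain \<Lambda> where \<Lambda>: "1 \<le> \<Lambda>" "\<And>D f P. D \<in> \<D> \<Longrightarrow> f \<in> L2 M \<Longrightarrow> integrable M f \<Longrightarrow> P \<in> cubes_of D \<Longrightarrow>
    emeasure M (exceptional D f \<Lambda> P) \<le> ennreal (\<epsilon> / 8) * emeasure M P" by (rule exceptional_small) blast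
  let ?C = "2 * (\<Lambda> * (1 + 2 * C1))"
  have "1 * 1 \<le> \<Lambda> * (1 + 2 * C1)" using \<Lambda>(1) C1_nonneg by (intro mult_mono) auto
  then have "1 \<le> ?C" by simp
  moreover have "\<exists>(I :: (nat \<times> 'a set) set) E. countable I \<and> disjoint_family_on E I \<and>
      (\<forall>i\<in>I. snd i \<in> cubes_of D \<and> E i \<in> sets M \<and> E i \<subseteq> snd i \<and> emeasure M (snd i) \<le> 2 * emeasure M (E i)) \<and>
      (AE x in M. x \<in> Q \<longrightarrow> (\<exists>J\<subseteq>I. finite J \<and> (\<forall>i\<in>J. x \<in> snd i) \<and> \<bar>T f x\<bar> \<le> ?C * (\<Sum>i\<in>J. avg D f (snd i))))"
    if a: "D \<in> \<D>" "Q \<in> cubes_of D" "f \<in> L2 M" "integrable M f" "\<And>y. y \<notin> Q \<Longrightarrow> f y = 0" for D Q f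
  proof -
    note c = a(1,3,4) \<Lambda>(1) \<Lambda>(2)[OF a(1,3,4)]
    let ?S = "generation D f \<Lambda> Q"
    let ?I = "{(n, P). P \<in> ?S n}"
    \<comment> \<open>What is left of a cube after removing its children. It is at least half of the
      cube, and such sets are disjoint within and across generations.\<close>
    define E where "E i = snd i - \<Union>(?S (Suc (fst i)))" for i :: "nat \<times> 'a set"
    have I: "?I = Sigma UNIV ?S" by auto
    have "countable ?I" unfolding I using countable_generation[OF c] by (intro countable_SIGMA) auto
    moreover have "disjoint_family_on E ?I"
      unfolding disjoint_family_on_def
    proof (intro ballI impI)
      have *: "E i \<inter> E j = {}" if ij: "i \<in> ?I" "j \<in> ?I" "i \<noteq> j" "fst i \<le> fst j" for i j
      proof (cases "fst i = fst j")
        case True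
        then have "snd i \<in> ?S (fst i)" "snd j \<in> ?S (fst i)" "snd i \<noteq> snd j"
          using ij by (auto simp: prod_eq_iff)
        then have "disjnt (snd i) (snd j)" using disjoint_generation[OF c, of Q "fst i"] by (auto simp: pairwise_def)
        then show ?thesis unfolding E_def by (auto simp: disjnt_def)
      next
        case False
        then have "\<Union>(?S (fst j)) \<subseteq> \<Union>(?S (Suc (fst i)))" using ij(4) by (intro generation_antimono[OF c]) auto
        moreover have "snd j \<subseteq> \<Union>(?S (fst j))" using ij(2) by auto
        ultimately show ?thesis unfolding E_def by blast
      qed
      fix i j assume "i \<in> ?I" "j \<in> ?I" "i \<noteq> j"
      then show "E i \<inter> E j = {}" using *[of i j] *[of j i] by (cases "fst i \<le> fst j") auto
    qed
    moreover have "snd i \<in> cubes_of D \<and> E i \<in> sets M \<and> E i \<subseteq> snd i \<and> emeasure M (snd i) \<le> 2 * emeasure M (E i)"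
      if i: "i \<in> ?I" for i
    proof -
      have S: "snd i \<in> ?S (fst i)" using i by auto
      have P: "snd i \<in> cubes_of D" by (rule generation_cubes[OF c a(2) S])
      have U: "\<Union>(?S (Suc (fst i))) \<in> sets M" by (rule generation_Union_sets[OF c a(2)])
      let ?H = "snd i \<inter> \<Union>(?S (Suc (fst i)))"
      have H: "?H \<in> sets M" using U cubes_of_sets[OF a(1) P] by auto
      have Em: "E i \<in> sets M" unfolding E_def using U cubes_of_sets[OF a(1) P] by auto
      have h: "2 * emeasure M ?H \<le> emeasure M (snd i)"
      proof -
        have "?H = \<Union>(children D f \<Lambda> (snd i))" by (rule generation_next[OF c S])
        moreover have "2 * emeasure M (\<Union>(children D f \<Lambda> (snd i))) \<le> emeasure M (snd i)" by (rule children_measure[OF c P])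
        ultimately show ?thesis by simp
      qed
      have split: "emeasure M (snd i) = emeasure M (E i) + emeasure M ?H"
      proof -
        have "E i \<inter> ?H = {}" "E i \<union> ?H = snd i" unfolding E_def by blast+
        then show ?thesis using plus_emeasure[OF Em H] by simp
      qed
      have fin: "emeasure M ?H < \<infinity>"
        using emeasure_mono[of ?H "snd i" M] cubes_of_sets[OF a(1) P] cubes_of_finite[OF a(1) P] by (auto intro: le_less_trans)
      have "emeasure M ?H + emeasure M ?H \<le> emeasure M ?H + emeasure M (E i)"
        using h unfolding split mult_2 by (simp add: add.commute)
      then have "emeasure M ?H \<le> emeasure M (E i)" using fin by (auto simp: ennreal_add_left_cancel_le)
      then have "emeasure M (snd i) \<le> 2 * emeasure M (E i)" unfolding split mult_2 by (rule add_left_mono)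
      then show ?thesis using P Em unfolding E_def by auto
    qed
    moreover note generation_domination[OF c a(2,5)]
    ultimately show ?thesis by blast
  qed
  ultimately show ?thesis by (rule that)
qed

end

section \<open>The weighted weak type estimate\<close>

context cz_space
begin

text \<open>Sparse domination gives sums over dilates of cubes of one system. After passing to cubes
  of adjacent systems, these sums are split by system and \<open>sparse_weighted_bound\<close> is
  applied to each part.\<close>

lemma local_weighted_weak_type:
  obtains C where "0 < C" "\<And>w f Q t. w \<in> Ainf \<rho> M \<D> \<Longrightarrow> f \<in> L2 M \<Longrightarrow> integrable M f \<Longrightarrow> Q \<in> cubes \<D> \<Longrightarrow>
    (\<And>y. y \<notin> Q \<Longrightarrow> f y = 0) \<Longrightarrow> 0 < t \<Longrightarrow>
    ennreal t * wmeas M w {x\<in>Q. t < \<bar>T f x\<bar>}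
      \<le> ennreal (C * ln (exp 1 + enn2real (Ainf_const M \<D> w))) * (\<integral>\<^sup>+x. ennreal \<bar>f x\<bar> * maximal M \<D> w x \<partial>M)"
proof -
  obtain Cs where Cs: "1 \<le> Cs" "\<And>D Q f. D \<in> \<D> \<Longrightarrow> Q \<in> cubes_of D \<Longrightarrow> f \<in> L2 M \<Longrightarrow> integrable M f \<Longrightarrow> (\<And>y. y \<notin> Q \<Longrightarrow> f y = 0) \<Longrightarrow>
    \<exists>(I :: (nat \<times> 'a set) set) E. countable I \<and> disjoint_family_on E I \<and>
      (\<forall>i\<in>I. snd i \<in> cubes_of D \<and> E i \<in> sets M \<and> E i \<subseteq> snd i \<and> emeasure M (snd i) \<le> 2 * emeasure M (E i)) \<and>
      (AE x in M. x \<in> Q \<longrightarrow> (\<exists>J\<subseteq>I. finite J \<and> (\<forall>i\<in>J. x \<in> snd i) \<and> \<bar>T f x\<bar> \<le> Cs * (\<Sum>i\<in>J. avg D f (snd i))))"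
    by (rule sparse_domination) blast
  obtain Cd where Cd: "1 \<le> Cd" "\<And>D P. D \<in> \<D> \<Longrightarrow> P \<in> cubes_of D \<Longrightarrow>
    \<exists>Q\<in>cubes \<D>. dilate D P \<subseteq> Q \<and> emeasure M Q \<le> ennreal Cd * emeasure M P" by (rule dilate_in_cube) blast
  \<comment> \<open>The packing constant of the adjacent cubes: 2 from the disjoint parts
    \<open>E i\<close>, and \<open>Cd\<close> from replacing a cube by its adjacent cube.\<close>
  define \<Lambda> where "\<Lambda> = nat \<lceil>2 * Cd\<rceil>"
  have \<Lambda>: "0 < \<Lambda>" "2 * Cd \<le> real \<Lambda>" unfolding \<Lambda>_def using Cd(1) by linarith+
  obtain C where C: "0 < C" "\<And>w f D I (S :: nat \<times> 'a set \<Rightarrow> 'a set) a s. w \<in> Ainf \<rho> M \<D> \<Longrightarrow> D \<in> \<D> \<Longrightarrow> f \<in> borel_measurable M \<Longrightarrow>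
    finite I \<Longrightarrow> (\<And>i. i \<in> I \<Longrightarrow> S i \<in> cubes_of D) \<Longrightarrow>
    (\<And>i. i \<in> I \<Longrightarrow> (\<Sum>k\<in>{k\<in>I. S k \<subseteq> S i}. emeasure M (S k)) \<le> of_nat \<Lambda> * emeasure M (S i)) \<Longrightarrow>
    (\<And>i. i \<in> I \<Longrightarrow> (\<integral>\<^sup>+x\<in>S i. ennreal \<bar>f x\<bar> \<partial>M) = ennreal (a i) * emeasure M (S i)) \<Longrightarrow>
    (\<And>i. i \<in> I \<Longrightarrow> 0 \<le> a i) \<Longrightarrow> 0 \<le> s \<Longrightarrow>
    wmeas M w {x\<in>space M. 1 < (\<Sum>i\<in>I. s * a i * indicator (S i) x)}
      \<le> ennreal (C * ln (exp 1 + enn2real (Ainf_const M \<D> w)) * s) * (\<integral>\<^sup>+x. ennreal \<bar>f x\<bar> * maximal M \<D> w x \<partial>M)"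
    by (rule sparse_weighted_bound[OF \<Lambda>(1)]) blast
  define n where "n = real (card \<D>)"
  \<comment> \<open>The summand 1 only keeps the constant positive if there is no dyadic system at
    all.\<close>
  define C' where "C' = n * C * (Cs * Cd * n) + 1"
  have n0: "0 \<le> n" unfolding n_def by simp
  have C'0: "0 < C'" unfolding C'_def using C(1) Cs(1) Cd(1) n0 by (simp add: add_nonneg_pos)
  have "ennreal t * wmeas M w {x\<in>Q. t < \<bar>T f x\<bar>}
      \<le> ennreal (C' * ln (exp 1 + enn2real (Ainf_const M \<D> w))) * (\<integral>\<^sup>+x. ennreal \<bar>f x\<bar> * maximal M \<D> w x \<partial>M)"
    if w: "w \<in> Ainf \<rho> M \<D>" and f: "f \<in> L2 M" and fint: "integrable M f" and Q: "Q \<in> cubes \<D>"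
      and f0: "\<And>y. y \<notin> Q \<Longrightarrow> f y = 0" and t: "0 < t" for w f Q t
  proof -
    let ?L = "ln (exp 1 + enn2real (Ainf_const M \<D> w))"
    let ?G = "\<integral>\<^sup>+x. ennreal \<bar>f x\<bar> * maximal M \<D> w x \<partial>M"
    have L0: "0 \<le> ?L" by (simp add: add_increasing2)
    have fm[measurable]: "f \<in> borel_measurable M" by (rule L2_measurable[OF f])
    have wm[measurable]: "w \<in> borel_measurable M" using w unfolding Ainf_def weight_def by simp
    have Tm[measurable]: "T f \<in> borel_measurable M" by (rule T_measurable[OF f])
    have Qm[measurable]: "Q \<in> sets M" by (rule cube_measurable[OF Q])
    obtain D where D: "D \<in> \<D>" "Q \<in> cubes_of D" using Q unfolding cubes_eq by blast
    have "card \<D> \<noteq> 0" using D(1) finite_systems by auto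
    then have n1: "1 \<le> n" unfolding n_def by simp
    obtain I :: "(nat \<times> 'a set) set" and E where I: "countable I" and E: "disjoint_family_on E I"
      and IE: "\<forall>i\<in>I. snd i \<in> cubes_of D \<and> E i \<in> sets M \<and> E i \<subseteq> snd i \<and> emeasure M (snd i) \<le> 2 * emeasure M (E i)"
      and dom: "AE x in M. x \<in> Q \<longrightarrow> (\<exists>J\<subseteq>I. finite J \<and> (\<forall>i\<in>J. x \<in> snd i) \<and> \<bar>T f x\<bar> \<le> Cs * (\<Sum>i\<in>J. avg D f (snd i)))"
      using Cs(2)[OF D f fint f0] by blast
    have "\<forall>i\<in>I. \<exists>D' R. D' \<in> \<D> \<and> R \<in> cubes_of D' \<and> dilate D (snd i) \<subseteq> R \<and> emeasure M R \<le> ennreal Cd * emeasure M (snd i)"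
      using Cd(2)[OF D(1)] IE unfolding cubes_eq by blast
    \<comment> \<open>The adjacent cube of each sparse cube, and the system it belongs to. Different
      indices may share a cube.\<close>
    then obtain sys star where st: "\<And>i. i \<in> I \<Longrightarrow> sys i \<in> \<D>" "\<And>i. i \<in> I \<Longrightarrow> star i \<in> cubes_of (sys i)"
      "\<And>i. i \<in> I \<Longrightarrow> dilate D (snd i) \<subseteq> star i"
      "\<And>i. i \<in> I \<Longrightarrow> emeasure M (star i) \<le> ennreal Cd * emeasure M (snd i)" by metis
    have starc: "star i \<in> cubes \<D>" if "i \<in> I" for i using st(1,2)[OF that] unfolding cubes_eq by blast
    have snd_star: "snd i \<subseteq> star i" if "i \<in> I" for i
      using cube_subset_dilate[OF D(1), of "snd i"] IE st(3)[OF that] that by blast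
    define a where "a i = enn2real (\<integral>\<^sup>+x\<in>star i. ennreal \<bar>f x\<bar> \<partial>M) / measure M (star i)" for i
    have a0: "0 \<le> a i" for i unfolding a_def by simp
    have aeq: "(\<integral>\<^sup>+x\<in>star i. ennreal \<bar>f x\<bar> \<partial>M) = ennreal (a i) * emeasure M (star i)" if i: "i \<in> I" for i
    proof -
      have "(\<integral>\<^sup>+x\<in>star i. ennreal \<bar>f x\<bar> \<partial>M) \<le> (\<integral>\<^sup>+x. ennreal \<bar>f x\<bar> \<partial>M)" by (rule set_nn_integral_le_space)
      also have "\<dots> < \<infinity>" using fint by (simp add: integrable_iff_bounded)
      finally have fin: "(\<integral>\<^sup>+x\<in>star i. ennreal \<bar>f x\<bar> \<partial>M) < \<infinity>" .
      have m: "0 < measure M (star i)" "emeasure M (star i) = ennreal (measure M (star i))"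
        using cube_measure_pos[OF starc[OF i]] cube_measure_finite[OF starc[OF i]]
        by (auto simp: measure_def enn2real_positive_iff)
      have "ennreal (a i) * emeasure M (star i) = ennreal (a i * measure M (star i))"
        unfolding m(2) by (simp add: ennreal_mult a0)
      also have "a i * measure M (star i) = enn2real (\<integral>\<^sup>+x\<in>star i. ennreal \<bar>f x\<bar> \<partial>M)"
        unfolding a_def using m(1) by simp
      finally show ?thesis using fin by simp
    qed
    have avga: "avg D f (snd i) \<le> Cd * a i" if i: "i \<in> I" for i
    proof -
      have P: "snd i \<in> cubes_of D" using IE i by blast
      have m: "0 < measure M (snd i)" "emeasure M (snd i) = ennreal (measure M (snd i))"
        using cubes_of_pos[OF D(1) P] cubes_of_finite[OF D(1) P] by (auto simp: measure_def enn2real_positive_iff)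
      have "ennreal (avg D f (snd i)) * emeasure M (snd i) = (\<integral>\<^sup>+x\<in>dilate D (snd i). ennreal \<bar>f x\<bar> \<partial>M)"
        by (rule avg_eq[OF D(1) P fint])
      also have "\<dots> \<le> (\<integral>\<^sup>+x\<in>star i. ennreal \<bar>f x\<bar> \<partial>M)" by (rule set_nn_integral_subset[OF st(3)[OF i]])
      also have "\<dots> \<le> ennreal (a i) * (ennreal Cd * emeasure M (snd i))"
        unfolding aeq[OF i] by (rule mult_left_mono[OF st(4)[OF i]]) simp
      finally have "avg D f (snd i) * measure M (snd i) \<le> a i * (Cd * measure M (snd i))"
        unfolding m(2) using Cd(1) a0 avg_nonneg by (simp add: ennreal_mult[symmetric])
      then have "avg D f (snd i) * measure M (snd i) \<le> (Cd * a i) * measure M (snd i)" by (simp add: mult_ac)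
      then show ?thesis using m(1) by (rule mult_right_le_imp_le)
    qed
    define Bad where "Bad (J :: (nat \<times> 'a set) set) = {x\<in>space M. t < Cs * (\<Sum>i\<in>J. avg D f (snd i) * indicator (snd i) x)}" for J
    \<comment> \<open>If the whole sum exceeds \<open>t\<close>, then for one of the n systems the
      part of the sum, scaled by \<open>s\<close>, exceeds 1; \<open>Cs\<close> and
      \<open>Cd\<close> come from sparse domination and from the passage to adjacent cubes.\<close>
    define s where "s = Cs * Cd * n / t"
    have s0: "0 \<le> s" unfolding s_def using Cs(1) Cd(1) n0 t by simp
    have Badm: "Bad J \<in> sets M" if "J \<subseteq> I" for J
    proof -
      have [measurable]: "snd i \<in> sets M" if "i \<in> J" for i using that \<open>J \<subseteq> I\<close> IE cubes_of_sets[OF D(1)] by blast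
      show ?thesis unfolding Bad_def by measurable
    qed
    have Bad: "wmeas M w (Bad J) \<le> ennreal (n * (C * ?L * s)) * ?G" if J: "J \<subseteq> I" "finite J" for J
    proof -
      define JD where "JD D' = {i\<in>J. sys i = D'}" for D'
      define Y where "Y D' = {x\<in>space M. 1 < (\<Sum>i\<in>JD D'. s * a i * indicator (star i) x)}" for D'
      have JD: "JD D' \<subseteq> J" "finite (JD D')" for D' using J(2) unfolding JD_def by auto
      have starm: "star i \<in> sets M" if "i \<in> J" for i using that J(1) cube_measurable[OF starc] by blast
      have Ym: "Y D' \<in> sets M" for D'
      proof -
        have [measurable]: "star i \<in> sets M" if "i \<in> JD D'" for i using starm JD(1) that by blast
        show ?thesis unfolding Y_def by measurable
      qed
      \<comment> \<open>The packing condition survives the passage to adjacent cubes: if star k lies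
        in star i, then so does the set E k, and these sets are disjoint.\<close>
      have YB: "wmeas M w (Y D') \<le> ennreal (C * ?L * s) * ?G" if D': "D' \<in> \<D>" for D'
        unfolding Y_def
      proof (rule C(2)[OF w D' fm JD(2) _ _ _ a0 s0])
        fix i assume i: "i \<in> JD D'"
        then have iI: "i \<in> I" and si: "sys i = D'" using J(1) unfolding JD_def by auto
        show "star i \<in> cubes_of D'" using st(2)[OF iI] si by simp
        show "(\<integral>\<^sup>+x\<in>star i. ennreal \<bar>f x\<bar> \<partial>M) = ennreal (a i) * emeasure M (star i)" by (rule aeq[OF iI])
        let ?K = "{k\<in>JD D'. star k \<subseteq> star i}"
        have K: "finite ?K" "?K \<subseteq> I" using JD(2)[of D'] JD(1)[of D'] J(1) by auto
        have "(\<Sum>k\<in>?K. emeasure M (star k)) \<le> (\<Sum>k\<in>?K. ennreal (2 * Cd) * emeasure M (E k))"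
        proof (rule sum_mono)
          fix k assume "k \<in> ?K"
          then have kI: "k \<in> I" using K by blast
          have "emeasure M (star k) \<le> ennreal Cd * emeasure M (snd k)" by (rule st(4)[OF kI])
          also have "\<dots> \<le> ennreal Cd * (2 * emeasure M (E k))" using IE kI by (intro mult_left_mono) auto
          also have "\<dots> = ennreal (2 * Cd) * emeasure M (E k)" using Cd(1) by (simp add: ennreal_mult mult_ac)
          finally show "emeasure M (star k) \<le> ennreal (2 * Cd) * emeasure M (E k)" .
        qed
        also have "\<dots> = ennreal (2 * Cd) * emeasure M (\<Union>k\<in>?K. E k)"
          unfolding sum_distrib_left[symmetric] using K IE E
          by (subst sum_emeasure) (auto intro: disjoint_family_on_mono)
        also have "\<dots> \<le> ennreal (real \<Lambda>) * emeasure M (star i)"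
        proof (intro mult_mono ennreal_leI \<Lambda>(2) emeasure_mono)
          show "(\<Union>k\<in>?K. E k) \<subseteq> star i" using IE K(2) snd_star by blast
          show "star i \<in> sets M" by (rule cube_measurable[OF starc[OF iI]])
        qed auto
        finally show "(\<Sum>k\<in>?K. emeasure M (star k)) \<le> of_nat \<Lambda> * emeasure M (star i)"
          by (simp add: ennreal_of_nat_eq_real_of_nat)
      qed
      have "Bad J \<subseteq> (\<Union>D'\<in>\<D>. Y D')"
      proof (rule subsetI, rule ccontr)
        fix x assume x: "x \<in> Bad J" and nx: "x \<notin> (\<Union>D'\<in>\<D>. Y D')"
        have xs: "x \<in> space M" using x unfolding Bad_def by simp
        have "(\<Sum>i\<in>J. avg D f (snd i) * indicator (snd i) x) \<le> (\<Sum>i\<in>J. Cd * a i * indicator (star i) x)"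
        proof (rule sum_mono)
          fix i assume "i \<in> J"
          then have i: "i \<in> I" using J by blast
          show "avg D f (snd i) * indicator (snd i) x \<le> Cd * a i * indicator (star i) x"
            using avga[OF i] snd_star[OF i] Cd(1) a0[of i] by (auto simp: indicator_def)
        qed
        also have "\<dots> = (\<Sum>D'\<in>\<D>. \<Sum>i\<in>JD D'. Cd * a i * indicator (star i) x)"
          unfolding JD_def using st(1) J by (intro sum.group[symmetric] finite_systems) auto
        finally have "Cs * (\<Sum>i\<in>J. avg D f (snd i) * indicator (snd i) x)
            \<le> Cs * (\<Sum>D'\<in>\<D>. \<Sum>i\<in>JD D'. Cd * a i * indicator (star i) x)"
          using Cs(1) by (intro mult_left_mono) auto
        then have "t < Cs * (\<Sum>D'\<in>\<D>. \<Sum>i\<in>JD D'. Cd * a i * indicator (star i) x)"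
          using x unfolding Bad_def by simp
        then have "t * (n / t) < Cs * (\<Sum>D'\<in>\<D>. \<Sum>i\<in>JD D'. Cd * a i * indicator (star i) x) * (n / t)"
          using n1 t by (intro mult_strict_right_mono) auto
        also have "\<dots> = (\<Sum>D'\<in>\<D>. \<Sum>i\<in>JD D'. s * a i * indicator (star i) x)"
          unfolding s_def by (simp add: sum_distrib_left sum_distrib_right mult_ac)
        also have "\<dots> \<le> (\<Sum>D'\<in>\<D>. 1)"
          using nx xs unfolding Y_def by (intro sum_mono) (auto simp: not_less)
        finally show False using t unfolding n_def by simp
      qed
      then have "wmeas M w (Bad J) \<le> emeasure (density M (\<lambda>x. ennreal (w x))) (\<Union>D'\<in>\<D>. Y D')"
        unfolding wmeas_def using Badm[OF J(1)] Ym finite_systems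
        by (subst emeasure_density[symmetric]) (auto intro!: emeasure_mono)
      also have "\<dots> \<le> (\<Sum>D'\<in>\<D>. emeasure (density M (\<lambda>x. ennreal (w x))) (Y D'))"
        by (rule emeasure_subadditive_finite) (use Ym finite_systems in auto)
      also have "\<dots> = (\<Sum>D'\<in>\<D>. wmeas M w (Y D'))"
        unfolding wmeas_def using Ym by (simp add: emeasure_density)
      also have "\<dots> \<le> (\<Sum>D'\<in>\<D>. ennreal (C * ?L * s) * ?G)" by (rule sum_mono[OF YB])
      also have "\<dots> = ennreal (n * (C * ?L * s)) * ?G"
        unfolding n_def using C(1) L0 s0 by (simp add: ennreal_mult ennreal_of_nat_eq_real_of_nat mult.assoc)
      finally show ?thesis .
    qed
    \<comment> \<open>The domination uses a finite set of indices that depends on the point. Finite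
      sets exhausting the countable index set turn this into an increasing union, to which the bound
      for finite families passes.\<close>
    define In where "In m = I \<inter> to_nat_on I -` {..m}" for m
    have In: "In m \<subseteq> I" "finite (In m)" for m
      unfolding In_def using finite_vimage_IntI[OF finite_atMost inj_on_to_nat_on[OF I]] by (auto simp: Int_commute)
    have Bad_mono: "Bad J \<subseteq> Bad J'" if "J \<subseteq> J'" "J' \<subseteq> I" "finite J'" for J J'
    proof
      fix x assume x: "x \<in> Bad J"
      have "(\<Sum>i\<in>J. avg D f (snd i) * indicator (snd i) x) \<le> (\<Sum>i\<in>J'. avg D f (snd i) * indicator (snd i) x)"
        by (rule sum_mono2) (use that avg_nonneg in auto)
      then have "Cs * (\<Sum>i\<in>J. avg D f (snd i) * indicator (snd i) x) \<le> Cs * (\<Sum>i\<in>J'. avg D f (snd i) * indicator (snd i) x)"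
        using Cs(1) by (intro mult_left_mono) auto
      then show "x \<in> Bad J'" using x unfolding Bad_def by auto
    qed
    have "wmeas M w {x\<in>Q. t < \<bar>T f x\<bar>} \<le> (\<integral>\<^sup>+x\<in>(\<Union>m. Bad (In m)). ennreal (w x) \<partial>M)"
      unfolding wmeas_def
    proof (rule nn_integral_mono_AE)
      show "AE x in M. ennreal (w x) * indicator {x\<in>Q. t < \<bar>T f x\<bar>} x \<le> ennreal (w x) * indicator (\<Union>m. Bad (In m)) x"
        using dom
      proof (rule AE_mp, intro AE_I2 impI)
        fix x assume xs: "x \<in> space M" and d: "x \<in> Q \<longrightarrow> (\<exists>J\<subseteq>I. finite J \<and> (\<forall>i\<in>J. x \<in> snd i) \<and> \<bar>T f x\<bar> \<le> Cs * (\<Sum>i\<in>J. avg D f (snd i)))"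
        show "ennreal (w x) * indicator {x\<in>Q. t < \<bar>T f x\<bar>} x \<le> ennreal (w x) * indicator (\<Union>m. Bad (In m)) x"
        proof (cases "x \<in> {x\<in>Q. t < \<bar>T f x\<bar>}")
          case True
          then obtain J where J: "J \<subseteq> I" "finite J" "\<forall>i\<in>J. x \<in> snd i" "\<bar>T f x\<bar> \<le> Cs * (\<Sum>i\<in>J. avg D f (snd i))"
            using d by auto
          have "(\<Sum>i\<in>J. avg D f (snd i)) = (\<Sum>i\<in>J. avg D f (snd i) * indicator (snd i) x)"
            using J(3) by (intro sum.cong) auto
          then have xJ: "x \<in> Bad J" using True J(4) xs unfolding Bad_def by simp
          have "J \<subseteq> In (Max (insert 0 (to_nat_on I ` J)))"
            using J(1,2) unfolding In_def by auto
          then have "x \<in> Bad (In (Max (insert 0 (to_nat_on I ` J))))" using Bad_mono[OF _ In] xJ by blast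
          then have "x \<in> (\<Union>m. Bad (In m))" by blast
          then show ?thesis using True by simp
        qed simp
      qed
    qed
    also have "\<dots> = emeasure (density M (\<lambda>x. ennreal (w x))) (\<Union>m. Bad (In m))"
      using Badm[OF In(1)] by (subst emeasure_density) auto
    also have "\<dots> = (SUP m. emeasure (density M (\<lambda>x. ennreal (w x))) (Bad (In m)))"
    proof (rule SUP_emeasure_incseq[symmetric])
      show "range (\<lambda>m. Bad (In m)) \<subseteq> sets (density M (\<lambda>x. ennreal (w x)))" using Badm[OF In(1)] by auto
      show "incseq (\<lambda>m. Bad (In m))"
        unfolding incseq_def by (intro allI impI Bad_mono In) (auto simp: In_def)
    qed
    also have "\<dots> \<le> ennreal (n * (C * ?L * s)) * ?G"
    proof (rule SUP_least)
      fix m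
      have "emeasure (density M (\<lambda>x. ennreal (w x))) (Bad (In m)) = wmeas M w (Bad (In m))"
        unfolding wmeas_def using Badm[OF In(1)] by (subst emeasure_density) auto
      then show "emeasure (density M (\<lambda>x. ennreal (w x))) (Bad (In m)) \<le> ennreal (n * (C * ?L * s)) * ?G"
        using Bad[OF In] by simp
    qed
    finally have "ennreal t * wmeas M w {x\<in>Q. t < \<bar>T f x\<bar>} \<le> ennreal t * (ennreal (n * (C * ?L * s)) * ?G)"
      by (rule mult_left_mono) simp
    also have "\<dots> = ennreal (t * (n * (C * ?L * s))) * ?G"
      using t n0 C(1) L0 s0 by (simp add: ennreal_mult mult.assoc)
    also have "t * (n * (C * ?L * s)) = n * C * (Cs * Cd * n) * ?L"
      unfolding s_def using t by simp
    also have "ennreal (n * C * (Cs * Cd * n) * ?L) * ?G \<le> ennreal (C' * ?L) * ?G"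
      unfolding C'_def using L0 by (intro mult_right_mono ennreal_leI) auto
    finally show ?thesis .
  qed
  then show ?thesis by (rule that[OF C'0])
qed

section \<open>From functions supported in a cube to all of the space of square integrable
  functions\<close>

lemma weighted_weak_type:
  obtains C where "0 < C" "\<And>w f. w \<in> Ainf \<rho> M \<D> \<Longrightarrow> f \<in> L2 M \<Longrightarrow> space M \<noteq> {} \<Longrightarrow>
    weak_L1_norm M w (T f)
      \<le> ennreal (C * ln (exp 1 + enn2real (Ainf_const M \<D> w))) * (\<integral>\<^sup>+x. ennreal \<bar>f x\<bar> * maximal M \<D> w x \<partial>M)"
proof -
  obtain C where C: "0 < C" "\<And>w f Q t. w \<in> Ainf \<rho> M \<D> \<Longrightarrow> f \<in> L2 M \<Longrightarrow> integrable M f \<Longrightarrow> Q \<in> cubes \<D> \<Longrightarrow>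
    (\<And>y. y \<notin> Q \<Longrightarrow> f y = 0) \<Longrightarrow> 0 < t \<Longrightarrow>
    ennreal t * wmeas M w {x\<in>Q. t < \<bar>T f x\<bar>}
      \<le> ennreal (C * ln (exp 1 + enn2real (Ainf_const M \<D> w))) * (\<integral>\<^sup>+x. ennreal \<bar>f x\<bar> * maximal M \<D> w x \<partial>M)"
    by (rule local_weighted_weak_type) blast
  have "ennreal t * wmeas M w {x\<in>space M. t < \<bar>T f x\<bar>}
      \<le> ennreal (C * ln (exp 1 + enn2real (Ainf_const M \<D> w))) * (\<integral>\<^sup>+x. ennreal \<bar>f x\<bar> * maximal M \<D> w x \<partial>M)"
    if w: "w \<in> Ainf \<rho> M \<D>" and f: "f \<in> L2 M" and ne: "space M \<noteq> {}" and t: "0 < t" for w f t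
  proof -
    let ?K = "ennreal (C * ln (exp 1 + enn2real (Ainf_const M \<D> w)))"
    let ?G = "\<integral>\<^sup>+x. ennreal \<bar>f x\<bar> * maximal M \<D> w x \<partial>M"
    have fm[measurable]: "f \<in> borel_measurable M" by (rule L2_measurable[OF f])
    have wm[measurable]: "(\<lambda>x. ennreal (w x)) \<in> borel_measurable M"
      using w unfolding Ainf_def by (intro weight_measurable) auto
    have f2: "integrable M (\<lambda>x. (f x)\<^sup>2)" using f by (simp add: L2_def)
    obtain x0 where x0: "x0 \<in> space M" using ne by blast
    define b0 where "b0 n = B x0 (real (Suc n))" for n
    have b0m[measurable]: "b0 n \<in> sets M" for n unfolding b0_def by (rule ball_sets[OF x0])
    have b0fin: "emeasure M (b0 n) < \<infinity>" for n unfolding b0_def by (rule ball_finite[OF x0]) simp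
    have "\<exists>Q. Q \<in> cubes \<D> \<and> b0 n \<subseteq> Q" for n
      using covering[OF x0, of "real (Suc n)"] unfolding b0_def by auto
    then obtain Q where Q: "\<And>n. Q n \<in> cubes \<D>" "\<And>n. b0 n \<subseteq> Q n" by metis
    have Qm[measurable]: "Q n \<in> sets M" for n by (rule cube_measurable[OF Q(1)])
    define g where "g n x = f x * indicator (b0 n) x" for n x
    define h where "h n x = f x * indicator (space M - b0 n) x" for n x
    have g: "g n \<in> L2 M" for n unfolding g_def[abs_def] by (rule L2_cut[OF f b0m])
    have h: "h n \<in> L2 M" for n unfolding h_def[abs_def] by (rule L2_cut[OF f]) measurable
    \<comment> \<open>On a ball, which has finite measure, a square integrable function is
      integrable, by 2|f| \<le> 1 + f^2.\<close>
    have gi: "integrable M (g n)" for n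
    proof (rule Bochner_Integration.integrable_bound)
      show "integrable M (\<lambda>x. indicator (b0 n) x + (f x)\<^sup>2)" using f2 b0m b0fin[of n] by auto
      show "g n \<in> borel_measurable M" by (rule L2_measurable[OF g])
      show "AE x in M. norm (g n x) \<le> norm (indicator (b0 n) x + (f x)\<^sup>2)"
      proof (intro AE_I2)
        fix x
        have "0 \<le> (\<bar>f x\<bar> - 1)\<^sup>2" by simp
        then have "2 * \<bar>f x\<bar> \<le> 1 + (f x)\<^sup>2" by (simp add: power2_diff)
        then show "norm (g n x) \<le> norm (indicator (b0 n) x + (f x)\<^sup>2)"
          unfolding g_def by (auto simp: indicator_def)
      qed
    qed
    have hlim: "(\<lambda>n. \<integral>x. (h n x)\<^sup>2 \<partial>M) \<longlonglongrightarrow> (\<integral>x. 0 \<partial>M)"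
    proof (rule integral_dominated_convergence[where w = "\<lambda>x. (f x)\<^sup>2"])
      show "(\<lambda>x. (h n x)\<^sup>2) \<in> borel_measurable M" for n using L2_measurable[OF h] by simp
      show "AE x in M. norm ((h n x)\<^sup>2) \<le> (f x)\<^sup>2" for n by (intro AE_I2) (auto simp: h_def indicator_def)
      show "AE x in M. (\<lambda>n. (h n x)\<^sup>2) \<longlonglongrightarrow> 0"
      proof (intro AE_I2)
        fix x assume x: "x \<in> space M"
        obtain N :: nat where N: "\<rho> x0 x < real N" using reals_Archimedean2 by blast
        have "h n x = 0" if "N \<le> n" for n
        proof -
          have "x \<in> b0 n" unfolding b0_def using N that x by (intro qballI) auto
          then show ?thesis unfolding h_def by simp
        qed
        then have "eventually (\<lambda>n. (h n x)\<^sup>2 = 0) sequentially"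
          unfolding eventually_sequentially by auto
        then show "(\<lambda>n. (h n x)\<^sup>2) \<longlonglongrightarrow> 0" by (rule tendsto_eventually)
      qed
    qed (use f2 in auto)
    have Th2: "integrable M (\<lambda>x. (T (h n) x)\<^sup>2)" for n using T_L2[OF h] by (simp add: L2_def)
    have Thle: "(\<integral>x. (T (h n) x)\<^sup>2 \<partial>M) \<le> b * (\<integral>x. (h n x)\<^sup>2 \<partial>M)" for n
    proof -
      have h2: "integrable M (\<lambda>x. (h n x)\<^sup>2)" using h by (simp add: L2_def)
      have "ennreal (\<integral>x. (T (h n) x)\<^sup>2 \<partial>M) \<le> ennreal (b * (\<integral>x. (h n x)\<^sup>2 \<partial>M))"
        using T_bounded[OF h, of n] Th2 h2 b0 by (simp add: nn_integral_eq_integral ennreal_mult)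
      then show ?thesis using b0 by (subst (asm) ennreal_le_iff) auto
    qed
    have "(\<lambda>n. b * (\<integral>x. (h n x)\<^sup>2 \<partial>M)) \<longlonglongrightarrow> 0" using tendsto_mult_left[OF hlim, of b] by simp
    then have "(\<lambda>n. \<integral>x. (T (h n) x)\<^sup>2 \<partial>M) \<longlonglongrightarrow> 0"
      by (rule Lim_null_comparison[rotated]) (use Thle in \<open>auto intro!: always_eventually\<close>)
    then have "\<exists>r::nat\<Rightarrow>nat. strict_mono r \<and> (AE x in M. (\<lambda>n. (T (h (r n)) x)\<^sup>2) \<longlonglongrightarrow> 0)"
      by (intro tendsto_L1_AE_subseq Th2) simp
    \<comment> \<open>The truncated tails tend to 0 in mean square, hence so do their images under
      \<open>T\<close>; pointwise convergence holds along a subsequence.\<close>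
    then obtain r :: "nat \<Rightarrow> nat" where r: "strict_mono r" "AE x in M. (\<lambda>n. (T (h (r n)) x)\<^sup>2) \<longlonglongrightarrow> 0" by blast
    have lin: "AE x in M. \<forall>n. T f x = T (g n) x + T (h n) x"
    proof (subst AE_all_countable, rule allI)
      fix n
      \<comment> \<open>Functions are total: \<open>g n\<close> and \<open>h n\<close> vanish
        outside \<open>space M\<close>, where \<open>f\<close> may not. The difference is null and
        hence invisible to \<open>T\<close>.\<close>
      let ?e = "\<lambda>x. f x * indicator (- space M) x"
      have e: "?e \<in> L2 M" by (rule L2_dominated[OF f]) auto
      have "AE x in M. T (\<lambda>x. g n x + h n x) x = T (g n) x + T (h n) x" by (rule T_add[OF g h]) simp
      moreover have "AE x in M. T f x = T (\<lambda>x. g n x + h n x) x + T ?e x"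
        by (rule T_add[OF _ e])
          (use L2_linear[OF g[of n] h[of n], of 1 1] sets.sets_into_space[OF b0m[of n]] in
            \<open>auto simp: g_def h_def indicator_def\<close>)
      moreover have "AE x in M. T ?e x = 0" by (rule T_null[OF e]) auto
      ultimately show "AE x in M. T f x = T (g n) x + T (h n) x" by eventually_elim simp
    qed
    define S where "S n = {x\<in>Q n. t < \<bar>T (g n) x\<bar>}" for n
    have Sm[measurable]: "S n \<in> sets M" for n
    proof -
      have [measurable]: "T (g n) \<in> borel_measurable M" by (rule T_measurable[OF g])
      have "S n = {x\<in>space M. t < \<bar>T (g n) x\<bar>} \<inter> Q n"
        using sets.sets_into_space[OF Qm[of n]] unfolding S_def by auto
      also have "\<dots> \<in> sets M" by measurable
      finally show ?thesis .
    qed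
    have Sb: "(\<integral>\<^sup>+x. ennreal t * (ennreal (w x) * indicator (S n) x) \<partial>M) \<le> ?K * ?G" for n
    proof -
      have "(\<integral>\<^sup>+x. ennreal t * (ennreal (w x) * indicator (S n) x) \<partial>M) = ennreal t * wmeas M w (S n)"
        unfolding wmeas_def by (rule nn_integral_cmult) measurable
      also have "\<dots> \<le> ?K * (\<integral>\<^sup>+x. ennreal \<bar>g n x\<bar> * maximal M \<D> w x \<partial>M)"
        unfolding S_def by (rule C(2)[OF w g gi Q(1) _ t]) (use Q(2)[of n] in \<open>auto simp: g_def indicator_def\<close>)
      also have "\<dots> \<le> ?K * ?G"
        by (intro mult_left_mono nn_integral_mono mult_right_mono ennreal_leI) (auto simp: g_def indicator_def)
      finally show ?thesis .
    qed
    have "ennreal t * wmeas M w {x\<in>space M. t < \<bar>T f x\<bar>}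
        = (\<integral>\<^sup>+x. ennreal t * (ennreal (w x) * indicator {x\<in>space M. t < \<bar>T f x\<bar>} x) \<partial>M)"
    proof -
      have [measurable]: "T f \<in> borel_measurable M" by (rule T_measurable[OF f])
      show ?thesis unfolding wmeas_def by (rule nn_integral_cmult[symmetric]) measurable
    qed
    also have "\<dots> \<le> (\<integral>\<^sup>+x. liminf (\<lambda>n. ennreal t * (ennreal (w x) * indicator (S (r n)) x)) \<partial>M)"
    proof (rule nn_integral_mono_AE)
      show "AE x in M. ennreal t * (ennreal (w x) * indicator {x\<in>space M. t < \<bar>T f x\<bar>} x)
          \<le> liminf (\<lambda>n. ennreal t * (ennreal (w x) * indicator (S (r n)) x))"
        using r(2) lin
      proof (rule AE_mp[OF AE_conjI], intro AE_I2 impI)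
        fix x assume x: "x \<in> space M" and
          "(\<lambda>n. (T (h (r n)) x)\<^sup>2) \<longlonglongrightarrow> 0 \<and> (\<forall>n. T f x = T (g n) x + T (h n) x)"
        then have l: "(\<lambda>n. (T (h (r n)) x)\<^sup>2) \<longlonglongrightarrow> 0" and e: "\<And>n. T f x = T (g n) x + T (h n) x" by auto
        show "ennreal t * (ennreal (w x) * indicator {x\<in>space M. t < \<bar>T f x\<bar>} x)
          \<le> liminf (\<lambda>n. ennreal t * (ennreal (w x) * indicator (S (r n)) x))"
        proof (cases "t < \<bar>T f x\<bar>")
          case True
          \<comment> \<open>The strict inequality leaves the margin \<open>d\<close>: once the tail
            term is below it, x belongs to the level set of the truncated function, so Fatou's lemma
            applies.\<close>
          define d where "d = \<bar>T f x\<bar> - t"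
          have d: "0 < d" using True unfolding d_def by simp
          have "eventually (\<lambda>n. (T (h (r n)) x)\<^sup>2 < d\<^sup>2) sequentially"
            using d by (intro order_tendstoD(2)[OF l]) simp
          moreover obtain N :: nat where N: "\<rho> x0 x < real N" using reals_Archimedean2 by blast
          have "eventually (\<lambda>n. N \<le> n) sequentially" by (rule eventually_ge_at_top)
          ultimately have "eventually (\<lambda>n. ennreal t * (ennreal (w x) * indicator {x\<in>space M. t < \<bar>T f x\<bar>} x)
              \<le> ennreal t * (ennreal (w x) * indicator (S (r n)) x)) sequentially"
          proof eventually_elim
            case (elim n)
            have "N \<le> r n" using elim(2) seq_suble[OF r(1), of n] by simp
            then have "x \<in> b0 (r n)" unfolding b0_def using N x by (intro qballI) auto
            then have "x \<in> Q (r n)" using Q(2) by blast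
            moreover have "\<bar>T (h (r n)) x\<bar> < d"
              by (rule power2_less_imp_less) (use elim(1) d in auto)
            then have "t < \<bar>T (g (r n)) x\<bar>" using e[of "r n"] unfolding d_def by linarith
            ultimately have "x \<in> S (r n)" unfolding S_def by simp
            then show ?case by (simp add: indicator_def)
          qed
          then show ?thesis by (rule Liminf_bounded)
        qed simp
      qed
    qed
    also have "\<dots> \<le> liminf (\<lambda>n. \<integral>\<^sup>+x. ennreal t * (ennreal (w x) * indicator (S (r n)) x) \<partial>M)"
      by (rule nn_integral_liminf) measurable
    also have "\<dots> \<le> liminf (\<lambda>n::nat. ?K * ?G)" by (rule Liminf_mono) (use Sb in auto)
    also have "\<dots> = ?K * ?G" by (rule Liminf_const) simp
    finally show ?thesis .
  qed
  then have "weak_L1_norm M w (T f)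
      \<le> ennreal (C * ln (exp 1 + enn2real (Ainf_const M \<D> w))) * (\<integral>\<^sup>+x. ennreal \<bar>f x\<bar> * maximal M \<D> w x \<partial>M)"
    if "w \<in> Ainf \<rho> M \<D>" "f \<in> L2 M" "space M \<noteq> {}" for w f
    using that unfolding weak_L1_norm_def by (intro SUP_least) auto
  then show ?thesis by (rule that[OF C(1)])
qed

end

section \<open>Assembly of the final estimate\<close>

lemma cz_operator_obtains:
  assumes d: "dyadic_space \<rho> M \<kappa> A \<epsilon> \<D> \<delta> C0 c" and T: "cz_operator \<rho> M T"
  obtains K \<eta> CK b where "cz_space \<rho> M \<kappa> A \<epsilon> \<D> \<delta> C0 c T K \<eta> CK b"
proof -
  from T have T1: "\<forall>f\<in>L2 M. T f \<in> L2 M"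
    and T2: "\<forall>f\<in>L2 M. \<forall>g\<in>L2 M. \<forall>a b. AE x in M. T (\<lambda>y. a * f y + b * g y) x = a * T f x + b * T g x"
    and T3: "\<exists>B. \<forall>f\<in>L2 M. L2_norm M (T f) \<le> B * L2_norm M f"
    and T4: "\<exists>K. cz_kernel \<rho> M K \<and>
        (\<forall>f\<in>L2 M. AE x in M. x \<notin> ess_support \<rho> M f \<longrightarrow> T f x = (\<integral>y. K x y * f y \<partial>M))"
    unfolding cz_operator_def by blast+
  obtain Bd where Bd: "\<forall>f\<in>L2 M. L2_norm M (T f) \<le> Bd * L2_norm M f" using T3 by blast
  obtain K where K: "cz_kernel \<rho> M K"
    "\<forall>f\<in>L2 M. AE x in M. x \<notin> ess_support \<rho> M f \<longrightarrow> T f x = (\<integral>y. K x y * f y \<partial>M)" using T4 by blast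
  obtain \<eta> CK where ker: "0 < \<eta>" "\<forall>x0\<in>space M. \<forall>y\<in>space M. x0 \<noteq> y \<longrightarrow>
     \<bar>K x0 y\<bar> \<le> CK / measure M (qball (space M) \<rho> x0 (\<rho> x0 y)) \<and>
     (\<forall>x\<in>space M. x \<noteq> y \<and> \<rho> x0 x \<le> \<eta> * \<rho> x0 y \<longrightarrow>
        \<bar>K x y - K x0 y\<bar>
          \<le> (\<rho> x x0 / \<rho> x0 y) powr \<eta> * (1 / measure M (qball (space M) \<rho> x0 (\<rho> x0 y))) \<and>
        \<bar>K y x - K y x0\<bar>
          \<le> (\<rho> x x0 / \<rho> x0 y) powr \<eta> * (1 / measure M (qball (space M) \<rho> x0 (\<rho> x0 y))))"
    using K(1) unfolding cz_kernel_def by (elim exE conjE) (rule that)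
  have "cz_space_axioms \<rho> M T K \<eta> (max 0 CK) (Bd\<^sup>2)"
  proof
    show "T f \<in> L2 M" if "f \<in> L2 M" for f using T1 that by blast
    show "AE x in M. T (\<lambda>y. a * f y + b * g y) x = a * T f x + b * T g x"
      if "f \<in> L2 M" "g \<in> L2 M" for f g a b using T2 that by blast
    show "0 \<le> Bd\<^sup>2" by simp
    show "(\<integral>\<^sup>+x. ennreal ((T f x)\<^sup>2) \<partial>M) \<le> ennreal (Bd\<^sup>2) * (\<integral>\<^sup>+x. ennreal ((f x)\<^sup>2) \<partial>M)" if f: "f \<in> L2 M" for f
    proof -
      have Tf: "T f \<in> L2 M" using T1 f by blast
      have i: "integrable M (\<lambda>x. (f x)\<^sup>2)" "integrable M (\<lambda>x. (T f x)\<^sup>2)" using f Tf by (auto simp: L2_def)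
      have nn: "0 \<le> (\<integral>x. (f x)\<^sup>2 \<partial>M)" "0 \<le> (\<integral>x. (T f x)\<^sup>2 \<partial>M)" by (auto intro: integral_nonneg_AE)
      have "(L2_norm M (T f))\<^sup>2 \<le> (Bd * L2_norm M f)\<^sup>2"
        using Bd f by (intro power_mono) (auto simp: L2_norm_def nn)
      then have "(\<integral>x. (T f x)\<^sup>2 \<partial>M) \<le> Bd\<^sup>2 * (\<integral>x. (f x)\<^sup>2 \<partial>M)"
        using nn by (simp add: L2_norm_def power_mult_distrib)
      then have "ennreal (\<integral>x. (T f x)\<^sup>2 \<partial>M) \<le> ennreal (Bd\<^sup>2) * ennreal (\<integral>x. (f x)\<^sup>2 \<partial>M)"
        using nn by (subst ennreal_mult[symmetric]) (auto intro: ennreal_leI)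
      then show ?thesis using i by (simp add: nn_integral_eq_integral)
    qed
    show "0 < \<eta>" by (rule ker(1))
    show "0 \<le> max 0 CK" by simp
    show "\<bar>K x y\<bar> \<le> max 0 CK / measure M (qball (space M) \<rho> x (\<rho> x y))"
      if "x \<in> space M" "y \<in> space M" "x \<noteq> y" for x y
    proof -
      have "\<bar>K x y\<bar> \<le> CK / measure M (qball (space M) \<rho> x (\<rho> x y))"
        using bspec[OF bspec[OF ker(2) that(1)] that(2)] that(3) by simp
      also have "\<dots> \<le> max 0 CK / measure M (qball (space M) \<rho> x (\<rho> x y))" by (intro divide_right_mono) auto
      finally show ?thesis .
    qed
    show "\<bar>K z y - K x y\<bar> \<le> (\<rho> z x / \<rho> x y) powr \<eta> * (1 / measure M (qball (space M) \<rho> x (\<rho> x y)))"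
      "\<bar>K y z - K y x\<bar> \<le> (\<rho> z x / \<rho> x y) powr \<eta> * (1 / measure M (qball (space M) \<rho> x (\<rho> x y)))"
      if "x \<in> space M" "y \<in> space M" "z \<in> space M" "x \<noteq> y" "z \<noteq> y" "\<rho> x z \<le> \<eta> * \<rho> x y" for x y z
      using bspec[OF bspec[OF ker(2) that(1)] that(2)] that(3-6) by simp_all
    show "AE x in M. x \<notin> ess_support \<rho> M f \<longrightarrow> T f x = (\<integral>y. K x y * f y \<partial>M)" if "f \<in> L2 M" for f
      using K(2) that by blast
  qed
  then have "cz_space \<rho> M \<kappa> A \<epsilon> \<D> \<delta> C0 c T K \<eta> (max 0 CK) (Bd\<^sup>2)" using d by (rule cz_space.intro[rotated])
  then show ?thesis by (rule that)
qed

theorem corollary3p4: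
  fixes \<rho> :: "'a \<Rightarrow> 'a \<Rightarrow> real"
    and M :: "'a measure"
    and \<epsilon> :: real
    and \<D> :: "(int \<Rightarrow> 'a set set) set"
    and T :: "('a \<Rightarrow> real) \<Rightarrow> 'a \<Rightarrow> real"
  assumes "homogeneous_type \<rho> M"
    and "adjacent_dyadic_systems \<rho> M \<epsilon> \<D>"
    and "cz_operator \<rho> M T"
  shows "\<exists>C::real. 0 < C \<and> (\<forall>f\<in>L2 M.
    (\<forall>w\<in>Ainf \<rho> M \<D>. \<forall>r. r = 1 + 1 / (2 * inverse \<epsilon> * enn2real (Ainf_const M \<D> w) - 1) \<longrightarrow>
       weak_L1_norm M w (T f)
         \<le> ennreal (C * ln (exp 1 + enn2real (Ainf_const M \<D> w))) * L1_norm M (maximal_r M \<D> r w) f) \<and>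
    (\<forall>w\<in>A1 \<rho> M \<D>.
       weak_L1_norm M w (T f)
         \<le> ennreal (C * enn2real (A1_const M \<D> w) * ln (exp 1 + enn2real (Ainf_const M \<D> w)))
            * L1_norm M (\<lambda>x. ennreal (w x)) f))"
proof (cases "space M = {}")
  \<comment> \<open>No cube exists then, and [w] as a supremum over the empty set is 0, so that the
    lower bound for [w] fails; but all norms vanish.\<close>
  case True
  have "weak_L1_norm M w g = 0" for w :: "'a \<Rightarrow> real" and g
    unfolding weak_L1_norm_def wmeas_def using True by (simp add: nn_integral_empty bot_ennreal)
  then show ?thesis by (intro exI[of _ 1]) simp
next
  case False
  obtain \<kappa> A where h: "homogeneous_space \<rho> M \<kappa> A" by (rule homogeneous_type_obtains[OF assms(1)])
  obtain \<delta> C0 c where d: "dyadic_space \<rho> M \<kappa> A \<epsilon> \<D> \<delta> C0 c"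
    by (rule adjacent_dyadic_systems_obtains[OF h assms(2)])
  obtain K \<eta> CK b where cz: "cz_space \<rho> M \<kappa> A \<epsilon> \<D> \<delta> C0 c T K \<eta> CK b"
    by (rule cz_operator_obtains[OF d assms(3)])
  interpret cz_space \<rho> M \<kappa> A \<epsilon> \<D> \<delta> C0 c T K \<eta> CK b by (rule cz)
  obtain C where C: "0 < C" "\<And>w f. w \<in> Ainf \<rho> M \<D> \<Longrightarrow> f \<in> L2 M \<Longrightarrow> space M \<noteq> {} \<Longrightarrow>
    weak_L1_norm M w (T f)
      \<le> ennreal (C * ln (exp 1 + enn2real (Ainf_const M \<D> w))) * (\<integral>\<^sup>+x. ennreal \<bar>f x\<bar> * maximal M \<D> w x \<partial>M)"
    by (rule weighted_weak_type) blast
  have 1: "weak_L1_norm M w (T f)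
      \<le> ennreal (C * ln (exp 1 + enn2real (Ainf_const M \<D> w))) * L1_norm M (maximal_r M \<D> r w) f"
    if f: "f \<in> L2 M" and w: "w \<in> Ainf \<rho> M \<D>"
      and r: "r = 1 + 1 / (2 * inverse \<epsilon> * enn2real (Ainf_const M \<D> w) - 1)" for f w r
  proof -
    \<comment> \<open>Both 1/\<epsilon> and [w] are at least 1, so the denominator in the definition
      of r is at least 1 and r \<ge> 1.\<close>
    have "1 \<le> inverse \<epsilon>" using eps_pos eps_less by (simp add: one_le_inverse)
    then have "1 * 1 \<le> inverse \<epsilon> * enn2real (Ainf_const M \<D> w)"
      using Ainf_const_ge_1[OF w False] eps_pos by (intro mult_mono) auto
    then have "1 \<le> r" unfolding r by simp
    moreover have "weight \<rho> M w" using w unfolding Ainf_def by simp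
    ultimately have le: "maximal M \<D> w x \<le> maximal_r M \<D> r w x" for x by (intro maximal_le_maximal_r)
    have "(\<integral>\<^sup>+x. ennreal \<bar>f x\<bar> * maximal M \<D> w x \<partial>M) \<le> L1_norm M (maximal_r M \<D> r w) f"
      unfolding L1_norm_def by (intro nn_integral_mono mult_left_mono le) simp
    then show ?thesis using C(2)[OF w f False] by (meson mult_left_mono order_trans zero_le)
  qed
  have 2: "weak_L1_norm M w (T f)
      \<le> ennreal (C * enn2real (A1_const M \<D> w) * ln (exp 1 + enn2real (Ainf_const M \<D> w)))
          * L1_norm M (\<lambda>x. ennreal (w x)) f"
    if f: "f \<in> L2 M" and w: "w \<in> A1 \<rho> M \<D>" for f w
  proof -
    let ?c = "enn2real (A1_const M \<D> w)" and ?L = "ln (exp 1 + enn2real (Ainf_const M \<D> w))"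
    have L0: "0 \<le> ?L" by (simp add: add_increasing2)
    have [measurable]: "f \<in> borel_measurable M" "(\<lambda>x. ennreal (w x)) \<in> borel_measurable M"
      using L2_measurable[OF f] w weight_measurable unfolding A1_def by auto
    have "(\<integral>\<^sup>+x. ennreal \<bar>f x\<bar> * maximal M \<D> w x \<partial>M) \<le> (\<integral>\<^sup>+x. ennreal ?c * (ennreal \<bar>f x\<bar> * ennreal (w x)) \<partial>M)"
    proof (rule nn_integral_mono_AE)
      show "AE x in M. ennreal \<bar>f x\<bar> * maximal M \<D> w x \<le> ennreal ?c * (ennreal \<bar>f x\<bar> * ennreal (w x))"
        using A1_maximal_le[OF w]
      proof eventually_elim
        case (elim x)
        then have "ennreal \<bar>f x\<bar> * maximal M \<D> w x \<le> ennreal \<bar>f x\<bar> * (ennreal ?c * ennreal (w x))"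
          by (rule mult_left_mono) simp
        then show ?case by (simp add: mult.left_commute)
      qed
    qed
    also have "\<dots> = ennreal ?c * L1_norm M (\<lambda>x. ennreal (w x)) f"
      unfolding L1_norm_def by (rule nn_integral_cmult) measurable
    finally have "ennreal (C * ?L) * (\<integral>\<^sup>+x. ennreal \<bar>f x\<bar> * maximal M \<D> w x \<partial>M)
        \<le> ennreal (C * ?L) * (ennreal ?c * L1_norm M (\<lambda>x. ennreal (w x)) f)" by (rule mult_left_mono) simp
    also have "\<dots> = ennreal (C * ?L * ?c) * L1_norm M (\<lambda>x. ennreal (w x)) f"
      using C(1) L0 by (simp add: ennreal_mult mult.assoc)
    also have "C * ?L * ?c = C * ?c * ?L" by simp
    finally show ?thesis using C(2)[OF A1_subset_Ainf[OF w] f False] by (rule order_trans[rotated])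
  qed
  show ?thesis using C(1) 1 2 by blast
qed

end
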